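(* Let $H_h=-h^2\Delta+V_1-ihV_2$ on $L^2(\mathbb R^n)$ be as in the context and let $E>0$. Assume that for some $s\in\left(\frac12,\frac{1+\rho}2\right)$ there exist $\varepsilon,h_0>0$ such that, with $J=(E-\varepsilon,E+\varepsilon)$, the limit $$\langle x\rangle^{-s}(H_h-(\lambda+i0))^{-1}\langle x\rangle^{-s}=\lim_{\mu\to0^+}\langle x\rangle^{-s}(H_h-(\lambda+i\mu))^{-1}\langle x\rangle^{-s}$$ exists for all $\lambda\in J$ and $h\in(0,h_0]$, with the estimate (for some constant $c\ge 0$) $$\left\|\langle x\rangle^{-s}(H_h-z)^{-1}\langle x\rangle^{-s}\right\|\le\frac ch$$ uniformly in $z\in\mathbb C_{J,+}$ and $h\in(0,h_0]$. Then every bounded trajectory of energy $E$ goes through $\mathcal O=\{(x,\xi)\in\mathbb R^{2n}:V_2(x)>0\}$.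
   Context: Setting: $V_1\in C^\infty(\mathbb R^n,\mathbb R)$ satisfies, for some $\rho>0$ and constants $C_\alpha\ge0$, $|\partial^\alpha V_1(x)|\le C_\alpha\langle x\rangle^{-\rho-|\alpha|}$ for all $\alpha\in\mathbb N^n$, $x\in\mathbb R^n$. $V_2\in C^\infty(\mathbb R^n,\mathbb R)$ is nonnegative, has bounded derivatives (of any order), and $V_2(x)\to0$ as $|x|\to\infty$. The parameter $h$ lies in $(0,1]$, and $H_h$ has domain $H^2(\mathbb R^n)$. Notation: $\langle x\rangle=\sqrt{1+|x|^2}$; for $J\subset\mathbb R$, $\mathbb C_{J,+}=\{z\in\mathbb C:\operatorname{Im}z>0,\ \operatorname{Re}z\in J\}$. The limit is taken in $\mathcal L(L^2(\mathbb R^n))$ (bounded operators). Classical flow: $p(x,\xi)=|\xi|^2+V_1(x)$ and $\phi^t(x_0,\xi_0)=(\bar x(t,x_0,\xi_0),\bar\xi(t,x_0,\xi_0))$ is the Hamiltonian flow: $\partial_t\bar x=2\bar\xi$, $\partial_t\bar\xi=-\nabla V_1(\bar x)$, $\phi^0=\mathrm{id}$. A bounded trajectory of energy $E$ is a trajectory $\{\phi^t(w)\}_{t\in\mathbb R}$ with $p(w)=E$ and $\{\bar x(t,w)\}_{t\in\mathbb R}$ bounded; it goes through $\mathcal O$ if $\phi^t(w)\in\mathcal O$ for some $t\in\mathbb R$. *)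

theory Defs
  imports "HOL-Analysis.Analysis"
begin

section \<open>Smooth functions and iterated partial derivatives\<close>

definition partial :: "'n::finite \<Rightarrow> (real^'n \<Rightarrow> 'b::real_normed_vector) \<Rightarrow> real^'n \<Rightarrow> 'b"
  where "partial j f x = frechet_derivative f (at x) (axis j 1)"

text \<open>A multi-index \<open>\<alpha>\<close> is presented by a list of coordinates: \<open>pderivs js\<close> is \<open>\<partial>\<^sup>\<alpha>\<close> with
  \<open>\<alpha> = count_list js\<close> and \<open>|\<alpha>| = length js\<close>. For smooth functions the order of the list is
  irrelevant.\<close>

primrec pderivs :: "'n::finite list \<Rightarrow> (real^'n \<Rightarrow> 'b::real_normed_vector) \<Rightarrow> real^'n \<Rightarrow> 'b"
  where
    "pderivs [] f = f"
  | "pderivs (j # js) f = partial j (pderivs js f)"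

text \<open>All iterated partial derivatives exist and are (totally) differentiable, hence continuous;
  this is \<open>C\<^sup>\<infinity>\<close>.\<close>

definition smooth :: "(real^'n::finite \<Rightarrow> 'b::real_normed_vector) \<Rightarrow> bool"
  where "smooth f \<longleftrightarrow> (\<forall>js x. pderivs js f differentiable (at x))"

definition grad :: "(real^'n::finite \<Rightarrow> real) \<Rightarrow> real^'n \<Rightarrow> real^'n"
  where "grad V x = (\<chi> j. partial j V x)"

definition test_function :: "(real^'n::finite \<Rightarrow> complex) \<Rightarrow> bool"
  where "test_function \<phi> \<longleftrightarrow> smooth \<phi> \<and> compact (closure {x. \<phi> x \<noteq> 0})"

definition jbracket :: "real^'n::finite \<Rightarrow> real"
  where "jbracket x = sqrt (1 + (norm x)\<^sup>2)"

lemma smooth_pderivs_measurable: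
  assumes "smooth f"
  shows "pderivs js f \<in> borel_measurable borel"
proof -
  have "continuous_on UNIV (pderivs js f)"
    using assms by (auto simp: smooth_def intro!: continuous_at_imp_continuous_on
        differentiable_imp_continuous_within)
  then show ?thesis by (rule borel_measurable_continuous_onI)
qed


section \<open>The space of square-integrable functions modulo null sets\<close>

definition sq_integrable :: "(real^'n::finite \<Rightarrow> complex) \<Rightarrow> bool"
  where "sq_integrable f \<longleftrightarrow>
    f \<in> borel_measurable borel \<and> integrable lborel (\<lambda>x. (norm (f x))\<^sup>2)"

definition L2_norm :: "(real^'n::finite \<Rightarrow> complex) \<Rightarrow> real"
  where "L2_norm f = sqrt (\<integral>x. (norm (f x))\<^sup>2 \<partial>lborel)"

definition L2_eq :: "(real^'n::finite \<Rightarrow> complex) \<Rightarrow> (real^'n \<Rightarrow> complex) \<Rightarrow> bool"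
  where "L2_eq f g \<longleftrightarrow> sq_integrable f \<and> sq_integrable g \<and> (AE x in lborel. f x = g x)"

lemma sq_integrable_measurable: "sq_integrable f \<Longrightarrow> f \<in> borel_measurable borel"
  by (simp add: sq_integrable_def)

lemma sq_integrable_zero: "sq_integrable (\<lambda>_. 0)"
  by (simp add: sq_integrable_def)

lemma sq_integrable_add:
  assumes "sq_integrable f" "sq_integrable g"
  shows "sq_integrable (\<lambda>x. f x + g x)"
  unfolding sq_integrable_def
proof
  show m: "(\<lambda>x. f x + g x) \<in> borel_measurable borel"
    using assms by (auto simp: sq_integrable_def)
  have le: "(norm (f x + g x))\<^sup>2 \<le> 2 * (norm (f x))\<^sup>2 + 2 * (norm (g x))\<^sup>2" for x
  proof -
    have "(norm (f x + g x))\<^sup>2 \<le> (norm (f x) + norm (g x))\<^sup>2"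
      by (intro power_mono norm_triangle_ineq) simp
    also have "\<dots> \<le> 2 * (norm (f x))\<^sup>2 + 2 * (norm (g x))\<^sup>2"
      using sum_squares_bound[of "norm (f x)" "norm (g x)"] by (simp add: power2_sum)
    finally show ?thesis .
  qed
  show "integrable lborel (\<lambda>x. (norm (f x + g x))\<^sup>2)"
  proof (rule Bochner_Integration.integrable_bound)
    show "integrable lborel (\<lambda>x. 2 * (norm (f x))\<^sup>2 + 2 * (norm (g x))\<^sup>2)"
      using assms by (auto simp: sq_integrable_def)
    show "(\<lambda>x. (norm (f x + g x))\<^sup>2) \<in> borel_measurable lborel"
      using m by simp
    show "AE x in lborel. norm ((norm (f x + g x))\<^sup>2)
        \<le> norm (2 * (norm (f x))\<^sup>2 + 2 * (norm (g x))\<^sup>2)"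
      using le by simp
  qed
qed

lemma sq_integrable_bounded_mult:
  assumes V: "V \<in> borel_measurable borel" "bounded (range V)" and f: "sq_integrable f"
  shows "sq_integrable (\<lambda>x. V x * f x)"
  unfolding sq_integrable_def
proof
  show m: "(\<lambda>x. V x * f x) \<in> borel_measurable borel"
    using V f by (auto simp: sq_integrable_def)
  obtain B where B: "norm (V x) \<le> B" for x
    using V(2) by (auto simp: bounded_iff)
  show "integrable lborel (\<lambda>x. (norm (V x * f x))\<^sup>2)"
  proof (rule Bochner_Integration.integrable_bound)
    show "integrable lborel (\<lambda>x. B\<^sup>2 * (norm (f x))\<^sup>2)"
      using f by (auto simp: sq_integrable_def)
    show "(\<lambda>x. (norm (V x * f x))\<^sup>2) \<in> borel_measurable lborel"
      using m by simp
    show "AE x in lborel. norm ((norm (V x * f x))\<^sup>2) \<le> norm (B\<^sup>2 * (norm (f x))\<^sup>2)"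
      using B by (intro AE_I2)
        (auto simp: norm_mult power_mult_distrib intro!: mult_right_mono power_mono)
  qed
qed

lemma sq_integrable_scale: "sq_integrable f \<Longrightarrow> sq_integrable (\<lambda>x. c * f x)"
  by (rule sq_integrable_bounded_mult) auto

lemma L2_norm_cong: "L2_eq f g \<Longrightarrow> L2_norm f = L2_norm g"
  unfolding L2_norm_def L2_eq_def sq_integrable_def
  by (intro arg_cong[of _ _ sqrt] integral_cong_AE) auto

lemma L2_norm_power2: "(L2_norm f)\<^sup>2 = (\<integral>x. (norm (f x))\<^sup>2 \<partial>lborel)"
  by (simp add: L2_norm_def)

lemma L2_norm_nonneg: "0 \<le> L2_norm f"
  by (simp add: L2_norm_def)

lemma L2_norm_eq_0_iff:
  assumes "sq_integrable f"
  shows "L2_norm f = 0 \<longleftrightarrow> (AE x in lborel. f x = 0)"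
proof -
  have "L2_norm f = 0 \<longleftrightarrow> (\<integral>x. (norm (f x))\<^sup>2 \<partial>lborel) = 0"
    by (simp add: L2_norm_def)
  also have "\<dots> \<longleftrightarrow> (AE x in lborel. (norm (f x))\<^sup>2 = 0)"
    using assms by (intro integral_nonneg_eq_0_iff_AE) (auto simp: sq_integrable_def)
  finally show ?thesis by simp
qed

lemma L2_norm_triangle:
  assumes f: "sq_integrable f" and g: "sq_integrable g"
  shows "L2_norm (\<lambda>x. f x + g x) \<le> L2_norm f + L2_norm g"
proof -
  have fi: "integrable lborel (\<lambda>x. (norm (f x))\<^sup>2)"
    and gi: "integrable lborel (\<lambda>x. (norm (g x))\<^sup>2)"
    and fgi: "integrable lborel (\<lambda>x. (norm (f x + g x))\<^sup>2)"
    using f g sq_integrable_add[OF f g] by (simp_all only: sq_integrable_def)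
  define a b where "a = L2_norm f" and "b = L2_norm g"
  have ab: "a \<ge> 0" "b \<ge> 0" by (auto simp: a_def b_def L2_norm_nonneg)
  have key: "(L2_norm (\<lambda>x. f x + g x))\<^sup>2 \<le> (1 + t) * a\<^sup>2 + (1 + 1 / t) * b\<^sup>2" if t: "t > 0" for t
  proof -
    have le: "(norm (f x + g x))\<^sup>2 \<le> (1 + t) * (norm (f x))\<^sup>2 + (1 + 1 / t) * (norm (g x))\<^sup>2" for x
    proof -
      define u v where "u = norm (f x)" and "v = norm (g x)"
      have "(norm (f x + g x))\<^sup>2 \<le> (u + v)\<^sup>2"
        unfolding u_def v_def by (intro power_mono norm_triangle_ineq) simp
      also have "\<dots> \<le> (1 + t) * u\<^sup>2 + (1 + 1 / t) * v\<^sup>2"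
      proof -
        have "(1 + t) * u\<^sup>2 + (1 + 1 / t) * v\<^sup>2 - (u + v)\<^sup>2 = (t * u - v)\<^sup>2 / t"
          using t by (simp add: divide_simps) (simp add: algebra_simps power2_eq_square)
        moreover have "(t * u - v)\<^sup>2 / t \<ge> 0" using t by simp
        ultimately show ?thesis by linarith
      qed
      finally show ?thesis by (simp add: u_def v_def)
    qed
    have "(L2_norm (\<lambda>x. f x + g x))\<^sup>2
        \<le> (\<integral>x. (1 + t) * (norm (f x))\<^sup>2 + (1 + 1 / t) * (norm (g x))\<^sup>2 \<partial>lborel)"
      unfolding L2_norm_power2
    proof (rule integral_mono[OF fgi _ le])
      show "integrable lborel (\<lambda>x. (1 + t) * (norm (f x))\<^sup>2 + (1 + 1 / t) * (norm (g x))\<^sup>2)"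
        by (intro Bochner_Integration.integrable_add integrable_mult_right fi gi)
    qed
    also have "\<dots> = (1 + t) * a\<^sup>2 + (1 + 1 / t) * b\<^sup>2"
      by (subst Bochner_Integration.integral_add)
        (simp_all only: integral_mult_right_zero a_def b_def L2_norm_power2 integrable_mult_right fi gi)
    finally show ?thesis .
  qed
  have "L2_norm (\<lambda>x. f x + g x) \<le> a + b + e" if e: "e > 0" for e
  proof -
    define a' b' where "a' = a + e / 2" and "b' = b + e / 2"
    have pos: "a' > 0" "b' > 0" and le: "a \<le> a'" "b \<le> b'"
      using ab e by (simp_all add: a'_def b'_def)
    have "(L2_norm (\<lambda>x. f x + g x))\<^sup>2 \<le> (1 + b' / a') * a\<^sup>2 + (1 + 1 / (b' / a')) * b\<^sup>2"
      by (rule key) (use pos in simp)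
    also have "\<dots> \<le> (1 + b' / a') * a'\<^sup>2 + (1 + 1 / (b' / a')) * b'\<^sup>2"
      using ab pos le by (intro add_mono mult_left_mono power_mono) simp_all
    also have "\<dots> = (a' + b')\<^sup>2"
      using pos by (simp add: divide_simps) (simp add: algebra_simps power2_eq_square)
    finally have "L2_norm (\<lambda>x. f x + g x) \<le> a' + b'"
      by (rule power2_le_imp_le) (use pos in simp)
    also have "a' + b' = a + b + e" by (simp add: a'_def b'_def)
    finally show ?thesis .
  qed
  then show ?thesis
    unfolding a_def b_def by (rule field_le_epsilon)
qed

quotient_type (overloaded) 'n L2 = "real^'n::finite \<Rightarrow> complex" / partial: L2_eq
proof (rule part_equivpI)
  show "\<exists>f. L2_eq f f"
    using sq_integrable_zero by (auto simp: L2_eq_def)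
  show "symp L2_eq"
    by (auto simp: symp_def L2_eq_def)
  show "transp L2_eq"
    by (auto simp: transp_def L2_eq_def)
qed

instantiation L2 :: (finite) real_normed_vector
begin

lift_definition zero_L2 :: "'a L2" is "\<lambda>_. 0"
  by (auto simp: L2_eq_def sq_integrable_zero)

lift_definition plus_L2 :: "'a L2 \<Rightarrow> 'a L2 \<Rightarrow> 'a L2" is "\<lambda>f g x. f x + g x"
  by (auto simp: L2_eq_def sq_integrable_add)

lift_definition uminus_L2 :: "'a L2 \<Rightarrow> 'a L2" is "\<lambda>f x. - f x"
  using sq_integrable_scale[of _ "-1"] by (auto simp: L2_eq_def)

definition minus_L2 :: "'a L2 \<Rightarrow> 'a L2 \<Rightarrow> 'a L2"
  where "minus_L2 f g = f + - g"

lift_definition scaleR_L2 :: "real \<Rightarrow> 'a L2 \<Rightarrow> 'a L2" is "\<lambda>c f x. c *\<^sub>R f x"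
  using sq_integrable_scale[of _ "complex_of_real _"]
  by (auto simp: L2_eq_def scaleR_conv_of_real)

lift_definition norm_L2 :: "'a L2 \<Rightarrow> real" is L2_norm
  by (rule L2_norm_cong)

definition dist_L2 :: "'a L2 \<Rightarrow> 'a L2 \<Rightarrow> real"
  where "dist_L2 f g = norm (f - g)"

definition sgn_L2 :: "'a L2 \<Rightarrow> 'a L2"
  where "sgn_L2 f = inverse (norm f) *\<^sub>R f"

definition uniformity_L2 :: "('a L2 \<times> 'a L2) filter"
  where "uniformity_L2 = (INF e\<in>{0<..}. principal {(f, g). dist f g < e})"

definition open_L2 :: "'a L2 set \<Rightarrow> bool"
  where "open_L2 U \<longleftrightarrow> (\<forall>f\<in>U. eventually (\<lambda>(f', g). f' = f \<longrightarrow> g \<in> U) uniformity)"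

instance
proof
  fix f g k :: "'a L2" and a b :: real
  show "f + g + k = f + (g + k)"
    by transfer (auto simp: L2_eq_def add.assoc intro!: sq_integrable_add)
  show "f + g = g + f"
    by transfer (auto simp: L2_eq_def add.commute intro!: sq_integrable_add)
  show "0 + f = f"
    by transfer (auto simp: L2_eq_def)
  show "- f + f = 0"
    by transfer (auto simp: L2_eq_def sq_integrable_zero)
  show "f - g = f + - g"
    by (simp add: minus_L2_def)
  show "a *\<^sub>R (f + g) = a *\<^sub>R f + a *\<^sub>R g"
    by transfer (auto simp: L2_eq_def scaleR_conv_of_real distrib_left
        intro!: sq_integrable_add sq_integrable_scale)
  show "(a + b) *\<^sub>R f = a *\<^sub>R f + b *\<^sub>R f"
    by transfer (auto simp: L2_eq_def scaleR_conv_of_real scaleR_left_distrib distrib_right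
        intro!: sq_integrable_add sq_integrable_scale simp del: of_real_add, simp add: distrib_right)
  show "a *\<^sub>R b *\<^sub>R f = (a * b) *\<^sub>R f"
    by transfer (auto simp: L2_eq_def scaleR_conv_of_real mult.assoc
        intro!: sq_integrable_scale simp del: of_real_mult,
        auto simp: mult.assoc intro!: sq_integrable_scale)
  show "1 *\<^sub>R f = f"
    by transfer (auto simp: L2_eq_def)
  show "dist f g = norm (f - g)"
    by (simp add: dist_L2_def)
  show "sgn f = inverse (norm f) *\<^sub>R f"
    by (simp add: sgn_L2_def)
  show "uniformity = (INF e\<in>{0<..}. principal {(f::'a L2, g). dist f g < e})"
    by (simp add: uniformity_L2_def)
  show "open U \<longleftrightarrow> (\<forall>f\<in>U. \<forall>\<^sub>F (f', g) in uniformity. f' = f \<longrightarrow> g \<in> U)" for U :: "'a L2 set"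
    by (simp add: open_L2_def)
  show "norm f = 0 \<longleftrightarrow> f = 0"
    by transfer (auto simp: L2_eq_def L2_norm_eq_0_iff sq_integrable_zero)
  show "norm (f + g) \<le> norm f + norm g"
    by transfer (auto simp: L2_eq_def intro!: L2_norm_triangle)
  show "norm (a *\<^sub>R f) = \<bar>a\<bar> * norm f"
    by transfer (simp add: L2_norm_def power_mult_distrib real_sqrt_mult)
qed

end

text \<open>Multiplication by a bounded Borel function; constants give the complex scalar
  multiplication. All multipliers used below are bounded, so the value \<open>0\<close> for other \<open>V\<close> is
  never relevant.\<close>

lift_definition mult_op :: "(real^'n::finite \<Rightarrow> complex) \<Rightarrow> 'n L2 \<Rightarrow> 'n L2"
  is "\<lambda>V f x. if V \<in> borel_measurable borel \<and> bounded (range V) then V x * f x else 0"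
  subgoal for V f g
    by (cases "V \<in> borel_measurable borel \<and> bounded (range V)")
      (auto simp: L2_eq_def sq_integrable_zero sq_integrable_bounded_mult)
  done


section \<open>Weak derivatives and the Sobolev space of order two\<close>

lift_definition weak_deriv :: "'n::finite list \<Rightarrow> 'n L2 \<Rightarrow> 'n L2 \<Rightarrow> bool"
  is "\<lambda>js u v. \<forall>\<phi>. test_function \<phi> \<longrightarrow>
        (\<integral>x. u x * pderivs js \<phi> x \<partial>lborel) = (-1) ^ length js * (\<integral>x. v x * \<phi> x \<partial>lborel)"
proof -
  have cong: "(\<integral>x. w x * pderivs ks \<phi> x \<partial>lborel) = (\<integral>x. w' x * pderivs ks \<phi> x \<partial>lborel)"
    if "L2_eq w w'" "test_function \<phi>" for w w' :: "real^'n \<Rightarrow> complex" and ks \<phi>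
  proof (rule integral_cong_AE)
    have m: "w \<in> borel_measurable borel" "w' \<in> borel_measurable borel"
        "pderivs ks \<phi> \<in> borel_measurable borel"
      using that by (simp_all add: L2_eq_def sq_integrable_def test_function_def
          smooth_pderivs_measurable)
    show "(\<lambda>x. w x * pderivs ks \<phi> x) \<in> borel_measurable lborel"
        "(\<lambda>x. w' x * pderivs ks \<phi> x) \<in> borel_measurable lborel"
      using m by simp_all
    have "AE x in lborel. w x = w' x"
      using that(1) by (simp add: L2_eq_def)
    then show "AE x in lborel. w x * pderivs ks \<phi> x = w' x * pderivs ks \<phi> x"
      by (rule eventually_mono) simp
  qed
  fix js :: "'n list" and u u' v v' :: "real^'n \<Rightarrow> complex"
  assume uv: "L2_eq u u'" "L2_eq v v'"
  have "((\<integral>x. u x * pderivs js \<phi> x \<partial>lborel) = (-1) ^ length js * (\<integral>x. v x * \<phi> x \<partial>lborel)) =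
      ((\<integral>x. u' x * pderivs js \<phi> x \<partial>lborel) = (-1) ^ length js * (\<integral>x. v' x * \<phi> x \<partial>lborel))"
    if "test_function \<phi>" for \<phi>
    using cong[OF uv(1) that, of js] cong[OF uv(2) that, of "[]"] by (simp only: pderivs.simps(1))
  then show "(\<forall>\<phi>. test_function \<phi> \<longrightarrow>
        (\<integral>x. u x * pderivs js \<phi> x \<partial>lborel) = (-1) ^ length js * (\<integral>x. v x * \<phi> x \<partial>lborel)) =
    (\<forall>\<phi>. test_function \<phi> \<longrightarrow>
        (\<integral>x. u' x * pderivs js \<phi> x \<partial>lborel) = (-1) ^ length js * (\<integral>x. v' x * \<phi> x \<partial>lborel))"
    by (rule all_cong)
qed

definition H2 :: "'n::finite L2 set"
  where "H2 = {u. \<forall>js. length js \<le> 2 \<longrightarrow> (\<exists>v. weak_deriv js u v)}"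

definition laplacian :: "'n::finite L2 \<Rightarrow> 'n L2"
  where "laplacian u = (\<Sum>j\<in>UNIV. THE v. weak_deriv [j, j] u v)"


section \<open>Operators, resolvents and operator norms\<close>

text \<open>\<open>H\<^sub>h = - h\<^sup>2 \<Delta> + V\<^sub>1 - i h V\<^sub>2\<close>, to be used on its domain \<^const>\<open>H2\<close>.\<close>

definition schroedinger ::
    "(real^'n::finite \<Rightarrow> real) \<Rightarrow> (real^'n \<Rightarrow> real) \<Rightarrow> real \<Rightarrow> 'n L2 \<Rightarrow> 'n L2"
  where "schroedinger V1 V2 h u =
    - (h\<^sup>2 *\<^sub>R laplacian u) + mult_op (\<lambda>x. of_real (V1 x)) u
      - mult_op (\<lambda>x. \<i> * of_real (h * V2 x)) u"

definition resolvent :: "'n::finite L2 set \<Rightarrow> ('n L2 \<Rightarrow> 'n L2) \<Rightarrow> complex \<Rightarrow> 'n L2 \<Rightarrow> 'n L2"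
  where "resolvent D T z f = (THE u. u \<in> D \<and> T u - mult_op (\<lambda>_. z) u = f)"

definition weight :: "real \<Rightarrow> 'n::finite L2 \<Rightarrow> 'n L2"
  where "weight r = mult_op (\<lambda>x. of_real (jbracket x powr r))"

definition weighted_resolvent ::
    "(real^'n::finite \<Rightarrow> real) \<Rightarrow> (real^'n \<Rightarrow> real) \<Rightarrow> real \<Rightarrow> real \<Rightarrow> complex \<Rightarrow> 'n L2 \<Rightarrow> 'n L2"
  where "weighted_resolvent V1 V2 s h z =
    weight (- s) \<circ> resolvent H2 (schroedinger V1 V2 h) z \<circ> weight (- s)"

text \<open>The operator norm, extended by \<open>\<infinity>\<close> to maps that are not bounded operators. (On unbounded
  maps \<^const>\<open>onorm\<close> is a supremum of an unbounded set of reals, hence meaningless.)\<close>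

definition op_norm :: "('a::real_normed_vector \<Rightarrow> 'b::real_normed_vector) \<Rightarrow> ennreal"
  where "op_norm A = (if bounded_linear A then ennreal (onorm A) else \<infinity>)"

text \<open>Limit in operator norm. On \<open>L\<^sup>2\<close> the type \<open>\<Rightarrow>\<^sub>L\<close> only records real linearity of \<open>L\<close>; a norm
  limit of complex-linear maps is itself complex-linear.\<close>

definition op_tendsto ::
    "('c \<Rightarrow> 'a::real_normed_vector \<Rightarrow> 'b::real_normed_vector) \<Rightarrow> ('a \<Rightarrow>\<^sub>L 'b) \<Rightarrow> 'c filter \<Rightarrow> bool"
  where "op_tendsto A L F \<longleftrightarrow>
    ((\<lambda>\<mu>. op_norm (\<lambda>u. A \<mu> u - blinfun_apply L u)) \<longlongrightarrow> 0) F"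


section \<open>Classical dynamics\<close>

definition symbol_p :: "(real^'n::finite \<Rightarrow> real) \<Rightarrow> (real^'n) \<times> (real^'n) \<Rightarrow> real"
  where "symbol_p V1 w = (norm (snd w))\<^sup>2 + V1 (fst w)"

definition hamiltonian_flow ::
    "(real^'n::finite \<Rightarrow> real) \<Rightarrow> (real \<Rightarrow> (real^'n) \<times> (real^'n) \<Rightarrow> (real^'n) \<times> (real^'n)) \<Rightarrow> bool"
  where "hamiltonian_flow V1 \<phi> \<longleftrightarrow>
    (\<forall>w. \<phi> 0 w = w) \<and>
    (\<forall>w t. ((\<lambda>t. fst (\<phi> t w)) has_vector_derivative 2 *\<^sub>R snd (\<phi> t w)) (at t)) \<and>
    (\<forall>w t. ((\<lambda>t. snd (\<phi> t w)) has_vector_derivative - grad V1 (fst (\<phi> t w))) (at t))"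

definition upper_strip :: "real set \<Rightarrow> complex set"
  where "upper_strip J = {z. Im z > 0 \<and> Re z \<in> J}"

end

theory Submission
  imports Defs
begin

text \<open>Suppose a bounded trajectory \<open>(q, \<xi>)\<close> of energy \<open>E\<close> avoids the damping region. A Gaussian packet
  \<open>u = a exp (\<i>/h (S + \<xi>\<cdot>y + G y\<cdot>y/2))\<close>, \<open>y = x - q(t)\<close>, whose width \<open>G\<close> solves the Riccati equation of the
  linearised flow, is carried along it without loss of mass: \<open>V2\<close> vanishes to second order on the
  trajectory, so the damping contributes only an error \<open>O(h\<^sup>2)\<close>, and the cubic Taylor remainder of
  \<open>V1\<close> contributes \<open>O(h\<^sup>3\<^sup>/\<^sup>2)\<close>. Cut off in time by \<open>sin (\<pi>t/T)\<close> and Fourier transformed in \<open>t\<close>, the packet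
  yields quasimodes of energies spaced by \<open>2\<pi>h/T\<close>, with sources of size \<open>h/T\<close> coming from the cut-off.
  Applying the resolvent estimate to each and summing over the energies in a window around \<open>E\<close> by
  Bessel's inequality and its approximate converse gives, as \<open>h \<rightarrow> 0\<close>, \<open>T\<^sup>2 \<le> const\<close> with a constant
  independent of \<open>T\<close>, which fails for large \<open>T\<close>. Boundedness of the trajectory keeps the weights
  \<open>\<langle>x\<rangle>\<^sup>\<plusminus>\<^sup>s\<close> comparable to constants on the packet.\<close>

section \<open>Square-integrable functions\<close>

text \<open>A lower bound for a single quasimode is out of reach, since the trajectory may return to
  its past and the superposition in time may cancel. Summing over energies avoids it: Parseval in t
  returns the mass of the packet, which is conserved. What lies outside the energy window must then
  be negligible. Measured against E, the packet has an energy defect linear in x - q, and its width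
  is h^(1/2), so its time derivative is of size h^(-1/2); a window of fixed width \<epsilon>
  corresponds to time cells of length about h/\<epsilon>, and the loss (h/\<epsilon>)^2 / h tends to
  0. The balance is T^2 times the mass on one side, one T from Parseval and one from integrating in
  time, against (c/h)^2 * T^2 * (h/T)^2 = c^2 on the other. The energies of the quasimodes are real
  while the bound concerns Im z > 0: at \<omega> + i*\<mu> a quasimode v has its source changed by
  -i*\<mu>*v only, and \<mu> tends to 0 while h and T stay fixed.\<close>

lemma L2_cases:
  fixes u :: "'n::finite L2"
  obtains f where "sq_integrable f" "u = abs_L2 f"
proof -
  have "L2_eq (rep_L2 u) (rep_L2 u)" "abs_L2 (rep_L2 u) = u"
    by (simp_all add: Quotient_rep_reflp[OF Quotient_L2] Quotient_abs_rep[OF Quotient_L2])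
  then show thesis using that by (metis L2_eq_def)
qed

lemma L2_eq_refl: "sq_integrable f \<Longrightarrow> L2_eq f f"
  by (simp add: L2_eq_def)

lemma abs_L2_eq_iff:
  assumes "sq_integrable f" "sq_integrable g"
  shows "abs_L2 f = abs_L2 g \<longleftrightarrow> (AE x in lborel. f x = g x)"
proof -
  have "abs_L2 f = abs_L2 g \<longleftrightarrow> L2_eq f g"
    using Quotient_rel_abs2[OF Quotient_L2] Quotient_rel[OF Quotient_L2, of f g] assms by (auto simp: L2_eq_def)
  then show ?thesis using assms by (simp add: L2_eq_def)
qed

lemma norm_abs_L2: "sq_integrable f \<Longrightarrow> norm (abs_L2 f) = L2_norm f"
  by (rule norm_L2.abs_eq[OF L2_eq_refl])

lemma add_abs_L2:
  "sq_integrable f \<Longrightarrow> sq_integrable g \<Longrightarrow> abs_L2 f + abs_L2 g = abs_L2 (\<lambda>x. f x + g x)"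
  by (rule plus_L2.abs_eq[OF L2_eq_refl L2_eq_refl])

lemma uminus_abs_L2: "sq_integrable f \<Longrightarrow> - abs_L2 f = abs_L2 (\<lambda>x. - f x)"
  by (rule uminus_L2.abs_eq[OF L2_eq_refl])

lemma scaleR_abs_L2: "sq_integrable f \<Longrightarrow> c *\<^sub>R abs_L2 f = abs_L2 (\<lambda>x. c *\<^sub>R f x)"
  by (rule scaleR_L2.abs_eq[OF L2_eq_refl])

lemma diff_abs_L2:
  fixes f g :: "real^'n::finite \<Rightarrow> complex"
  assumes f: "sq_integrable f" and g: "sq_integrable g"
  shows "abs_L2 f - abs_L2 g = abs_L2 (\<lambda>x. f x - g x)"
proof -
  have "sq_integrable (\<lambda>x. - g x)" using sq_integrable_scale[OF g, of "-1"] by simp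
  then show ?thesis unfolding minus_L2_def uminus_abs_L2[OF g] by (simp add: add_abs_L2 f)
qed

lemma weak_deriv_abs_L2:
  fixes f g :: "real^'n::finite \<Rightarrow> complex"
  assumes "sq_integrable f" "sq_integrable g"
  shows "weak_deriv js (abs_L2 f) (abs_L2 g) \<longleftrightarrow> (\<forall>\<phi>. test_function \<phi> \<longrightarrow>
    (\<integral>x. f x * pderivs js \<phi> x \<partial>lborel) = (-1) ^ length js * (\<integral>x. g x * \<phi> x \<partial>lborel))"
  by (rule weak_deriv.abs_eq[OF L2_eq_refl[OF assms(1)] L2_eq_refl[OF assms(2)]])

lemma zero_abs_L2: "(0 :: 'n::finite L2) = abs_L2 (\<lambda>_. 0)"
  by (rule zero_L2.abs_eq)

lemma mult_op_abs_L2: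
  assumes "sq_integrable f" "V \<in> borel_measurable borel" "bounded (range V)"
  shows "mult_op V (abs_L2 f) = abs_L2 (\<lambda>x. V x * f x)"
  using mult_op.abs_eq[OF L2_eq_refl[OF assms(1)], of V] assms by simp

lemma sq_integrable_uminus: "sq_integrable f \<Longrightarrow> sq_integrable (\<lambda>x. - f x)"
  using sq_integrable_scale[of f "-1"] by simp

lemma sq_integrable_diff: "sq_integrable f \<Longrightarrow> sq_integrable g \<Longrightarrow> sq_integrable (\<lambda>x. f x - g x)"
  using sq_integrable_add[OF _ sq_integrable_uminus[of g]] by simp

lemma sq_integrable_cnj: "sq_integrable f \<Longrightarrow> sq_integrable (\<lambda>x. cnj (f x))"
proof -
  have "cnj \<in> borel_measurable borel" by (intro borel_measurable_continuous_onI continuous_intros)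
  then have "(\<lambda>x. cnj (f x)) \<in> borel_measurable borel" if "f \<in> borel_measurable borel"
    using measurable_compose[OF that] by blast
  then show "sq_integrable f \<Longrightarrow> ?thesis" by (simp add: sq_integrable_def)
qed

lemma sq_integrable_sum: "(\<And>i. i \<in> I \<Longrightarrow> sq_integrable (f i)) \<Longrightarrow> sq_integrable (\<lambda>x. \<Sum>i\<in>I. f i x)"
  by (induction I rule: infinite_finite_induct) (auto simp: sq_integrable_zero intro!: sq_integrable_add)

lemma sum_abs_L2:
  assumes "\<And>i. i \<in> I \<Longrightarrow> sq_integrable (f i)"
  shows "(\<Sum>i\<in>I. abs_L2 (f i)) = abs_L2 (\<lambda>x. \<Sum>i\<in>I. f i x)"
  using assms
  by (induction I rule: infinite_finite_induct) (auto simp: zero_abs_L2 add_abs_L2 sq_integrable_sum)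

lemma sq_integrable_mult_integrable:
  fixes f g :: "real^'n::finite \<Rightarrow> complex"
  assumes "sq_integrable f" "sq_integrable g"
  shows "integrable lborel (\<lambda>x. f x * g x)"
proof (rule Bochner_Integration.integrable_bound)
  show "integrable lborel (\<lambda>x. (norm (f x))\<^sup>2 + (norm (g x))\<^sup>2)"
    using assms by (auto simp: sq_integrable_def)
  show "(\<lambda>x. f x * g x) \<in> borel_measurable lborel"
    using assms by (auto simp: sq_integrable_def)
  have "norm (f x * g x) \<le> (norm (f x))\<^sup>2 + (norm (g x))\<^sup>2" for x
  proof -
    have "0 \<le> norm (f x) * norm (g x)" by simp
    with sum_squares_bound[of "norm (f x)" "norm (g x)"] show ?thesis unfolding norm_mult by linarith
  qed
  then show "AE x in lborel. norm (f x * g x) \<le> norm ((norm (f x))\<^sup>2 + (norm (g x))\<^sup>2)"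
    by (auto intro: order_trans)
qed

definition L2_inner :: "(real^'n::finite \<Rightarrow> complex) \<Rightarrow> (real^'n \<Rightarrow> complex) \<Rightarrow> complex"
  where "L2_inner f g = (\<integral>x. f x * cnj (g x) \<partial>lborel)"

lemma L2_inner_cnj: "L2_inner g f = cnj (L2_inner f g)"
  unfolding L2_inner_def by (subst Bochner_Integration.integral_cnj[symmetric]) (simp add: mult.commute)

lemma L2_inner_self: "L2_inner f f = of_real ((L2_norm f)\<^sup>2)"
  unfolding L2_inner_def L2_norm_power2
  by (simp only: complex_norm_square[symmetric] integral_complex_of_real)

text \<open>Cauchy-Schwarz from 2ab <= t*a^2 + b^2/t with the optimal t, the ratio of the two norms.
  Both norms are raised by \<open>e\<close> so that the ratio is defined when one of them vanishes;
  \<open>e\<close> tends to 0 at the end.\<close>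

lemma integral_mult_le_L2:
  assumes f: "sq_integrable f" and g: "sq_integrable g"
  shows "(\<integral>x. norm (f x) * norm (g x) \<partial>lborel) \<le> L2_norm f * L2_norm g"
proof -
  define a b where "a = L2_norm f" and "b = L2_norm g"
  have i: "integrable lborel (\<lambda>x. norm (f x) * norm (g x))"
    using integrable_norm[OF sq_integrable_mult_integrable[OF f g]] by (simp add: norm_mult)
  have key: "2 * (\<integral>x. norm (f x) * norm (g x) \<partial>lborel) \<le> t * a\<^sup>2 + b\<^sup>2 / t" if "t > 0" for t
  proof -
    have "(\<integral>x. 2 * (norm (f x) * norm (g x)) \<partial>lborel) \<le> (\<integral>x. t * (norm (f x))\<^sup>2 + (norm (g x))\<^sup>2 / t \<partial>lborel)"
    proof (rule integral_mono)
      fix x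
      have "0 \<le> (t * norm (f x) - norm (g x))\<^sup>2 / t" using that by simp
      then show "2 * (norm (f x) * norm (g x)) \<le> t * (norm (f x))\<^sup>2 + (norm (g x))\<^sup>2 / t"
        using that by (simp add: power2_diff field_simps power2_eq_square)
    qed (use f g i in \<open>auto simp: sq_integrable_def\<close>)
    also have "\<dots> = t * a\<^sup>2 + b\<^sup>2 / t"
      using f g by (subst Bochner_Integration.integral_add) (auto simp: sq_integrable_def a_def b_def L2_norm_power2)
    finally show ?thesis by simp
  qed
  have ab: "a \<ge> 0" "b \<ge> 0" by (auto simp: a_def b_def L2_norm_nonneg)
  have "(\<integral>x. norm (f x) * norm (g x) \<partial>lborel) \<le> (a + e) * (b + e)" if "e > 0" for e
  proof -
    have "2 * (\<integral>x. norm (f x) * norm (g x) \<partial>lborel) \<le> ((b + e) / (a + e)) * a\<^sup>2 + b\<^sup>2 / ((b + e) / (a + e))"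
      using ab that by (intro key) auto
    also have "\<dots> \<le> ((b + e) / (a + e)) * (a + e)\<^sup>2 + (b + e)\<^sup>2 / ((b + e) / (a + e))"
      using ab that by (intro add_mono mult_left_mono divide_right_mono power_mono) auto
    also have "\<dots> = 2 * ((a + e) * (b + e))"
      using ab that by (simp add: power2_eq_square)
    finally show ?thesis by simp
  qed
  then have le: "(\<integral>x. norm (f x) * norm (g x) \<partial>lborel) \<le> (a + e) * (b + e)" if "e > 0" for e using that by blast
  have "((\<lambda>e. (a + e) * (b + e)) \<longlongrightarrow> (a + 0) * (b + 0)) (at_right 0)"
    by (intro tendsto_intros)
  then have "(\<integral>x. norm (f x) * norm (g x) \<partial>lborel) \<le> (a + 0) * (b + 0)"
    by (rule tendsto_lowerbound) (auto simp: eventually_at_filter le)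
  then show ?thesis by (simp add: a_def b_def)
qed

lemma norm_L2_inner_le:
  assumes "sq_integrable f" "sq_integrable g"
  shows "norm (L2_inner f g) \<le> L2_norm f * L2_norm g"
proof -
  have "norm (L2_inner f g) \<le> (\<integral>x. norm (f x * cnj (g x)) \<partial>lborel)"
    unfolding L2_inner_def by (rule integral_norm_bound)
  also have "\<dots> \<le> L2_norm f * L2_norm g"
    using integral_mult_le_L2[OF assms] by (simp add: norm_mult)
  finally show ?thesis .
qed

lemma L2_inner_diff:
  assumes "sq_integrable f" "sq_integrable g" "sq_integrable k"
  shows L2_inner_diff_left: "L2_inner (\<lambda>x. f x - g x) k = L2_inner f k - L2_inner g k"
    and L2_inner_diff_right: "L2_inner f (\<lambda>x. g x - k x) = L2_inner f g - L2_inner f k"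
proof -
  note i = sq_integrable_mult_integrable[OF _ sq_integrable_cnj]
  show "L2_inner (\<lambda>x. f x - g x) k = L2_inner f k - L2_inner g k"
    unfolding L2_inner_def left_diff_distrib by (rule Bochner_Integration.integral_diff; intro i assms)
  show "L2_inner f (\<lambda>x. g x - k x) = L2_inner f g - L2_inner f k"
    unfolding L2_inner_def complex_cnj_diff right_diff_distrib
    by (rule Bochner_Integration.integral_diff; intro i assms)
qed


section \<open>Discrete Fourier coefficients on an interval\<close>

text \<open>Geometric series of an N-th root of unity; that \<open>N\<close> does not divide
  \<open>d\<close> is what makes the root different from 1.\<close>

lemma sum_cis_powers:
  fixes d :: int
  assumes "N > 0" "\<not> int N dvd d"
  shows "(\<Sum>k<N. cis (2 * pi * of_int d / of_nat N) ^ k) = 0"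
proof -
  let ?x = "cis (2 * pi * of_int d / of_nat N)"
  have "?x ^ N = cis (2 * pi * of_int d)"
    unfolding Complex.DeMoivre using assms by simp
  also have "\<dots> = 1"
    using cis_multiple_2pi[of "of_int d"] by (simp add: mult.commute)
  finally have 1: "?x ^ N = 1" .
  have "?x \<noteq> 1"
  proof
    assume "?x = 1"
    then have "cos (2 * pi * of_int d / of_nat N) = 1"
      by (metis cis.simps(1) one_complex.simps(1))
    then obtain n :: int where "2 * pi * of_int d / of_nat N = of_int n * 2 * pi"
      by (auto simp: cos_one_2pi_int)
    then have "real_of_int d = of_int n * of_nat N"
      using assms by (auto simp: field_simps)
    then have "d = n * int N"
      by (metis of_int_eq_iff of_int_mult of_int_of_nat_eq)
    then show False using assms by simp
  qed
  then show ?thesis using 1 by (simp add: geometric_sum)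
qed

text \<open>The frequencies k - r may be shifted by any real r: the shift multiplies the term (j, l)
  by the unimodular \<open>w\<close>, which is 1 on the diagonal, and orthogonality of characters
  removes everything off the diagonal.\<close>

lemma finite_parseval:
  fixes b :: "nat \<Rightarrow> complex" and r :: real
  assumes N: "N > 0"
  shows "(\<Sum>k<N. (norm (\<Sum>j<N. b j * cis (2 * pi * (real k - r) * real j / real N)))\<^sup>2)
      = real N * (\<Sum>j<N. (norm (b j))\<^sup>2)"
proof -
  define w where "w d = cis (- 2 * pi * r * real_of_int d / real N)" for d
  define z where "z d = cis (2 * pi * real_of_int d / real N)" for d
  have split: "cis (2 * pi * (real k - r) * real j / real N) * cnj (cis (2 * pi * (real k - r) * real l / real N))
      = w (int j - int l) * z (int j - int l) ^ k" for j k l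
    unfolding w_def z_def cis_cnj cis_mult Complex.DeMoivre
    by (rule arg_cong[of _ _ cis]) (use N in \<open>simp add: field_simps\<close>)
  have zs: "(\<Sum>k<N. z (int j - int l) ^ k) = (if j = l then of_nat N else 0)" if "j < N" "l < N" for j l
  proof (cases "j = l")
    case False
    have "\<not> int N dvd int j - int l"
    proof
      assume "int N dvd int j - int l"
      then have "int j mod int N = int l mod int N" by (simp add: mod_eq_dvd_iff)
      then show False using that False by simp
    qed
    then show ?thesis using False sum_cis_powers[OF N, of "int j - int l"] by (simp add: z_def)
  qed (simp add: z_def)
  have "complex_of_real (\<Sum>k<N. (norm (\<Sum>j<N. b j * cis (2 * pi * (real k - r) * real j / real N)))\<^sup>2)
     = (\<Sum>k<N. \<Sum>j<N. \<Sum>l<N. b j * cnj (b l) * (w (int j - int l) * z (int j - int l) ^ k))"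
    unfolding of_real_sum complex_norm_square cnj_sum sum_product
    by (intro sum.cong refl) (simp flip: split)
  also have "\<dots> = (\<Sum>j<N. \<Sum>k<N. \<Sum>l<N. b j * cnj (b l) * (w (int j - int l) * z (int j - int l) ^ k))"
    by (rule sum.swap)
  also have "\<dots> = (\<Sum>j<N. \<Sum>l<N. \<Sum>k<N. b j * cnj (b l) * (w (int j - int l) * z (int j - int l) ^ k))"
    by (intro sum.cong refl sum.swap)
  also have "\<dots> = (\<Sum>j<N. \<Sum>l<N. b j * cnj (b l) * w (int j - int l) * (if j = l then of_nat N else 0))"
    by (intro sum.cong refl) (simp add: zs sum_distrib_left[symmetric] mult.assoc)
  also have "\<dots> = (\<Sum>j<N. b j * cnj (b j) * of_nat N)"
  proof (intro sum.cong refl)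
    fix j assume "j \<in> {..<N}"
    have "(\<Sum>l<N. b j * cnj (b l) * w (int j - int l) * (if j = l then of_nat N else 0))
      = (\<Sum>l<N. if j = l then b j * cnj (b j) * of_nat N else 0)"
      by (intro sum.cong refl) (simp add: w_def)
    then show "(\<Sum>l<N. b j * cnj (b l) * w (int j - int l) * (if j = l then of_nat N else 0))
      = b j * cnj (b j) * of_nat N" using \<open>j \<in> {..<N}\<close> by simp
  qed
  also have "\<dots> = complex_of_real (real N * (\<Sum>j<N. (norm (b j))\<^sup>2))"
    by (simp add: sum_distrib_left mult.commute flip: complex_norm_square)
  finally show ?thesis using of_real_eq_iff by blast
qed

text \<open>Folds an integral over N consecutive cells onto one cell, so that an identity of
  Parseval type valid for each offset \<sigma> can be integrated over \<sigma>.\<close>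

lemma integral_cells:
  fixes f :: "real \<Rightarrow> 'a::euclidean_space"
  assumes f: "continuous_on UNIV f" and "\<tau> \<ge> 0"
  shows "integral {0..real N * \<tau>} f = integral {0..\<tau>} (\<lambda>\<sigma>. \<Sum>j<N. f (real j * \<tau> + \<sigma>))"
proof (induction N)
  case (Suc N)
  have c: "continuous_on A f" for A using f continuous_on_subset by blast
  have sh: "integral {0..\<tau>} (\<lambda>\<sigma>. f (real N * \<tau> + \<sigma>)) = integral {real N * \<tau>..real (Suc N) * \<tau>} f"
  proof -
    have eq: "real (Suc N) * \<tau> = \<tau> + real N * \<tau>" by (simp add: distrib_right)
    have "integral {0..\<tau>} (f \<circ> (\<lambda>x. x + real N * \<tau>)) = integral {0 + real N * \<tau>..\<tau> + real N * \<tau>} f"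
      by (rule integral_shift[OF c])
    then show ?thesis
      unfolding eq o_def add_0 by (simp only: add.commute[of _ "real N * \<tau>"])
  qed
  have ci: "(\<lambda>\<sigma>. f (real j * \<tau> + \<sigma>)) integrable_on {0..\<tau>}" for j
    by (intro integrable_continuous_interval continuous_on_compose2[OF c] continuous_intros) auto
  have "integral {0..real (Suc N) * \<tau>} f = integral {0..real N * \<tau>} f + integral {real N * \<tau>..real (Suc N) * \<tau>} f"
    using assms(2) by (intro Henstock_Kurzweil_Integration.integral_combine[symmetric] integrable_continuous_interval c)
      (auto simp: algebra_simps)
  also have "\<dots> = integral {0..\<tau>} (\<lambda>\<sigma>. \<Sum>j<Suc N. f (real j * \<tau> + \<sigma>))"
    unfolding sh[symmetric] Suc.IH
    by (simp add: ci integrable_sum Henstock_Kurzweil_Integration.integral_add)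
  finally show ?case .
qed simp

text \<open>The mean square deviation of \<open>norm (f t)\<close> from its average
  \<open>I / L\<close> is nonnegative; expanded, this is the inequality for the integral of the
  norm, which dominates the norm of the integral.\<close>

lemma integral_cauchy_schwarz:
  fixes f :: "real \<Rightarrow> 'a::banach"
  assumes "a \<le> b" and f: "continuous_on {a..b} f"
  shows "(norm (integral {a..b} f))\<^sup>2 \<le> (b - a) * integral {a..b} (\<lambda>t. (norm (f t))\<^sup>2)"
proof (cases "a = b")
  case False
  define L I where "L = b - a" and "I = integral {a..b} (\<lambda>t. norm (f t))"
  have L: "L > 0" using False assms by (simp add: L_def)
  have i1: "(\<lambda>t. norm (f t)) integrable_on {a..b}" and i2: "(\<lambda>t. (norm (f t))\<^sup>2) integrable_on {a..b}"
    by (intro integrable_continuous_interval continuous_intros f)+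
  have "0 \<le> integral {a..b} (\<lambda>t. (norm (f t) - I / L)\<^sup>2)"
    by (intro integral_nonneg integrable_continuous_interval continuous_intros f) auto
  also have "\<dots> = integral {a..b} (\<lambda>t. (norm (f t))\<^sup>2 - (2 * I / L) * norm (f t) + (I / L)\<^sup>2)"
    by (intro integral_cong) (simp add: power2_diff)
  also have "\<dots> = integral {a..b} (\<lambda>t. (norm (f t))\<^sup>2) - (2 * I / L) * I + L * (I / L)\<^sup>2"
  proof -
    have i3: "(\<lambda>t. (2 * I / L) * norm (f t)) integrable_on {a..b}"
      using i1 by (rule integrable_on_mult_right)
    show ?thesis
      using i1 i2 i3 assms(1) by (subst Henstock_Kurzweil_Integration.integral_add integral_diff)
        (auto simp: integrable_diff I_def L_def Henstock_Kurzweil_Integration.integral_diff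
          simp del: times_divide_eq_left)
  qed
  also have "\<dots> = integral {a..b} (\<lambda>t. (norm (f t))\<^sup>2) - I\<^sup>2 / L"
    using L by (simp add: field_simps power2_eq_square)
  finally have "I\<^sup>2 \<le> L * integral {a..b} (\<lambda>t. (norm (f t))\<^sup>2)"
    using L by (simp add: field_simps)
  moreover have "(norm (integral {a..b} f))\<^sup>2 \<le> I\<^sup>2"
    unfolding I_def
    by (intro power_mono integral_norm_bound_integral integrable_continuous_interval f i1) auto
  ultimately show ?thesis by (simp add: L_def)
qed simp

text \<open>Turned by the phase at the midpoint, the integrand has real part cos (\<omega> *
  (\<sigma> - \<tau>/2)), at least 1 - x^2/2. Integration gives \<tau> - \<omega>^2 * \<tau>^3 / 24,
  and (\<omega> * \<tau>)^2 <= 16, from pi < 4, leaves one third of \<tau>.\<close>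

lemma norm_integral_cis_ge:
  assumes "\<tau> \<ge> 0" "\<bar>\<omega> * \<tau>\<bar> \<le> pi"
  shows "\<tau> / 3 \<le> norm (integral {0..\<tau>} (\<lambda>\<sigma>. cis (\<omega> * \<sigma>)))"
proof -
  define s where "s = \<tau> / 2"
  have cc: "continuous_on A (\<lambda>\<sigma>. cis (\<omega> * \<sigma> + c))" for A c
    by (intro continuous_intros)
  have "\<tau> / 3 \<le> \<tau> - \<omega>\<^sup>2 * \<tau> ^ 3 / 24"
  proof -
    have "(\<omega> * \<tau>)\<^sup>2 \<le> 4\<^sup>2"
      using assms(2) pi_less_4 by (subst abs_le_square_iff[symmetric]) simp
    then have "\<tau> * (\<omega> * \<tau>)\<^sup>2 \<le> \<tau> * 16" using assms(1) by (intro mult_left_mono) auto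
    then show ?thesis by (simp add: power_mult_distrib power2_eq_square power3_eq_cube algebra_simps)
  qed
  also have "\<tau> - \<omega>\<^sup>2 * \<tau> ^ 3 / 24 = integral {0..\<tau>} (\<lambda>\<sigma>. 1 - (\<omega> * (\<sigma> - s))\<^sup>2 / 2)"
  proof -
    have "((\<lambda>\<sigma>. 1 - (\<omega> * (\<sigma> - s))\<^sup>2 / 2) has_integral
        (\<tau> - \<omega>\<^sup>2 * (\<tau> - s) ^ 3 / 6) - (0 - \<omega>\<^sup>2 * (0 - s) ^ 3 / 6)) {0..\<tau>}"
      using assms(1) by (intro fundamental_theorem_of_calculus)
        (auto intro!: derivative_eq_intros simp: power2_eq_square field_simps
          simp flip: has_real_derivative_iff_has_vector_derivative)
    moreover have "(\<tau> - \<omega>\<^sup>2 * (\<tau> - s) ^ 3 / 6) - (0 - \<omega>\<^sup>2 * (0 - s) ^ 3 / 6) = \<tau> - \<omega>\<^sup>2 * \<tau> ^ 3 / 24"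
      by (simp add: s_def power3_eq_cube field_simps)
    ultimately show ?thesis by (simp add: integral_unique)
  qed
  also have "\<dots> \<le> integral {0..\<tau>} (\<lambda>\<sigma>. Re (cis (- \<omega> * s) * cis (\<omega> * \<sigma>)))"
  proof (intro integral_le integrable_continuous_interval continuous_intros cis_conv_exp)
    fix \<sigma>
    define x where "x = \<omega> * (\<sigma> - s)"
    have "cos x = 1 - 2 * (sin (x / 2))\<^sup>2"
      using cos_double_sin[of "x / 2"] by simp
    moreover have "(sin (x / 2))\<^sup>2 \<le> (x / 2)\<^sup>2"
      using abs_sin_x_le_abs_x[of "x / 2"] by (rule abs_le_square_iff[THEN iffD1])
    ultimately show "1 - (\<omega> * (\<sigma> - s))\<^sup>2 / 2 \<le> Re (cis (- \<omega> * s) * cis (\<omega> * \<sigma>))"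
      unfolding cis_mult by (simp add: x_def[symmetric] power_divide)
         (simp add: x_def algebra_simps)
  qed auto
  also have "\<dots> = Re (cis (- \<omega> * s) * integral {0..\<tau>} (\<lambda>\<sigma>. cis (\<omega> * \<sigma>)))"
  proof -
    have "((\<lambda>\<sigma>. cis (\<omega> * \<sigma>)) has_integral integral {0..\<tau>} (\<lambda>\<sigma>. cis (\<omega> * \<sigma>))) {0..\<tau>}"
      using cc[of _ 0] by (intro integrable_integral integrable_continuous_interval) simp
    then have "((\<lambda>\<sigma>. Re (cis (- \<omega> * s) * cis (\<omega> * \<sigma>))) has_integral
      Re (cis (- \<omega> * s) * integral {0..\<tau>} (\<lambda>\<sigma>. cis (\<omega> * \<sigma>)))) {0..\<tau>}"
      by (intro has_integral_Re has_integral_mult_right)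
    then show ?thesis by (rule integral_unique)
  qed
  also have "\<dots> \<le> norm (integral {0..\<tau>} (\<lambda>\<sigma>. cis (\<omega> * \<sigma>)))"
    by (rule order_trans[OF complex_Re_le_cmod]) (simp add: norm_mult)
  finally show ?thesis .
qed
text \<open>Splitting \<open>{0..T}\<close> into \<open>N\<close> cells of length \<open>\<tau>\<close> turns \<open>ghat k\<close> into an integral over one cell of a
  discrete Fourier transform, to which Parseval applies. The reverse inequality needs the frequencies
  to satisfy \<open>\<bar>k - r\<bar> \<le> N / 2\<close>, so that the phase \<open>e k\<close> turns by at most a half circle per cell and its
  mean over a cell is bounded below.\<close>

lemma window_bessel_coercivity:
  fixes g g' :: "real \<Rightarrow> complex" and r T \<tau> :: real
  assumes N: "N > 0" and T: "T > 0" and \<tau>: "\<tau> = T / real N"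
    and cg: "continuous_on UNIV g"
  defines "e \<equiv> \<lambda>k t. cis (2 * pi * (real k - r) * t / T)"
  defines "ghat \<equiv> \<lambda>k. integral {0..T} (\<lambda>t. g t * e k t)"
  shows window_bessel: "(\<Sum>k<N. (norm (ghat k))\<^sup>2) \<le> T * integral {0..T} (\<lambda>t. (norm (g t))\<^sup>2)"
    and window_coercivity: "\<lbrakk>real N = 2 * r; \<And>t. (g has_vector_derivative g' t) (at t); continuous_on UNIV g'\<rbrakk> \<Longrightarrow>
      T / 18 * integral {0..T} (\<lambda>t. (norm (g t))\<^sup>2)
        \<le> (\<Sum>k<N. (norm (ghat k))\<^sup>2) + T * \<tau>\<^sup>2 * integral {0..T} (\<lambda>t. (norm (g' t))\<^sup>2)"
proof -
  have \<tau>0: "\<tau> > 0" and T\<tau>: "real N * \<tau> = T" using N T by (auto simp: \<tau>)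
  have ce: "continuous_on A (e k)" for A k unfolding e_def by (intro continuous_intros) (use T in auto)
  have cg': "continuous_on A g" for A using cg continuous_on_subset by blast
  have sh: "continuous_on A (\<lambda>\<sigma>. f (real j * \<tau> + \<sigma>))" if "continuous_on UNIV f" for f :: "real \<Rightarrow> complex" and j A
    by (intro continuous_on_compose2[OF that] continuous_intros) auto
  \<comment> \<open>Discrete Fourier transform in the cell index at fixed offset \<sigma>. As T = N
    * \<tau>, the phase splits by \<open>esplit\<close> into a factor that sees only the cell and
    one that sees only \<sigma>, so \<open>ghat k\<close> becomes an integral of
    \<open>D g k\<close> over one cell.\<close>
  define D where "D f k \<sigma> = (\<Sum>j<N. f (real j * \<tau> + \<sigma>) * cis (2 * pi * (real k - r) * real j / real N))"
    for f :: "real \<Rightarrow> complex" and k \<sigma>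
  have cD: "continuous_on A (D f k)" if "continuous_on UNIV f" for A f k
    unfolding D_def by (intro continuous_intros sh that)
  have esplit: "e k (real j * \<tau> + \<sigma>) = cis (2 * pi * (real k - r) * real j / real N) * e k \<sigma>" for k j \<sigma>
    unfolding e_def cis_mult by (rule arg_cong[of _ _ cis]) (use N T in \<open>simp add: \<tau> field_simps\<close>)
  have ghat: "ghat k = integral {0..\<tau>} (\<lambda>\<sigma>. D g k \<sigma> * e k \<sigma>)" for k
  proof -
    have "ghat k = integral {0..\<tau>} (\<lambda>\<sigma>. \<Sum>j<N. g (real j * \<tau> + \<sigma>) * e k (real j * \<tau> + \<sigma>))"
      unfolding ghat_def T\<tau>[symmetric] using \<tau>0 by (intro integral_cells continuous_intros cg' ce) auto
    then show ?thesis by (simp add: D_def esplit sum_distrib_right mult.assoc)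
  qed
  have parseval: "(\<Sum>k<N. (norm (D f k \<sigma>))\<^sup>2) = real N * (\<Sum>j<N. (norm (f (real j * \<tau> + \<sigma>)))\<^sup>2)" for f \<sigma>
    unfolding D_def by (rule finite_parseval[OF N])
  have intD: "(\<Sum>k<N. integral {0..\<tau>} (\<lambda>\<sigma>. (norm (D f k \<sigma>))\<^sup>2)) = real N * integral {0..T} (\<lambda>t. (norm (f t))\<^sup>2)"
    if f: "continuous_on UNIV f" for f
  proof -
    have "(\<Sum>k<N. integral {0..\<tau>} (\<lambda>\<sigma>. (norm (D f k \<sigma>))\<^sup>2)) = integral {0..\<tau>} (\<lambda>\<sigma>. \<Sum>k<N. (norm (D f k \<sigma>))\<^sup>2)"
      by (intro integral_sum[symmetric] integrable_continuous_interval continuous_intros cD f) auto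
    also have "\<dots> = real N * integral {0..\<tau>} (\<lambda>\<sigma>. \<Sum>j<N. (norm (f (real j * \<tau> + \<sigma>)))\<^sup>2)"
      by (simp add: parseval)
    also have "integral {0..\<tau>} (\<lambda>\<sigma>. \<Sum>j<N. (norm (f (real j * \<tau> + \<sigma>)))\<^sup>2) = integral {0..T} (\<lambda>t. (norm (f t))\<^sup>2)"
      unfolding T\<tau>[symmetric] using \<tau>0 by (intro integral_cells[symmetric] continuous_intros f) auto
    finally show ?thesis .
  qed
  have normD: "norm (D f k \<sigma> * e k \<sigma>) = norm (D f k \<sigma>)" for f k \<sigma>
    by (simp add: norm_mult e_def)
  have cs: "(norm (ghat k))\<^sup>2 \<le> \<tau> * integral {0..\<tau>} (\<lambda>\<sigma>. (norm (D g k \<sigma>))\<^sup>2)" for k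
    using integral_cauchy_schwarz[of 0 \<tau> "\<lambda>\<sigma>. D g k \<sigma> * e k \<sigma>"] \<tau>0
    by (simp add: ghat normD cD[OF cg] ce continuous_on_mult)
  have "(\<Sum>k<N. (norm (ghat k))\<^sup>2) \<le> \<tau> * (\<Sum>k<N. integral {0..\<tau>} (\<lambda>\<sigma>. (norm (D g k \<sigma>))\<^sup>2))"
    unfolding sum_distrib_left by (intro sum_mono cs)
  also have "\<dots> = T * integral {0..T} (\<lambda>t. (norm (g t))\<^sup>2)"
    unfolding intD[OF cg] by (simp flip: T\<tau>)
  finally show "(\<Sum>k<N. (norm (ghat k))\<^sup>2) \<le> T * integral {0..T} (\<lambda>t. (norm (g t))\<^sup>2)" .

  assume r: "real N = 2 * r" and g': "\<And>t. (g has_vector_derivative g' t) (at t)" and cg1: "continuous_on UNIV g'"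
  define I where "I k = integral {0..\<tau>} (\<lambda>\<sigma>. (norm (D g' k \<sigma>))\<^sup>2)" for k
  have D': "((\<lambda>\<sigma>. D g k \<sigma>) has_vector_derivative D g' k \<sigma>) (at \<sigma>)" for k \<sigma>
  proof -
    have "((\<lambda>\<sigma>. g (real j * \<tau> + \<sigma>)) has_vector_derivative g' (real j * \<tau> + \<sigma>)) (at \<sigma>)" for j
    proof -
      have "((\<lambda>\<sigma>. real j * \<tau> + \<sigma>) has_vector_derivative 1) (at \<sigma>)"
        by (auto intro!: derivative_eq_intros simp flip: has_real_derivative_iff_has_vector_derivative)
      from vector_diff_chain_at[OF this g'] show ?thesis by (simp add: o_def)
    qed
    then show ?thesis unfolding D_def
      by (intro has_vector_derivative_sum has_vector_derivative_mult_left)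
  qed
  have bound: "(norm (D g k \<sigma> - D g k \<sigma>0))\<^sup>2 \<le> \<tau> * I k" if "\<sigma> \<in> {0..\<tau>}" "\<sigma>0 \<in> {0..\<tau>}" for k \<sigma> \<sigma>0
  proof -
    have main: "(norm (D g k b - D g k a))\<^sup>2 \<le> \<tau> * I k" if "0 \<le> a" "a \<le> b" "b \<le> \<tau>" for a b
    proof -
      have "(D g' k has_integral D g k b - D g k a) {a..b}"
        using that by (intro fundamental_theorem_of_calculus has_vector_derivative_at_within[OF D']) auto
      then have "D g k b - D g k a = integral {a..b} (D g' k)" by (simp add: integral_unique)
      then have "(norm (D g k b - D g k a))\<^sup>2 \<le> (b - a) * integral {a..b} (\<lambda>\<sigma>. (norm (D g' k \<sigma>))\<^sup>2)"
        using integral_cauchy_schwarz[OF that(2) cD[OF cg1]] by simp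
      also have "\<dots> \<le> \<tau> * I k" unfolding I_def
        by (intro mult_mono integral_subset_le integral_nonneg integrable_continuous_interval
            continuous_intros cD cg1) (use that in auto)
      finally show ?thesis .
    qed
    show ?thesis using main[of \<sigma> \<sigma>0] main[of \<sigma>0 \<sigma>] that by (cases "\<sigma> \<le> \<sigma>0") (auto simp: norm_minus_commute)
  qed
  \<comment> \<open>\<open>D g k\<close> is frozen at an arbitrary offset: its product with the
    integral \<open>c\<close> of the phase is \<open>ghat k\<close> minus an oscillation term, which
    \<open>bound\<close> controls. The 9 comes from norm c >= \<tau>/3; the 2 from squaring a
    difference turns it into the 18 of the statement.\<close>
  have pointwise: "\<tau>\<^sup>2 / 9 * (norm (D g k \<sigma>0))\<^sup>2 \<le> 2 * (norm (ghat k))\<^sup>2 + 2 * \<tau> ^ 3 * I k"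
    if k: "k < N" and \<sigma>0: "\<sigma>0 \<in> {0..\<tau>}" for k \<sigma>0
  proof -
    define c where "c = integral {0..\<tau>} (e k)"
    have "\<bar>real k - r\<bar> \<le> r" using k r by linarith
    then have "\<bar>2 * pi * (real k - r) / T * \<tau>\<bar> \<le> 2 * pi * r / T * \<tau>"
      using T \<tau>0 by (simp add: abs_mult divide_right_mono mult_left_mono mult_right_mono)
    also have "\<dots> = pi" using T N r by (simp add: \<tau> field_simps)
    finally have "\<tau> / 3 \<le> norm c"
      using norm_integral_cis_ge[of \<tau> "2 * pi * (real k - r) / T"] \<tau>0 by (simp add: c_def e_def[abs_def])
    then have "\<tau>\<^sup>2 / 9 * (norm (D g k \<sigma>0))\<^sup>2 \<le> (norm c)\<^sup>2 * (norm (D g k \<sigma>0))\<^sup>2"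
      using \<tau>0 power_mono[of "\<tau> / 3" "norm c" 2] by (intro mult_right_mono) (auto simp: power_divide)
    also have "\<dots> = (norm (D g k \<sigma>0 * c))\<^sup>2" by (simp add: norm_mult power_mult_distrib)
    also have "D g k \<sigma>0 * c = ghat k - integral {0..\<tau>} (\<lambda>\<sigma>. (D g k \<sigma> - D g k \<sigma>0) * e k \<sigma>)"
    proof -
      have i: "(\<lambda>\<sigma>. D g k \<sigma> * e k \<sigma>) integrable_on {0..\<tau>}" "(\<lambda>\<sigma>. D g k \<sigma>0 * e k \<sigma>) integrable_on {0..\<tau>}"
        by (intro integrable_continuous_interval continuous_intros cD cg ce)+
      show ?thesis using Henstock_Kurzweil_Integration.integral_diff[OF i] by (simp add: ghat left_diff_distrib c_def)
    qed
    also have "(norm \<dots>)\<^sup>2 \<le> 2 * (norm (ghat k))\<^sup>2 + 2 * (norm (integral {0..\<tau>} (\<lambda>\<sigma>. (D g k \<sigma> - D g k \<sigma>0) * e k \<sigma>)))\<^sup>2"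
      (is "(norm (?a - ?b))\<^sup>2 \<le> _")
    proof -
      have "(norm (?a - ?b))\<^sup>2 \<le> (norm ?a + norm ?b)\<^sup>2" by (intro power_mono norm_triangle_ineq4) auto
      also have "\<dots> \<le> 2 * (norm ?a)\<^sup>2 + 2 * (norm ?b)\<^sup>2"
        using sum_squares_bound[of "norm ?a" "norm ?b"] by (simp add: power2_sum)
      finally show ?thesis .
    qed
    also have "(norm (integral {0..\<tau>} (\<lambda>\<sigma>. (D g k \<sigma> - D g k \<sigma>0) * e k \<sigma>)))\<^sup>2 \<le>
        (\<tau> - 0) * integral {0..\<tau>} (\<lambda>\<sigma>. (norm ((D g k \<sigma> - D g k \<sigma>0) * e k \<sigma>))\<^sup>2)"
      using \<tau>0 by (intro integral_cauchy_schwarz continuous_intros cD cg ce) auto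
    also have "integral {0..\<tau>} (\<lambda>\<sigma>. (norm ((D g k \<sigma> - D g k \<sigma>0) * e k \<sigma>))\<^sup>2) \<le> integral {0..\<tau>} (\<lambda>\<sigma>. \<tau> * I k)"
      using bound[OF _ \<sigma>0, of _ k]
      by (intro integral_le integrable_continuous_interval continuous_intros cD cg ce)
        (auto simp: norm_mult e_def)
    also have "integral {0..\<tau>} (\<lambda>\<sigma>. \<tau> * I k) = \<tau> * (\<tau> * I k)" using \<tau>0 by simp
    finally show ?thesis using \<tau>0 by (simp add: power3_eq_cube algebra_simps)
  qed
  \<comment> \<open>Integrating over the free offset \<open>\<sigma>0\<close> restores the square
    integral of \<open>D g k\<close>, to which Parseval applies.\<close>
  have "\<tau> * (\<Sum>k<N. 2 * (norm (ghat k))\<^sup>2 + 2 * \<tau> ^ 3 * I k) = integral {0..\<tau>} (\<lambda>\<sigma>0. \<Sum>k<N. 2 * (norm (ghat k))\<^sup>2 + 2 * \<tau> ^ 3 * I k)"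
    using \<tau>0 by simp
  also have "\<dots> \<ge> integral {0..\<tau>} (\<lambda>\<sigma>0. \<Sum>k<N. \<tau>\<^sup>2 / 9 * (norm (D g k \<sigma>0))\<^sup>2)"
    by (intro integral_le integrable_continuous_interval continuous_intros cD cg sum_mono pointwise) auto
  also have "integral {0..\<tau>} (\<lambda>\<sigma>0. \<Sum>k<N. \<tau>\<^sup>2 / 9 * (norm (D g k \<sigma>0))\<^sup>2)
      = \<tau>\<^sup>2 / 9 * (\<Sum>k<N. integral {0..\<tau>} (\<lambda>\<sigma>. (norm (D g k \<sigma>))\<^sup>2))"
  proof -
    have "integral {0..\<tau>} (\<lambda>\<sigma>0. \<Sum>k<N. \<tau>\<^sup>2 / 9 * (norm (D g k \<sigma>0))\<^sup>2)
       = (\<Sum>k<N. integral {0..\<tau>} (\<lambda>\<sigma>. \<tau>\<^sup>2 / 9 * (norm (D g k \<sigma>))\<^sup>2))"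
      by (intro integral_sum integrable_continuous_interval continuous_intros cD cg) auto
    then show ?thesis by (simp add: sum_distrib_left)
  qed
  finally have "\<tau>\<^sup>2 / 9 * (real N * integral {0..T} (\<lambda>t. (norm (g t))\<^sup>2))
     \<le> \<tau> * (2 * (\<Sum>k<N. (norm (ghat k))\<^sup>2) + 2 * \<tau> ^ 3 * (\<Sum>k<N. I k))"
    by (simp add: intD[OF cg] sum.distrib sum_distrib_left)
  also have "(\<Sum>k<N. I k) = real N * integral {0..T} (\<lambda>t. (norm (g' t))\<^sup>2)"
    unfolding I_def by (rule intD[OF cg1])
  finally have "\<tau> * (T / 9 * integral {0..T} (\<lambda>t. (norm (g t))\<^sup>2))
     \<le> \<tau> * (2 * (\<Sum>k<N. (norm (ghat k))\<^sup>2) + 2 * T * \<tau>\<^sup>2 * integral {0..T} (\<lambda>t. (norm (g' t))\<^sup>2))"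
    by (simp add: power2_eq_square power3_eq_cube algebra_simps flip: T\<tau>)
  then have "T / 9 * integral {0..T} (\<lambda>t. (norm (g t))\<^sup>2)
     \<le> 2 * (\<Sum>k<N. (norm (ghat k))\<^sup>2) + 2 * T * \<tau>\<^sup>2 * integral {0..T} (\<lambda>t. (norm (g' t))\<^sup>2)"
    using \<tau>0 by simp
  then show "T / 18 * integral {0..T} (\<lambda>t. (norm (g t))\<^sup>2)
        \<le> (\<Sum>k<N. (norm (ghat k))\<^sup>2) + T * \<tau>\<^sup>2 * integral {0..T} (\<lambda>t. (norm (g' t))\<^sup>2)"
    by simp
qed


section \<open>Linear differential equations and the matrix Riccati equation\<close>

text \<open>The oriented interval integral serves both signs of t; the fundamental theorem is
  applied on an interval [-b, b] with t in its interior, where the restricted filter is the full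
  one.\<close>

lemma continuous_antiderivative:
  fixes f :: "real \<Rightarrow> 'a::euclidean_space"
  assumes "continuous_on UNIV f"
  obtains F where "F 0 = 0" "\<And>t. (F has_vector_derivative f t) (at t)"
proof -
  define F where "F t = (LBINT s=ereal 0..ereal t. f s)" for t :: real
  have "F 0 = 0" by (simp add: F_def)
  moreover have "(F has_vector_derivative f t) (at t)" for t
  proof -
    define b where "b = \<bar>t\<bar> + 1"
    have "((\<lambda>u. LBINT s=ereal 0..ereal u. f s) has_vector_derivative f t) (at t within {-b..b})"
      by (rule interval_integral_FTC2) (auto simp: b_def intro: continuous_on_subset[OF assms])
    moreover have "at t within {-b..b} = at t"
      by (rule at_within_interior) (auto simp: b_def)
    ultimately show ?thesis by (simp add: F_def[abs_def])
  qed
  ultimately show thesis using that by blast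
qed

text \<open>Composition with s * sgn t reduces negative times to positive ones. Applied inductively,
  the division by k + 1 builds up the factorials of the Picard series.\<close>

lemma norm_le_of_derivative_power_bound:
  fixes f :: "real \<Rightarrow> 'a::euclidean_space"
  assumes f: "\<And>t. (f has_vector_derivative f' t) (at t)" "f 0 = 0"
    and le: "\<And>s. \<bar>s\<bar> \<le> b \<Longrightarrow> norm (f' s) \<le> C * \<bar>s\<bar> ^ k" and t: "\<bar>t\<bar> \<le> b"
  shows "norm (f t) \<le> C * \<bar>t\<bar> ^ Suc k / real (Suc k)"
proof (cases "t = 0")
  case False
  define g where "g s = f (s * sgn t)" for s
  have g: "(g has_vector_derivative sgn t *\<^sub>R f' (s * sgn t)) (at s)" for s
  proof -
    have "((\<lambda>s. s * sgn t) has_vector_derivative sgn t) (at s)"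
      by (auto intro!: derivative_eq_intros simp flip: has_real_derivative_iff_has_vector_derivative)
    from vector_diff_chain_at[OF this f(1)] show ?thesis by (simp add: o_def g_def[abs_def])
  qed
  have "norm (g \<bar>t\<bar> - g 0) \<le> C * \<bar>t\<bar> ^ Suc k / real (Suc k) - C * 0 ^ Suc k / real (Suc k)"
  proof (rule differentiable_bound_general)
    show "0 < \<bar>t\<bar>" using False by simp
    show "continuous_on {0..\<bar>t\<bar>} g"
      using g by (meson continuous_at_imp_continuous_on has_vector_derivative_continuous)
    show "continuous_on {0..\<bar>t\<bar>} (\<lambda>s. C * s ^ Suc k / real (Suc k))"
      by (intro continuous_intros) auto
    fix s assume s: "0 < s" "s < \<bar>t\<bar>"
    show "(g has_vector_derivative sgn t *\<^sub>R f' (s * sgn t)) (at s)" by (rule g)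
    have "((\<lambda>s. C * s ^ Suc k / real (Suc k)) has_real_derivative C * (real (Suc k) * s ^ k) / real (Suc k)) (at s)"
      using DERIV_cdivide[OF DERIV_cmult[OF DERIV_pow[of "Suc k" s]], of C "real (Suc k)"] by simp
    then show "((\<lambda>s. C * s ^ Suc k / real (Suc k)) has_vector_derivative C * s ^ k) (at s)"
      by (simp add: has_real_derivative_iff_has_vector_derivative)
    have "\<bar>s * sgn t\<bar> = s" using s False by (simp add: abs_mult)
    then show "norm (sgn t *\<^sub>R f' (s * sgn t)) \<le> C * s ^ k"
      using le[of "s * sgn t"] s t False by (simp add: abs_sgn_eq)
  qed
  then show ?thesis by (simp add: g_def f(2) mult.commute abs_mult_sgn mult_sgn_abs)
qed (simp add: f(2))

text \<open>Picard series: \<open>y 0\<close> is the constant initial value and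
  \<open>y (Suc k)\<close> the antiderivative, zero at 0, of L applied to \<open>y k\<close>. On
  [-b, b] the k-th term is at most norm y0 * (M * b)^k / k!, so the series and its termwise
  derivative converge uniformly there.\<close>

lemma linear_ode_solution:
  fixes L :: "real \<Rightarrow> 'a::euclidean_space \<Rightarrow>\<^sub>L 'a" and y0 :: 'a
  assumes L: "continuous_on UNIV L"
  obtains Y where "Y 0 = y0" "\<And>t. (Y has_vector_derivative L t (Y t)) (at t)"
proof -
  define step where "step Z = (SOME F. F 0 = 0 \<and> (\<forall>t. (F has_vector_derivative L t (Z t)) (at t)))" for Z
  define y where "y = rec_nat (\<lambda>_. y0) (\<lambda>_. step)"
  have y0: "y 0 = (\<lambda>_. y0)" and ySuc: "y (Suc k) = step (y k)" for k by (simp_all add: y_def)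
  have step: "step Z 0 = 0 \<and> (\<forall>t. (step Z has_vector_derivative L t (Z t)) (at t))"
    if "continuous_on UNIV Z" for Z
  proof -
    have "continuous_on UNIV (\<lambda>t. blinfun_apply (L t) (Z t))" by (intro continuous_intros L that)
    then obtain F where "F 0 = 0" "\<And>t. (F has_vector_derivative L t (Z t)) (at t)"
      using continuous_antiderivative by blast
    then have "\<exists>F. F 0 = 0 \<and> (\<forall>t. (F has_vector_derivative L t (Z t)) (at t))" by blast
    then show ?thesis unfolding step_def by (rule someI_ex)
  qed
  have cont: "continuous_on UNIV (y k)" for k
  proof (induction k)
    case (Suc k)
    then show ?case using step[OF Suc]
      by (metis continuous_at_imp_continuous_on has_vector_derivative_continuous ySuc)
  qed (simp add: y0)
  have der: "(y (Suc k) has_vector_derivative L t (y k t)) (at t)" and init: "y (Suc k) 0 = 0" for k t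
    using step[OF cont[of k]] by (simp_all add: ySuc)
  have bound: "norm (y k t) \<le> norm y0 * M ^ k / fact k * \<bar>t\<bar> ^ k"
    if M: "\<And>s. \<bar>s\<bar> \<le> b \<Longrightarrow> norm (L s) \<le> M" and t: "\<bar>t\<bar> \<le> b" for k t b M
    using t
  proof (induction k arbitrary: t)
    case (Suc k)
    have "norm (y (Suc k) t) \<le> (norm y0 * M ^ Suc k / fact k) * \<bar>t\<bar> ^ Suc k / real (Suc k)"
    proof (rule norm_le_of_derivative_power_bound[OF der init _ Suc.prems])
      fix s assume s: "\<bar>s\<bar> \<le> b"
      have "norm (L s (y k s)) \<le> norm (L s) * norm (y k s)" by (rule norm_blinfun)
      also have "\<dots> \<le> M * (norm y0 * M ^ k / fact k * \<bar>s\<bar> ^ k)"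
        using order_trans[OF norm_ge_zero M[OF s]] by (intro mult_mono Suc.IH s M) auto
      also have "\<dots> = norm y0 * M ^ Suc k / fact k * \<bar>s\<bar> ^ k" by (simp only: power_Suc) algebra
      finally show "norm (L s (y k s)) \<le> norm y0 * M ^ Suc k / fact k * \<bar>s\<bar> ^ k" .
    qed
    then show ?case by (simp add: field_simps)
  qed (simp add: y0)
  have sol: "\<exists>Y. Y 0 = y0 \<and> (\<forall>t\<in>{-b<..<b}. (\<lambda>k. y k t) sums Y t \<and> (Y has_vector_derivative L t (Y t)) (at t))"
    if b: "b > 0" for b
  proof -
    have "compact ((\<lambda>t. norm (L t)) ` {-b..b})"
      by (intro compact_continuous_image continuous_intros continuous_on_subset[OF L]) auto
    then obtain M where M: "\<And>s. \<bar>s\<bar> \<le> b \<Longrightarrow> norm (L s) \<le> M"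
      using compact_imp_bounded[THEN bounded_imp_bdd_above] unfolding bdd_above_def
      by (metis (no_types, lifting) abs_le_iff atLeastAtMost_iff image_eqI minus_le_iff)
    have M0: "M \<ge> 0" using M[of 0] b norm_ge_zero[of "L 0"] by linarith
    define c where "c k = norm y0 * ((M * b) ^ k /\<^sub>R fact k)" for k
    have sc: "summable c" unfolding c_def by (intro summable_mult summable_exp_generic)
    have yc: "norm (y k t) \<le> c k" if "\<bar>t\<bar> \<le> b" for k t
    proof -
      have "norm (y k t) \<le> norm y0 * M ^ k / fact k * \<bar>t\<bar> ^ k" by (rule bound[OF M that])
      also have "\<dots> \<le> norm y0 * M ^ k / fact k * b ^ k"
        using that M0 by (intro mult_left_mono power_mono) auto
      finally show ?thesis by (simp add: c_def power_mult_distrib field_simps)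
    qed
    \<comment> \<open>The index is shifted: the derivative of \<open>y (Suc j)\<close> is L applied
      to \<open>y j\<close>, while the constant \<open>y 0\<close> contributes 0.\<close>
    define f' where "f' k t = (case k of 0 \<Rightarrow> 0 | Suc j \<Rightarrow> L t (y j t))" for k t
    have fd: "(y k has_vector_derivative f' k t) (at t)" for k t
      by (cases k) (auto simp: f'_def der y0)
    define Y where "Y t = (\<Sum>k. y k t)" for t
    have sumY: "(\<lambda>k. y k t) sums Y t" if "\<bar>t\<bar> \<le> b" for t
      unfolding Y_def using yc[OF that] sc by (intro summable_sums) (rule summable_comparison_test', auto)
    have sumf': "(\<lambda>k. f' k t) sums L t (Y t)" if "\<bar>t\<bar> \<le> b" for t
    proof -
      have "(\<lambda>k. f' (Suc k) t) sums L t (Y t)"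
        using blinfun.bounded_linear_right[THEN bounded_linear.sums, OF sumY[OF that]] by (simp add: f'_def)
      then show ?thesis by (subst (asm) sums_Suc_iff) (simp add: f'_def)
    qed
    define c' where "c' k = (case k of 0 \<Rightarrow> 0 | Suc j \<Rightarrow> M * c j)" for k
    have sc': "summable c'"
      by (subst summable_Suc_iff[symmetric]) (simp add: c'_def sc summable_mult)
    have fc': "norm (f' k t) \<le> c' k" if "\<bar>t\<bar> \<le> b" for k t
    proof (cases k)
      case (Suc j)
      have "norm (L t (y j t)) \<le> norm (L t) * norm (y j t)" by (rule norm_blinfun)
      also have "\<dots> \<le> M * c j" by (intro mult_mono M yc that M0) auto
      finally show ?thesis by (simp add: Suc f'_def c'_def)
    qed (simp add: f'_def c'_def)
    have unif: "uniform_limit {-b<..<b} (\<lambda>n t. \<Sum>i<n. f' i t) (\<lambda>t. L t (Y t)) sequentially"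
    proof -
      have "uniform_limit {-b<..<b} (\<lambda>n t. \<Sum>i<n. f' i t) (\<lambda>t. \<Sum>i. f' i t) sequentially"
        by (rule Weierstrass_m_test[OF _ sc']) (auto intro!: fc')
      moreover have "(\<Sum>i. f' i t) = L t (Y t)" if "t \<in> {-b<..<b}" for t
        using sumf'[of t] that by (auto simp: sums_iff)
      ultimately show ?thesis by (subst (asm) uniform_limit_cong') auto
    qed
    have "\<exists>g. \<forall>t\<in>{-b<..<b}. (\<lambda>k. y k t) sums g t \<and> (g has_derivative (\<lambda>h. h *\<^sub>R L t (Y t))) (at t within {-b<..<b})"
    proof (rule has_derivative_series)
      show "convex {-b<..<b}" by simp
      show "(y n has_derivative (\<lambda>h. h *\<^sub>R f' n t)) (at t within {-b<..<b})" for n t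
        using fd[of n t] by (auto simp: has_vector_derivative_def intro: has_derivative_at_withinI)
      show "\<forall>\<^sub>F n in sequentially. \<forall>t\<in>{-b<..<b}. \<forall>h. norm ((\<Sum>i<n. h *\<^sub>R f' i t) - h *\<^sub>R L t (Y t)) \<le> e * norm h"
        if e: "e > 0" for e
        using uniform_limitD[OF unif e]
      proof eventually_elim
        case (elim n)
        have "norm ((\<Sum>i<n. h *\<^sub>R f' i t) - h *\<^sub>R L t (Y t)) \<le> e * norm h" if "t \<in> {-b<..<b}" for t h
        proof -
          have "norm ((\<Sum>i<n. h *\<^sub>R f' i t) - h *\<^sub>R L t (Y t)) = \<bar>h\<bar> * norm ((\<Sum>i<n. f' i t) - L t (Y t))"
            by (simp add: scaleR_diff_right flip: scaleR_sum_right norm_scaleR)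
          also have "\<dots> \<le> \<bar>h\<bar> * e"
            using elim that by (intro mult_left_mono) (auto simp: dist_norm less_imp_le)
          finally show ?thesis by (simp add: mult.commute)
        qed
        then show ?case by blast
      qed
      show "0 \<in> {-b<..<b}" using b by simp
      show "(\<lambda>k. y k 0) sums Y 0" using sumY[of 0] b by simp
    qed
    then obtain g where g: "\<And>t. t \<in> {-b<..<b} \<Longrightarrow> (\<lambda>k. y k t) sums g t"
      "\<And>t. t \<in> {-b<..<b} \<Longrightarrow> (g has_derivative (\<lambda>h. h *\<^sub>R L t (Y t))) (at t within {-b<..<b})" by blast
    have gY: "g t = Y t" if "t \<in> {-b<..<b}" for t
      using sums_unique2[OF g(1)[OF that] sumY[of t]] that by auto
    have "Y 0 = y0"
    proof -
      have "(\<lambda>k. y k 0) sums (\<Sum>k\<in>{0}. y k 0)"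
        by (rule sums_finite) (auto simp: init gr0_conv_Suc)
      then show ?thesis using sumY[of 0] b by (auto simp: y0 dest: sums_unique2)
    qed
    moreover have "(g has_vector_derivative L t (g t)) (at t)" if "t \<in> {-b<..<b}" for t
    proof -
      have "at t within {-b<..<b} = at t" using that by (intro at_within_open) auto
      then show ?thesis using g(2)[OF that] gY[OF that] by (simp add: has_vector_derivative_def)
    qed
    ultimately show ?thesis using g(1) gY[of 0] b by (intro exI[of _ g]) auto
  qed
  define Y where "Y t = (\<Sum>k. y k t)" for t
  \<comment> \<open>The local solutions on the intervals (-b, b) are sums of one and the same
    series, hence restrictions of a single global \<open>Y\<close>.\<close>
  have "(Y has_vector_derivative L t (Y t)) (at t)" for t
  proof -
    obtain Z where Z: "\<forall>s\<in>{-(\<bar>t\<bar>+1)<..<\<bar>t\<bar>+1}. (\<lambda>k. y k s) sums Z s \<and> (Z has_vector_derivative L s (Z s)) (at s)"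
    proof -
      have "0 < \<bar>t\<bar> + 1" by simp
      from sol[OF this] show ?thesis using that by blast
    qed
    then have ZY: "Z s = Y s" if "s \<in> {-(\<bar>t\<bar>+1)<..<\<bar>t\<bar>+1}" for s
      using that by (auto simp: Y_def sums_iff)
    have tin: "t \<in> {-(\<bar>t\<bar>+1)<..<\<bar>t\<bar>+1}" by auto
    have "(Z has_vector_derivative L t (Y t)) (at t)" using bspec[OF Z tin] ZY[OF tin] by simp
    then show ?thesis
      by (rule has_vector_derivative_transform_within_open[OF _ open_greaterThanLessThan tin ZY])
  qed
  moreover have "Y 0 = y0"
  proof -
    have "(\<lambda>k. y k 0) sums (\<Sum>k\<in>{0}. y k 0)"
      by (rule sums_finite) (auto simp: init gr0_conv_Suc)
    then show ?thesis by (auto simp: y0 Y_def sums_iff)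
  qed
  ultimately show thesis using that by blast
qed

text \<open>The quotient form passes through limits of products, which is how the derivative of an
  inverse matrix is computed below.\<close>

lemma has_vector_derivative_iff_quotient:
  "(f has_vector_derivative D) (at s) \<longleftrightarrow> ((\<lambda>t. (f t - f s) /\<^sub>R (t - s)) \<longlongrightarrow> D) (at (s::real))"
proof -
  have "norm (f t - f s - (t - s) *\<^sub>R D) / norm (t - s) = norm ((f t - f s) /\<^sub>R (t - s) - D)" if "t \<noteq> s" for t
  proof -
    have "(f t - f s) /\<^sub>R (t - s) - D = (f t - f s - (t - s) *\<^sub>R D) /\<^sub>R (t - s)"
      using that by (simp add: scaleR_diff_right)
    then show ?thesis by (simp add: divide_inverse)
  qed
  then have "((\<lambda>t. norm (f t - f s - (t - s) *\<^sub>R D) / norm (t - s)) \<longlongrightarrow> 0) (at s)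
    \<longleftrightarrow> ((\<lambda>t. norm ((f t - f s) /\<^sub>R (t - s) - D)) \<longlongrightarrow> 0) (at s)"
    by (intro tendsto_cong) (auto simp: eventually_at_filter)
  also have "\<dots> \<longleftrightarrow> ((\<lambda>t. (f t - f s) /\<^sub>R (t - s)) \<longlongrightarrow> D) (at s)"
    by (simp add: tendsto_norm_zero_iff LIM_zero_iff)
  finally show ?thesis
    by (simp add: has_vector_derivative_def has_derivative_iff_norm bounded_linear_scaleR_left)
qed

section \<open>Complex matrices, their adjoints and quadratic forms\<close>

lemma bounded_bilinear_matrix_mult:
  "bounded_bilinear ((**) :: complex^'n::finite^'n \<Rightarrow> complex^'n^'n \<Rightarrow> complex^'n^'n)"
  unfolding bilinear_conv_bounded_bilinear[symmetric] bilinear_def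
  by (auto intro!: linearI simp: matrix_matrix_mult_def vec_eq_iff sum.distrib distrib_left distrib_right scaleR_sum_right)

lemma bounded_bilinear_matrix_vector_mult:
  "bounded_bilinear ((*v) :: complex^'n::finite^'n \<Rightarrow> complex^'n \<Rightarrow> complex^'n)"
  unfolding bilinear_conv_bounded_bilinear[symmetric] bilinear_def
  by (auto intro!: linearI simp: matrix_vector_mult_def vec_eq_iff sum.distrib distrib_left distrib_right scaleR_sum_right)

interpretation mm: bounded_bilinear "(**) :: complex^'n::finite^'n \<Rightarrow> complex^'n^'n \<Rightarrow> complex^'n^'n"
  by (rule bounded_bilinear_matrix_mult)

interpretation mv: bounded_bilinear "(*v) :: complex^'n::finite^'n \<Rightarrow> complex^'n \<Rightarrow> complex^'n"
  by (rule bounded_bilinear_matrix_vector_mult)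

definition adjoint_mat :: "complex^'n::finite^'n \<Rightarrow> complex^'n^'n"
  where "adjoint_mat M = (\<chi> i j. cnj (M $ j $ i))"

definition herm :: "complex^'n::finite \<Rightarrow> complex^'n \<Rightarrow> complex"
  where "herm x y = (\<Sum>i\<in>UNIV. cnj (x $ i) * y $ i)"

definition cvec :: "real^'n::finite \<Rightarrow> complex^'n"
  where "cvec y = (\<chi> i. of_real (y $ i))"

text \<open>Bilinear, without conjugation, as a complex phase requires. On real vectors it agrees
  with the sesquilinear \<open>herm\<close> of the matrix, and through \<open>herm\<close> its
  imaginary part is shown to be positive.\<close>

definition quad :: "complex^'n::finite^'n \<Rightarrow> real^'n \<Rightarrow> complex"
  where "quad G y = (\<Sum>i\<in>UNIV. \<Sum>j\<in>UNIV. G $ i $ j * of_real (y $ i) * of_real (y $ j))"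

lemma bounded_linear_transpose: "bounded_linear (transpose :: complex^'n::finite^'n \<Rightarrow> complex^'n^'n)"
  unfolding linear_conv_bounded_linear[symmetric]
  by (rule linearI) (auto simp: transpose_def vec_eq_iff)

lemma bounded_linear_adjoint_mat: "bounded_linear (adjoint_mat :: complex^'n::finite^'n \<Rightarrow> complex^'n^'n)"
  unfolding linear_conv_bounded_linear[symmetric]
  by (rule linearI) (auto simp: adjoint_mat_def vec_eq_iff)

lemma adjoint_mat_mult: "adjoint_mat (A ** B) = adjoint_mat B ** adjoint_mat A"
  by (simp add: adjoint_mat_def matrix_matrix_mult_def vec_eq_iff cnj_sum mult.commute)

lemma herm_matrix_left: "herm (M *v x) y = herm x (adjoint_mat M *v y)"
proof -
  have "herm (M *v x) y = (\<Sum>i\<in>UNIV. \<Sum>j\<in>UNIV. cnj (M $ i $ j) * cnj (x $ j) * y $ i)"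
    by (simp add: herm_def matrix_vector_mult_def sum_distrib_right)
  also have "\<dots> = (\<Sum>j\<in>UNIV. \<Sum>i\<in>UNIV. cnj (M $ i $ j) * cnj (x $ j) * y $ i)" by (rule sum.swap)
  also have "\<dots> = herm x (adjoint_mat M *v y)"
    by (simp add: herm_def matrix_vector_mult_def adjoint_mat_def sum_distrib_left mult_ac)
  finally show ?thesis .
qed

lemma herm_self: "herm x x = of_real ((norm x)\<^sup>2)"
proof -
  have "(norm x)\<^sup>2 = (\<Sum>i\<in>UNIV. (norm (x $ i))\<^sup>2)"
    by (simp add: norm_vec_def L2_set_def sum_nonneg)
  then show ?thesis by (simp add: herm_def complex_norm_square mult.commute del: of_real_power)
qed

lemma norm_herm_le: "norm (herm x y) \<le> norm x * norm y"
proof -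
  have "norm (herm x y) \<le> (\<Sum>i\<in>UNIV. norm (x $ i) * norm (y $ i))"
    unfolding herm_def by (rule order_trans[OF norm_sum]) (simp add: norm_mult)
  also have "\<dots> \<le> norm x * norm y"
    unfolding norm_vec_def using L2_set_mult_ineq[of "\<lambda>i. norm (x $ i)" "\<lambda>i. norm (y $ i)" UNIV] by simp
  finally show ?thesis .
qed

lemma herm_commute: "herm y x = cnj (herm x y)"
  by (simp add: herm_def mult.commute)

lemma herm_diff_right: "herm x (y - z) = herm x y - herm x z"
  by (simp add: herm_def right_diff_distrib sum_subtractf)

lemma norm_cvec: "norm (cvec y) = norm y"
  by (simp add: norm_vec_def cvec_def)

lemma quad_conv_herm: "quad G y = herm (cvec y) (G *v cvec y)"
  by (simp add: quad_def herm_def cvec_def matrix_vector_mult_def sum_distrib_left mult_ac)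

text \<open>Entries are read off by testing on coordinate vectors; each factor CARD comes from
  bounding a Euclidean norm by a sum, once over the rows and once inside a row.\<close>

lemma norm_matrix_le_of_vector_bound:
  fixes M :: "complex^'n::finite^'n"
  assumes "\<And>w. norm (M *v w) \<le> C * norm w"
  shows "norm M \<le> real CARD('n) * (real CARD('n) * C)"
proof -
  have entry: "norm (M $ i $ j) \<le> C" for i j
  proof -
    have ax: "norm (axis j (1::complex) :: complex^'n) = 1"
      by (simp add: norm_vec_def L2_set_def axis_def if_distrib[of norm] if_distrib[of "\<lambda>x. x\<^sup>2"] cong: if_cong)
    have "M $ i $ j = (M *v axis j 1) $ i"
      by (simp add: matrix_vector_mult_def axis_def if_distrib cong: if_cong)
    then have "norm (M $ i $ j) \<le> norm (M *v axis j 1)"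
      using Finite_Cartesian_Product.norm_nth_le[of "M *v axis j 1" i] by simp
    also have "\<dots> \<le> C" using assms[of "axis j 1"] ax by simp
    finally show ?thesis .
  qed
  have "norm M \<le> (\<Sum>i\<in>UNIV. norm (M $ i))" unfolding norm_vec_def by (rule L2_set_le_sum) simp
  also have "\<dots> \<le> (\<Sum>i\<in>UNIV. \<Sum>j\<in>UNIV. norm (M $ i $ j))"
    by (rule sum_mono) (subst norm_vec_def, rule L2_set_le_sum, simp)
  also have "\<dots> \<le> (\<Sum>i\<in>(UNIV::'n set). \<Sum>j\<in>(UNIV::'n set). C)" by (intro sum_mono entry)
  finally show ?thesis by simp
qed

lemma continuous_bounded_on_interval:
  fixes f :: "real \<Rightarrow> 'a::real_normed_vector"
  assumes "continuous_on UNIV f"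
  obtains M where "M > 0" "\<And>t. \<bar>t\<bar> \<le> b \<Longrightarrow> norm (f t) \<le> M"
proof -
  have "bounded (f ` {-b..b})"
    by (intro compact_imp_bounded compact_continuous_image continuous_on_subset[OF assms]) auto
  then obtain M where "M > 0" "\<forall>y\<in>f ` {-b..b}. norm y \<le> M" by (auto simp: bounded_pos)
  then show thesis by (intro that[of M]) (auto simp: abs_le_iff)
qed

lemma has_vector_derivative_zero_const:
  fixes f :: "real \<Rightarrow> 'a::real_normed_vector"
  assumes "\<And>t. (f has_vector_derivative 0) (at t)"
  shows "f t = f 0"
proof -
  have "\<exists>c. \<forall>x\<in>UNIV. f x = c"
    using assms by (intro has_derivative_zero_constant) (auto simp: has_vector_derivative_def)
  then show ?thesis by auto
qed

text \<open>The identity Z(t) - Z(s) = - Z(t) (Q(t) - Q(s)) Z(s) is used twice: with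
  \<open>Z\<close> locally bounded it gives continuity of \<open>Z\<close>, and divided by t - s it
  then gives the derivative.\<close>

lemma matrix_inverse_has_vector_derivative:
  fixes Q Z :: "real \<Rightarrow> complex^'n::finite^'n"
  assumes inv: "\<And>t. Z t ** Q t = mat 1" "\<And>t. Q t ** Z t = mat 1"
    and bd: "\<And>b. \<exists>C. \<forall>t. \<bar>t\<bar> \<le> b \<longrightarrow> norm (Z t) \<le> C"
    and Q: "(Q has_vector_derivative Q') (at s)"
  shows "(Z has_vector_derivative - (Z s ** Q' ** Z s)) (at s)"
proof -
  have diff: "Z t - Z s = - (Z t ** (Q t - Q s) ** Z s)" for t
    by (simp add: mm.diff_left mm.diff_right inv matrix_mul_assoc[symmetric])
  have cQ: "(Q \<longlongrightarrow> Q s) (at s)"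
    using has_vector_derivative_continuous[OF Q] by (simp add: continuous_at)
  have "((\<lambda>t. Z t - Z s) \<longlongrightarrow> 0) (at s)"
  proof -
    obtain C where C: "\<And>t. \<bar>t\<bar> \<le> \<bar>s\<bar> + 1 \<Longrightarrow> norm (Z t) \<le> C" using bd by blast
    have "Bfun Z (at s)"
    proof (rule BfunI)
      show "\<forall>\<^sub>F t in at s. norm (Z t) \<le> C"
        unfolding eventually_at by (rule exI[of _ 1]) (auto intro!: C simp: dist_real_def)
    qed
    moreover have "Zfun (\<lambda>t. Q t - Q s) (at s)"
      using cQ by (simp add: tendsto_Zfun_iff)
    ultimately have "Zfun (\<lambda>t. Z t ** (Q t - Q s)) (at s)" by (rule mm.Bfun_prod_Zfun)
    then have "Zfun (\<lambda>t. Z t - Z s) (at s)"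
      unfolding diff by (intro Zfun_minus mm.Zfun_left)
    then show ?thesis by (simp add: tendsto_Zfun_iff)
  qed
  then have cZ: "(Z \<longlongrightarrow> Z s) (at s)" by (rule LIM_zero_cancel)
  have "((\<lambda>t. - (Z t ** ((Q t - Q s) /\<^sub>R (t - s)) ** Z s)) \<longlongrightarrow> - (Z s ** Q' ** Z s)) (at s)"
    using Q unfolding has_vector_derivative_iff_quotient
    by (intro tendsto_minus mm.tendsto cZ tendsto_const)
  moreover have "- (Z t ** ((Q t - Q s) /\<^sub>R (t - s)) ** Z s) = (Z t - Z s) /\<^sub>R (t - s)" for t
    by (subst diff) (simp add: mm.scaleR_left mm.scaleR_right)
  ultimately show ?thesis by (simp add: has_vector_derivative_iff_quotient)
qed

text \<open>\<open>G = P Q\<inverse>\<close> for the linear Hamiltonian system \<open>Q' = 2P\<close>, \<open>P' = - A Q\<close>, \<open>Q 0 = 1\<close>, \<open>P 0 = \<i>\<close>. The conserved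
  quantities \<open>Q\<^sup>TP - P\<^sup>TQ = 0\<close> and \<open>Q\<^sup>*P - P\<^sup>*Q = 2\<i>\<close> give the symmetry of \<open>G\<close>, the invertibility of \<open>Q\<close>
  and the positivity of \<open>Im G\<close>.\<close>

lemma riccati_solution:
  fixes A :: "real \<Rightarrow> complex^'n::finite^'n"
  assumes cA: "continuous_on UNIV A" and sA: "\<And>t. transpose (A t) = A t" and rA: "\<And>t. adjoint_mat (A t) = A t"
  obtains G where "\<And>t. (G has_vector_derivative - 2 *\<^sub>R (G t ** G t) - A t) (at t)"
    and "\<And>t. transpose (G t) = G t"
    and "\<And>b. \<exists>m>0. \<forall>t. \<bar>t\<bar> \<le> b \<longrightarrow> (\<forall>y. m * (norm y)\<^sup>2 \<le> Im (quad (G t) y))"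
proof -
  \<comment> \<open>On pairs (Q, P) the Hamiltonian system is one linear equation in a product of
    matrix spaces.\<close>
  define f where "f t w = (2 *\<^sub>R snd w, - (A t ** fst w))" for t and w :: "(complex^'n^'n) \<times> (complex^'n^'n)"
  have blf: "bounded_linear (f t)" for t unfolding f_def
    by (intro bounded_linear_Pair bounded_linear_minus bounded_linear_compose[OF bounded_linear_scaleR_right]
       bounded_linear_compose[OF mm.bounded_linear_right] bounded_linear_fst bounded_linear_snd)
  define L where "L t = Blinfun (f t)" for t
  have L: "blinfun_apply (L t) = f t" for t by (simp add: L_def bounded_linear_Blinfun_apply blf)
  have cL: "continuous_on UNIV L"
    by (rule continuous_on_blinfun_componentwise)
      (auto simp: L f_def intro!: continuous_intros cA mm.continuous_on)
  obtain Y where Y0: "Y 0 = (mat 1, mat \<i>)" and Y: "\<And>t. (Y has_vector_derivative L t (Y t)) (at t)"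
    using linear_ode_solution[OF cL] by blast
  define Q P where "Q t = fst (Y t)" and "P t = snd (Y t)" for t
  have Q': "(Q has_vector_derivative 2 *\<^sub>R P t) (at t)" and P': "(P has_vector_derivative - (A t ** Q t)) (at t)" for t
    using bounded_linear.has_vector_derivative[OF bounded_linear_fst Y[of t]]
      bounded_linear.has_vector_derivative[OF bounded_linear_snd Y[of t]]
    by (simp_all add: L f_def Q_def[abs_def] P_def[abs_def])
  note cont = continuous_at_imp_continuous_on[OF ballI[OF has_vector_derivative_continuous]]
  have cQ: "continuous_on UNIV Q" and cP: "continuous_on UNIV P" by (rule cont, rule Q' P')+
  have Q0: "Q 0 = mat 1" and P0: "P 0 = mat \<i>" by (simp_all add: Q_def P_def Y0)

  have sym: "transpose (Q t) ** P t - transpose (P t) ** Q t = 0" for t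
  proof -
    note T' = bounded_linear.has_vector_derivative[OF bounded_linear_transpose]
    have "((\<lambda>t. transpose (Q t) ** P t - transpose (P t) ** Q t) has_vector_derivative
       (transpose (Q t) ** (- (A t ** Q t)) + transpose (2 *\<^sub>R P t) ** P t)
        - (transpose (P t) ** (2 *\<^sub>R P t) + transpose (- (A t ** Q t)) ** Q t)) (at t)" for t
      by (intro has_vector_derivative_diff mm.has_vector_derivative T' Q' P')
    moreover have "(transpose (Q t) ** (- (A t ** Q t)) + transpose (2 *\<^sub>R P t) ** P t)
        - (transpose (P t) ** (2 *\<^sub>R P t) + transpose (- (A t ** Q t)) ** Q t) = 0" for t
      by (simp add: linear_scale[OF bounded_linear.linear[OF bounded_linear_transpose]]
          linear_neg[OF bounded_linear.linear[OF bounded_linear_transpose]]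
          mm.minus_left mm.minus_right mm.scaleR_left mm.scaleR_right matrix_transpose_mul sA matrix_mul_assoc)
    ultimately have "((\<lambda>t. transpose (Q t) ** P t - transpose (P t) ** Q t) has_vector_derivative 0) (at t)" for t by simp
    from has_vector_derivative_zero_const[OF this, of t] show ?thesis
      by (simp add: Q0 P0 transpose_mat)
  qed
  have wronskian: "adjoint_mat (Q t) ** P t - adjoint_mat (P t) ** Q t = mat (2 * \<i>)" for t
  proof -
    note T' = bounded_linear.has_vector_derivative[OF bounded_linear_adjoint_mat]
    have adj: "adjoint_mat (mat c) = (mat (cnj c) :: complex^'n^'n)" for c
      by (auto simp: adjoint_mat_def mat_def vec_eq_iff)
    have "((\<lambda>t. adjoint_mat (Q t) ** P t - adjoint_mat (P t) ** Q t) has_vector_derivative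
       (adjoint_mat (Q t) ** (- (A t ** Q t)) + adjoint_mat (2 *\<^sub>R P t) ** P t)
        - (adjoint_mat (P t) ** (2 *\<^sub>R P t) + adjoint_mat (- (A t ** Q t)) ** Q t)) (at t)" for t
      by (intro has_vector_derivative_diff mm.has_vector_derivative T' Q' P')
    moreover have "(adjoint_mat (Q t) ** (- (A t ** Q t)) + adjoint_mat (2 *\<^sub>R P t) ** P t)
        - (adjoint_mat (P t) ** (2 *\<^sub>R P t) + adjoint_mat (- (A t ** Q t)) ** Q t) = 0" for t
      by (simp add: linear_scale[OF bounded_linear.linear[OF bounded_linear_adjoint_mat]]
          linear_neg[OF bounded_linear.linear[OF bounded_linear_adjoint_mat]]
          mm.minus_left mm.minus_right mm.scaleR_left mm.scaleR_right adjoint_mat_mult rA matrix_mul_assoc)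
    ultimately have "((\<lambda>t. adjoint_mat (Q t) ** P t - adjoint_mat (P t) ** Q t) has_vector_derivative 0) (at t)" for t by simp
    from has_vector_derivative_zero_const[OF this, of t] have
      "adjoint_mat (Q t) ** P t - adjoint_mat (P t) ** Q t = mat \<i> - mat (- \<i>)"
      by (simp add: Q0 P0 adj)
    also have "\<dots> = mat (2 * \<i>)" by (simp add: vec_eq_iff mat_def)
    finally show ?thesis .
  qed
  \<comment> \<open>The conserved matrix evaluated on a vector. It forces v = 0 when Q v = 0, it
    bounds the inverse of \<open>Q\<close>, and for v = Z y it identifies the imaginary part of the
    form of \<open>G\<close> at y with the squared norm of Z y.\<close>
  have Im_herm: "Im (herm (Q t *v v) (P t *v v)) = (norm v)\<^sup>2" for t v
  proof -
    have "herm (Q t *v v) (P t *v v) - herm (P t *v v) (Q t *v v)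
      = herm v ((adjoint_mat (Q t) ** P t - adjoint_mat (P t) ** Q t) *v v)"
      by (simp add: herm_matrix_left matrix_vector_mul_assoc herm_diff_right mv.diff_left)
    also have "\<dots> = 2 * \<i> * herm v v"
      unfolding wronskian
      by (simp add: herm_def matrix_vector_mult_def mat_def if_distrib if_distribR sum_distrib_left mult_ac cong: if_cong)
    finally have "herm (Q t *v v) (P t *v v) - cnj (herm (Q t *v v) (P t *v v)) = 2 * \<i> * of_real ((norm v)\<^sup>2)"
      unfolding herm_self by (subst (asm) (2) herm_commute)
    from arg_cong[OF this, of Im] show ?thesis by (simp del: of_real_power)
  qed
  have "\<exists>Z. Z ** Q t = mat 1 \<and> Q t ** Z = mat 1" for t
  proof -
    have "v = 0" if "Q t *v v = 0" for v
      using Im_herm[of t v] that by (simp add: herm_def)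
    then obtain Z where "Z ** Q t = mat 1" using matrix_left_invertible_ker[of "Q t"] by blast
    then show ?thesis using matrix_left_right_inverse by blast
  qed
  then obtain Z where ZQ: "\<And>t. Z t ** Q t = mat 1" and QZ: "\<And>t. Q t ** Z t = mat 1" by metis
  obtain K where K: "\<And>(M::complex^'n^'n) v. norm (M *v v) \<le> norm M * norm v * K" and K0: "K > 0"
    using mv.pos_bounded by blast
  \<comment> \<open>Bounds the inverse without determinants: one factor norm (Z w) on the right
    cancels against the left side in \<open>Zbd\<close>, and only a bound for \<open>P\<close>
    remains.\<close>
  have Zw: "(norm (Z t *v w))\<^sup>2 \<le> norm w * (norm (P t) * norm (Z t *v w) * K)" for t w
  proof -
    have "(norm (Z t *v w))\<^sup>2 = Im (herm w (P t *v (Z t *v w)))"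
      using Im_herm[of t "Z t *v w"] by (simp add: matrix_vector_mul_assoc QZ)
    also have "\<dots> \<le> norm (herm w (P t *v (Z t *v w)))" by (rule order_trans[OF abs_ge_self abs_Im_le_cmod])
    also have "\<dots> \<le> norm w * norm (P t *v (Z t *v w))" by (rule norm_herm_le)
    also have "\<dots> \<le> norm w * (norm (P t) * norm (Z t *v w) * K)" by (intro mult_left_mono K) auto
    finally show ?thesis .
  qed
  have Zbd: "\<exists>C. \<forall>t. \<bar>t\<bar> \<le> b \<longrightarrow> norm (Z t) \<le> C" for b
  proof -
    obtain M where M: "\<And>t. \<bar>t\<bar> \<le> b \<Longrightarrow> norm (P t) \<le> M" and M0: "M > 0"
      using continuous_bounded_on_interval[OF cP] by blast
    have "norm (Z t) \<le> real CARD('n) * (real CARD('n) * (M * K))" if "\<bar>t\<bar> \<le> b" for t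
    proof (rule norm_matrix_le_of_vector_bound)
      fix w
      have "(norm (Z t *v w))\<^sup>2 \<le> norm w * (M * norm (Z t *v w) * K)"
        using K0 by (intro order_trans[OF Zw] mult_left_mono mult_right_mono M that) auto
      then show "norm (Z t *v w) \<le> M * K * norm w"
        using M0 K0 by (cases "norm (Z t *v w) = 0") (auto simp: power2_eq_square mult_ac)
    qed
    then show ?thesis by blast
  qed
  have Z': "(Z has_vector_derivative - (Z t ** (2 *\<^sub>R P t) ** Z t)) (at t)" for t
    by (rule matrix_inverse_has_vector_derivative[OF ZQ QZ Zbd Q'])
  define G where "G t = P t ** Z t" for t
  show thesis
  proof
    show "(G has_vector_derivative - 2 *\<^sub>R (G t ** G t) - A t) (at t)" for t
    proof -
      have "(G has_vector_derivative P t ** (- (Z t ** (2 *\<^sub>R P t) ** Z t)) + (- (A t ** Q t)) ** Z t) (at t)"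
        unfolding G_def by (intro mm.has_vector_derivative Z' P')
      moreover have "P t ** (- (Z t ** (2 *\<^sub>R P t) ** Z t)) + (- (A t ** Q t)) ** Z t = - 2 *\<^sub>R (G t ** G t) - A t"
        by (simp add: G_def mm.minus_left mm.minus_right mm.scaleR_left mm.scaleR_right matrix_mul_assoc[symmetric] QZ)
      ultimately show ?thesis by simp
    qed
    show "transpose (G t) = G t" for t
    proof -
      have "transpose (G t) = transpose (Z t) ** (transpose (P t) ** Q t) ** Z t"
        by (simp add: G_def matrix_transpose_mul matrix_mul_assoc[symmetric] QZ)
      also have "transpose (P t) ** Q t = transpose (Q t) ** P t" using sym[of t] by simp
      also have "transpose (Z t) ** (transpose (Q t) ** P t) ** Z t = transpose (Q t ** Z t) ** (P t ** Z t)"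
        by (simp add: matrix_transpose_mul matrix_mul_assoc)
      finally show ?thesis by (simp add: QZ G_def transpose_mat)
    qed
    show "\<exists>m>0. \<forall>t. \<bar>t\<bar> \<le> b \<longrightarrow> (\<forall>y. m * (norm y)\<^sup>2 \<le> Im (quad (G t) y))" for b
    proof -
      obtain M where M: "\<And>t. \<bar>t\<bar> \<le> b \<Longrightarrow> norm (Q t) \<le> M" and M0: "M > 0"
        using continuous_bounded_on_interval[OF cQ] by blast
      have "1 / (M * K)\<^sup>2 * (norm y)\<^sup>2 \<le> Im (quad (G t) y)" if "\<bar>t\<bar> \<le> b" for t and y :: "real^'n"
      proof -
        define v where "v = Z t *v cvec y"
        have Qv: "Q t *v v = cvec y" by (simp add: v_def matrix_vector_mul_assoc QZ)
        have "Im (quad (G t) y) = (norm v)\<^sup>2"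
          using Im_herm[of t v] unfolding Qv
          by (simp add: quad_conv_herm G_def v_def matrix_vector_mul_assoc)
        moreover have "norm y \<le> (M * K) * norm v"
        proof -
          have "norm y \<le> norm (Q t) * norm v * K" using K[of "Q t" v] by (simp add: Qv norm_cvec)
          also have "\<dots> \<le> M * norm v * K" using K0 by (intro mult_right_mono M that) auto
          finally show ?thesis by (simp add: mult_ac)
        qed
        then have "(norm y)\<^sup>2 \<le> (M * K)\<^sup>2 * (norm v)\<^sup>2"
          by (metis norm_ge_zero power_mono power_mult_distrib)
        ultimately show ?thesis using M0 K0 by (simp add: field_simps)
      qed
      then show ?thesis using M0 K0 by (intro exI[of _ "1 / (M * K)\<^sup>2"]) auto
    qed
  qed
qed


section \<open>Test functions and the lemma of du Bois-Reymond\<close>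

lemma pderivs_append: "pderivs (js @ ks) f = pderivs js (pderivs ks f)"
  by (induction js) auto

lemma smooth_partial:
  assumes "smooth f"
  shows "smooth (partial j f)"
  unfolding smooth_def
proof (intro allI)
  fix js x
  have "pderivs (js @ [j]) f = pderivs js (partial j f)" by (simp add: pderivs_append)
  then show "pderivs js (partial j f) differentiable (at x)"
    using assms unfolding smooth_def by (auto dest: spec[of _ "js @ [j]"])
qed

lemma smooth_differentiable:
  assumes "smooth f"
  shows "f differentiable (at x)"
  using assms[unfolded smooth_def, rule_format, of "[]" x] by simp

text \<open>All iterated derivatives stay inside the invariant set \<open>S\<close>, so smoothness
  is reduced to differentiability and to one derivative at a time.\<close>

lemma smooth_coinduct:
  assumes "f \<in> S" and "\<And>g x. g \<in> S \<Longrightarrow> g differentiable (at x)" and "\<And>g j. g \<in> S \<Longrightarrow> partial j g \<in> S"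
  shows "smooth f"
proof -
  have "pderivs js f \<in> S" for js by (induction js) (auto intro: assms)
  then show ?thesis using assms(2) by (auto simp: smooth_def)
qed

lemma smooth_imp_continuous_on: "smooth f \<Longrightarrow> continuous_on A f"
  by (intro continuous_at_imp_continuous_on ballI differentiable_imp_continuous_within smooth_differentiable)

lemma partial_eqI: "(f has_derivative f') (at x) \<Longrightarrow> partial j f x = f' (axis j 1)"
  using frechet_derivative_at[of f f' x] by (simp add: partial_def)

lemma has_vector_derivative_line:
  fixes f :: "real^'n::finite \<Rightarrow> 'b::real_normed_vector"
  assumes "f differentiable (at (x + t *\<^sub>R axis j 1))"
  shows "((\<lambda>t. f (x + t *\<^sub>R axis j 1)) has_vector_derivative partial j f (x + t *\<^sub>R axis j 1)) (at t)"
proof -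
  have "((\<lambda>t. x + t *\<^sub>R axis j 1) has_vector_derivative axis j 1) (at t)"
    by (auto intro!: derivative_eq_intros)
  moreover have "(f has_derivative frechet_derivative f (at (x + t *\<^sub>R axis j 1))) (at (x + t *\<^sub>R axis j 1))"
    using assms frechet_derivative_works by blast
  ultimately have "(f \<circ> (\<lambda>t. x + t *\<^sub>R axis j 1) has_vector_derivative partial j f (x + t *\<^sub>R axis j 1)) (at t)"
    unfolding partial_def
    using vector_derivative_diff_chain_within[of "\<lambda>t. x + t *\<^sub>R axis j 1" "axis j 1" t UNIV f] has_derivative_at_withinI by blast
  then show ?thesis by (simp add: o_def)
qed

lemma test_function_partial:
  assumes "test_function \<phi>"
  shows "test_function (partial j \<phi>)"
proof -
  let ?S = "closure {x. \<phi> x \<noteq> 0}"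
  have "partial j \<phi> x = 0" if "x \<notin> ?S" for x
  proof -
    have "(\<phi> has_derivative (\<lambda>_. 0)) (at x)"
    proof (rule has_derivative_transform_within_open[of "\<lambda>_. 0" _ _ _ "- ?S"])
      show "0 = \<phi> y" if "y \<in> - ?S" for y
        using that closure_subset[of "{x. \<phi> x \<noteq> 0}"] by (cases "\<phi> y = 0") auto
    qed (use that in auto)
    from partial_eqI[OF this, of j] show ?thesis by simp
  qed
  then have "{x. partial j \<phi> x \<noteq> 0} \<subseteq> ?S" by auto
  then have "closure {x. partial j \<phi> x \<noteq> 0} \<subseteq> ?S" by (simp add: closure_minimal)
  then have "compact (closure {x. partial j \<phi> x \<noteq> 0})"
    using assms bounded_subset unfolding test_function_def compact_eq_bounded_closed by blast
  then show ?thesis using assms smooth_partial by (auto simp: test_function_def)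
qed

text \<open>The functions y^(-k) * exp (-1/y), continued by 0. For \<open>k = 0\<close> this is the
  classical smooth function with a zero of infinite order; the powers are there because
  differentiation produces them.\<close>

definition flat :: "nat \<Rightarrow> real \<Rightarrow> real"
  where "flat k y = (if y > 0 then (1 / y) ^ k * exp (- 1 / y) else 0)"

lemma flat_tendsto_0: "(flat k \<longlongrightarrow> 0) (at 0)"
proof (rule filterlim_split_at)
  have "((\<lambda>y. inverse y ^ k / exp (inverse y)) \<longlongrightarrow> 0) (at_right (0::real))"
    using filterlim_compose[OF tendsto_power_div_exp_0 filterlim_inverse_at_top_right] .
  then show "(flat k \<longlongrightarrow> 0) (at_right 0)"
  proof (rule Lim_transform_eventually)
    show "\<forall>\<^sub>F y in at_right 0. inverse y ^ k / exp (inverse y) = flat k y"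
      by (auto simp: eventually_at_filter flat_def exp_minus field_simps)
  qed
  have "((\<lambda>_. 0) \<longlongrightarrow> 0) (at_left (0::real))" by simp
  then show "(flat k \<longlongrightarrow> 0) (at_left 0)"
    by (rule Lim_transform_eventually) (auto simp: eventually_at_filter flat_def)
qed

lemma flat_has_real_derivative:
  "(flat k has_real_derivative - real k * flat (Suc k) y + flat (Suc (Suc k)) y) (at y)"
proof -
  consider "y > 0" | "y < 0" | "y = 0" by linarith
  then show ?thesis
  proof cases
    case 1
    have "((\<lambda>y. (1 / y) ^ k * exp (- 1 / y)) has_real_derivative
       - real k * flat (Suc k) y + flat (Suc (Suc k)) y) (at y)"
    proof (cases k)
      case 0
      then show ?thesis using 1 by (auto intro!: derivative_eq_intros simp: flat_def field_simps power2_eq_square)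
    next
      case (Suc l)
      then show ?thesis using 1
        by (auto intro!: derivative_eq_intros simp: flat_def divide_simps power2_eq_square)
           (cases l; simp add: algebra_simps)
    qed
    then show ?thesis
      by (rule has_field_derivative_transform_within_open[where S = "{0<..}"]) (use 1 in \<open>auto simp: flat_def\<close>)
  next
    case 2
    have "((\<lambda>_. 0) has_real_derivative 0) (at y)" by simp
    then have "(flat k has_real_derivative 0) (at y)"
      by (rule has_field_derivative_transform_within_open[where S = "{..<0}"]) (use 2 in \<open>auto simp: flat_def\<close>)
    then show ?thesis using 2 by (simp add: flat_def)
  next
    case 3
    \<comment> \<open>At 0 the difference quotient of \<open>flat k\<close> is
      \<open>flat (Suc k)\<close> itself, whose limit is already known.\<close>
    have "((\<lambda>h. (flat k (0 + h) - flat k 0) / h) \<longlongrightarrow> 0) (at 0)"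
    proof (rule Lim_transform_eventually[OF flat_tendsto_0[of "Suc k"]])
      show "\<forall>\<^sub>F h in at 0. flat (Suc k) h = (flat k (0 + h) - flat k 0) / h"
        by (auto simp: eventually_at_filter flat_def)
    qed
    then show ?thesis using 3 by (simp add: DERIV_def flat_def)
  qed
qed

text \<open>A class of functions closed under partial derivatives, because \<open>(flat k)'\<close> is a combination of such
  functions; smoothness of the cut-offs then follows by coinduction.\<close>

inductive_set bump_algebra :: "(real^'n::finite \<Rightarrow> complex) set" where
  const: "(\<lambda>_. c) \<in> bump_algebra"
| flat: "(\<lambda>x. of_real (flat k (a * x $ i + b))) \<in> bump_algebra"
| add: "f \<in> bump_algebra \<Longrightarrow> g \<in> bump_algebra \<Longrightarrow> (\<lambda>x. f x + g x) \<in> bump_algebra"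
| mult: "f \<in> bump_algebra \<Longrightarrow> g \<in> bump_algebra \<Longrightarrow> (\<lambda>x. f x * g x) \<in> bump_algebra"

lemma bump_algebra_derivative:
  assumes "f \<in> bump_algebra"
  shows "\<exists>f'. (\<forall>x. (f has_derivative f' x) (at x)) \<and> (\<forall>v. (\<lambda>x. f' x v) \<in> bump_algebra)"
  using assms
proof induction
  case (const c)
  show ?case by (rule exI[of _ "\<lambda>_ _. 0"]) (auto intro: bump_algebra.const)
next
  case (flat k a i b)
  let ?d = "\<lambda>y. - real k * flat (Suc k) y + flat (Suc (Suc k)) y"
  have "((\<lambda>x. of_real (flat k (a * x $ i + b))) has_derivative
      (\<lambda>v. complex_of_real (a * v $ i * ?d (a * x $ i + b)))) (at x)" for x
  proof -
    have "((\<lambda>x. a * x $ i + b) has_derivative (\<lambda>v. a * v $ i)) (at x)"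
      by (auto intro!: derivative_eq_intros bounded_linear.has_derivative[OF bounded_linear_vec_nth])
    from DERIV_compose_FDERIV[OF flat_has_real_derivative this]
    show ?thesis by (intro has_derivative_of_real) simp
  qed
  moreover have "(\<lambda>x. complex_of_real (a * v $ i * ?d (a * x $ i + b))) \<in> bump_algebra" for v
  proof -
    have "(\<lambda>x. complex_of_real (a * v $ i) * (complex_of_real (- real k) * of_real (flat (Suc k) (a * x $ i + b))
       + of_real (flat (Suc (Suc k)) (a * x $ i + b)))) \<in> bump_algebra"
      by (intro bump_algebra.intros)
    then show ?thesis by simp
  qed
  ultimately show ?case
    by (intro exI[of _ "\<lambda>x v. complex_of_real (a * v $ i * ?d (a * x $ i + b))"] conjI allI) auto
next
  case (add f g)
  then obtain f' g' where "\<And>x. (f has_derivative f' x) (at x)" "\<And>v. (\<lambda>x. f' x v) \<in> bump_algebra"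
    "\<And>x. (g has_derivative g' x) (at x)" "\<And>v. (\<lambda>x. g' x v) \<in> bump_algebra" by blast
  then show ?case
    by (intro exI[of _ "\<lambda>x v. f' x v + g' x v"] conjI allI has_derivative_add bump_algebra.add)
next
  case (mult f g)
  then obtain f' g' where "\<And>x. (f has_derivative f' x) (at x)" "\<And>v. (\<lambda>x. f' x v) \<in> bump_algebra"
    "\<And>x. (g has_derivative g' x) (at x)" "\<And>v. (\<lambda>x. g' x v) \<in> bump_algebra" by blast
  then show ?case using mult
    by (intro exI[of _ "\<lambda>x v. f x * g' x v + f' x v * g x"] conjI allI has_derivative_mult
        bump_algebra.add bump_algebra.mult)
qed

lemma bump_algebra_smooth: "f \<in> bump_algebra \<Longrightarrow> smooth f"
proof (rule smooth_coinduct[of _ bump_algebra])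
  fix g :: "real^'n \<Rightarrow> complex" and j x assume "g \<in> bump_algebra"
  then obtain g' where g': "\<And>x. (g has_derivative g' x) (at x)" "\<And>v. (\<lambda>x. g' x v) \<in> bump_algebra"
    using bump_algebra_derivative by blast
  show "g differentiable (at x)" using g'(1) by (auto simp: differentiable_def)
  have "partial j g = (\<lambda>x. g' x (axis j 1))" using partial_eqI[OF g'(1)] by auto
  then show "partial j g \<in> bump_algebra" using g'(2) by simp
qed

lemma bump_algebra_prod: "(\<And>i. i \<in> I \<Longrightarrow> f i \<in> bump_algebra) \<Longrightarrow> (\<lambda>x. \<Prod>i\<in>I. f i x) \<in> bump_algebra"
  by (induction I rule: infinite_finite_induct) (auto intro: bump_algebra.intros)

text \<open>Every factor is \<open>flat 0\<close> of m times the signed distance to a face. As m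
  grows it tends to 1 inside the box, and the product vanishes outside: test functions between 0 and
  the indicator of the box that converge to it.\<close>

definition box_bump :: "real^'n::finite \<Rightarrow> real^'n \<Rightarrow> nat \<Rightarrow> real^'n \<Rightarrow> real"
  where "box_bump a b m x = (\<Prod>i\<in>UNIV. flat 0 (real m * x $ i + - real m * a $ i) * flat 0 (- real m * x $ i + real m * b $ i))"

lemma flat_0_bounds: "0 \<le> flat 0 y" "flat 0 y \<le> 1"
  by (auto simp: flat_def)

lemma box_bump_bounds: "0 \<le> box_bump a b m x" "box_bump a b m x \<le> 1"
  unfolding box_bump_def
  by (auto intro!: prod_nonneg prod_le_1 mult_le_one simp: flat_0_bounds)

lemma box_bump_eq_0: "x \<notin> box a b \<Longrightarrow> box_bump a b m x = 0"
proof -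
  assume "x \<notin> box a b"
  then obtain i where "x $ i \<le> a $ i \<or> b $ i \<le> x $ i" by (auto simp: mem_box_cart not_less)
  then have "real m * x $ i + - real m * a $ i \<le> 0 \<or> - real m * x $ i + real m * b $ i \<le> 0"
    using mult_left_mono[of "x $ i" "a $ i" "real m"] mult_left_mono[of "b $ i" "x $ i" "real m"] by auto
  then have "flat 0 (real m * x $ i + - real m * a $ i) * flat 0 (- real m * x $ i + real m * b $ i) = 0"
    by (auto simp: flat_def not_less)
  then show ?thesis unfolding box_bump_def by (intro prod_zero) auto
qed

lemma test_function_box_bump: "test_function (\<lambda>x. complex_of_real (box_bump a b m x))"
proof -
  have "(\<lambda>x. complex_of_real (box_bump a b m x)) \<in> bump_algebra"
    unfolding box_bump_def of_real_prod of_real_mult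
    by (intro bump_algebra_prod bump_algebra.mult bump_algebra.flat)
  moreover have "closure {x. complex_of_real (box_bump a b m x) \<noteq> 0} \<subseteq> cbox a b"
    using box_bump_eq_0[of _ a b m] box_subset_cbox[of a b] by (intro closure_minimal closed_cbox) auto
  then have "compact (closure {x. complex_of_real (box_bump a b m x) \<noteq> 0})"
    using bounded_subset[OF bounded_cbox] unfolding compact_eq_bounded_closed by blast
  ultimately show ?thesis by (simp add: test_function_def bump_algebra_smooth)
qed

lemma box_bump_tendsto: "(\<lambda>m. box_bump a b m x) \<longlonglongrightarrow> indicator (box a b) x"
proof (cases "x \<in> box a b")
  case True
  have lim: "(\<lambda>m. flat 0 (real m * c)) \<longlonglongrightarrow> 1" if "c > 0" for c
  proof -
    have "(\<lambda>m. exp (- (1 / c) * inverse (real m))) \<longlonglongrightarrow> exp (- (1 / c) * 0)"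
      by (intro tendsto_intros lim_inverse_n)
    then have "(\<lambda>m. exp (- (1 / c) * inverse (real m))) \<longlonglongrightarrow> 1" by simp
    then show ?thesis
      by (rule Lim_transform_eventually)
        (use that in \<open>auto simp: flat_def field_simps intro!: eventually_sequentiallyI[of 1]\<close>)
  qed
  have "(\<lambda>m. box_bump a b m x) \<longlonglongrightarrow> (\<Prod>i\<in>(UNIV::'a set). 1 * 1)"
    unfolding box_bump_def
  proof (intro tendsto_prod tendsto_mult)
    fix i
    show "(\<lambda>m. flat 0 (real m * x $ i + - real m * a $ i)) \<longlonglongrightarrow> 1"
      using lim[of "x $ i - a $ i"] True by (simp add: mem_box_cart right_diff_distrib)
    show "(\<lambda>m. flat 0 (- real m * x $ i + real m * b $ i)) \<longlonglongrightarrow> 1"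
      using lim[of "b $ i - x $ i"] True by (simp add: mem_box_cart right_diff_distrib)
  qed
  then show ?thesis using True by simp
qed (simp add: box_bump_eq_0)

text \<open>Cut to one box, the function is integrable; the sets over which its integral vanishes
  form a Dynkin system containing the boxes, which are stable under intersection and generate the
  Borel sets. Countably many boxes exhaust the space.\<close>

lemma AE_zero_of_box_integrals:
  fixes f :: "'a::euclidean_space \<Rightarrow> real"
  assumes int: "\<And>a b. integrable lborel (\<lambda>x. indicator (box a b) x * f x)"
    and zero: "\<And>a b. (\<integral>x. indicator (box a b) x * f x \<partial>lborel) = 0"
  shows "AE x in lborel. f x = 0"
proof -
  have AE_box: "AE x in lborel. indicator (box c d) x * f x = 0" for c d
  proof -
    define w where "w x = indicator (box c d) x * f x" for x
    have wi: "integrable lborel w" using int[of c d] by (simp add: w_def[abs_def])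
    have wA: "integrable lborel (\<lambda>x. indicator A x *\<^sub>R w x)" if "A \<in> sets borel" for A
      using that wi by (intro integrable_mult_indicator) auto
    have w_box: "(\<integral>x. indicator (box a b) x *\<^sub>R w x \<partial>lborel) = 0" for a b
    proof -
      obtain a' b' where ab: "box a b \<inter> box c d = box a' b'" by (rule that[OF box_Int_box])
      have "indicator (box a b) x *\<^sub>R w x = indicator (box a' b') x * f x" for x
        unfolding w_def ab[symmetric] by (simp add: indicator_inter_arith)
      then show ?thesis using zero by simp
    qed
    have w_total: "(\<integral>x. w x \<partial>lborel) = 0" using zero[of c d] by (simp add: w_def)
    have "(\<integral>x. indicator A x *\<^sub>R w x \<partial>lborel) = 0" if "A \<in> sets borel" for A
    proof -
      have "Int_stable (range (\<lambda>(a, b). box a b :: 'a set))"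
        by (auto simp: Int_stable_def box_Int_box)
      moreover have "range (\<lambda>(a, b). box a b :: 'a set) \<subseteq> Pow UNIV" by auto
      moreover have "A \<in> sigma_sets UNIV (range (\<lambda>(a, b). box a b :: 'a set))"
        using that unfolding borel_eq_box by simp
      ultimately show ?thesis
      proof (induction rule: sigma_sets_induct_disjoint)
        case (basic A)
        then show ?case using w_box by auto
      next
        case (compl A)
        then have A: "A \<in> sets borel" unfolding borel_eq_box by simp
        have "(\<integral>x. indicator (UNIV - A) x *\<^sub>R w x \<partial>lborel) = (\<integral>x. w x - indicator A x *\<^sub>R w x \<partial>lborel)"
          by (intro Bochner_Integration.integral_cong refl) (auto split: split_indicator)
        also have "\<dots> = 0"
          using wi wA[OF A] compl.IH w_total by (subst Bochner_Integration.integral_diff) auto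
        finally show ?case .
      next
        case (union A)
        then have A: "A i \<in> sets lborel" for i unfolding sets_lborel borel_eq_box by auto
        have "set_lebesgue_integral lborel (\<Union>i. A i) w = (\<Sum>i. set_lebesgue_integral lborel (A i) w)"
        proof (rule lebesgue_integral_countable_add)
          show "set_integrable lborel (\<Union>i. A i) w"
            unfolding set_integrable_def by (rule wA) (use A in auto)
        qed (use A union in \<open>auto simp: disjoint_family_on_def\<close>)
        then show ?case using union.IH by (simp add: set_lebesgue_integral_def)
      qed simp
    qed
    then have "AE x in lborel. w x = 0"
      by (intro density_unique_real[OF wi]) (auto simp: set_lebesgue_integral_def)
    then show ?thesis by (simp add: w_def)
  qed
  have "AE x in lborel. \<forall>m::nat. indicator (box (- real m *\<^sub>R One) (real m *\<^sub>R One)) x * f x = 0"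
    unfolding AE_all_countable using AE_box by blast
  then show ?thesis
  proof eventually_elim
    case (elim x)
    have "x \<in> (\<Union>m::nat. box (- real m *\<^sub>R One) (real m *\<^sub>R One))"
      using UN_box_eq_UNIV by auto
    then show ?case using elim by (auto simp: indicator_def split: if_splits)
  qed
qed

lemma sq_integrable_indicator_box: "sq_integrable (\<lambda>x. complex_of_real (indicator (box a b) x))"
  unfolding sq_integrable_def
  by (auto simp: power2_eq_square indicator_inter_arith[symmetric] emeasure_lborel_box_eq intro!: integrable_real_indicator)

text \<open>Box bumps converge to indicators of boxes and are dominated by them, so vanishing passes
  from test functions to boxes. Integrability is asked on boxes, the form in which the integrals of
  translates in \<open>weak_translate\<close> have it.\<close>

lemma du_bois_reymond:
  fixes v :: "real^'n::finite \<Rightarrow> complex"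
  assumes v: "v \<in> borel_measurable borel"
    and int: "\<And>a b. integrable lborel (\<lambda>x. complex_of_real (indicator (box a b) x) * v x)"
    and zero: "\<And>\<phi>. test_function \<phi> \<Longrightarrow> (\<integral>x. v x * \<phi> x \<partial>lborel) = 0"
  shows "AE x in lborel. v x = 0"
proof -
  have int0: "(\<integral>x. complex_of_real (indicator (box a b) x) * v x \<partial>lborel) = 0" for a b
  proof -
    have "(\<lambda>m. \<integral>x. v x * complex_of_real (box_bump a b m x) \<partial>lborel) \<longlonglongrightarrow>
       (\<integral>x. complex_of_real (indicator (box a b) x) * v x \<partial>lborel)"
    proof (rule integral_dominated_convergence[where w = "\<lambda>x. norm (complex_of_real (indicator (box a b) x) * v x)"])
      show "(\<lambda>x. complex_of_real (indicator (box a b) x) * v x) \<in> borel_measurable lborel"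
        using int by (rule borel_measurable_integrable)
      show "(\<lambda>x. v x * complex_of_real (box_bump a b m x)) \<in> borel_measurable lborel" for m
      proof -
        have "(\<lambda>x. complex_of_real (box_bump a b m x)) \<in> borel_measurable borel"
          using test_function_box_bump[of a b m] unfolding test_function_def
          by (intro borel_measurable_continuous_onI smooth_imp_continuous_on) simp
        from borel_measurable_times[OF v this] show ?thesis by simp
      qed
      show "integrable lborel (\<lambda>x. norm (complex_of_real (indicator (box a b) x) * v x))"
        using int by (rule integrable_norm)
      show "AE x in lborel. (\<lambda>m. v x * complex_of_real (box_bump a b m x)) \<longlonglongrightarrow> complex_of_real (indicator (box a b) x) * v x"
        by (intro AE_I2) (subst mult.commute, intro tendsto_intros box_bump_tendsto)
      show "AE x in lborel. norm (v x * complex_of_real (box_bump a b m x)) \<le> norm (complex_of_real (indicator (box a b) x) * v x)" for m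
        using box_bump_bounds[of a b m] box_bump_eq_0[of _ a b m]
        by (intro AE_I2) (auto simp: norm_mult mult.commute indicator_def intro!: mult_left_le)
    qed
    then have "(\<lambda>m::nat. 0) \<longlonglongrightarrow> (\<integral>x. complex_of_real (indicator (box a b) x) * v x \<partial>lborel)"
      by (simp only: zero[OF test_function_box_bump])
    then show ?thesis by (rule LIMSEQ_unique[OF _ tendsto_const])
  qed
  have "AE x in lborel. Re (v x) = 0"
  proof (rule AE_zero_of_box_integrals)
    show "integrable lborel (\<lambda>x. indicator (box a b) x * Re (v x))" for a b
      using integrable_Re[OF int] by simp
    show "(\<integral>x. indicator (box a b) x * Re (v x) \<partial>lborel) = 0" for a b
      using integral_Re[OF int, of a b] int0[of a b] by simp
  qed
  moreover have "AE x in lborel. Im (v x) = 0"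
  proof (rule AE_zero_of_box_integrals)
    show "integrable lborel (\<lambda>x. indicator (box a b) x * Im (v x))" for a b
      using integrable_Im[OF int] by simp
    show "(\<integral>x. indicator (box a b) x * Im (v x) \<partial>lborel) = 0" for a b
      using integral_Im[OF int, of a b] int0[of a b] by simp
  qed
  ultimately show ?thesis by eventually_elim (simp add: complex_eq_iff)
qed


section \<open>Weak derivatives and the weighted resolvent\<close>

lemma integral_shift_lborel:
  fixes f :: "'a::euclidean_space \<Rightarrow> 'b::{banach, second_countable_topology}"
  assumes "f \<in> borel_measurable borel"
  shows "(\<integral>x. f (x + c) \<partial>lborel) = (\<integral>x. f x \<partial>lborel)"
    and "integrable lborel (\<lambda>x. f (x + c)) \<longleftrightarrow> integrable lborel f"
proof -
  have eq: "distr lborel borel (\<lambda>x. x + c) = (lborel :: 'a measure)"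
  proof -
    have "(\<lambda>x. x + c) = (+) c" by (auto simp: add.commute)
    then show ?thesis using lborel_distr_plus[of c] by simp
  qed
  show "(\<integral>x. f (x + c) \<partial>lborel) = (\<integral>x. f x \<partial>lborel)"
    using integral_distr[of "\<lambda>x. x + c" lborel borel f] assms by (simp add: eq)
  show "integrable lborel (\<lambda>x. f (x + c)) \<longleftrightarrow> integrable lborel f"
    using integrable_distr_eq[of "\<lambda>x. x + c" lborel borel f] assms by (simp add: eq)
qed

text \<open>A bound for the spatial L1 norms that is uniform over the compact interval gives joint
  integrability, from which all four conclusions are read off.\<close>

lemma fubini_Icc:
  fixes F :: "real \<Rightarrow> 'a::euclidean_space \<Rightarrow> 'b::{banach, second_countable_topology}"
  assumes m: "(\<lambda>p. F (fst p) (snd p)) \<in> borel_measurable (borel \<Otimes>\<^sub>M borel)"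
    and int: "\<And>t. t \<in> {a..b} \<Longrightarrow> integrable lborel (F t)"
    and bd: "\<And>t. t \<in> {a..b} \<Longrightarrow> (\<integral>x. norm (F t x) \<partial>lborel) \<le> C"
  shows "AE x in lborel. set_integrable lborel {a..b} (\<lambda>t. F t x)"
    and "integrable lborel (\<lambda>x. LINT t:{a..b}|lborel. F t x)"
    and "(\<integral>x. (LINT t:{a..b}|lborel. F t x) \<partial>lborel) = (LINT t:{a..b}|lborel. (\<integral>x. F t x \<partial>lborel))"
    and "set_integrable lborel {a..b} (\<lambda>t. \<integral>x. F t x \<partial>lborel)"
proof -
  define G where "G t x = indicator {a..b} t *\<^sub>R F t x" for t x
  have mG: "(\<lambda>(t, x). G t x) \<in> borel_measurable (lborel \<Otimes>\<^sub>M lborel)"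
    using m unfolding G_def by (simp add: case_prod_beta')
  have mn: "(\<lambda>t. \<integral>x. norm (G t x) \<partial>lborel) \<in> borel_measurable lborel"
    by (rule lborel.borel_measurable_lebesgue_integral) (use mG in \<open>simp add: case_prod_beta'\<close>)
  have iG: "integrable (lborel \<Otimes>\<^sub>M lborel) (\<lambda>(t, x). G t x)"
  proof (rule lborel_pair.Fubini_integrable[OF mG])
    show "integrable lborel (\<lambda>t. \<integral>x. norm (case (t, x) of (t, x) \<Rightarrow> G t x) \<partial>lborel)"
    proof (rule Bochner_Integration.integrable_bound)
      show "integrable lborel (\<lambda>t. indicator {a..b} t * C)"
        by (intro integrable_mult_left) (simp add: integrable_real_indicator emeasure_lborel_Icc_eq)
      show "AE t in lborel. norm (\<integral>x. norm (case (t, x) of (t, x) \<Rightarrow> G t x) \<partial>lborel) \<le> norm (indicator {a..b} t * C)"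
        using bd by (intro AE_I2) (fastforce simp: G_def indicator_def)
    qed (use mn in simp)
    show "AE t in lborel. integrable lborel (\<lambda>x. case (t, x) of (t, x) \<Rightarrow> G t x)"
      using int by (intro AE_I2) (auto simp: G_def indicator_def)
  qed
  have eq: "(\<integral>t. G t x \<partial>lborel) = (LINT t:{a..b}|lborel. F t x)" for x
    by (simp add: G_def set_lebesgue_integral_def)
  have eq2: "(\<integral>x. G t x \<partial>lborel) = indicator {a..b} t *\<^sub>R (\<integral>x. F t x \<partial>lborel)" for t
    by (simp add: G_def)
  show "AE x in lborel. set_integrable lborel {a..b} (\<lambda>t. F t x)"
    using lborel_pair.AE_integrable_snd[OF iG] by (simp add: set_integrable_def G_def)
  show "integrable lborel (\<lambda>x. LINT t:{a..b}|lborel. F t x)"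
    using lborel_pair.integrable_snd[OF iG] by (simp add: eq)
  show "(\<integral>x. (LINT t:{a..b}|lborel. F t x) \<partial>lborel) = (LINT t:{a..b}|lborel. (\<integral>x. F t x \<partial>lborel))"
    using lborel_pair.Fubini_integral[OF iG] unfolding eq eq2 by (simp add: set_lebesgue_integral_def)
  show "set_integrable lborel {a..b} (\<lambda>t. \<integral>x. F t x \<partial>lborel)"
    using lborel_pair.integrable_fst[OF iG] unfolding eq2 set_integrable_def .
qed

lemma LINT_Icc_FTC:
  fixes f f' :: "real \<Rightarrow> 'b::euclidean_space"
  assumes "a \<le> b" "\<And>t. (f has_vector_derivative f' t) (at t)" "continuous_on UNIV f'"
  shows "(LINT t:{a..b}|lborel. f' t) = f b - f a"
  unfolding set_lebesgue_integral_def
  by (rule integral_FTC_Icc)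
     (use assms in \<open>auto intro: has_vector_derivative_at_within continuous_on_subset\<close>)

text \<open>Translation invariance replaces boundary terms: the integral of g' is averaged over
  translates by t * e with t in [0, 1], and exchanging the integrals turns it into the integral of
  g(x + e) - g(x), which is 0.\<close>

lemma integral_directional_derivative_zero:
  fixes g g' :: "'a::euclidean_space \<Rightarrow> 'b::euclidean_space"
  assumes der: "\<And>x t. ((\<lambda>t. g (x + t *\<^sub>R e)) has_vector_derivative g' (x + t *\<^sub>R e)) (at t)"
    and c: "continuous_on UNIV g'" and i: "integrable lborel g" "integrable lborel g'"
  shows "(\<integral>x. g' x \<partial>lborel) = 0"
proof -
  have m: "g \<in> borel_measurable borel" "g' \<in> borel_measurable borel"
    using i borel_measurable_integrable by auto
  have cs: "continuous_on UNIV (\<lambda>t. g' (x + t *\<^sub>R e))" for x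
    by (intro continuous_on_compose2[OF c] continuous_intros) auto
  have "(\<integral>x. (LINT t:{0..1}|lborel. g' (x + t *\<^sub>R e)) \<partial>lborel) = (LINT t:{0..1::real}|lborel. (\<integral>x. g' (x + t *\<^sub>R e) \<partial>lborel))"
  proof (rule fubini_Icc(3))
    show "(\<lambda>p. g' (snd p + fst p *\<^sub>R e)) \<in> borel_measurable (borel \<Otimes>\<^sub>M borel)"
      by (rule measurable_compose[OF _ m(2)]) measurable
    show "integrable lborel (\<lambda>x. g' (x + t *\<^sub>R e))" for t
      using i(2) integral_shift_lborel(2)[OF m(2)] by blast
    show "(\<integral>x. norm (g' (x + t *\<^sub>R e)) \<partial>lborel) \<le> (\<integral>x. norm (g' x) \<partial>lborel)" for t
      using integral_shift_lborel(1)[of "\<lambda>x. norm (g' x)"] m by simp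
  qed
  also have "\<dots> = (LINT t:{0..1::real}|lborel. (\<integral>x. g' x \<partial>lborel))"
    by (simp add: integral_shift_lborel(1)[OF m(2)])
  also have "\<dots> = (\<integral>x. g' x \<partial>lborel)"
    by (simp add: set_lebesgue_integral_def)
  finally have "(\<integral>x. g' x \<partial>lborel) = (\<integral>x. (LINT t:{0..1}|lborel. g' (x + t *\<^sub>R e)) \<partial>lborel)" by simp
  also have "\<dots> = (\<integral>x. g (x + e) - g x \<partial>lborel)"
    using LINT_Icc_FTC[OF _ der cs, of 0 1] by simp
  also have "(\<integral>x. g (x + e) - g x \<partial>lborel) = 0"
    using i m by (subst Bochner_Integration.integral_diff)
      (auto simp: integral_shift_lborel)
  finally show ?thesis .
qed

lemma sq_integrable_test_function: "test_function \<phi> \<Longrightarrow> sq_integrable \<phi>"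
proof -
  assume t: "test_function \<phi>"
  let ?S = "closure {x. \<phi> x \<noteq> 0}"
  have c: "continuous_on A \<phi>" for A using t by (auto simp: test_function_def intro: smooth_imp_continuous_on)
  have "integrable lborel (\<lambda>x. indicator ?S x *\<^sub>R (norm (\<phi> x))\<^sup>2)"
    using t by (intro borel_integrable_compact continuous_intros c) (auto simp: test_function_def)
  also have "(\<lambda>x. indicator ?S x *\<^sub>R (norm (\<phi> x))\<^sup>2) = (\<lambda>x. (norm (\<phi> x))\<^sup>2)"
  proof
    fix x show "indicator ?S x *\<^sub>R (norm (\<phi> x))\<^sup>2 = (norm (\<phi> x))\<^sup>2"
      using closure_subset[of "{x. \<phi> x \<noteq> 0}"] by (cases "\<phi> x = 0") (auto simp: indicator_def)
  qed
  finally show ?thesis using c by (auto simp: sq_integrable_def intro: borel_measurable_continuous_onI)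
qed

lemma partial_shift:
  assumes "g differentiable (at (x + c))"
  shows "(\<lambda>x. g (x + c)) differentiable (at x)" "partial j (\<lambda>x. g (x + c)) x = partial j g (x + c)"
proof -
  have g': "(g has_derivative frechet_derivative g (at (x + c))) (at (x + c))"
    using assms frechet_derivative_works by blast
  have "((\<lambda>x. x + c) has_derivative (\<lambda>h. h)) (at x)" by (auto intro!: derivative_eq_intros)
  then have d: "((\<lambda>x. g (x + c)) has_derivative frechet_derivative g (at (x + c))) (at x)"
    using diff_chain_at[of "\<lambda>x. x + c" "\<lambda>h. h" x g] g' by (simp add: o_def)
  show "(\<lambda>x. g (x + c)) differentiable (at x)" using d by (auto simp: differentiable_def)
  show "partial j (\<lambda>x. g (x + c)) x = partial j g (x + c)"
    using partial_eqI[OF d] by (simp add: partial_def)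
qed

lemma smooth_shift:
  assumes "smooth f" shows "smooth (\<lambda>x. f (x + c))"
proof (rule smooth_coinduct[of _ "{\<lambda>x. g (x + c) | g. smooth g}"])
  fix g x assume "g \<in> {\<lambda>x. g (x + c) | g. smooth g}"
  then show "g differentiable (at x)" using partial_shift(1) smooth_differentiable by blast
next
  fix g j assume "g \<in> {\<lambda>x. g (x + c) | g. smooth g}"
  then obtain k where k: "g = (\<lambda>x. k (x + c))" "smooth k" by blast
  have "partial j g = (\<lambda>x. partial j k (x + c))"
    unfolding k(1) by (intro ext partial_shift(2) smooth_differentiable k(2))
  then show "partial j g \<in> {\<lambda>x. g (x + c) | g. smooth g}" using smooth_partial[OF k(2)] by blast
qed (use assms in blast)

lemma test_function_shift:
  assumes "test_function \<phi>" shows "test_function (\<lambda>x. \<phi> (x + c))"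
proof -
  have "bounded (closure {x. \<phi> x \<noteq> 0})" using assms by (simp add: test_function_def compact_imp_bounded)
  then have "bounded {x. \<phi> x \<noteq> 0}" using bounded_subset closure_subset by blast
  then have "bounded ((\<lambda>y. - c + y) ` {x. \<phi> x \<noteq> 0})" by (rule bounded_translation)
  moreover have "{x. \<phi> (x + c) \<noteq> 0} \<subseteq> (\<lambda>y. - c + y) ` {x. \<phi> x \<noteq> 0}"
  proof
    fix x assume "x \<in> {x. \<phi> (x + c) \<noteq> 0}"
    then show "x \<in> (\<lambda>y. - c + y) ` {x. \<phi> x \<noteq> 0}" by (intro image_eqI[of _ _ "x + c"]) auto
  qed
  ultimately have "bounded {x. \<phi> (x + c) \<noteq> 0}" by (rule bounded_subset)
  then show ?thesis using assms smooth_shift[of \<phi> c] by (simp add: test_function_def)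
qed

text \<open>The relation behind \<open>weak_deriv\<close> on representatives, with square
  integrability built in, so that arguments are made with functions and transferred to the quotient
  only at the end.\<close>

definition weakly :: "'n::finite list \<Rightarrow> (real^'n \<Rightarrow> complex) \<Rightarrow> (real^'n \<Rightarrow> complex) \<Rightarrow> bool"
  where "weakly js u v \<longleftrightarrow> sq_integrable u \<and> sq_integrable v \<and> (\<forall>\<phi>. test_function \<phi> \<longrightarrow>
        (\<integral>x. u x * pderivs js \<phi> x \<partial>lborel) = (-1) ^ length js * (\<integral>x. v x * \<phi> x \<partial>lborel))"

lemma weak_deriv_iff_weakly:
  "sq_integrable u \<Longrightarrow> sq_integrable v \<Longrightarrow> weak_deriv js (abs_L2 u) (abs_L2 v) \<longleftrightarrow> weakly js u v"
  by (simp add: weakly_def weak_deriv_abs_L2)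

lemma sq_integrable_shift:
  assumes "sq_integrable u"
  shows "sq_integrable (\<lambda>x. u (x + c))" "L2_norm (\<lambda>x. u (x + c)) = L2_norm u"
proof -
  have m: "(\<lambda>x. u (x + c)) \<in> borel_measurable borel"
    by (rule measurable_compose[OF _ sq_integrable_measurable[OF assms]]) measurable
  have m2: "(\<lambda>x. (norm (u x))\<^sup>2) \<in> borel_measurable borel"
    using sq_integrable_measurable[OF assms] by measurable
  show "sq_integrable (\<lambda>x. u (x + c))"
    using assms m integral_shift_lborel(2)[OF m2] by (simp add: sq_integrable_def)
  show "L2_norm (\<lambda>x. u (x + c)) = L2_norm u"
    using integral_shift_lborel(1)[OF m2] by (simp add: L2_norm_def)
qed

lemma L2_inner_shift:
  assumes "sq_integrable u" "sq_integrable g"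
  shows "L2_inner (\<lambda>x. u (x + c)) (\<lambda>x. g (x + c)) = L2_inner u g"
proof -
  have "(\<lambda>x. u x * cnj (g x)) \<in> borel_measurable borel"
    using assms sq_integrable_cnj[of g] by (intro borel_measurable_times) (auto simp: sq_integrable_def)
  from integral_shift_lborel(1)[OF this] show ?thesis by (simp add: L2_inner_def)
qed

lemma norm_LINT_Icc_le:
  fixes f :: "real \<Rightarrow> complex"
  assumes "set_integrable lborel {0..s} f" "0 \<le> s" "\<And>t. t \<in> {0..s} \<Longrightarrow> norm (f t - c) \<le> B"
  shows "norm ((LINT t:{0..s}|lborel. f t) - of_real s * c) \<le> s * B"
proof -
  have ci: "set_integrable lborel {0..s} (\<lambda>_. c)" for c :: "'b::{banach,second_countable_topology}"
    unfolding set_integrable_def by (rule borel_integrable_compact) auto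
  have "(LINT t:{0..s}|lborel. c) = of_real s * c"
    using assms(2) by (simp add: set_lebesgue_integral_def scaleR_conv_of_real)
  then have "norm ((LINT t:{0..s}|lborel. f t) - of_real s * c) = norm (LINT t:{0..s}|lborel. f t - c)"
    using set_integral_diff(2)[OF assms(1) ci[of c]] by simp
  also have "\<dots> \<le> (LINT t:{0..s}|lborel. norm (f t - c))"
    using set_integral_norm_bound[OF set_integral_diff(1)[OF assms(1) ci[of c]]] .
  also have "\<dots> \<le> (LINT t:{0..s}|lborel. B)"
    using assms(3) by (intro set_integral_mono set_integrable_norm set_integral_diff(1)[OF assms(1) ci] ci) auto
  also have "\<dots> = s * B" using assms(2) by (simp add: set_lebesgue_integral_def)
  finally show ?thesis .
qed

lemma norm_integral_mult_le_L2:
  assumes "sq_integrable f" "sq_integrable g"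
  shows "(\<integral>x. norm (f x * g x) \<partial>lborel) \<le> L2_norm f * L2_norm g"
  using integral_mult_le_L2[OF assms] by (simp add: norm_mult)

text \<open>Tested against \<phi>, both sides are moved onto translates of \<phi>, where the
  ordinary fundamental theorem of calculus applies; \<open>du_bois_reymond\<close> then removes the
  test function. A weak derivative thereby acquires the force of a difference quotient.\<close>

lemma weak_translate:
  fixes u v :: "real^'n::finite \<Rightarrow> complex"
  assumes w: "weakly [j] u v" and s: "0 \<le> s"
  defines "e \<equiv> axis j (1::real)"
  shows "AE x in lborel. u (x + s *\<^sub>R e) - u x = (LINT \<sigma>:{0..s}|lborel. v (x + \<sigma> *\<^sub>R e))"
proof -
  have u: "sq_integrable u" and v: "sq_integrable v"
    and uv: "\<And>\<phi>. test_function \<phi> \<Longrightarrow> (\<integral>x. u x * partial j \<phi> x \<partial>lborel) = - (\<integral>x. v x * \<phi> x \<partial>lborel)"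
    using w by (auto simp: weakly_def)
  have mv: "(\<lambda>p. v (snd p + fst p *\<^sub>R e)) \<in> borel_measurable (borel \<Otimes>\<^sub>M borel)"
    by (rule measurable_compose[OF _ sq_integrable_measurable[OF v]]) measurable
  define S where "S x = (LINT \<sigma>:{0..s}|lborel. v (x + \<sigma> *\<^sub>R e))" for x
  have Sg: "integrable lborel (\<lambda>x. S x * g x) \<and> (\<integral>x. S x * g x \<partial>lborel) = (LINT \<sigma>:{0..s}|lborel. (\<integral>x. v (x + \<sigma> *\<^sub>R e) * g x \<partial>lborel))"
    if g: "sq_integrable g" for g
  proof -
    note sv = sq_integrable_shift[OF v]
    have mp: "(\<lambda>p. v (snd p + fst p *\<^sub>R e) * g (snd p)) \<in> borel_measurable (borel \<Otimes>\<^sub>M borel)"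
      by (intro borel_measurable_times mv measurable_compose[OF measurable_snd sq_integrable_measurable[OF g]])
    have i: "integrable lborel (\<lambda>x. v (x + t *\<^sub>R e) * g x)" for t by (rule sq_integrable_mult_integrable[OF sv(1) g])
    have b: "(\<integral>x. norm (v (x + t *\<^sub>R e) * g x) \<partial>lborel) \<le> L2_norm v * L2_norm g" for t
      using norm_integral_mult_le_L2[OF sv(1) g] by (simp add: sv(2))
    have eq: "(LINT t:{0..s}|lborel. v (x + t *\<^sub>R e) * g x) = S x * g x" for x
      unfolding S_def by (rule set_integral_mult_left)
    show ?thesis using fubini_Icc(2,3)[OF mp i b, where a = 0 and b = s] unfolding eq by blast
  qed
  have mS: "S \<in> borel_measurable borel"
  proof -
    have "(\<lambda>p. indicator {0..s} (snd p) *\<^sub>R v (fst p + snd p *\<^sub>R e)) \<in> borel_measurable (borel \<Otimes>\<^sub>M lborel)"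
      using measurable_compose[OF measurable_pair_swap'[of borel borel], OF mv] 
      by (intro borel_measurable_scaleR) (auto simp: case_prod_beta' cong: measurable_cong_sets)
    then show ?thesis unfolding S_def set_lebesgue_integral_def
      by (intro lborel.borel_measurable_lebesgue_integral) (simp add: case_prod_beta')
  qed
  define d where "d x = u (x + s *\<^sub>R e) - u x" for x
  have d: "sq_integrable d" unfolding d_def by (intro sq_integrable_diff sq_integrable_shift u)
  have "AE x in lborel. d x - S x = 0"
  proof (rule du_bois_reymond)
    show "(\<lambda>x. d x - S x) \<in> borel_measurable borel" by (rule borel_measurable_diff[OF sq_integrable_measurable[OF d] mS])
    show "integrable lborel (\<lambda>x. complex_of_real (indicator (box a b) x) * (d x - S x))" for a b
      using Bochner_Integration.integrable_diff[OF sq_integrable_mult_integrable[OF d sq_integrable_indicator_box] 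
         conjunct1[OF Sg[OF sq_integrable_indicator_box]], of a b a b]
      by (simp add: algebra_simps)
    fix \<phi> :: "real^'n \<Rightarrow> complex" assume \<phi>: "test_function \<phi>"
    note sp = sq_integrable_test_function[OF \<phi>]
    have sm: "smooth \<phi>" using \<phi> by (simp add: test_function_def)
    have p: "test_function (partial j \<phi>)" by (rule test_function_partial[OF \<phi>])
    note sp' = sq_integrable_test_function[OF p]
    have shift_v: "(\<integral>x. v (x + \<sigma> *\<^sub>R e) * \<phi> x \<partial>lborel) = - (\<integral>x. u x * partial j \<phi> (x + (- \<sigma>) *\<^sub>R e) \<partial>lborel)" for \<sigma>
    proof -
      have t: "test_function (\<lambda>x. \<phi> (x + (- \<sigma>) *\<^sub>R e))" by (rule test_function_shift[OF \<phi>])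
      have "(\<lambda>x. v x * \<phi> (x + (- \<sigma>) *\<^sub>R e)) \<in> borel_measurable borel"
        using v sq_integrable_test_function[OF t] by (intro borel_measurable_times) (auto simp: sq_integrable_def)
      from integral_shift_lborel(1)[OF this, of "\<sigma> *\<^sub>R e"]
      have "(\<integral>x. v (x + \<sigma> *\<^sub>R e) * \<phi> x \<partial>lborel) = (\<integral>x. v x * \<phi> (x + (- \<sigma>) *\<^sub>R e) \<partial>lborel)" by simp
      also have "\<dots> = - (\<integral>x. u x * partial j (\<lambda>x. \<phi> (x + (- \<sigma>) *\<^sub>R e)) x \<partial>lborel)"
        using uv[OF t] by simp
      finally show ?thesis by (simp only: partial_shift(2)[OF smooth_differentiable[OF sm]])
    qed
    have shift_\<phi>: "(LINT \<sigma>:{0..s}|lborel. u x * partial j \<phi> (x + (- \<sigma>) *\<^sub>R e)) = u x * (\<phi> x - \<phi> (x + (- s) *\<^sub>R e))" for x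
    proof -
      have "((\<lambda>t. - \<phi> (x + (- t) *\<^sub>R e)) has_vector_derivative partial j \<phi> (x + (- t) *\<^sub>R e)) (at t)" for t
      proof -
        have "(uminus has_vector_derivative -1) (at t)" by (auto intro!: derivative_eq_intros)
        from vector_diff_chain_at[OF this has_vector_derivative_line[OF smooth_differentiable[OF sm], of x j "-t"]]
        have "((\<lambda>t. \<phi> (x + (- t) *\<^sub>R e)) has_vector_derivative - partial j \<phi> (x + (- t) *\<^sub>R e)) (at t)"
          by (simp add: o_def e_def)
        from has_vector_derivative_minus[OF this] show ?thesis by simp
      qed
      moreover have "continuous_on UNIV (\<lambda>t. partial j \<phi> (x + (- t) *\<^sub>R e))"
      proof -
        have c: "continuous_on UNIV (partial j \<phi>)" by (rule smooth_imp_continuous_on[OF smooth_partial[OF sm]])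
        show ?thesis by (rule continuous_on_compose2[OF c]) (intro continuous_intros, simp)
      qed
      ultimately have "(LINT \<sigma>:{0..s}|lborel. partial j \<phi> (x + (- \<sigma>) *\<^sub>R e)) = - \<phi> (x + (- s) *\<^sub>R e) - (- \<phi> (x + (- 0) *\<^sub>R e))"
        by (rule LINT_Icc_FTC[OF s])
      then show ?thesis by (simp add: set_integral_mult_right)
    qed
    have "(\<integral>x. S x * \<phi> x \<partial>lborel) = (LINT \<sigma>:{0..s}|lborel. (\<integral>x. v (x + \<sigma> *\<^sub>R e) * \<phi> x \<partial>lborel))"
      using Sg[OF sp] by simp
    also have "\<dots> = (LINT \<sigma>:{0..s}|lborel. - (\<integral>x. u x * partial j \<phi> (x + (- \<sigma>) *\<^sub>R e) \<partial>lborel))"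
      by (simp only: shift_v)
    also have "\<dots> = - (LINT \<sigma>:{0..s}|lborel. (\<integral>x. u x * partial j \<phi> (x + (- \<sigma>) *\<^sub>R e) \<partial>lborel))"
      by (simp add: set_lebesgue_integral_def)
    also have "(LINT \<sigma>:{0..s}|lborel. (\<integral>x. u x * partial j \<phi> (x + (- \<sigma>) *\<^sub>R e) \<partial>lborel))
       = (\<integral>x. (LINT \<sigma>:{0..s}|lborel. u x * partial j \<phi> (x + (- \<sigma>) *\<^sub>R e)) \<partial>lborel)"
    proof (rule fubini_Icc(3)[symmetric])
      note sh = sq_integrable_shift[OF sp']
      show "(\<lambda>p. u (snd p) * partial j \<phi> (snd p + (- fst p) *\<^sub>R e)) \<in> borel_measurable (borel \<Otimes>\<^sub>M borel)"
        by (intro borel_measurable_times measurable_compose[OF measurable_snd sq_integrable_measurable[OF u]]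
             measurable_compose[OF _ sq_integrable_measurable[OF sp']]) measurable
      show "integrable lborel (\<lambda>x. u x * partial j \<phi> (x + (- t) *\<^sub>R e))" for t
        by (rule sq_integrable_mult_integrable[OF u sh(1)])
      show "(\<integral>x. norm (u x * partial j \<phi> (x + (- t) *\<^sub>R e)) \<partial>lborel) \<le> L2_norm u * L2_norm (partial j \<phi>)" for t
        using norm_integral_mult_le_L2[OF u sh(1)] by (simp only: sh(2))
    qed
    also have "\<dots> = (\<integral>x. u x * (\<phi> x - \<phi> (x + (- s) *\<^sub>R e)) \<partial>lborel)"
      by (simp only: shift_\<phi>)
    also have "- (\<integral>x. u x * (\<phi> x - \<phi> (x + (- s) *\<^sub>R e)) \<partial>lborel) = (\<integral>x. d x * \<phi> x \<partial>lborel)"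
    proof -
      note st = sq_integrable_shift(1)[OF sp, of "(- s) *\<^sub>R e"]
      have m: "(\<lambda>x. u x * \<phi> (x + (- s) *\<^sub>R e)) \<in> borel_measurable borel"
        using borel_measurable_integrable[OF sq_integrable_mult_integrable[OF u st]] by simp
      have "(\<integral>x. u x * \<phi> (x + (- s) *\<^sub>R e) \<partial>lborel) = (\<integral>x. u (x + s *\<^sub>R e) * \<phi> x \<partial>lborel)"
        using integral_shift_lborel(1)[OF m, of "s *\<^sub>R e"] by simp
      moreover have "(\<integral>x. u x * (\<phi> x - \<phi> (x + (- s) *\<^sub>R e)) \<partial>lborel) = (\<integral>x. u x * \<phi> x \<partial>lborel) - (\<integral>x. u x * \<phi> (x + (- s) *\<^sub>R e) \<partial>lborel)"
        unfolding right_diff_distrib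
        by (rule Bochner_Integration.integral_diff[OF sq_integrable_mult_integrable[OF u sp] sq_integrable_mult_integrable[OF u st]])
      moreover have "(\<integral>x. d x * \<phi> x \<partial>lborel) = (\<integral>x. u (x + s *\<^sub>R e) * \<phi> x \<partial>lborel) - (\<integral>x. u x * \<phi> x \<partial>lborel)"
        unfolding d_def left_diff_distrib
        by (rule Bochner_Integration.integral_diff[OF sq_integrable_mult_integrable[OF sq_integrable_shift(1)[OF u] sp] sq_integrable_mult_integrable[OF u sp]])
      ultimately show ?thesis by simp
    qed
    finally have eq: "(\<integral>x. S x * \<phi> x \<partial>lborel) = (\<integral>x. d x * \<phi> x \<partial>lborel)" .
    show "(\<integral>x. (d x - S x) * \<phi> x \<partial>lborel) = 0"
      unfolding left_diff_distrib
      using Bochner_Integration.integral_diff[OF sq_integrable_mult_integrable[OF d sp] conjunct1[OF Sg[OF sp]]] eq by simp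
  qed
  then show ?thesis by (simp add: d_def S_def)
qed

lemma weak_translate_inner:
  fixes u v g :: "real^'n::finite \<Rightarrow> complex"
  assumes w: "weakly [j] u v" and g: "sq_integrable g" and s: "0 \<le> s"
  defines "e \<equiv> axis j (1::real)"
  shows "L2_inner (\<lambda>x. u (x + s *\<^sub>R e) - u x) g = (LINT \<sigma>:{0..s}|lborel. L2_inner (\<lambda>x. v (x + \<sigma> *\<^sub>R e)) g)"
    and "set_integrable lborel {0..s} (\<lambda>\<sigma>. L2_inner (\<lambda>x. v (x + \<sigma> *\<^sub>R e)) g)"
proof -
  have u: "sq_integrable u" and v: "sq_integrable v" using w by (auto simp: weakly_def)
  note sv = sq_integrable_shift[OF v] and cg = sq_integrable_cnj[OF g]
  have mp: "(\<lambda>p. v (snd p + fst p *\<^sub>R e) * cnj (g (snd p))) \<in> borel_measurable (borel \<Otimes>\<^sub>M borel)"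
    by (intro borel_measurable_times measurable_compose[OF measurable_snd sq_integrable_measurable[OF cg]]
        measurable_compose[OF _ sq_integrable_measurable[OF v]]) measurable
  have i: "integrable lborel (\<lambda>x. v (x + t *\<^sub>R e) * cnj (g x))" for t
    by (rule sq_integrable_mult_integrable[OF sv(1) cg])
  have b: "(\<integral>x. norm (v (x + t *\<^sub>R e) * cnj (g x)) \<partial>lborel) \<le> L2_norm v * L2_norm (\<lambda>x. cnj (g x))" for t
    using norm_integral_mult_le_L2[OF sv(1) cg] by (simp only: sv(2))
  note F = fubini_Icc[OF mp i b, where a = 0 and b = s]
  show "set_integrable lborel {0..s} (\<lambda>\<sigma>. L2_inner (\<lambda>x. v (x + \<sigma> *\<^sub>R e)) g)"
    using F(4) by (simp add: L2_inner_def)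
  have "L2_inner (\<lambda>x. u (x + s *\<^sub>R e) - u x) g = (\<integral>x. (LINT t:{0..s}|lborel. v (x + t *\<^sub>R e) * cnj (g x)) \<partial>lborel)"
    unfolding L2_inner_def
  proof (rule integral_cong_AE)
    show "(\<lambda>x. (u (x + s *\<^sub>R e) - u x) * cnj (g x)) \<in> borel_measurable lborel"
      by (intro borel_measurable_integrable sq_integrable_mult_integrable cg sq_integrable_diff sq_integrable_shift u)
    show "(\<lambda>x. LINT t:{0..s}|lborel. v (x + t *\<^sub>R e) * cnj (g x)) \<in> borel_measurable lborel"
      by (rule borel_measurable_integrable[OF F(2)])
    show "AE x in lborel. (u (x + s *\<^sub>R e) - u x) * cnj (g x) = (LINT t:{0..s}|lborel. v (x + t *\<^sub>R e) * cnj (g x))"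
      using weak_translate[OF w s] unfolding e_def by eventually_elim (simp add: set_integral_mult_left)
  qed
  then show "L2_inner (\<lambda>x. u (x + s *\<^sub>R e) - u x) g = (LINT \<sigma>:{0..s}|lborel. L2_inner (\<lambda>x. v (x + \<sigma> *\<^sub>R e)) g)"
    using F(3) by (simp add: L2_inner_def)
qed

text \<open>The increment is paired with itself: each translate of \<open>v\<close> has the norm of
  \<open>v\<close>, so the squared norm of the increment is at most s * norm v times its norm, and
  one factor cancels.\<close>

lemma weak_translate_norm:
  fixes u v :: "real^'n::finite \<Rightarrow> complex"
  assumes w: "weakly [j] u v" and s: "0 \<le> s"
  shows "L2_norm (\<lambda>x. u (x + s *\<^sub>R axis j 1) - u x) \<le> s * L2_norm v"
proof -
  define d where "d x = u (x + s *\<^sub>R axis j 1) - u x" for x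
  have u: "sq_integrable u" and v: "sq_integrable v" using w by (auto simp: weakly_def)
  have d: "sq_integrable d" unfolding d_def by (intro sq_integrable_diff sq_integrable_shift u)
  note W = weak_translate_inner[OF w d s]
  have "norm (L2_inner d d) \<le> s * (L2_norm v * L2_norm d)"
  proof -
    have "norm (L2_inner (\<lambda>x. v (x + \<sigma> *\<^sub>R axis j 1)) d - 0) \<le> L2_norm v * L2_norm d" for \<sigma>
      using norm_L2_inner_le[OF sq_integrable_shift(1)[OF v] d, of "\<sigma> *\<^sub>R axis j 1"]
      by (simp add: sq_integrable_shift(2)[OF v])
    from norm_LINT_Icc_le[OF W(2) s this] show ?thesis using W(1) by (simp add: d_def[symmetric, abs_def])
  qed
  then have "(L2_norm d)\<^sup>2 \<le> s * (L2_norm v * L2_norm d)"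
    unfolding L2_inner_self norm_of_real by simp
  then have "L2_norm d * L2_norm d \<le> (s * L2_norm v) * L2_norm d" by (simp add: power2_eq_square mult_ac)
  moreover have "0 \<le> s * L2_norm v" by (rule mult_nonneg_nonneg[OF s L2_norm_nonneg])
  ultimately have "L2_norm d \<le> s * L2_norm v"
    using L2_norm_nonneg[of d] by (cases "L2_norm d = 0") (auto simp: mult_le_cancel_right)
  then show ?thesis by (simp add: d_def[abs_def])
qed

text \<open>Functions with a weak derivative in \<open>L\<^sup>2\<close> have difference quotients converging weakly to it, so
  translation invariance of the inner product replaces an approximation of \<open>g\<close> by test functions.\<close>

lemma weakly_antisymmetric:
  fixes u v g g' :: "real^'n::finite \<Rightarrow> complex"
  assumes uv: "weakly [j] u v" and gg: "weakly [j] g g'"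
  shows "L2_inner v g = - L2_inner u g'"
proof -
  define e where "e = axis j (1::real)"
  have u: "sq_integrable u" and v: "sq_integrable v" using uv by (auto simp: weakly_def)
  have g: "sq_integrable g" and g': "sq_integrable g'" using gg by (auto simp: weakly_def)
  define \<tau> where "\<tau> s f x = f (x + s *\<^sub>R e)" for s and f :: "real^'n \<Rightarrow> complex" and x
  have st: "sq_integrable (\<tau> s f)" "L2_norm (\<tau> s f) = L2_norm f" if "sq_integrable f" for s f
    unfolding \<tau>_def by (rule sq_integrable_shift[OF that])+
  have inv: "L2_inner (\<tau> s f) (\<tau> s k) = L2_inner f k" if "sq_integrable f" "sq_integrable k" for s f k
    unfolding \<tau>_def by (rule L2_inner_shift[OF that])
  have dn: "L2_norm (\<lambda>x. \<tau> s f x - f x) \<le> s * L2_norm f'" if "weakly [j] f f'" "0 \<le> s" for s f f'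
    unfolding \<tau>_def e_def by (rule weak_translate_norm[OF that])
  define K where "K = L2_norm v * L2_norm g'"
  \<comment> \<open>\<open>I\<close> divided by s is compared with both inner products of the claim.
    Each comparison costs at most \<open>s * K\<close>, because a translation by at most s changes g
    or u by at most s times the norm of its derivative; afterwards s tends to 0.\<close>
  have bound: "s * norm (L2_inner v g + L2_inner u g') \<le> s * (s * (2 * K))" if s: "0 < s" for s
  proof -
    define I where "I = L2_inner (\<lambda>x. \<tau> s u x - u x) g"
    have s0: "0 \<le> s" using s by simp
    note su = sq_integrable_diff[OF st(1)[OF u] u] and sg = sq_integrable_diff[OF st(1)[OF g] g]
    have 1: "norm (I - of_real s * L2_inner v g) \<le> s * (s * K)"
    proof -
      have "norm (L2_inner (\<tau> \<sigma> v) g - L2_inner v g) \<le> s * K" if "\<sigma> \<in> {0..s}" for \<sigma>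
      proof -
        have "L2_inner (\<tau> \<sigma> v) g - L2_inner v g = L2_inner (\<tau> \<sigma> v) g - L2_inner (\<tau> \<sigma> v) (\<tau> \<sigma> g)"
          by (simp add: inv v g)
        also have "\<dots> = - L2_inner (\<tau> \<sigma> v) (\<lambda>x. \<tau> \<sigma> g x - g x)"
          by (simp add: L2_inner_diff_right st v g)
        also have "norm \<dots> \<le> L2_norm (\<tau> \<sigma> v) * L2_norm (\<lambda>x. \<tau> \<sigma> g x - g x)"
          unfolding norm_minus_cancel by (intro norm_L2_inner_le st sq_integrable_diff v g)
        also have "\<dots> \<le> L2_norm v * (\<sigma> * L2_norm g')"
          using that by (intro mult_mono dn gg) (auto simp: st v L2_norm_nonneg)
        also have "\<dots> \<le> L2_norm v * (s * L2_norm g')"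
          using that by (intro mult_left_mono mult_right_mono L2_norm_nonneg) auto
        finally show ?thesis by (simp add: K_def mult_ac)
      qed
      then have A: "norm (L2_inner (\<lambda>x. v (x + \<sigma> *\<^sub>R axis j 1)) g - L2_inner v g) \<le> s * K" if "\<sigma> \<in> {0..s}" for \<sigma>
        using that by (simp add: \<tau>_def[abs_def] e_def)
      note W = weak_translate_inner[OF uv g s0]
      from norm_LINT_Icc_le[OF W(2) s0 A] show ?thesis
        unfolding W(1)[symmetric] by (simp add: I_def \<tau>_def e_def)
    qed
    have 2: "norm (I + of_real s * L2_inner u g') \<le> s * (s * K)"
    proof -
      have "norm (L2_inner (\<tau> \<sigma> g') (\<tau> s u) - L2_inner g' u) \<le> s * K" if "\<sigma> \<in> {0..s}" for \<sigma>
      proof -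
        have "L2_inner (\<tau> \<sigma> g') (\<tau> s u) - L2_inner g' u = L2_inner (\<tau> \<sigma> g') (\<tau> \<sigma> (\<tau> (s - \<sigma>) u)) - L2_inner (\<tau> \<sigma> g') (\<tau> \<sigma> u)"
        proof -
          have "\<tau> \<sigma> (\<tau> (s - \<sigma>) u) = \<tau> s u" by (simp add: \<tau>_def fun_eq_iff scaleR_left_diff_distrib)
          then show ?thesis by (simp add: inv g' u)
        qed
        also have "\<dots> = L2_inner g' (\<tau> (s - \<sigma>) u) - L2_inner g' u"
          by (simp add: inv g' u st)
        also have "\<dots> = L2_inner g' (\<lambda>x. \<tau> (s - \<sigma>) u x - u x)"
          by (simp add: L2_inner_diff_right st g' u)
        also have "norm \<dots> \<le> L2_norm g' * L2_norm (\<lambda>x. \<tau> (s - \<sigma>) u x - u x)"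
          by (intro norm_L2_inner_le st sq_integrable_diff g' u)
        also have "\<dots> \<le> L2_norm g' * ((s - \<sigma>) * L2_norm v)"
          using that by (intro mult_left_mono dn uv) (auto simp: L2_norm_nonneg)
        also have "\<dots> \<le> L2_norm g' * (s * L2_norm v)"
          using that by (intro mult_left_mono mult_right_mono L2_norm_nonneg) auto
        finally show ?thesis by (simp add: K_def mult_ac)
      qed
      then have A: "norm (L2_inner (\<lambda>x. g' (x + \<sigma> *\<^sub>R axis j 1)) (\<tau> s u) - L2_inner g' u) \<le> s * K" if "\<sigma> \<in> {0..s}" for \<sigma>
        using that by (simp add: \<tau>_def[abs_def] e_def)
      note W = weak_translate_inner[OF gg st(1)[OF u] s0]
      from norm_LINT_Icc_le[OF W(2) s0 A]
      have "norm (L2_inner (\<lambda>x. \<tau> s g x - g x) (\<tau> s u) - of_real s * L2_inner g' u) \<le> s * (s * K)"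
        unfolding W(1)[symmetric] by (simp add: \<tau>_def e_def)
      \<comment> \<open>Summation by parts: invariance of the inner product under translation moves
        the increment from u to g.\<close>
      moreover have "I = - cnj (L2_inner (\<lambda>x. \<tau> s g x - g x) (\<tau> s u))"
      proof -
        have "I = L2_inner (\<tau> s u) g - L2_inner u g"
          unfolding I_def by (rule L2_inner_diff_left; intro st u g)
        also have "L2_inner u g = L2_inner (\<tau> s u) (\<tau> s g)" by (simp add: inv u g)
        also have "L2_inner (\<tau> s u) g - \<dots> = - L2_inner (\<tau> s u) (\<lambda>x. \<tau> s g x - g x)"
          by (simp add: L2_inner_diff_right st u g)
        finally show ?thesis by (simp add: L2_inner_cnj[of "\<tau> s u"])
      qed
      then have "I + of_real s * L2_inner u g' = - cnj (L2_inner (\<lambda>x. \<tau> s g x - g x) (\<tau> s u) - of_real s * L2_inner g' u)"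
        by (simp add: L2_inner_cnj[of u])
      ultimately show ?thesis by (simp only: norm_minus_cancel complex_mod_cnj)
    qed
    have "s * norm (L2_inner v g + L2_inner u g') = norm (of_real s * (L2_inner v g + L2_inner u g'))"
      using s by (simp add: norm_mult)
    also have "\<dots> = norm ((I + of_real s * L2_inner u g') - (I - of_real s * L2_inner v g))"
      by (simp add: algebra_simps)
    also have "\<dots> \<le> s * (s * K) + s * (s * K)"
      by (rule order_trans[OF norm_triangle_ineq4 add_mono[OF 2 1]])
    finally show ?thesis by (simp add: algebra_simps)
  qed
  have "norm (L2_inner v g + L2_inner u g') \<le> s * (2 * K)" if "s > 0" for s
    using bound[OF that] that by (simp add: mult_le_cancel_left)
  moreover have "((\<lambda>s. s * (2 * K)) \<longlongrightarrow> 0 * (2 * K)) (at_right 0)" by (intro tendsto_intros)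
  ultimately have "norm (L2_inner v g + L2_inner u g') \<le> 0 * (2 * K)"
    by (intro tendsto_lowerbound[where F = "at_right 0"]) (auto simp: eventually_at_filter)
  then show ?thesis by (simp add: eq_neg_iff_add_eq_0)
qed

lemma weakly_unique:
  assumes v: "weakly js u v" and w: "weakly js u w"
  shows "AE x in lborel. v x = w x"
proof -
  have sv: "sq_integrable v" and sw: "sq_integrable w" using v w by (auto simp: weakly_def)
  have d: "sq_integrable (\<lambda>x. v x - w x)" by (rule sq_integrable_diff[OF sv sw])
  have "AE x in lborel. v x - w x = 0"
  proof (rule du_bois_reymond)
    show "(\<lambda>x. v x - w x) \<in> borel_measurable borel" by (rule sq_integrable_measurable[OF d])
    show "integrable lborel (\<lambda>x. complex_of_real (indicator (box a b) x) * (v x - w x))" for a b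
      by (rule sq_integrable_mult_integrable[OF sq_integrable_indicator_box d])
    fix \<phi> :: "real^'a \<Rightarrow> complex" assume \<phi>: "test_function \<phi>"
    note sp = sq_integrable_test_function[OF \<phi>]
    have "(-1) ^ length js * (\<integral>x. v x * \<phi> x \<partial>lborel) = (-1) ^ length js * (\<integral>x. w x * \<phi> x \<partial>lborel)"
      using v w \<phi> by (auto simp: weakly_def)
    then show "(\<integral>x. (v x - w x) * \<phi> x \<partial>lborel) = 0"
      unfolding left_diff_distrib
      by (subst Bochner_Integration.integral_diff[OF sq_integrable_mult_integrable[OF sv sp] sq_integrable_mult_integrable[OF sw sp]]) simp
  qed
  then show ?thesis by simp
qed

text \<open>The derivative of a test function is again a test function, so the first-order relation
  may be tested with \<open>partial j \<phi>\<close> and compared with the second-order one.\<close>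

lemma weakly_twice:
  assumes v: "weakly [j] u v" and w: "weakly [j, j] u w"
  shows "weakly [j] v w"
  unfolding weakly_def
proof (intro conjI allI impI)
  fix \<phi> :: "real^'a \<Rightarrow> complex" assume \<phi>: "test_function \<phi>"
  have "(\<integral>x. u x * partial j (partial j \<phi>) x \<partial>lborel) = - (\<integral>x. v x * partial j \<phi> x \<partial>lborel)"
    using v test_function_partial[OF \<phi>, of j] by (auto simp: weakly_def)
  moreover have "(\<integral>x. u x * partial j (partial j \<phi>) x \<partial>lborel) = (\<integral>x. w x * \<phi> x \<partial>lborel)"
    using w \<phi> by (auto simp: weakly_def)
  ultimately show "(\<integral>x. v x * pderivs [j] \<phi> x \<partial>lborel) = (- 1) ^ length [j] * (\<integral>x. w x * \<phi> x \<partial>lborel)"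
    by simp
qed (use v w in \<open>auto simp: weakly_def\<close>)

section \<open>The Laplacian on \<open>H2\<close>, and uniqueness for the damped equation\<close>

lemma laplacian_abs_L2:
  fixes u :: "real^'n::finite \<Rightarrow> complex"
  assumes "\<And>j. weakly [j, j] u (w j)"
  shows "laplacian (abs_L2 u) = abs_L2 (\<lambda>x. \<Sum>j\<in>UNIV. w j x)"
proof -
  have u: "sq_integrable u" and w: "sq_integrable (w j)" for j using assms by (auto simp: weakly_def)
  have "(THE v. weak_deriv [j, j] (abs_L2 u) v) = abs_L2 (w j)" for j
  proof (rule the_equality)
    show "weak_deriv [j, j] (abs_L2 u) (abs_L2 (w j))" using assms weak_deriv_iff_weakly[OF u w] by blast
    fix v assume *: "weak_deriv [j, j] (abs_L2 u) v"
    obtain v' where v': "sq_integrable v'" "v = abs_L2 v'" by (rule L2_cases)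
    then have "weakly [j, j] u v'" using * weak_deriv_iff_weakly[OF u] by blast
    from weakly_unique[OF this assms] show "v = abs_L2 (w j)" using v' w abs_L2_eq_iff by blast
  qed
  then show ?thesis by (simp add: laplacian_def sum_abs_L2[OF w])
qed

lemma H2_cases:
  fixes U :: "'n::finite L2"
  assumes "U \<in> H2"
  obtains u v w where "U = abs_L2 u" "\<And>j. weakly [j] u (v j)" "\<And>j. weakly [j, j] u (w j)"
proof -
  obtain u where u: "sq_integrable u" "U = abs_L2 u" by (rule L2_cases)
  have ex: "\<exists>v. weakly js u v" if len: "length js \<le> 2" for js
  proof -
    obtain V where V: "weak_deriv js (abs_L2 u) V" using assms len u by (auto simp: H2_def)
    obtain v where v: "sq_integrable v" "V = abs_L2 v" by (rule L2_cases)
    then show ?thesis using V weak_deriv_iff_weakly[OF u(1)] by blast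
  qed
  have "\<exists>v. \<forall>j. weakly [j] u (v j)" by (rule choice) (use ex in simp)
  moreover have "\<exists>w. \<forall>j. weakly [j, j] u (w j)" by (rule choice) (use ex in simp)
  ultimately show thesis using that u(2) by blast
qed

lemma weakly_diff:
  assumes "weakly js u v" "weakly js u' v'"
  shows "weakly js (\<lambda>x. u x - u' x) (\<lambda>x. v x - v' x)"
  unfolding weakly_def
proof (intro conjI allI impI)
  have s: "sq_integrable u" "sq_integrable v" "sq_integrable u'" "sq_integrable v'"
    using assms by (auto simp: weakly_def)
  show "sq_integrable (\<lambda>x. u x - u' x)" "sq_integrable (\<lambda>x. v x - v' x)" by (intro sq_integrable_diff s)+
  fix \<phi> :: "real^'a \<Rightarrow> complex" assume \<phi>: "test_function \<phi>"
  have "test_function (pderivs js \<phi>)" for js by (induction js) (auto intro: \<phi> test_function_partial)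
  note sp = sq_integrable_test_function[OF this]
  have i: "integrable lborel (\<lambda>x. f x * pderivs ks \<phi> x)" if "sq_integrable f" for f ks
    by (rule sq_integrable_mult_integrable[OF that sp])
  show "(\<integral>x. (u x - u' x) * pderivs js \<phi> x \<partial>lborel) = (- 1) ^ length js * (\<integral>x. (v x - v' x) * \<phi> x \<partial>lborel)"
    unfolding left_diff_distrib
    using assms \<phi> i[OF s(2), of "[]"] i[OF s(4), of "[]"]
    by (simp add: Bochner_Integration.integral_diff i s weakly_def right_diff_distrib)
qed

text \<open>Integration by parts makes each summand minus the squared norm of a first
  derivative.\<close>

lemma L2_inner_laplacian_real:
  assumes "\<And>j. weakly [j] u (v j)" "\<And>j. weakly [j, j] u (w j)"
  shows "Im (L2_inner (\<lambda>x. \<Sum>j\<in>UNIV. w j x) u) = 0"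
proof -
  have u: "sq_integrable u" and w: "sq_integrable (w j)" for j using assms by (auto simp: weakly_def)
  have "L2_inner (\<lambda>x. \<Sum>j\<in>UNIV. w j x) u = (\<Sum>j\<in>UNIV. L2_inner (w j) u)"
    unfolding L2_inner_def sum_distrib_right
    by (intro Bochner_Integration.integral_sum sq_integrable_mult_integrable w sq_integrable_cnj u)
  also have "\<dots> = (\<Sum>j\<in>UNIV. - of_real ((L2_norm (v j))\<^sup>2))"
    using weakly_antisymmetric[OF weakly_twice[OF assms] assms(1)] by (simp add: L2_inner_self)
  finally show ?thesis by (simp add: Im_sum del: of_real_power)
qed

context
  fixes V1 V2 :: "real^'n::finite \<Rightarrow> real" and h :: real
  assumes V1: "V1 \<in> borel_measurable borel" "bounded (range V1)"
    and V2: "V2 \<in> borel_measurable borel" "bounded (range V2)" "\<And>x. 0 \<le> V2 x"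
    and h: "0 < h"
begin

lemma schroedinger_abs_L2:
  assumes w: "\<And>j. weakly [j, j] u (w j)"
  shows "schroedinger V1 V2 h (abs_L2 u) - mult_op (\<lambda>_. z) (abs_L2 u) =
    abs_L2 (\<lambda>x. - of_real (h\<^sup>2) * (\<Sum>j\<in>UNIV. w j x) + of_real (V1 x) * u x - \<i> * of_real (h * V2 x) * u x - z * u x)"
    and "sq_integrable (\<lambda>x. - of_real (h\<^sup>2) * (\<Sum>j\<in>UNIV. w j x) + of_real (V1 x) * u x - \<i> * of_real (h * V2 x) * u x - z * u x)"
proof -
  have u: "sq_integrable u" and sw: "sq_integrable (\<lambda>x. \<Sum>j\<in>UNIV. w j x)"
    using w by (auto simp: weakly_def intro: sq_integrable_sum)
  have m1: "(\<lambda>x. complex_of_real (V1 x)) \<in> borel_measurable borel" using V1(1) by simp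
  have m2: "(\<lambda>x. \<i> * complex_of_real (h * V2 x)) \<in> borel_measurable borel" using V2(1) by simp
  have b1: "bounded (range (\<lambda>x. complex_of_real (V1 x)))" using V1(2) by (auto simp: bounded_iff)
  have b2: "bounded (range (\<lambda>x. \<i> * complex_of_real (h * V2 x)))"
  proof -
    obtain B where "\<And>x. \<bar>V2 x\<bar> \<le> B" using V2(2) by (auto simp: bounded_iff)
    then have "norm (\<i> * complex_of_real (h * V2 x)) \<le> h * B" for x
      using h by (simp add: norm_mult mult_left_mono)
    then show ?thesis by (auto simp: bounded_iff)
  qed
  have bz: "bounded (range (\<lambda>_::real^'n. z))" by auto
  note sb = sq_integrable_bounded_mult[OF m1 b1 u] sq_integrable_bounded_mult[OF m2 b2 u] sq_integrable_scale[OF u, of z]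
    sq_integrable_scale[OF sw, of "of_real (h\<^sup>2)"]
  have sm: "sq_integrable (\<lambda>x. - (h\<^sup>2 *\<^sub>R (\<Sum>j\<in>UNIV. w j x)))"
    using sq_integrable_uminus[OF sb(4)] by (simp add: scaleR_conv_of_real)
  have sr: "sq_integrable (\<lambda>x. h\<^sup>2 *\<^sub>R (\<Sum>j\<in>UNIV. w j x))"
    using sb(4) by (simp add: scaleR_conv_of_real)
  have s1: "sq_integrable (\<lambda>x. - (h\<^sup>2 *\<^sub>R (\<Sum>j\<in>UNIV. w j x)) + of_real (V1 x) * u x)"
    by (rule sq_integrable_add[OF sm sb(1)])
  have s2: "sq_integrable (\<lambda>x. - (h\<^sup>2 *\<^sub>R (\<Sum>j\<in>UNIV. w j x)) + of_real (V1 x) * u x - \<i> * of_real (h * V2 x) * u x)"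
    by (rule sq_integrable_diff[OF s1 sb(2)])
  show "schroedinger V1 V2 h (abs_L2 u) - mult_op (\<lambda>_. z) (abs_L2 u) =
    abs_L2 (\<lambda>x. - of_real (h\<^sup>2) * (\<Sum>j\<in>UNIV. w j x) + of_real (V1 x) * u x - \<i> * of_real (h * V2 x) * u x - z * u x)"
    unfolding schroedinger_def laplacian_abs_L2[OF w] mult_op_abs_L2[OF u m1 b1] mult_op_abs_L2[OF u m2 b2]
      mult_op_abs_L2[OF u borel_measurable_const bz] scaleR_abs_L2[OF sw] uminus_abs_L2[OF sr]
      add_abs_L2[OF sm sb(1)] diff_abs_L2[OF s1 sb(2)] diff_abs_L2[OF s2 sb(3)]
    by (simp add: scaleR_conv_of_real)
  show "sq_integrable (\<lambda>x. - of_real (h\<^sup>2) * (\<Sum>j\<in>UNIV. w j x) + of_real (V1 x) * u x - \<i> * of_real (h * V2 x) * u x - z * u x)"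
    using sq_integrable_diff[OF s2 sb(3)] by (simp add: scaleR_conv_of_real)
qed

text \<open>Pair with u and take imaginary parts: the Laplacian and \<open>V1\<close> contribute
  real numbers, and what remains is the integral of (h * V2 + Im z) times the squared modulus of u.
  The sign of the damping makes this weight at least Im z > 0.\<close>

lemma schroedinger_injective:
  assumes v: "\<And>j. weakly [j] u (v j)" and w: "\<And>j. weakly [j, j] u (w j)" and z: "Im z > 0"
    and eq: "AE x in lborel. - of_real (h\<^sup>2) * (\<Sum>j\<in>UNIV. w j x) + of_real (V1 x) * u x
       - \<i> * of_real (h * V2 x) * u x - z * u x = 0"
  shows "AE x in lborel. u x = 0"
proof -
  have u: "sq_integrable u" and sw: "sq_integrable (\<lambda>x. \<Sum>j\<in>UNIV. w j x)"
    using w by (auto simp: weakly_def intro: sq_integrable_sum)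
  have i2: "integrable lborel (\<lambda>x. B x * (norm (u x))\<^sup>2)" if B: "B \<in> borel_measurable borel" "bounded (range B)" for B :: "real^'n \<Rightarrow> real"
  proof -
    have "sq_integrable (\<lambda>x. complex_of_real (B x) * u x)"
      using B u by (intro sq_integrable_bounded_mult) (auto simp: bounded_iff)
    from integrable_Re[OF sq_integrable_mult_integrable[OF this sq_integrable_cnj[OF u]]]
    show ?thesis by (simp add: complex_norm_square[symmetric] mult.assoc del: of_real_power Re_complex_of_real)
       (simp add: Re_complex_of_real[of "B _ * _", unfolded of_real_mult])
  qed
  have iL: "integrable lborel (\<lambda>x. Im ((\<Sum>j\<in>UNIV. w j x) * cnj (u x)))"
    by (intro integrable_Im sq_integrable_mult_integrable sw sq_integrable_cnj u)
  have "(\<integral>x. h\<^sup>2 * Im ((\<Sum>j\<in>UNIV. w j x) * cnj (u x)) + (h * V2 x + Im z) * (norm (u x))\<^sup>2 \<partial>lborel) = (\<integral>x. 0 \<partial>(lborel :: (real^'n) measure))"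
  proof (rule integral_cong_AE)
    show "AE x in lborel. h\<^sup>2 * Im ((\<Sum>j\<in>UNIV. w j x) * cnj (u x)) + (h * V2 x + Im z) * (norm (u x))\<^sup>2 = 0"
      using eq
    proof eventually_elim
      case (elim x)
      define W where "W = (\<Sum>j\<in>UNIV. w j x)"
      have "of_real (h\<^sup>2) * (W * cnj (u x)) = (of_real (V1 x) - \<i> * of_real (h * V2 x) - z) * (u x * cnj (u x))"
        using arg_cong[OF elim, of "\<lambda>y. y * cnj (u x)"] by (simp add: W_def algebra_simps)
      then have "Im (of_real (h\<^sup>2) * (W * cnj (u x))) = Im ((of_real (V1 x) - \<i> * of_real (h * V2 x) - z) * of_real ((norm (u x))\<^sup>2))"
        by (simp only: complex_norm_square)
      then have "h\<^sup>2 * Im (W * cnj (u x)) = - (h * V2 x + Im z) * (norm (u x))\<^sup>2"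
      proof -
        have A: "Im (of_real r * y) = r * Im y" "Im (y * of_real r) = Im y * r" for r y by simp_all
        assume "Im (of_real (h\<^sup>2) * (W * cnj (u x))) = Im ((of_real (V1 x) - \<i> * of_real (h * V2 x) - z) * of_real ((norm (u x))\<^sup>2))"
        then show ?thesis unfolding A by simp
      qed
      then show ?case unfolding W_def[symmetric] by (simp only: minus_mult_left[symmetric] add.left_inverse)
    qed
    show "(\<lambda>x. h\<^sup>2 * Im ((\<Sum>j\<in>UNIV. w j x) * cnj (u x)) + (h * V2 x + Im z) * (norm (u x))\<^sup>2) \<in> borel_measurable lborel"
      using borel_measurable_integrable[OF iL] V2(1) sq_integrable_measurable[OF u] by simp
  qed simp
  moreover have "(\<integral>x. h\<^sup>2 * Im ((\<Sum>j\<in>UNIV. w j x) * cnj (u x)) + (h * V2 x + Im z) * (norm (u x))\<^sup>2 \<partial>lborel)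
     = h\<^sup>2 * (\<integral>x. Im ((\<Sum>j\<in>UNIV. w j x) * cnj (u x)) \<partial>lborel) + (\<integral>x. (h * V2 x + Im z) * (norm (u x))\<^sup>2 \<partial>lborel)"
  proof (subst Bochner_Integration.integral_add)
    have "bounded (range (\<lambda>x. h * V2 x + Im z))"
    proof -
      obtain B where "\<And>x. \<bar>V2 x\<bar> \<le> B" using V2(2) by (auto simp: bounded_iff)
      then have "norm (h * V2 x + Im z) \<le> h * B + \<bar>Im z\<bar>" for x
        using h by (intro order_trans[OF norm_triangle_ineq] add_mono) (auto simp: abs_mult mult_left_mono)
      then show ?thesis by (auto simp: bounded_iff)
    qed
    then show "integrable lborel (\<lambda>x. (h * V2 x + Im z) * (norm (u x))\<^sup>2)" using V2(1) by (intro i2) auto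
  qed (use iL in auto)
  moreover have "(\<integral>x. Im ((\<Sum>j\<in>UNIV. w j x) * cnj (u x)) \<partial>lborel) = 0"
    using L2_inner_laplacian_real[OF v w] unfolding L2_inner_def
    by (subst integral_Im) (intro sq_integrable_mult_integrable sw sq_integrable_cnj u, simp)
  ultimately have 0: "(\<integral>x. (h * V2 x + Im z) * (norm (u x))\<^sup>2 \<partial>lborel) = 0" by simp
  have "Im z * (\<integral>x. (norm (u x))\<^sup>2 \<partial>lborel) = (\<integral>x. Im z * (norm (u x))\<^sup>2 \<partial>lborel)" by simp
  also have "\<dots> \<le> (\<integral>x. (h * V2 x + Im z) * (norm (u x))\<^sup>2 \<partial>lborel)"
  proof (rule integral_mono)
    show "integrable lborel (\<lambda>x. Im z * (norm (u x))\<^sup>2)" by (rule i2) auto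
    have "bounded (range (\<lambda>x. h * V2 x + Im z))"
    proof -
      obtain B where "\<And>x. \<bar>V2 x\<bar> \<le> B" using V2(2) by (auto simp: bounded_iff)
      then have "norm (h * V2 x + Im z) \<le> h * B + \<bar>Im z\<bar>" for x
        using h by (intro order_trans[OF norm_triangle_ineq] add_mono) (auto simp: abs_mult mult_left_mono)
      then show ?thesis by (auto simp: bounded_iff)
    qed
    then show "integrable lborel (\<lambda>x. (h * V2 x + Im z) * (norm (u x))\<^sup>2)" using V2(1) by (intro i2) auto
    show "Im z * (norm (u x))\<^sup>2 \<le> (h * V2 x + Im z) * (norm (u x))\<^sup>2" for x
      using V2(3)[of x] h by (intro mult_right_mono) auto
  qed
  finally have "(L2_norm u)\<^sup>2 \<le> 0" using 0 z by (simp add: L2_norm_power2 mult_le_0_iff)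
  then have "L2_norm u = 0" by simp
  then show ?thesis using L2_norm_eq_0_iff[OF u] by simp
qed

text \<open>The right-hand side comes from a known element of \<open>H2\<close>, so the description
  in \<open>resolvent\<close> is settled by uniqueness, that is, by injectivity applied to the
  difference of two solutions.\<close>

lemma resolvent_eqI:
  assumes U: "U \<in> H2" and z: "Im z > 0"
  shows "resolvent H2 (schroedinger V1 V2 h) z (schroedinger V1 V2 h U - mult_op (\<lambda>_. z) U) = U"
  unfolding resolvent_def
proof (rule the_equality)
  fix U' assume U': "U' \<in> H2 \<and> schroedinger V1 V2 h U' - mult_op (\<lambda>_. z) U' = schroedinger V1 V2 h U - mult_op (\<lambda>_. z) U"
  obtain u v w where u: "U = abs_L2 u" "\<And>j. weakly [j] u (v j)" "\<And>j. weakly [j, j] u (w j)"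
    using H2_cases[OF U] by blast
  obtain u' v' w' where u': "U' = abs_L2 u'" "\<And>j. weakly [j] u' (v' j)" "\<And>j. weakly [j, j] u' (w' j)"
    using H2_cases[OF conjunct1[OF U']] by blast
  have "AE x in lborel. - of_real (h\<^sup>2) * (\<Sum>j\<in>UNIV. w' j x) + of_real (V1 x) * u' x - \<i> * of_real (h * V2 x) * u' x - z * u' x
    = - of_real (h\<^sup>2) * (\<Sum>j\<in>UNIV. w j x) + of_real (V1 x) * u x - \<i> * of_real (h * V2 x) * u x - z * u x"
    using U' unfolding u(1) u'(1) schroedinger_abs_L2(1)[OF u(3)] schroedinger_abs_L2(1)[OF u'(3)]
    by (subst (asm) abs_L2_eq_iff[OF schroedinger_abs_L2(2)[OF u'(3)] schroedinger_abs_L2(2)[OF u(3)]]) simp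
  then have "AE x in lborel. - of_real (h\<^sup>2) * (\<Sum>j\<in>UNIV. w' j x - w j x) + of_real (V1 x) * (u' x - u x)
      - \<i> * of_real (h * V2 x) * (u' x - u x) - z * (u' x - u x) = 0"
    by eventually_elim (simp add: sum_subtractf algebra_simps)
  from schroedinger_injective[OF weakly_diff[OF u'(2) u(2)] weakly_diff[OF u'(3) u(3)] z this]
  have "AE x in lborel. u' x = u x" by simp
  moreover have "sq_integrable u" "sq_integrable u'" using u(2) u'(2) by (auto simp: weakly_def)
  ultimately show "U' = U" unfolding u(1) u'(1) by (simp add: abs_L2_eq_iff)
qed (use U in simp)

text \<open>A finite \<open>op_norm\<close> carries bounded linearity with it, because that norm is
  infinite on every other map; \<open>onorm\<close> then applies. \<open>G\<close> is the source
  freed from its weight, which the inner \<open>weight (- s)\<close> of the weighted resolvent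
  restores.\<close>

lemma weighted_estimate:
  assumes z: "Im z > 0" and op: "op_norm (weighted_resolvent V1 V2 s h z) \<le> ennreal B" "0 \<le> B"
    and U: "U \<in> H2" and eq: "schroedinger V1 V2 h U - mult_op (\<lambda>_. z) U = weight (- s) G"
  shows "norm (weight (- s) U) \<le> B * norm G"
proof -
  have bl: "bounded_linear (weighted_resolvent V1 V2 s h z)"
    using op(1) by (auto simp: op_norm_def top_unique split: if_splits)
  then have "onorm (weighted_resolvent V1 V2 s h z) \<le> B"
    using op by (simp add: op_norm_def)
  moreover have "weighted_resolvent V1 V2 s h z G = weight (- s) U"
    using resolvent_eqI[OF U z] by (simp add: weighted_resolvent_def eq)
  ultimately show ?thesis
    using onorm[OF bl, of G] by (metis mult_right_mono norm_ge_zero order_trans)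
qed

end


section \<open>Gaussian wave packets\<close>

text \<open>No conjugation: differentiating a complex quadratic phase produces the bilinear square
  of the momentum, not the Hermitian one.\<close>

definition cdot :: "complex^'n::finite \<Rightarrow> complex^'n \<Rightarrow> complex"
  where "cdot x y = (\<Sum>i\<in>UNIV. x $ i * y $ i)"

lemma bounded_bilinear_cdot: "bounded_bilinear cdot"
  unfolding bilinear_conv_bounded_bilinear[symmetric] bilinear_def
  by (auto intro!: linearI simp: cdot_def sum.distrib distrib_left distrib_right scaleR_sum_right)

interpretation cd: bounded_bilinear cdot
  by (rule bounded_bilinear_cdot)

lemma bounded_linear_cvec: "bounded_linear cvec"
  unfolding linear_conv_bounded_linear[symmetric]
  by (rule linearI) (auto simp: cvec_def vec_eq_iff complex_eq_iff)

lemmas cvec_scaleR = linear_scale[OF bounded_linear.linear[OF bounded_linear_cvec]]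
  and cvec_minus = linear_neg[OF bounded_linear.linear[OF bounded_linear_cvec]]
  and cvec_has_vector_derivative = bounded_linear.has_vector_derivative[OF bounded_linear_cvec]
  and cvec_continuous_on = bounded_linear.continuous_on[OF bounded_linear_cvec]

lemma cdot_commute: "cdot x y = cdot y x"
  by (simp add: cdot_def mult.commute)

lemma cdot_matrix_left: "cdot (M *v x) y = cdot x (transpose M *v y)"
proof -
  have "cdot (M *v x) y = (\<Sum>i\<in>UNIV. \<Sum>j\<in>UNIV. M $ i $ j * x $ j * y $ i)"
    by (simp add: cdot_def matrix_vector_mult_def sum_distrib_right)
  also have "\<dots> = (\<Sum>j\<in>UNIV. \<Sum>i\<in>UNIV. M $ i $ j * x $ j * y $ i)" by (rule sum.swap)
  also have "\<dots> = cdot x (transpose M *v y)"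
    by (simp add: cdot_def matrix_vector_mult_def transpose_def sum_distrib_left mult_ac)
  finally show ?thesis .
qed

lemma norm_cdot_le: "norm (cdot x y) \<le> norm x * norm y"
proof -
  have "norm (cdot x y) \<le> (\<Sum>i\<in>UNIV. norm (x $ i) * norm (y $ i))"
    unfolding cdot_def by (rule order_trans[OF norm_sum]) (simp add: norm_mult)
  also have "\<dots> \<le> norm x * norm y"
    unfolding norm_vec_def using L2_set_mult_ineq[of "\<lambda>i. norm (x $ i)" "\<lambda>i. norm (y $ i)" UNIV] by simp
  finally show ?thesis .
qed

lemma quad_conv_cdot: "quad G y = cdot (cvec y) (G *v cvec y)"
  by (simp add: quad_def cdot_def cvec_def matrix_vector_mult_def sum_distrib_left mult_ac)

lemma cdot_cvec: "cdot (cvec x) (cvec y) = of_real (x \<bullet> y)"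
  by (simp add: cdot_def cvec_def inner_vec_def)

lemma cvec_axis: "cvec (axis j 1) = axis j 1"
  by (auto simp: cvec_def axis_def vec_eq_iff)

lemma cdot_axis: "cdot x (axis j 1) = x $ j" "cdot (axis j 1) x = x $ j"
proof -
  show "cdot (axis j 1) x = x $ j" for x
    by (simp add: cdot_def axis_def if_distrib[of "\<lambda>c. c * _"] cong: if_cong)
  then show "cdot x (axis j 1) = x $ j" by (simp add: cdot_commute[of x])
qed

lemma matrix_vector_mult_axis: "((M :: complex^'n::finite^'n) *v axis j 1) $ i = M $ i $ j"
  by (simp add: matrix_vector_mult_def axis_def if_distrib cong: if_cong)

lemma has_vector_derivative_exp:
  assumes "(f has_vector_derivative f') (at t)"
  shows "((\<lambda>t. exp (f t) :: complex) has_vector_derivative f' * exp (f t)) (at t)"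
  using field_vector_diff_chain_at[OF assms DERIV_exp] by (simp add: o_def)

text \<open>\<open>A\<close> stands for the Hessian of \<open>V\<close> along \<open>q\<close>.\<close>

locale wave_packet =
  fixes V :: "real^'n::finite \<Rightarrow> real" and q \<xi> :: "real \<Rightarrow> real^'n" and E :: real
    and A G :: "real \<Rightarrow> complex^'n^'n" and S :: "real \<Rightarrow> real" and a :: "real \<Rightarrow> complex"
  assumes q': "\<And>t. (q has_vector_derivative 2 *\<^sub>R \<xi> t) (at t)"
    and \<xi>': "\<And>t. (\<xi> has_vector_derivative - grad V (q t)) (at t)"
    and energy: "\<And>t. (norm (\<xi> t))\<^sup>2 + V (q t) = E"
    and A_cont: "continuous_on UNIV A" and A_real: "\<And>t. adjoint_mat (A t) = A t" and A_sym: "\<And>t. transpose (A t) = A t"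
    and grad_cont: "continuous_on UNIV (\<lambda>t. grad V (q t))"
    and G': "\<And>t. (G has_vector_derivative - 2 *\<^sub>R (G t ** G t) - A t) (at t)"
    and G_sym: "\<And>t. transpose (G t) = G t"
    and G_pos: "\<And>b. \<exists>m>0. \<forall>t. \<bar>t\<bar> \<le> b \<longrightarrow> (\<forall>y. m * (norm y)\<^sup>2 \<le> Im (quad (G t) y))"
    and S': "\<And>t. (S has_vector_derivative (norm (\<xi> t))\<^sup>2 - V (q t)) (at t)"
    and a': "\<And>t. (a has_vector_derivative - trace (G t) * a t) (at t)"
    and a0: "a 0 = 1"
begin

definition dev :: "real \<Rightarrow> real^'n \<Rightarrow> complex^'n"
  where "dev t x = cvec (x - q t)"

text \<open>The gradient in x of \<open>phase\<close>; it equals \<xi> on the trajectory and is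
  complex away from it.\<close>

definition momentum :: "real \<Rightarrow> real^'n \<Rightarrow> complex^'n"
  where "momentum t x = cvec (\<xi> t) + G t *v dev t x"

definition phase :: "real \<Rightarrow> real^'n \<Rightarrow> complex"
  where "phase t x = of_real (S t) + cdot (cvec (\<xi> t)) (dev t x) + cdot (dev t x) (G t *v dev t x) / 2"

definition packet :: "real \<Rightarrow> real \<Rightarrow> real^'n \<Rightarrow> complex"
  where "packet h t x = a t * exp (\<i> / of_real h * phase t x)"

text \<open>Second-order Taylor polynomial of \<open>V\<close> at q(t), once \<open>A\<close> is the
  Hessian. The packet solves the Schroedinger equation with this quadratic potential
  exactly.\<close>

definition taylor :: "real \<Rightarrow> real^'n \<Rightarrow> complex"
  where "taylor t x = of_real (V (q t) + grad V (q t) \<bullet> (x - q t)) + cdot (dev t x) (A t *v dev t x) / 2"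

lemma cont_q: "continuous_on UNIV q" and cont_\<xi>: "continuous_on UNIV \<xi>" and cont_G: "continuous_on UNIV G"
  and cont_S: "continuous_on UNIV S" and cont_a: "continuous_on UNIV a"
  by (intro continuous_at_imp_continuous_on ballI has_vector_derivative_continuous, rule q' \<xi>' G' S' a')+

lemma cdot_G: "cdot x (G t *v y) = cdot (G t *v x) y"
  using cdot_matrix_left[of "G t" x y] by (simp add: G_sym)

lemma dev_line: "((\<lambda>s. dev t (x + s *\<^sub>R axis j 1)) has_vector_derivative axis j 1) (at s)"
proof -
  have "((\<lambda>s. x + s *\<^sub>R axis j 1 - q t) has_vector_derivative axis j 1) (at s)"
    by (auto intro!: derivative_eq_intros)
  from cvec_has_vector_derivative[OF this] show ?thesis by (simp add: dev_def cvec_axis)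
qed

lemma momentum_line:
  "((\<lambda>s. momentum t (x + s *\<^sub>R axis j 1) $ i) has_vector_derivative G t $ i $ j) (at s)"
proof -
  have "((\<lambda>s. momentum t (x + s *\<^sub>R axis j 1)) has_vector_derivative 0 + G t *v axis j 1) (at s)"
    unfolding momentum_def
    by (intro has_vector_derivative_add has_vector_derivative_const
        bounded_linear.has_vector_derivative[OF mv.bounded_linear_right] dev_line)
  from bounded_linear.has_vector_derivative[OF bounded_linear_vec_nth this, of i]
  show ?thesis by (simp add: matrix_vector_mult_axis)
qed

lemma packet_line:
  "((\<lambda>s. packet h t (x + s *\<^sub>R axis j 1)) has_vector_derivative
     \<i> / of_real h * momentum t (x + s *\<^sub>R axis j 1) $ j * packet h t (x + s *\<^sub>R axis j 1)) (at s)"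
proof -
  let ?x = "x + s *\<^sub>R axis j 1"
  have "((\<lambda>s. phase t (x + s *\<^sub>R axis j 1)) has_vector_derivative
     0 + cdot (cvec (\<xi> t)) (axis j 1)
      + (cdot (dev t ?x) (G t *v axis j 1) + cdot (axis j 1) (G t *v dev t ?x)) / 2) (at s)"
    unfolding phase_def
    by (intro has_vector_derivative_add has_vector_derivative_const has_vector_derivative_divide
        bounded_linear.has_vector_derivative[OF cd.bounded_linear_right] cd.has_vector_derivative
        bounded_linear.has_vector_derivative[OF mv.bounded_linear_right] dev_line)
  moreover have "0 + cdot (cvec (\<xi> t)) (axis j 1)
      + (cdot (dev t ?x) (G t *v axis j 1) + cdot (axis j 1) (G t *v dev t ?x)) / 2 = momentum t ?x $ j"
    by (simp add: cdot_G[of "dev t ?x" t "axis j 1"] cdot_axis momentum_def)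
  ultimately have "((\<lambda>s. phase t (x + s *\<^sub>R axis j 1)) has_vector_derivative momentum t ?x $ j) (at s)" by simp
  from has_vector_derivative_mult_right[OF has_vector_derivative_exp[OF has_vector_derivative_mult_right[OF this]], of "a t" "\<i> / of_real h"]
  show ?thesis by (simp add: packet_def mult_ac)
qed

text \<open>The equations for \<open>S\<close>, \<open>q\<close>, \<open>\<xi>\<close> and
  \<open>G\<close> make the phase solve the Hamilton-Jacobi equation with \<open>taylor\<close> in
  place of \<open>V\<close>, order by order in x - q, and the equation for \<open>a\<close> matches
  the term -i*h*trace G of the Laplacian. Hence i*h times this derivative is (-h^2 Laplacian +
  taylor) applied to the packet.\<close>

lemma packet_time:
  "((\<lambda>t. packet h t x) has_vector_derivative
     (- (\<i> / of_real h) * (cdot (momentum t x) (momentum t x) + taylor t x) - trace (G t)) * packet h t x) (at t)"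
proof -
  have dev': "((\<lambda>t. dev t x) has_vector_derivative - 2 *\<^sub>R cvec (\<xi> t)) (at t)"
  proof -
    have "((\<lambda>t. x - q t) has_vector_derivative 0 - 2 *\<^sub>R \<xi> t) (at t)"
      by (intro has_vector_derivative_diff has_vector_derivative_const q')
    from cvec_has_vector_derivative[OF this] show ?thesis by (simp add: dev_def cvec_minus cvec_scaleR)
  qed
  let ?y = "dev t x" and ?p = "cvec (\<xi> t)"
  have "((\<lambda>t. phase t x) has_vector_derivative
      of_real ((norm (\<xi> t))\<^sup>2 - V (q t)) + (cdot ?p (- 2 *\<^sub>R ?p) + cdot (cvec (- grad V (q t))) ?y)
      + (cdot ?y (G t *v (- 2 *\<^sub>R ?p) + (- 2 *\<^sub>R (G t ** G t) - A t) *v ?y) + cdot (- 2 *\<^sub>R ?p) (G t *v ?y)) / 2) (at t)"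
    unfolding phase_def
    by (intro has_vector_derivative_add has_vector_derivative_divide has_vector_derivative_of_real
        cd.has_vector_derivative mv.has_vector_derivative dev' G' S'[folded has_real_derivative_iff_has_vector_derivative] cvec_has_vector_derivative \<xi>')
  moreover have "of_real ((norm (\<xi> t))\<^sup>2 - V (q t)) + (cdot ?p (- 2 *\<^sub>R ?p) + cdot (cvec (- grad V (q t))) ?y)
      + (cdot ?y (G t *v (- 2 *\<^sub>R ?p) + (- 2 *\<^sub>R (G t ** G t) - A t) *v ?y) + cdot (- 2 *\<^sub>R ?p) (G t *v ?y)) / 2
      = - (cdot (momentum t x) (momentum t x) + taylor t x)"
  proof -
    have 1: "cdot ?y (G t *v ?p) = cdot ?p (G t *v ?y)" by (subst cdot_G) (rule cdot_commute)
    have 2: "cdot ?y ((G t ** G t) *v ?y) = cdot (G t *v ?y) (G t *v ?y)"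
      by (simp add: cdot_G flip: matrix_vector_mul_assoc)
    have 3: "cdot (cvec (grad V (q t))) ?y = of_real (grad V (q t) \<bullet> (x - q t))" by (simp add: dev_def cdot_cvec)
    have 4: "cdot ?p ?p = of_real ((norm (\<xi> t))\<^sup>2)" by (simp add: cdot_cvec power2_norm_eq_inner)
    have 5: "cdot (momentum t x) (momentum t x) = cdot ?p ?p + 2 * cdot ?p (G t *v ?y) + cdot (G t *v ?y) (G t *v ?y)"
      by (simp add: momentum_def cd.add_left cd.add_right cdot_commute[of "G t *v ?y" ?p])
    show ?thesis
      unfolding 5 taylor_def
      by (simp add: cd.add_right cd.diff_right cd.minus_right cd.minus_left cd.scaleR_left cd.scaleR_right
          mv.diff_left mv.add_right mv.minus_right mv.minus_left mv.scaleR_left mv.scaleR_right cvec_minus 1 2 3 4)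
         (simp add: scaleR_conv_of_real field_simps)
  qed
  ultimately have "((\<lambda>t. phase t x) has_vector_derivative - (cdot (momentum t x) (momentum t x) + taylor t x)) (at t)" by simp
  note D = has_vector_derivative_mult[OF a' has_vector_derivative_exp[OF has_vector_derivative_mult_right[OF this, of "\<i> / of_real h"]]]
  show ?thesis unfolding packet_def
    by (rule has_vector_derivative_eq_rhs[OF D]) (simp add: algebra_simps)
qed

text \<open>The energy E cancels the terms of order zero in x - q. What is left is linear and
  quadratic, of size h^(1/2) on the packet, and governs the time derivative of the packet multiplied
  by exp (i*E*t/h).\<close>

lemma energy_defect:
  "of_real E - cdot (momentum t x) (momentum t x) - taylor t x =
    - (2 * cdot (cvec (\<xi> t)) (G t *v dev t x) + cdot (G t *v dev t x) (G t *v dev t x)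
      + of_real (grad V (q t) \<bullet> (x - q t)) + cdot (dev t x) (A t *v dev t x) / 2)"
proof -
  have "cdot (momentum t x) (momentum t x) = of_real ((norm (\<xi> t))\<^sup>2) + 2 * cdot (cvec (\<xi> t)) (G t *v dev t x) + cdot (G t *v dev t x) (G t *v dev t x)"
    by (simp add: momentum_def cd.add_left cd.add_right cdot_commute[of "G t *v dev t x" "cvec (\<xi> t)"] cdot_cvec power2_norm_eq_inner)
  moreover have "complex_of_real E = of_real ((norm (\<xi> t))\<^sup>2) + of_real (V (q t))"
    unfolding energy[of t, symmetric] by simp
  ultimately show ?thesis by (simp add: taylor_def)
qed

lemma norm_packet:
  assumes "h > 0"
  shows "(norm (packet h t x))\<^sup>2 = (norm (a t))\<^sup>2 * exp (- Im (quad (G t) (x - q t)) / h)"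
proof -
  have r: "Re (\<i> / of_real h * phase t x) = (- Im (quad (G t) (x - q t)) / h) / 2"
    by (simp add: phase_def dev_def cdot_cvec quad_conv_cdot Im_divide_of_real)
  have sq: "(exp (r / 2))\<^sup>2 = exp r" for r :: real
    by (simp add: power2_eq_square flip: exp_add)
  show ?thesis unfolding packet_def norm_mult power_mult_distrib norm_exp_eq_Re r sq ..
qed

lemma continuous_on_dev: "continuous_on UNIV (\<lambda>p. dev (fst p) (snd p))"
  unfolding dev_def
  by (intro cvec_continuous_on continuous_intros continuous_on_compose2[OF cont_q]) auto

lemma continuous_on_taylor:
  assumes "continuous_on UNIV V"
  shows "continuous_on UNIV (\<lambda>p. taylor (fst p) (snd p))"
  unfolding taylor_def
  by (intro continuous_intros cd.continuous_on mv.continuous_on continuous_on_dev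
      continuous_on_compose2[OF assms] continuous_on_compose2[OF cont_q]
      continuous_on_compose2[OF grad_cont] continuous_on_compose2[OF A_cont]) auto

lemma continuous_on_packet:
  assumes "h > 0"
  shows "continuous_on UNIV (\<lambda>p. packet h (fst p) (snd p))"
  unfolding packet_def phase_def
  by (intro continuous_intros cd.continuous_on cvec_continuous_on mv.continuous_on continuous_on_dev
      continuous_on_compose2[OF cont_\<xi>] continuous_on_compose2[OF cont_G]
      continuous_on_compose2[OF cont_S] continuous_on_compose2[OF cont_a]) (use assms in auto)

end

section \<open>Taylor estimates along segments\<close>

lemma has_real_derivative_segment:
  fixes f :: "real^'n::finite \<Rightarrow> real"
  assumes "f differentiable (at (x + s *\<^sub>R y))"
  shows "((\<lambda>s. f (x + s *\<^sub>R y)) has_real_derivative (\<Sum>i\<in>UNIV. y $ i * partial i f (x + s *\<^sub>R y))) (at s)"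
proof -
  define D where "D = frechet_derivative f (at (x + s *\<^sub>R y))"
  have D: "(f has_derivative D) (at (x + s *\<^sub>R y))"
    unfolding D_def using assms frechet_derivative_works by blast
  have "((\<lambda>s. x + s *\<^sub>R y) has_derivative (\<lambda>h. h *\<^sub>R y)) (at s)" by (auto intro!: derivative_eq_intros)
  from diff_chain_at[OF this D] have "((\<lambda>s. f (x + s *\<^sub>R y)) has_derivative (\<lambda>h. D (h *\<^sub>R y))) (at s)"
    by (simp add: o_def)
  moreover have lin: "linear D" using D has_derivative_linear by blast
  have "D y = (\<Sum>i\<in>UNIV. y $ i * partial i f (x + s *\<^sub>R y))"
  proof -
    have "D y = D (\<Sum>i\<in>UNIV. y $ i *\<^sub>R axis i 1)"
      using basis_expansion[of y] by (simp add: scalar_mult_eq_scaleR)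
    also have "\<dots> = (\<Sum>i\<in>UNIV. y $ i * D (axis i 1))" by (simp add: linear_sum[OF lin] linear_scale[OF lin])
    finally show ?thesis by (simp add: partial_def D_def)
  qed
  then have "(\<lambda>h. D (h *\<^sub>R y)) = (*) (\<Sum>i\<in>UNIV. y $ i * partial i f (x + s *\<^sub>R y))"
    by (auto simp: linear_scale[OF lin] mult.commute)
  ultimately show ?thesis by (simp add: has_field_derivative_def)
qed

lemma abs_sum_component_le:
  fixes y :: "real^'n::finite"
  assumes "\<And>i. \<bar>f i\<bar> \<le> C" "0 \<le> C"
  shows "\<bar>\<Sum>i\<in>UNIV. y $ i * f i\<bar> \<le> real CARD('n) * C * norm y"
proof -
  have "\<bar>\<Sum>i\<in>UNIV. y $ i * f i\<bar> \<le> (\<Sum>i\<in>(UNIV::'n set). norm y * C)"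
    using assms component_le_norm_cart[of y]
    by (intro order_trans[OF sum_abs] sum_mono) (auto simp: abs_mult intro!: mult_mono)
  then show ?thesis by (simp add: mult_ac)
qed

text \<open>Maclaurin's formula for \<open>V\<close> along the segment from x to x + y. The
  remainder is a triple sum of third derivatives, hence the cube of the dimension; the factor 1/6 is
  given away.\<close>

lemma taylor_remainder_third:
  fixes V :: "real^'n::finite \<Rightarrow> real"
  assumes V: "smooth V" and B: "\<And>i j k x. \<bar>pderivs [k, j, i] V x\<bar> \<le> B"
  shows "\<bar>V (x + y) - (V x + grad V x \<bullet> y + (\<Sum>i\<in>UNIV. \<Sum>j\<in>UNIV. pderivs [j, i] V x * y $ i * y $ j) / 2)\<bar>
    \<le> real CARD('n) ^ 3 * B * norm y ^ 3"
proof -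
  have B0: "B \<ge> 0" using order_trans[OF abs_ge_zero B] .
  have dd: "((\<lambda>s. pderivs js V (x + s *\<^sub>R y)) has_real_derivative
      (\<Sum>i\<in>UNIV. y $ i * pderivs (i # js) V (x + s *\<^sub>R y))) (at s)" for js s
  proof -
    have "pderivs js V differentiable (at (x + s *\<^sub>R y))" using V by (simp add: smooth_def)
    from has_real_derivative_segment[OF this] show ?thesis by simp
  qed
  define f1 where "f1 s = (\<Sum>i\<in>UNIV. y $ i * pderivs [i] V (x + s *\<^sub>R y))" for s
  define f2 where "f2 s = (\<Sum>i\<in>UNIV. y $ i * (\<Sum>j\<in>UNIV. y $ j * pderivs [j, i] V (x + s *\<^sub>R y)))" for s
  define f3 where "f3 s = (\<Sum>i\<in>UNIV. y $ i * (\<Sum>j\<in>UNIV. y $ j * (\<Sum>k\<in>UNIV. y $ k * pderivs [k, j, i] V (x + s *\<^sub>R y))))" for s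
  define D where "D m = (if m = 0 then \<lambda>s. V (x + s *\<^sub>R y) else if m = 1 then f1 else if m = 2 then f2 else f3)" for m :: nat
  have d0: "((\<lambda>s. V (x + s *\<^sub>R y)) has_real_derivative f1 s) (at s)" for s
    using dd[of "[]"] by (simp add: f1_def)
  have d1: "(f1 has_real_derivative f2 s) (at s)" for s
    unfolding f1_def f2_def
    by (intro DERIV_sum DERIV_cmult dd)
  have d2: "(f2 has_real_derivative f3 s) (at s)" for s
    unfolding f2_def f3_def
    by (intro DERIV_sum DERIV_cmult dd)
  have "\<exists>t>0. t < 1 \<and> V (x + 1 *\<^sub>R y) = (\<Sum>m<3. D m 0 / fact m * 1 ^ m) + D 3 t / fact 3 * 1 ^ 3"
  proof (rule Maclaurin)
    show "\<forall>m t. m < 3 \<and> 0 \<le> t \<and> t \<le> 1 \<longrightarrow> (D m has_real_derivative D (Suc m) t) (at t)"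
    proof (intro allI impI)
      fix m :: nat and t :: real assume "m < 3 \<and> 0 \<le> t \<and> t \<le> 1"
      then consider "m = 0" | "m = 1" | "m = 2" by linarith
      then show "(D m has_real_derivative D (Suc m) t) (at t)"
        by cases (auto simp: D_def d0 d1 d2 numeral_2_eq_2)
    qed
  qed (auto simp: D_def)
  then obtain t where t: "V (x + y) = V x + f1 0 + f2 0 / 2 + f3 t / 6"
    by (auto simp: D_def numeral_3_eq_3 fact_numeral)
  have f1: "f1 0 = grad V x \<bullet> y" by (simp add: f1_def grad_def inner_vec_def mult.commute)
  have f2: "f2 0 = (\<Sum>i\<in>UNIV. \<Sum>j\<in>UNIV. pderivs [j, i] V x * y $ i * y $ j)"
    by (simp add: f2_def sum_distrib_left mult_ac)
  have "\<bar>f3 t\<bar> \<le> real CARD('n) * (real CARD('n) * (real CARD('n) * B * norm y) * norm y) * norm y"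
    unfolding f3_def by (intro abs_sum_component_le B mult_nonneg_nonneg B0) auto
  also have "\<dots> = real CARD('n) ^ 3 * B * norm y ^ 3" by (simp add: power3_eq_cube)
  finally show ?thesis by (simp add: t f1 f2)
qed

text \<open>A zero of a nonnegative function is a minimum, so the first derivative vanishes and
  Maclaurin's formula starts at order two. This makes the damping term h * V2 of order h^2 on a
  packet centred at a zero of V2.\<close>

lemma nonneg_zero_quadratic_bound:
  fixes V :: "real^'n::finite \<Rightarrow> real"
  assumes V: "smooth V" and B: "\<And>i j x. \<bar>pderivs [j, i] V x\<bar> \<le> B" and pos: "\<And>x. 0 \<le> V x" and zero: "V x = 0"
  shows "V (x + y) \<le> real CARD('n) ^ 2 * B * norm y ^ 2"
proof -
  have B0: "B \<ge> 0" using order_trans[OF abs_ge_zero B] .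
  have dd: "((\<lambda>s. pderivs js V (x + s *\<^sub>R y)) has_real_derivative
      (\<Sum>i\<in>UNIV. y $ i * pderivs (i # js) V (x + s *\<^sub>R y))) (at s)" for js s
  proof -
    have "pderivs js V differentiable (at (x + s *\<^sub>R y))" using V by (simp add: smooth_def)
    from has_real_derivative_segment[OF this] show ?thesis by simp
  qed
  define f1 where "f1 s = (\<Sum>i\<in>UNIV. y $ i * pderivs [i] V (x + s *\<^sub>R y))" for s
  define f2 where "f2 s = (\<Sum>i\<in>UNIV. y $ i * (\<Sum>j\<in>UNIV. y $ j * pderivs [j, i] V (x + s *\<^sub>R y)))" for s
  define D where "D m = (if m = 0 then \<lambda>s. V (x + s *\<^sub>R y) else if m = 1 then f1 else f2)" for m :: nat
  have d0: "((\<lambda>s. V (x + s *\<^sub>R y)) has_real_derivative f1 s) (at s)" for s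
    using dd[of "[]"] by (simp add: f1_def)
  have d1: "(f1 has_real_derivative f2 s) (at s)" for s
    unfolding f1_def f2_def
    by (intro DERIV_sum DERIV_cmult dd)
  have "f1 0 = 0"
    by (rule DERIV_local_min[OF d0[of 0], of 1]) (auto simp: zero pos)
  have "\<exists>t>0. t < 1 \<and> V (x + 1 *\<^sub>R y) = (\<Sum>m<2. D m 0 / fact m * 1 ^ m) + D 2 t / fact 2 * 1 ^ 2"
  proof (rule Maclaurin)
    show "\<forall>m t. m < 2 \<and> 0 \<le> t \<and> t \<le> 1 \<longrightarrow> (D m has_real_derivative D (Suc m) t) (at t)"
    proof (intro allI impI)
      fix m :: nat and t :: real assume "m < 2 \<and> 0 \<le> t \<and> t \<le> 1"
      then consider "m = 0" | "m = 1" by linarith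
      then show "(D m has_real_derivative D (Suc m) t) (at t)"
        by cases (auto simp: D_def d0 d1)
    qed
  qed (auto simp: D_def)
  then obtain t where t: "V (x + y) = f2 t / 2"
    using \<open>f1 0 = 0\<close> zero by (auto simp: D_def numeral_2_eq_2)
  have "\<bar>f2 t\<bar> \<le> real CARD('n) * (real CARD('n) * B * norm y) * norm y"
    unfolding f2_def by (intro abs_sum_component_le B mult_nonneg_nonneg B0) auto
  also have "\<dots> = real CARD('n) ^ 2 * B * norm y ^ 2" by (simp add: power2_eq_square)
  finally show ?thesis unfolding t by linarith
qed


section \<open>Gaussian integrals and conservation of mass\<close>

lemma nn_integral_exp_minus_abs_finite: "(\<integral>\<^sup>+x. ennreal (exp (- \<bar>x\<bar>)) \<partial>lborel) < \<infinity>"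
proof -
  let ?f = "\<lambda>x::real. ennreal (exp (- x)) * indicator {0..} x"
  have half: "(\<integral>\<^sup>+x. ?f x \<partial>lborel) = ennreal (0 - (- exp (- 0)))"
  proof (rule nn_integral_FTC_atLeast)
    show "((\<lambda>x::real. - exp (- x)) \<longlongrightarrow> 0) at_top"
      using tendsto_minus[OF filterlim_compose[OF exp_at_bot filterlim_uminus_at_bot_at_top]] by simp
  qed (auto intro!: derivative_eq_intros)
  have "(\<integral>\<^sup>+x. ?f x \<partial>lborel) = ennreal \<bar>-1\<bar> * (\<integral>\<^sup>+x. ?f (0 + (- 1) * x) \<partial>lborel)"
    by (rule nn_integral_real_affine) auto
  then have refl: "(\<integral>\<^sup>+x. ?f (- x) \<partial>lborel) = (\<integral>\<^sup>+x. ?f x \<partial>lborel)" by simp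
  have "(\<integral>\<^sup>+x. ennreal (exp (- \<bar>x\<bar>)) \<partial>lborel) \<le> (\<integral>\<^sup>+x. ?f x + ?f (- x) \<partial>lborel)"
    by (intro nn_integral_mono) (auto simp: indicator_def)
  also have "\<dots> = (\<integral>\<^sup>+x. ?f x \<partial>lborel) + (\<integral>\<^sup>+x. ?f (- x) \<partial>lborel)"
    by (rule nn_integral_add) auto
  also have "\<dots> < \<infinity>" unfolding refl half by simp
  finally show ?thesis .
qed

text \<open>In each coordinate exp (-\<beta> * r^2) is at most a constant times exp (-|r|), by
  completing a square, and the integral of the product of these one-dimensional bounds
  factorises.\<close>

lemma integrable_gaussian:
  assumes "\<beta> > 0"
  shows "integrable lborel (\<lambda>x::'a::euclidean_space. exp (- \<beta> * (norm x)\<^sup>2))"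
proof (rule integrableI_nonneg)
  have one: "exp (- \<beta> * r\<^sup>2) \<le> exp (1 / (4 * \<beta>)) * exp (- \<bar>r\<bar>)" for r :: real
  proof -
    have "0 \<le> (2 * \<beta> * \<bar>r\<bar> - 1)\<^sup>2 / (4 * \<beta>)" using assms by simp
    also have "(2 * \<beta> * \<bar>r\<bar> - 1)\<^sup>2 / (4 * \<beta>) = \<beta> * r\<^sup>2 - \<bar>r\<bar> + 1 / (4 * \<beta>)"
      using assms by (simp add: power2_diff power_mult_distrib field_simps) (simp add: power2_eq_square)
    finally show ?thesis by (simp flip: exp_add)
  qed
  have le: "exp (- \<beta> * (norm x)\<^sup>2) \<le> (\<Prod>b\<in>Basis. exp (1 / (4 * \<beta>)) * exp (- \<bar>x \<bullet> b\<bar>))" for x :: 'a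
  proof -
    have "(norm x)\<^sup>2 = x \<bullet> x" by (rule power2_norm_eq_inner)
    also have "\<dots> = (\<Sum>b\<in>Basis. (x \<bullet> b)\<^sup>2)" by (subst euclidean_inner) (simp add: power2_eq_square)
    finally have "(norm x)\<^sup>2 = (\<Sum>b\<in>Basis. (x \<bullet> b)\<^sup>2)" .
    then have "exp (- \<beta> * (norm x)\<^sup>2) = (\<Prod>b\<in>Basis. exp (- \<beta> * (x \<bullet> b)\<^sup>2))"
      by (simp add: exp_sum sum_distrib_left flip: sum_negf)
    also have "\<dots> \<le> (\<Prod>b\<in>Basis. exp (1 / (4 * \<beta>)) * exp (- \<bar>x \<bullet> b\<bar>))"
      by (intro prod_mono conjI one) auto
    finally show ?thesis .
  qed
  have "(\<integral>\<^sup>+x. ennreal (exp (- \<beta> * (norm x)\<^sup>2)) \<partial>(lborel :: 'a measure))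
      \<le> (\<integral>\<^sup>+x. (\<Prod>b\<in>Basis. ennreal (exp (1 / (4 * \<beta>)) * exp (- \<bar>x \<bullet> b\<bar>))) \<partial>(lborel :: 'a measure))"
    using le by (intro nn_integral_mono) (simp add: prod_ennreal ennreal_leI)
  also have "\<dots> = (\<integral>\<^sup>+x. ennreal (\<Prod>b\<in>Basis. exp (1 / (4 * \<beta>)) * exp (- \<bar>x \<bullet> b\<bar>)) \<partial>(lborel :: 'a measure))"
    by (simp add: prod_ennreal)
  also have "\<dots> = (\<Prod>b\<in>(Basis::'a set). \<integral>\<^sup>+r. ennreal (exp (1 / (4 * \<beta>)) * exp (- \<bar>r\<bar>)) \<partial>lborel)"
    by (subst nn_integral_lborel_prod[symmetric]) (auto simp: prod_ennreal)
  also have "\<dots> < \<infinity>"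
  proof -
    have "(\<integral>\<^sup>+r. ennreal (exp (1 / (4 * \<beta>)) * exp (- \<bar>r\<bar>)) \<partial>lborel)
      = ennreal (exp (1 / (4 * \<beta>))) * (\<integral>\<^sup>+r. ennreal (exp (- \<bar>r\<bar>)) \<partial>lborel)"
      by (simp add: ennreal_mult nn_integral_cmult)
    also have "\<dots> < \<infinity>" using nn_integral_exp_minus_abs_finite by (simp add: ennreal_mult_less_top)
    finally show ?thesis by (simp add: power_less_top_ennreal)
  qed
  finally show "(\<integral>\<^sup>+x. ennreal (exp (- \<beta> * (norm x)\<^sup>2)) \<partial>(lborel :: 'a measure)) < \<infinity>" .
qed auto

text \<open>From 1 + r <= exp r and completing the square in k*r - \<beta>*r^2/2: half of the
  Gaussian exponent pays for the polynomial.\<close>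

lemma polynomial_gaussian_le:
  assumes "\<beta> > 0" "0 \<le> r"
  shows "(1 + r) ^ k * exp (- \<beta> * r\<^sup>2) \<le> exp ((real k)\<^sup>2 / (2 * \<beta>)) * exp (- (\<beta> / 2) * r\<^sup>2)"
proof -
  have "(1 + r) ^ k \<le> exp r ^ k" using assms(2) exp_ge_add_one_self[of r] by (intro power_mono) auto
  also have "\<dots> = exp (real k * r)" by (simp add: exp_of_nat_mult)
  finally have "(1 + r) ^ k * exp (- \<beta> * r\<^sup>2) \<le> exp (real k * r) * exp (- \<beta> * r\<^sup>2)" by (intro mult_right_mono) auto
  also have "\<dots> \<le> exp ((real k)\<^sup>2 / (2 * \<beta>)) * exp (- (\<beta> / 2) * r\<^sup>2)"
  proof -
    have "0 \<le> (real k - \<beta> * r)\<^sup>2 / (2 * \<beta>)" using assms(1) by simp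
    also have "\<dots> = (real k)\<^sup>2 / (2 * \<beta>) - real k * r + \<beta> / 2 * r\<^sup>2"
      using assms(1) by (simp add: power2_diff power_mult_distrib field_simps) (simp add: power2_eq_square)
    finally show ?thesis by (simp flip: exp_add)
  qed
  finally show ?thesis .
qed

lemma integrable_polynomial_gaussian:
  assumes "\<beta> > 0"
  shows "integrable lborel (\<lambda>x::'a::euclidean_space. (1 + norm x) ^ k * exp (- \<beta> * (norm x)\<^sup>2))"
proof (rule Bochner_Integration.integrable_bound)
  show "integrable lborel (\<lambda>x::'a. exp ((real k)\<^sup>2 / (2 * \<beta>)) * exp (- (\<beta> / 2) * (norm x)\<^sup>2))"
    using assms by (intro integrable_mult_right integrable_gaussian) simp
  show "AE x::'a in lborel. norm ((1 + norm x) ^ k * exp (- \<beta> * (norm x)\<^sup>2))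
     \<le> norm (exp ((real k)\<^sup>2 / (2 * \<beta>)) * exp (- (\<beta> / 2) * (norm x)\<^sup>2))"
    using polynomial_gaussian_le[OF assms norm_ge_zero, of _ k] by (intro AE_I2) (simp add: abs_mult)
qed auto

lemma integrable_of_gaussian_bound:
  fixes f :: "'a::euclidean_space \<Rightarrow> 'b::{banach, second_countable_topology}"
  assumes "f \<in> borel_measurable borel" "\<And>x. norm (f x) \<le> B * ((1 + norm x) ^ k * exp (- \<beta> * (norm x)\<^sup>2))" "\<beta> > 0"
  shows "integrable lborel f"
proof (rule Bochner_Integration.integrable_bound)
  show "integrable lborel (\<lambda>x::'a. B * ((1 + norm x) ^ k * exp (- \<beta> * (norm x)\<^sup>2)))"
    by (intro integrable_mult_right integrable_polynomial_gaussian assms)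
  show "AE x in lborel. norm (f x) \<le> norm (B * ((1 + norm x) ^ k * exp (- \<beta> * (norm x)\<^sup>2)))"
    using order_trans[OF assms(2) abs_ge_self] by (intro AE_I2) simp
qed (use assms in simp)

text \<open>Joint continuity supplies the measurability for Fubini; one constant and one exponent
  for all t in [0, T] supply the domination.\<close>

definition gaussian_family :: "real \<Rightarrow> (real \<Rightarrow> real^'n::finite \<Rightarrow> complex) \<Rightarrow> bool"
  where "gaussian_family T f \<longleftrightarrow> continuous_on UNIV (\<lambda>p. f (fst p) (snd p)) \<and>
    (\<exists>B \<beta>. 0 \<le> B \<and> 0 < \<beta> \<and> (\<forall>t\<in>{0..T}. \<forall>x. norm (f t x) \<le> B * exp (- \<beta> * (norm x)\<^sup>2)))"

text \<open>The multipliers of Gaussian families: weights, potentials, momenta and functions of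
  time. Multiplication by them costs half of the Gaussian exponent.\<close>

definition poly_family :: "real \<Rightarrow> (real \<Rightarrow> real^'n::finite \<Rightarrow> complex) \<Rightarrow> bool"
  where "poly_family T f \<longleftrightarrow> continuous_on UNIV (\<lambda>p. f (fst p) (snd p)) \<and>
    (\<exists>B k. 0 \<le> B \<and> (\<forall>t\<in>{0..T}. \<forall>x. norm (f t x) \<le> B * (1 + norm x) ^ k))"

lemma poly_family_time:
  assumes "continuous_on UNIV f"
  shows "poly_family T (\<lambda>t _. f t)"
proof -
  obtain M where "M > 0" "\<And>t. \<bar>t\<bar> \<le> T \<Longrightarrow> norm (f t) \<le> M" using continuous_bounded_on_interval[OF assms] by blast
  moreover have "continuous_on UNIV (\<lambda>p. f (fst p))"
    by (rule continuous_on_compose2[OF assms]) (auto intro: continuous_intros)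
  ultimately show ?thesis unfolding poly_family_def by (intro conjI exI[of _ M] exI[of _ 0]) auto
qed

lemma poly_family_const: "poly_family T (\<lambda>_ _. c)"
  by (rule poly_family_time) simp

lemma poly_family_bounded:
  assumes "continuous_on UNIV f" "\<And>x. norm (f x) \<le> B"
  shows "poly_family T (\<lambda>_. f)"
proof -
  have "continuous_on UNIV (\<lambda>p. f (snd p))"
    by (rule continuous_on_compose2[OF assms(1)]) (auto intro: continuous_intros)
  moreover have "0 \<le> B" using order_trans[OF norm_ge_zero assms(2)] .
  ultimately show ?thesis unfolding poly_family_def using assms(2) by (intro conjI exI[of _ B] exI[of _ 0]) auto
qed

lemma poly_family_component: "poly_family T (\<lambda>_ x. of_real (x $ i))"
  unfolding poly_family_def
proof (intro conjI exI[of _ 1] ballI allI)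
  show "continuous_on UNIV (\<lambda>p. complex_of_real (snd p $ i))" by (intro continuous_intros)
  show "norm (complex_of_real (x $ i)) \<le> 1 * (1 + norm x) ^ 1" for x using component_le_norm_cart[of x i] by simp
qed simp

lemma poly_family_mult:
  assumes "poly_family T f" "poly_family T g"
  shows "poly_family T (\<lambda>t x. f t x * g t x)"
proof -
  obtain B k where f: "0 \<le> B" "\<And>t x. t \<in> {0..T} \<Longrightarrow> norm (f t x) \<le> B * (1 + norm x) ^ k"
    using assms(1) unfolding poly_family_def by blast
  obtain C l where g: "0 \<le> C" "\<And>t x. t \<in> {0..T} \<Longrightarrow> norm (g t x) \<le> C * (1 + norm x) ^ l"
    using assms(2) unfolding poly_family_def by blast
  have "norm (f t x * g t x) \<le> (B * C) * (1 + norm x) ^ (k + l)" if "t \<in> {0..T}" for t x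
    using mult_mono[OF f(2)[OF that] g(2)[OF that], of x x] f(1) by (simp add: norm_mult power_add mult_ac)
  then show ?thesis using assms f(1) g(1) unfolding poly_family_def
    by (intro conjI exI[of _ "B * C"] exI[of _ "k + l"]) (auto intro: continuous_on_mult)
qed

lemma poly_family_add:
  assumes "poly_family T f" "poly_family T g"
  shows "poly_family T (\<lambda>t x. f t x + g t x)"
proof -
  obtain B k where f: "0 \<le> B" "\<And>t x. t \<in> {0..T} \<Longrightarrow> norm (f t x) \<le> B * (1 + norm x) ^ k"
    using assms(1) unfolding poly_family_def by blast
  obtain C l where g: "0 \<le> C" "\<And>t x. t \<in> {0..T} \<Longrightarrow> norm (g t x) \<le> C * (1 + norm x) ^ l"
    using assms(2) unfolding poly_family_def by blast
  have "norm (f t x + g t x) \<le> (B + C) * (1 + norm x) ^ (k + l)" if "t \<in> {0..T}" for t x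
  proof -
    have "norm (f t x + g t x) \<le> B * (1 + norm x) ^ k + C * (1 + norm x) ^ l"
      by (intro norm_triangle_mono f g that)
    also have "\<dots> \<le> B * (1 + norm x) ^ (k + l) + C * (1 + norm x) ^ (k + l)"
      using f(1) g(1) by (intro add_mono mult_left_mono power_increasing) auto
    finally show ?thesis by (simp add: distrib_right)
  qed
  then show ?thesis using assms f(1) g(1) unfolding poly_family_def
    by (intro conjI exI[of _ "B + C"] exI[of _ "k + l"]) (auto intro: continuous_on_add)
qed

lemma poly_family_sum:
  "(\<And>i. i \<in> I \<Longrightarrow> poly_family T (f i)) \<Longrightarrow> poly_family T (\<lambda>t x. \<Sum>i\<in>I. f i t x)"
  by (induction I rule: infinite_finite_induct) (auto intro: poly_family_const poly_family_add)

lemma gaussian_family_mult: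
  assumes "poly_family T f" "gaussian_family T g"
  shows "gaussian_family T (\<lambda>t x. f t x * g t x)"
proof -
  obtain B k where f: "0 \<le> B" "\<And>t x. t \<in> {0..T} \<Longrightarrow> norm (f t x) \<le> B * (1 + norm x) ^ k"
    using assms(1) unfolding poly_family_def by blast
  obtain C \<beta> where g: "0 \<le> C" "0 < \<beta>" "\<And>t x. t \<in> {0..T} \<Longrightarrow> norm (g t x) \<le> C * exp (- \<beta> * (norm x)\<^sup>2)"
    using assms(2) unfolding gaussian_family_def by blast
  have "norm (f t x * g t x) \<le> (B * C * exp ((real k)\<^sup>2 / (2 * \<beta>))) * exp (- (\<beta> / 2) * (norm x)\<^sup>2)" if "t \<in> {0..T}" for t x
  proof -
    have "norm (f t x * g t x) \<le> (B * (1 + norm x) ^ k) * (C * exp (- \<beta> * (norm x)\<^sup>2))"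
      unfolding norm_mult using f(1) by (intro mult_mono f g that) auto
    also have "\<dots> = B * C * ((1 + norm x) ^ k * exp (- \<beta> * (norm x)\<^sup>2))" by simp
    also have "\<dots> \<le> B * C * (exp ((real k)\<^sup>2 / (2 * \<beta>)) * exp (- (\<beta> / 2) * (norm x)\<^sup>2))"
      using f(1) g(1) by (intro mult_left_mono polynomial_gaussian_le g(2)) auto
    finally show ?thesis by (simp add: mult.assoc)
  qed
  then show ?thesis using assms f(1) g(1,2) unfolding gaussian_family_def poly_family_def
    by (intro conjI exI[of _ "B * C * exp ((real k)\<^sup>2 / (2 * \<beta>))"] exI[of _ "\<beta> / 2"]) (auto intro: continuous_on_mult)
qed

lemma gaussian_family_bound:
  assumes "gaussian_family T f"
  obtains B \<beta> where "0 \<le> B" "0 < \<beta>" "\<And>t x. t \<in> {0..T} \<Longrightarrow> norm (f t x) \<le> B * exp (- \<beta> * (norm x)\<^sup>2)"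
  using assms unfolding gaussian_family_def by blast

lemma gaussian_family_measurable:
  assumes "gaussian_family T f"
  shows "(\<lambda>p. f (fst p) (snd p)) \<in> borel_measurable (borel \<Otimes>\<^sub>M borel)" "f t \<in> borel_measurable borel"
    "continuous_on A (\<lambda>t. f t x)"
proof -
  have c: "continuous_on UNIV (\<lambda>p. f (fst p) (snd p))" using assms by (simp add: gaussian_family_def)
  show "(\<lambda>p. f (fst p) (snd p)) \<in> borel_measurable (borel \<Otimes>\<^sub>M borel)"
    using borel_measurable_continuous_onI[OF c] by (simp add: borel_prod)
  have "continuous_on UNIV (\<lambda>x. f (fst (t, x)) (snd (t, x)))"
    by (rule continuous_on_compose2[OF c]) (auto intro!: continuous_intros)
  then show "f t \<in> borel_measurable borel" by (auto intro: borel_measurable_continuous_onI)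
  have "continuous_on A (\<lambda>t. f (fst (t, x)) (snd (t, x)))"
    by (rule continuous_on_compose2[OF c]) (auto intro!: continuous_intros)
  then show "continuous_on A (\<lambda>t. f t x)" by simp
qed

lemma jbracket_powr_le:
  assumes "r \<le> real k"
  shows "jbracket x powr r \<le> (1 + norm x) ^ k" "0 < jbracket x" "1 \<le> jbracket x"
proof -
  have ge: "1 \<le> jbracket x" by (simp add: jbracket_def)
  then show "1 \<le> jbracket x" "0 < jbracket x" by simp_all
  have "jbracket x \<le> 1 + norm x"
    unfolding jbracket_def by (rule real_le_lsqrt) (auto simp: power2_sum)
  then have "jbracket x ^ k \<le> (1 + norm x) ^ k" using ge by (intro power_mono) auto
  moreover have "jbracket x powr r \<le> jbracket x powr real k" using ge assms by (intro powr_mono) auto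
  ultimately show "jbracket x powr r \<le> (1 + norm x) ^ k" using ge by (simp add: powr_realpow)
qed

lemma continuous_on_jbracket_powr: "continuous_on A (\<lambda>x. jbracket x powr r)"
proof -
  have "jbracket x \<noteq> 0" for x using jbracket_powr_le(2)[of 0 0 x] by simp
  then show ?thesis unfolding jbracket_def by (intro continuous_intros) auto
qed

lemma poly_family_jbracket: "poly_family T (\<lambda>_ x. of_real (jbracket x powr r))"
  unfolding poly_family_def
proof (intro conjI exI[of _ "1::real"] exI[of _ "nat \<lceil>r\<rceil>"] ballI allI)
  show "continuous_on UNIV (\<lambda>p. complex_of_real (jbracket (snd p) powr r))"
    by (intro continuous_intros continuous_on_compose2[OF continuous_on_jbracket_powr[of UNIV]]) auto
  show "norm (complex_of_real (jbracket x powr r)) \<le> 1 * (1 + norm x) ^ (nat \<lceil>r\<rceil>)" for x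
    using jbracket_powr_le(1)[of r "nat \<lceil>r\<rceil>" x] by (simp add: real_nat_ceiling_ge)
qed simp

lemma sq_integrable_of_gaussian_bound:
  fixes f :: "real^'n::finite \<Rightarrow> complex"
  assumes f: "f \<in> borel_measurable borel" "\<And>x. norm (f x) \<le> B * exp (- \<beta> * (norm x)\<^sup>2)" and \<beta>: "\<beta> > 0"
  shows "sq_integrable f"
  unfolding sq_integrable_def
proof
  show "integrable lborel (\<lambda>x. (norm (f x))\<^sup>2)"
  proof (rule integrable_of_gaussian_bound[of _ "B\<^sup>2" 0 "2 * \<beta>"])
    show "norm ((norm (f x))\<^sup>2) \<le> B\<^sup>2 * ((1 + norm x) ^ 0 * exp (- (2 * \<beta>) * (norm x)\<^sup>2))" for x
    proof -
      have "(norm (f x))\<^sup>2 \<le> (B * exp (- \<beta> * (norm x)\<^sup>2))\<^sup>2" by (intro power_mono f) auto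
      also have "\<dots> = B\<^sup>2 * exp (- (2 * \<beta>) * (norm x)\<^sup>2)"
        by (simp add: power_mult_distrib power2_eq_square flip: exp_add)
      finally show ?thesis by simp
    qed
  qed (use f \<beta> in auto)
qed (rule f)

section \<open>Moments of the packet and conservation of its mass\<close>

lemma lborel_integral_scale:
  fixes f :: "'a::euclidean_space \<Rightarrow> real"
  assumes c: "c > 0" and f: "f \<in> borel_measurable borel"
  shows "integral\<^sup>L lborel f = c ^ DIM('a) * (\<integral>y. f (c *\<^sub>R y) \<partial>lborel)"
    and "integrable lborel (\<lambda>y. f (c *\<^sub>R y)) \<Longrightarrow> integrable lborel f"
proof -
  define D where "D = distr lborel borel (\<lambda>x::'a. c *\<^sub>R x)"
  have eq: "lborel = density D (\<lambda>_. ennreal (c ^ DIM('a)))"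
    using lborel_affine[of c "0::'a"] c by (simp add: D_def)
  have fD: "f \<in> borel_measurable D" using f by (simp add: D_def)
  have "integral\<^sup>L lborel f = (\<integral>x. c ^ DIM('a) *\<^sub>R f x \<partial>D)"
    by (subst eq, subst integral_density) (use c fD in auto)
  also have "\<dots> = (\<integral>x. c ^ DIM('a) *\<^sub>R f (c *\<^sub>R x) \<partial>lborel)"
    unfolding D_def using f by (subst integral_distr) auto
  finally show "integral\<^sup>L lborel f = c ^ DIM('a) * (\<integral>y. f (c *\<^sub>R y) \<partial>lborel)" by simp
  assume i: "integrable lborel (\<lambda>y. f (c *\<^sub>R y))"
  have "integrable D f" unfolding D_def using i f by (subst integrable_distr_eq) auto
  then have "integrable (density D (\<lambda>_. ennreal (c ^ DIM('a)))) f"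
    by (subst integrable_density) (use c fD in auto)
  then show "integrable lborel f" by (subst eq)
qed

lemma quad_scaleR: "quad M (c *\<^sub>R y) = of_real (c\<^sup>2) * quad M y"
  by (simp add: quad_def sum_distrib_left power2_eq_square mult_ac)

context wave_packet
begin

text \<open>The squared modulus of the packet after recentring at q(t) and dilating by sqrt h; this
  makes it independent of h.\<close>

definition profile :: "real \<Rightarrow> real^'n \<Rightarrow> real"
  where "profile t y = (norm (a t))\<^sup>2 * exp (- Im (quad (G t) y))"

lemma continuous_on_quad: "continuous_on UNIV (\<lambda>p. quad (G (fst p)) (snd p))"
  unfolding quad_def
  by (intro continuous_intros continuous_on_compose2[OF cont_G]) auto

lemma continuous_on_profile: "continuous_on UNIV (\<lambda>p. profile (fst p) (snd p))"
  unfolding profile_def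
  by (intro continuous_intros continuous_on_quad continuous_on_compose2[OF cont_a]) auto

lemma profile_measurable: "profile t \<in> borel_measurable borel"
proof -
  have "continuous_on UNIV (\<lambda>x. profile (fst (t, x)) (snd (t, x)))"
    by (rule continuous_on_compose2[OF continuous_on_profile]) (auto intro!: continuous_intros)
  then show ?thesis by (auto intro: borel_measurable_continuous_onI)
qed

lemma profile_bound:
  obtains M m where "0 < M" "0 < m" "\<And>t y. \<bar>t\<bar> \<le> T \<Longrightarrow> profile t y \<le> M * exp (- m * (norm y)\<^sup>2)"
proof -
  obtain m where m: "m > 0" "\<And>t y. \<bar>t\<bar> \<le> T \<Longrightarrow> m * (norm y)\<^sup>2 \<le> Im (quad (G t) y)" using G_pos by blast
  obtain M where M: "M > 0" "\<And>t. \<bar>t\<bar> \<le> T \<Longrightarrow> norm (a t) \<le> M" using continuous_bounded_on_interval[OF cont_a] by blast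
  have "profile t y \<le> M\<^sup>2 * exp (- m * (norm y)\<^sup>2)" if "\<bar>t\<bar> \<le> T" for t y
    unfolding profile_def using m(2)[OF that, of y] M(2)[OF that] by (intro mult_mono power_mono) auto
  then show thesis using that[of "M\<^sup>2" m] M(1) m(1) by auto
qed

lemma profile_nonneg: "0 \<le> profile t y"
  by (simp add: profile_def)

lemma moment_integrable: "integrable lborel (\<lambda>y. norm y ^ p * profile t y)"
proof -
  obtain M m where M: "0 < M" "0 < m" "\<And>y. profile t y \<le> M * exp (- m * (norm y)\<^sup>2)"
    using profile_bound[of "\<bar>t\<bar>"] by (metis order_refl)
  show ?thesis
  proof (rule integrable_of_gaussian_bound[of _ M p m])
    show "norm (norm y ^ p * profile t y) \<le> M * ((1 + norm y) ^ p * exp (- m * (norm y)\<^sup>2))" for y :: "real^'n"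
    proof -
      have "norm y ^ p * profile t y \<le> (1 + norm y) ^ p * (M * exp (- m * (norm y)\<^sup>2))"
        using profile_nonneg by (intro mult_mono power_mono M) auto
      then show ?thesis using profile_nonneg by (simp add: abs_mult mult_ac)
    qed
  qed (use M profile_measurable in auto)
qed

definition moment :: "nat \<Rightarrow> real \<Rightarrow> real"
  where "moment p t = (\<integral>y. norm y ^ p * profile t y \<partial>lborel)"

lemma moment_bounded: "\<exists>C>0. \<forall>t. \<bar>t\<bar> \<le> T \<longrightarrow> moment p t \<le> C"
proof -
  obtain M m where M: "0 < M" "0 < m" "\<And>t y. \<bar>t\<bar> \<le> T \<Longrightarrow> profile t y \<le> M * exp (- m * (norm y)\<^sup>2)"
    using profile_bound[of T] by metis
  define C where "C = (\<integral>y. M * ((1 + norm y) ^ p * exp (- m * (norm y)\<^sup>2)) \<partial>(lborel :: (real^'n) measure))"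
  have "moment p t \<le> C" if "\<bar>t\<bar> \<le> T" for t
    unfolding moment_def C_def
  proof (rule integral_mono[OF moment_integrable])
    show "integrable lborel (\<lambda>y::real^'n. M * ((1 + norm y) ^ p * exp (- m * (norm y)\<^sup>2)))"
      using M by (intro integrable_mult_right integrable_polynomial_gaussian)
    show "norm y ^ p * profile t y \<le> M * ((1 + norm y) ^ p * exp (- m * (norm y)\<^sup>2))" for y
      using mult_mono[OF power_mono[of "norm y" "1 + norm y" p] M(3)[OF that, of y]] profile_nonneg by (simp add: mult_ac)
  qed
  then show ?thesis by (intro exI[of _ "max C 1"]) (auto simp: le_max_iff_disj)
qed

text \<open>Substitution x = q(t) + sqrt h * y: the Jacobian gives the factor
  \<open>sqrt h ^ CARD('n)\<close>, common to all moments, and every power of the distance to the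
  centre gives one factor sqrt h.\<close>

lemma packet_moment:
  assumes h: "h > 0"
  shows "integrable lborel (\<lambda>x. norm (x - q t) ^ p * (norm (packet h t x))\<^sup>2)"
    and "(\<integral>x. norm (x - q t) ^ p * (norm (packet h t x))\<^sup>2 \<partial>lborel) = sqrt h ^ CARD('n) * (sqrt h ^ p * moment p t)"
proof -
  define f where "f y = norm y ^ p * ((norm (a t))\<^sup>2 * exp (- Im (quad (G t) y) / h))" for y :: "real^'n"
  have fx: "norm (x - q t) ^ p * (norm (packet h t x))\<^sup>2 = f (x + (- q t))" for x
    by (simp add: norm_packet[OF h] f_def)
  have fs: "f (sqrt h *\<^sub>R y) = sqrt h ^ p * (norm y ^ p * profile t y)" for y
    using h by (simp add: f_def profile_def quad_scaleR power_mult_distrib)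
  have "continuous_on UNIV (\<lambda>y. quad (G (fst (t, y))) (snd (t, y)))"
    by (rule continuous_on_compose2[OF continuous_on_quad]) (auto intro!: continuous_intros)
  then have mf: "f \<in> borel_measurable borel"
    unfolding f_def using h by (intro borel_measurable_continuous_onI continuous_intros) auto
  have fi: "integrable lborel f"
  proof -
    have "integrable lborel (\<lambda>y. f (sqrt h *\<^sub>R y))" unfolding fs by (intro integrable_mult_right moment_integrable)
    then show ?thesis using lborel_integral_scale(2)[OF _ mf, of "sqrt h"] h by simp
  qed
  show "integrable lborel (\<lambda>x. norm (x - q t) ^ p * (norm (packet h t x))\<^sup>2)"
    unfolding fx integral_shift_lborel(2)[OF mf] by (rule fi)
  show "(\<integral>x. norm (x - q t) ^ p * (norm (packet h t x))\<^sup>2 \<partial>lborel) = sqrt h ^ CARD('n) * (sqrt h ^ p * moment p t)"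
    unfolding fx integral_shift_lborel(1)[OF mf]
    using lborel_integral_scale(1)[OF _ mf, of "sqrt h"] h by (simp add: fs moment_def)
qed

text \<open>The integrand is -2 times the divergence of the field Re (G y) * profile, since the i-th
  derivative of the profile is -2 * Im (G y)_i * profile; divergences of decaying fields integrate
  to 0.\<close>

lemma profile_flux: "(\<integral>y. (- 2 * Re (trace (G t)) + 4 * (\<Sum>i\<in>UNIV. Re ((G t *v cvec y) $ i) * Im ((G t *v cvec y) $ i))) * profile t y \<partial>lborel) = 0"
proof -
  define r where "r i y = Re ((G t *v cvec y) $ i)" for i y
  define m where "m i y = Im ((G t *v cvec y) $ i)" for i y
  define g' where "g' i y = (Re (G t $ i $ i) - 2 * r i y * m i y) * profile t y" for i y
  have rl: "((\<lambda>s. r i (y + s *\<^sub>R axis i 1)) has_vector_derivative Re (G t $ i $ i)) (at s)" for i y s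
  proof -
    have "((\<lambda>s. y + s *\<^sub>R axis i 1) has_vector_derivative axis i 1) (at s)" by (auto intro!: derivative_eq_intros)
    note D = bounded_linear.has_vector_derivative[OF mv.bounded_linear_right cvec_has_vector_derivative[OF this], of "G t"]
    from bounded_linear.has_vector_derivative[OF bounded_linear_compose[OF bounded_linear_Re bounded_linear_vec_nth[of i]] D]
    show ?thesis by (simp add: r_def cvec_axis matrix_vector_mult_axis)
  qed
  have pl: "((\<lambda>s. profile t (y + s *\<^sub>R axis i 1)) has_vector_derivative - 2 * m i (y + s *\<^sub>R axis i 1) * profile t (y + s *\<^sub>R axis i 1)) (at s)" for i y s
  proof -
    let ?y = "y + s *\<^sub>R axis i 1"
    have "((\<lambda>s. y + s *\<^sub>R axis i 1) has_vector_derivative axis i 1) (at s)" by (auto intro!: derivative_eq_intros)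
    note c = cvec_has_vector_derivative[OF this]
    have "((\<lambda>s. quad (G t) (y + s *\<^sub>R axis i 1)) has_vector_derivative
       cdot (cvec ?y) (G t *v cvec (axis i 1)) + cdot (cvec (axis i 1)) (G t *v cvec ?y)) (at s)"
      unfolding quad_conv_cdot
      by (intro cd.has_vector_derivative c bounded_linear.has_vector_derivative[OF mv.bounded_linear_right])
    then have "((\<lambda>s. quad (G t) (y + s *\<^sub>R axis i 1)) has_vector_derivative 2 * (G t *v cvec ?y) $ i) (at s)"
      by (simp add: cvec_axis cdot_G[of "cvec ?y"] cdot_axis)
    from bounded_linear.has_vector_derivative[OF bounded_linear_Im this]
    have "((\<lambda>s. Im (quad (G t) (y + s *\<^sub>R axis i 1))) has_real_derivative 2 * m i ?y) (at s)"
      by (simp add: m_def has_real_derivative_iff_has_vector_derivative)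
    from DERIV_cmult[OF DERIV_fun_exp[OF DERIV_minus[OF this]], of "(norm (a t))\<^sup>2"]
    have "((\<lambda>s. profile t (y + s *\<^sub>R axis i 1)) has_real_derivative - 2 * m i ?y * profile t ?y) (at s)"
      by (simp add: profile_def mult_ac)
    then show ?thesis by (simp add: has_real_derivative_iff_has_vector_derivative)
  qed
  obtain M b where M: "0 < M" "0 < b" "\<And>y. profile t y \<le> M * exp (- b * (norm y)\<^sup>2)"
    using profile_bound[of "\<bar>t\<bar>"] by (metis order_refl)
  obtain K where K: "\<And>(M::complex^'n^'n) v. norm (M *v v) \<le> norm M * norm v * K" and K0: "K > 0"
    using mv.pos_bounded by blast
  define L where "L = norm (G t) * K + 1"
  have L: "\<bar>r i y\<bar> \<le> L * (1 + norm y)" "\<bar>m i y\<bar> \<le> L * (1 + norm y)" for i y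
  proof -
    have "norm ((G t *v cvec y) $ i) \<le> norm (G t *v cvec y)" by (rule Finite_Cartesian_Product.norm_nth_le)
    also have "\<dots> \<le> norm (G t) * norm y * K" using K[of "G t" "cvec y"] by (simp add: norm_cvec)
    also have "\<dots> \<le> L * (1 + norm y)" using K0 by (simp add: L_def algebra_simps)
    finally have "norm ((G t *v cvec y) $ i) \<le> L * (1 + norm y)" .
    then show "\<bar>r i y\<bar> \<le> L * (1 + norm y)" "\<bar>m i y\<bar> \<le> L * (1 + norm y)"
      unfolding r_def m_def using abs_Re_le_cmod abs_Im_le_cmod order_trans by blast+
  qed
  have L1: "L \<ge> 1" using K0 by (simp add: L_def)
  have cr: "continuous_on UNIV (r i)" "continuous_on UNIV (m i)" for i
    unfolding r_def m_def by (intro continuous_intros mv.continuous_on cvec_continuous_on)+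
  have "continuous_on UNIV (\<lambda>x. profile (fst (t, x)) (snd (t, x)))"
    by (rule continuous_on_compose2[OF continuous_on_profile]) (auto intro!: continuous_intros)
  then have cp: "continuous_on UNIV (profile t)" by simp
  have cg': "continuous_on UNIV (g' i)" for i unfolding g'_def by (intro continuous_intros cr cp)
  have ig: "integrable lborel (\<lambda>y. r i y * profile t y)" for i
  proof (rule integrable_of_gaussian_bound[of _ "L * M" 1 b])
    show "norm (r i y * profile t y) \<le> L * M * ((1 + norm y) ^ 1 * exp (- b * (norm y)\<^sup>2))" for y
      using mult_mono[OF L(1)[of i y] M(3)[of y]] L1 profile_nonneg by (simp add: abs_mult mult_ac)
  qed (use M in \<open>auto intro!: borel_measurable_continuous_onI continuous_intros cr cp\<close>)
  have ig': "integrable lborel (g' i)" for i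
  proof (rule integrable_of_gaussian_bound[of _ "(norm (G t) + 2 * L * L) * M" 2 b])
    show "norm (g' i y) \<le> (norm (G t) + 2 * L * L) * M * ((1 + norm y) ^ 2 * exp (- b * (norm y)\<^sup>2))" for y
    proof -
      have "\<bar>Re (G t $ i $ i)\<bar> \<le> norm (G t)"
        using abs_Re_le_cmod[of "G t $ i $ i"] Finite_Cartesian_Product.norm_nth_le[of "G t $ i" i]
          Finite_Cartesian_Product.norm_nth_le[of "G t" i] by linarith
      moreover have "norm (G t) * 1 \<le> norm (G t) * (1 + norm y)\<^sup>2"
        by (intro mult_left_mono) (auto simp: one_le_power)
      moreover have "\<bar>2 * r i y * m i y\<bar> \<le> 2 * ((L * (1 + norm y)) * (L * (1 + norm y)))"
        using mult_mono[OF L(1)[of i y] L(2)[of i y]] L1 by (simp add: abs_mult)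
      ultimately have "\<bar>Re (G t $ i $ i) - 2 * r i y * m i y\<bar> \<le> (norm (G t) + 2 * L * L) * (1 + norm y)\<^sup>2"
      proof -
        assume 1: "\<bar>Re (G t $ i $ i)\<bar> \<le> norm (G t)" "norm (G t) * 1 \<le> norm (G t) * (1 + norm y)\<^sup>2"
          "\<bar>2 * r i y * m i y\<bar> \<le> 2 * ((L * (1 + norm y)) * (L * (1 + norm y)))"
        have "\<bar>Re (G t $ i $ i) - 2 * r i y * m i y\<bar> \<le> norm (G t) * (1 + norm y)\<^sup>2 + 2 * ((L * (1 + norm y)) * (L * (1 + norm y)))"
          using 1 abs_triangle_ineq4[of "Re (G t $ i $ i)" "2 * r i y * m i y"] by linarith
        also have "\<dots> = (norm (G t) + 2 * L * L) * (1 + norm y)\<^sup>2" by (simp add: power2_eq_square algebra_simps)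
        finally show ?thesis .
      qed
      from mult_mono[OF this M(3)[of y]] show ?thesis
        using L1 profile_nonneg by (simp add: g'_def abs_mult mult_ac)
    qed
  qed (use M cg' in \<open>auto intro!: borel_measurable_continuous_onI\<close>)
  have z: "(\<integral>y. g' i y \<partial>lborel) = 0" for i
  proof (rule integral_directional_derivative_zero[OF _ cg' ig ig'])
    show "((\<lambda>s. r i (y + s *\<^sub>R axis i 1) * profile t (y + s *\<^sub>R axis i 1)) has_vector_derivative g' i (y + s *\<^sub>R axis i 1)) (at s)" for y s
      using has_vector_derivative_mult[OF rl[of i y s] pl[of y i s]] by (simp add: g'_def algebra_simps)
  qed
  have gs: "(\<Sum>i\<in>UNIV. g' i y) = (Re (trace (G t)) - 2 * (\<Sum>i\<in>UNIV. r i y * m i y)) * profile t y" for y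
    unfolding g'_def sum_distrib_right[symmetric] sum_subtractf
    by (simp add: trace_def Re_sum sum_distrib_left mult.assoc)
  have "(\<lambda>y. (- 2 * Re (trace (G t)) + 4 * (\<Sum>i\<in>UNIV. r i y * m i y)) * profile t y) = (\<lambda>y. - 2 * (\<Sum>i\<in>UNIV. g' i y))"
    unfolding gs by (intro ext) (simp add: algebra_simps)
  then show ?thesis unfolding r_def[symmetric] m_def[symmetric]
    by (simp add: Bochner_Integration.integral_sum ig' z)
qed

text \<open>\<open>A\<close> is real, so only the term -2 G^2 of the Riccati equation and the
  equation for \<open>a\<close> contribute; the result is the divergence treated in
  \<open>profile_flux\<close>.\<close>

lemma profile_time:
  "((\<lambda>t. profile t y) has_vector_derivative
    (- 2 * Re (trace (G t)) + 4 * (\<Sum>i\<in>UNIV. Re ((G t *v cvec y) $ i) * Im ((G t *v cvec y) $ i))) * profile t y) (at t)"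
proof -
  let ?g = "G t *v cvec y"
  have "((\<lambda>t. quad (G t) y) has_vector_derivative cdot (cvec y) ((- 2 *\<^sub>R (G t ** G t) - A t) *v cvec y)) (at t)"
    unfolding quad_conv_cdot
    by (intro bounded_linear.has_vector_derivative[OF cd.bounded_linear_right]
        bounded_linear.has_vector_derivative[OF mv.bounded_linear_left] G')
  moreover have "cdot (cvec y) ((- 2 *\<^sub>R (G t ** G t) - A t) *v cvec y) = - 2 * cdot ?g ?g - quad (A t) y"
  proof -
    have "cdot (cvec y) ((G t ** G t) *v cvec y) = cdot ?g ?g"
      by (simp add: cdot_G flip: matrix_vector_mul_assoc)
    then show ?thesis
      by (simp add: mv.diff_left mv.scaleR_left mv.minus_left cd.diff_right cd.scaleR_right cd.minus_right quad_conv_cdot)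
         (simp add: scaleR_conv_of_real)
  qed
  ultimately have "((\<lambda>t. Im (quad (G t) y)) has_vector_derivative Im (- 2 * cdot ?g ?g - quad (A t) y)) (at t)"
    using bounded_linear.has_vector_derivative[OF bounded_linear_Im] by metis
  moreover have "Im (quad (A t) y) = 0"
  proof -
    have "cnj (A t $ j $ i) = A t $ i $ j" for i j
      using A_real[of t] by (simp add: adjoint_mat_def vec_eq_iff)
    moreover have "A t $ j $ i = A t $ i $ j" for i j
      using A_sym[of t] by (simp add: transpose_def vec_eq_iff)
    ultimately have "Im (A t $ i $ j) = 0" for i j by (metis cnj.simps(2) complex_cnj_cancel_iff eq_neg_iff_add_eq_0 double_zero)
    then show ?thesis by (simp add: quad_def)
  qed
  moreover have "Im (cdot ?g ?g) = 2 * (\<Sum>i\<in>UNIV. Re (?g $ i) * Im (?g $ i))"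
    by (simp add: cdot_def sum_distrib_left mult_ac)
  ultimately have quad': "((\<lambda>t. Im (quad (G t) y)) has_real_derivative - 4 * (\<Sum>i\<in>UNIV. Re (?g $ i) * Im (?g $ i))) (at t)"
    by (simp add: has_real_derivative_iff_has_vector_derivative)
  have "((\<lambda>t. (norm (a t))\<^sup>2) has_real_derivative - 2 * Re (trace (G t)) * (norm (a t))\<^sup>2) (at t)"
  proof -
    have "((\<lambda>t. a t \<bullet> a t) has_vector_derivative a t \<bullet> (- trace (G t) * a t) + (- trace (G t) * a t) \<bullet> a t) (at t)"
      by (intro bounded_bilinear.has_vector_derivative[OF bounded_bilinear_inner] a')
    moreover have "a t \<bullet> (- trace (G t) * a t) + (- trace (G t) * a t) \<bullet> a t = - 2 * Re (trace (G t)) * (norm (a t))\<^sup>2"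
      unfolding cmod_power2 by (simp add: inner_complex_def power2_eq_square algebra_simps)
    ultimately show ?thesis
      by (simp add: has_real_derivative_iff_has_vector_derivative power2_norm_eq_inner)
  qed
  from DERIV_mult[OF this DERIV_fun_exp[OF DERIV_minus[OF quad']]]
  have "((\<lambda>t. profile t y) has_real_derivative
    (- 2 * Re (trace (G t)) + 4 * (\<Sum>i\<in>UNIV. Re (?g $ i) * Im (?g $ i))) * profile t y) (at t)"
    by (simp add: profile_def algebra_simps)
  then show ?thesis by (simp add: has_real_derivative_iff_has_vector_derivative)
qed

text \<open>The time derivative of the profile is a divergence, so its spatial integral vanishes at
  each time; Fubini exchanges this with the integral over time. The long part of the proof is the
  Gaussian bound, uniform on [0, t], that Fubini requires.\<close>

lemma mass_conserved:
  assumes "0 \<le> t"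
  shows "moment 0 t = moment 0 0"
proof -
  define k where "k t y = (- 2 * Re (trace (G t)) + 4 * (\<Sum>i\<in>UNIV. Re ((G t *v cvec y) $ i) * Im ((G t *v cvec y) $ i))) * profile t y" for t y
  obtain M b where M: "0 < M" "0 < b" "\<And>s y. \<bar>s\<bar> \<le> t \<Longrightarrow> profile s y \<le> M * exp (- b * (norm y)\<^sup>2)"
    using profile_bound[of t] by metis
  obtain K where K: "\<And>(M::complex^'n^'n) v. norm (M *v v) \<le> norm M * norm v * K" and K0: "K > 0"
    using mv.pos_bounded by blast
  obtain N where N: "N > 0" "\<And>s. \<bar>s\<bar> \<le> t \<Longrightarrow> norm (G s) \<le> N" using continuous_bounded_on_interval[OF cont_G] by blast
  have ctr: "continuous_on UNIV (\<lambda>s. trace (G s))" unfolding trace_def by (intro continuous_intros cont_G)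
  obtain N' where N': "N' > 0" "\<And>s. \<bar>s\<bar> \<le> t \<Longrightarrow> norm (trace (G s)) \<le> N'" using continuous_bounded_on_interval[OF ctr] by blast
  define B where "B = (2 * N' + 4 * (real CARD('n) * (N * K)\<^sup>2)) * M"
  have kb: "norm (k s y) \<le> B * ((1 + norm y) ^ 2 * exp (- b * (norm y)\<^sup>2))" if "\<bar>s\<bar> \<le> t" for s y
  proof -
    have c: "norm ((G s *v cvec y) $ i) \<le> N * K * norm y" for i
    proof -
      have "norm ((G s *v cvec y) $ i) \<le> norm (G s *v cvec y)" by (rule Finite_Cartesian_Product.norm_nth_le)
      also have "\<dots> \<le> norm (G s) * norm y * K" using K[of "G s" "cvec y"] by (simp add: norm_cvec)
      also have "\<dots> \<le> N * norm y * K" using K0 by (intro mult_right_mono N that) auto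
      finally show ?thesis by (simp add: mult_ac)
    qed
    have "\<bar>\<Sum>i\<in>UNIV. Re ((G s *v cvec y) $ i) * Im ((G s *v cvec y) $ i)\<bar> \<le> (\<Sum>i\<in>(UNIV::'n set). (N * K * norm y) * (N * K * norm y))"
      using N K0 order_trans[OF abs_Re_le_cmod c] order_trans[OF abs_Im_le_cmod c]
      by (intro order_trans[OF sum_abs] sum_mono) (auto simp: abs_mult intro!: mult_mono)
    also have "\<dots> = real CARD('n) * (N * K)\<^sup>2 * (norm y)\<^sup>2" by (simp add: power2_eq_square mult_ac)
    also have "\<dots> \<le> real CARD('n) * (N * K)\<^sup>2 * (1 + norm y)\<^sup>2" by (intro mult_left_mono power_mono) auto
    finally have 1: "\<bar>\<Sum>i\<in>UNIV. Re ((G s *v cvec y) $ i) * Im ((G s *v cvec y) $ i)\<bar> \<le> real CARD('n) * (N * K)\<^sup>2 * (1 + norm y)\<^sup>2" .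
    have "\<bar>Re (trace (G s))\<bar> \<le> N' * 1" using N'(2)[OF that] abs_Re_le_cmod[of "trace (G s)"] by linarith
    also have "\<dots> \<le> N' * (1 + norm y)\<^sup>2" using N'(1) by (intro mult_left_mono) (auto simp: one_le_power)
    finally have 2: "\<bar>Re (trace (G s))\<bar> \<le> N' * (1 + norm y)\<^sup>2" .
    have "\<bar>- 2 * Re (trace (G s)) + 4 * (\<Sum>i\<in>UNIV. Re ((G s *v cvec y) $ i) * Im ((G s *v cvec y) $ i))\<bar>
      \<le> (2 * N' + 4 * (real CARD('n) * (N * K)\<^sup>2)) * (1 + norm y)\<^sup>2"
      using 1 2 by (simp add: algebra_simps)
    from mult_mono[OF this M(3)[OF that, of y]] show ?thesis
      using N' profile_nonneg by (simp add: k_def B_def abs_mult mult_ac)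
  qed
  have ck: "continuous_on UNIV (\<lambda>p. k (fst p) (snd p))"
    unfolding k_def
    by (intro continuous_intros continuous_on_profile mv.continuous_on cvec_continuous_on
        continuous_on_compose2[OF cont_G] continuous_on_compose2[OF ctr]) auto
  have ck1: "continuous_on UNIV (\<lambda>s. k s y)" for y
  proof -
    have "continuous_on UNIV (\<lambda>s. k (fst (s, y)) (snd (s, y)))"
      by (rule continuous_on_compose2[OF ck]) (auto intro!: continuous_intros)
    then show ?thesis by simp
  qed
  have mk: "k s \<in> borel_measurable borel" for s
  proof -
    have "continuous_on UNIV (\<lambda>y. k (fst (s, y)) (snd (s, y)))"
      by (rule continuous_on_compose2[OF ck]) (auto intro!: continuous_intros)
    then show ?thesis by (auto intro: borel_measurable_continuous_onI)
  qed
  have ik: "integrable lborel (k s)" if "s \<in> {0..t}" for s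
    by (rule integrable_of_gaussian_bound[OF mk kb M(2)]) (use that in auto)
  have "(\<integral>y. (LINT s:{0..t}|lborel. k s y) \<partial>lborel) = (LINT s:{0..t}|lborel. (\<integral>y. k s y \<partial>lborel))"
  proof (rule fubini_Icc(3)[OF _ ik])
    show "(\<lambda>p. k (fst p) (snd p)) \<in> borel_measurable (borel \<Otimes>\<^sub>M borel)"
      using borel_measurable_continuous_onI[OF ck] by (simp add: borel_prod)
    show "(\<integral>y. norm (k s y) \<partial>lborel) \<le> (\<integral>y. B * ((1 + norm y) ^ 2 * exp (- b * (norm y)\<^sup>2)) \<partial>(lborel :: (real^'n) measure))" if "s \<in> {0..t}" for s
      using that by (intro integral_mono integrable_norm ik kb integrable_mult_right integrable_polynomial_gaussian M) auto
  qed auto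
  also have "\<dots> = 0" unfolding k_def profile_flux by simp
  also have "(\<lambda>y. LINT s:{0..t}|lborel. k s y) = (\<lambda>y. profile t y - profile 0 y)"
    using LINT_Icc_FTC[OF assms profile_time ck1[unfolded k_def]] by (auto simp: k_def)
  finally have "(\<integral>y. profile t y - profile 0 y \<partial>lborel) = 0" .
  then show ?thesis using moment_integrable[of 0] by (simp add: moment_def)
qed

lemma mass_pos: "0 < moment 0 0"
proof -
  have "profile 0 y > 0" for y by (simp add: profile_def a0)
  then have "\<not> (AE y in lborel. profile 0 y = 0)"
    by (simp add: less_imp_neq[THEN not_sym] trivial_limit_def[symmetric] ae_filter_eq_bot_iff)
  then have "moment 0 0 \<noteq> 0"
    using integral_nonneg_eq_0_iff_AE[OF moment_integrable[of 0 0]] profile_nonneg by (simp add: moment_def)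
  moreover have "moment 0 0 \<ge> 0" unfolding moment_def using profile_nonneg by (intro integral_nonneg_AE) auto
  ultimately show ?thesis by simp
qed

end


section \<open>Superpositions in time\<close>

definition tint :: "real \<Rightarrow> (real \<Rightarrow> real^'n::finite \<Rightarrow> complex) \<Rightarrow> real^'n \<Rightarrow> complex"
  where "tint T f x = (LINT t:{0..T}|lborel. f t x)"

lemma set_integrable_continuous:
  fixes f :: "real \<Rightarrow> 'b::{banach, second_countable_topology}"
  assumes "continuous_on {a..b} f"
  shows "set_integrable lborel {a..b} f"
  unfolding set_integrable_def by (rule borel_integrable_compact) (use assms in auto)

lemma gaussian_family_set_integrable:
  "gaussian_family T f \<Longrightarrow> set_integrable lborel {a..b} (\<lambda>t. f t x)"
  by (intro set_integrable_continuous gaussian_family_measurable)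

lemma tint_eq_integral: "gaussian_family T f \<Longrightarrow> tint T f x = integral {0..T} (\<lambda>t. f t x)"
  unfolding tint_def by (rule set_borel_integral_eq_integral(2)[OF gaussian_family_set_integrable])

lemma tint_mult_left: "tint T (\<lambda>t x. c x * f t x) x = c x * tint T f x"
  unfolding tint_def by (rule set_integral_mult_right)

lemma tint_add:
  assumes "gaussian_family T f" "gaussian_family T g"
  shows "tint T (\<lambda>t x. f t x + g t x) x = tint T f x + tint T g x"
  unfolding tint_def by (rule set_integral_add(2); rule gaussian_family_set_integrable[OF assms(1)] gaussian_family_set_integrable[OF assms(2)])

lemma gaussian_family_add:
  assumes "gaussian_family T f" "gaussian_family T g"
  shows "gaussian_family T (\<lambda>t x. f t x + g t x)"
proof -
  obtain B \<beta> where f: "0 \<le> B" "0 < \<beta>" "\<And>t x. t \<in> {0..T} \<Longrightarrow> norm (f t x) \<le> B * exp (- \<beta> * (norm x)\<^sup>2)"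
    using assms(1) by (rule gaussian_family_bound) blast
  obtain C \<gamma> where g: "0 \<le> C" "0 < \<gamma>" "\<And>t x. t \<in> {0..T} \<Longrightarrow> norm (g t x) \<le> C * exp (- \<gamma> * (norm x)\<^sup>2)"
    using assms(2) by (rule gaussian_family_bound) blast
  define \<delta> where "\<delta> = min \<beta> \<gamma>"
  have "norm (f t x + g t x) \<le> (B + C) * exp (- \<delta> * (norm x)\<^sup>2)" if t: "t \<in> {0..T}" for t x
  proof -
    have e: "exp (- \<beta> * (norm x)\<^sup>2) \<le> exp (- \<delta> * (norm x)\<^sup>2)" "exp (- \<gamma> * (norm x)\<^sup>2) \<le> exp (- \<delta> * (norm x)\<^sup>2)"
      by (simp_all add: \<delta>_def mult_right_mono)
    have "norm (f t x + g t x) \<le> B * exp (- \<beta> * (norm x)\<^sup>2) + C * exp (- \<gamma> * (norm x)\<^sup>2)"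
      by (intro norm_triangle_mono f g t)
    also have "\<dots> \<le> B * exp (- \<delta> * (norm x)\<^sup>2) + C * exp (- \<delta> * (norm x)\<^sup>2)"
      by (intro add_mono mult_left_mono e f(1) g(1))
    finally show ?thesis by (simp add: distrib_right)
  qed
  then show ?thesis using assms f(1,2) g(1,2) unfolding gaussian_family_def
    by (intro conjI exI[of _ "B + C"] exI[of _ \<delta>]) (auto intro: continuous_on_add simp: \<delta>_def)
qed

lemma gaussian_family_sum:
  assumes "finite I" "I \<noteq> {}" "\<And>i. i \<in> I \<Longrightarrow> gaussian_family T (f i)"
  shows "gaussian_family T (\<lambda>t x. \<Sum>i\<in>I. f i t x)"
  using assms by (induction I rule: finite_ne_induct) (auto intro: gaussian_family_add)

lemma tint_sum:
  assumes "\<And>i. i \<in> I \<Longrightarrow> gaussian_family T (f i)" "finite I"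
  shows "tint T (\<lambda>t x. \<Sum>i\<in>I. f i t x) x = (\<Sum>i\<in>I. tint T (f i) x)"
  unfolding tint_def set_lebesgue_integral_def scaleR_sum_right
  by (rule Bochner_Integration.integral_sum)
     (use gaussian_family_set_integrable[OF assms(1)] in \<open>auto simp: set_integrable_def\<close>)

lemma gaussian_family_integral_norm:
  assumes f: "gaussian_family T f" and \<psi>: "sq_integrable \<psi>"
  shows "\<exists>C. \<forall>t\<in>{0..T}. integrable lborel (\<lambda>x. f t x * \<psi> x) \<and> (\<integral>x. norm (f t x * \<psi> x) \<partial>lborel) \<le> C"
proof -
  obtain B \<beta> where b: "0 \<le> B" "0 < \<beta>" "\<And>t x. t \<in> {0..T} \<Longrightarrow> norm (f t x) \<le> B * exp (- \<beta> * (norm x)\<^sup>2)"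
    using f by (rule gaussian_family_bound) blast
  have sq: "sq_integrable (f t)" if "t \<in> {0..T}" for t
    by (rule sq_integrable_of_gaussian_bound[OF gaussian_family_measurable(2)[OF f] b(3)[OF that] b(2)])
  have sg: "sq_integrable (\<lambda>x. complex_of_real (B * exp (- \<beta> * (norm x)\<^sup>2)))"
    by (rule sq_integrable_of_gaussian_bound[where B = B and \<beta> = \<beta>]) (use b in \<open>auto simp: norm_mult simp del: of_real_mult\<close>)
  have "(\<integral>x. norm (f t x * \<psi> x) \<partial>lborel) \<le> (\<integral>x. norm (complex_of_real (B * exp (- \<beta> * (norm x)\<^sup>2)) * \<psi> x) \<partial>lborel)"
    if t: "t \<in> {0..T}" for t
  proof (rule integral_mono)
    show "norm (f t x * \<psi> x) \<le> norm (complex_of_real (B * exp (- \<beta> * (norm x)\<^sup>2)) * \<psi> x)" for x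
      unfolding norm_mult norm_of_real using b(3)[OF t, of x] by (intro mult_right_mono) auto
  qed (intro integrable_norm sq_integrable_mult_integrable sq[OF t] sg \<psi>)+
  then show ?thesis using sq_integrable_mult_integrable[OF sq \<psi>] by blast
qed

lemma tint_pairing:
  assumes f: "gaussian_family T f" and \<psi>: "sq_integrable \<psi>"
  shows "(\<integral>x. tint T f x * \<psi> x \<partial>lborel) = (LINT t:{0..T}|lborel. (\<integral>x. f t x * \<psi> x \<partial>lborel))"
proof -
  obtain C where C: "\<And>t. t \<in> {0..T} \<Longrightarrow> integrable lborel (\<lambda>x. f t x * \<psi> x)"
    "\<And>t. t \<in> {0..T} \<Longrightarrow> (\<integral>x. norm (f t x * \<psi> x) \<partial>lborel) \<le> C"
    using gaussian_family_integral_norm[OF f \<psi>] by blast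
  have m: "(\<lambda>p. f (fst p) (snd p) * \<psi> (snd p)) \<in> borel_measurable (borel \<Otimes>\<^sub>M borel)"
    by (intro borel_measurable_times gaussian_family_measurable(1)[OF f]
        measurable_compose[OF measurable_snd sq_integrable_measurable[OF \<psi>]])
  have eq: "tint T f x * \<psi> x = (LINT t:{0..T}|lborel. f t x * \<psi> x)" for x
    unfolding tint_def by (rule set_integral_mult_left[symmetric])
  show ?thesis unfolding eq by (rule fubini_Icc(3)[OF m C])
qed

lemma tint_gaussian:
  assumes f: "gaussian_family T f" and T: "0 \<le> T"
  shows "tint T f \<in> borel_measurable borel" "\<exists>B \<beta>. 0 < \<beta> \<and> (\<forall>x. norm (tint T f x) \<le> B * exp (- \<beta> * (norm x)\<^sup>2))"
    and "sq_integrable (tint T f)"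
proof -
  obtain B \<beta> where b: "0 \<le> B" "0 < \<beta>" "\<And>t x. t \<in> {0..T} \<Longrightarrow> norm (f t x) \<le> B * exp (- \<beta> * (norm x)\<^sup>2)"
    using f by (rule gaussian_family_bound) blast
  have i: "integrable lborel (f t)" if "t \<in> {0..T}" for t
    by (rule integrable_of_gaussian_bound[OF gaussian_family_measurable(2)[OF f], of _ B 0 \<beta>]) (use b that in auto)
  have "integrable lborel (\<lambda>x. LINT t:{0..T}|lborel. f t x)"
  proof (rule fubini_Icc(2)[OF gaussian_family_measurable(1)[OF f] i])
    show "(\<integral>x. norm (f t x) \<partial>lborel) \<le> (\<integral>x. B * exp (- \<beta> * (norm x)\<^sup>2) \<partial>(lborel :: (real^'a) measure))" if "t \<in> {0..T}" for t
      using b that by (intro integral_mono integrable_norm i integrable_mult_right integrable_gaussian) auto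
  qed auto
  then show m: "tint T f \<in> borel_measurable borel"
    using borel_measurable_integrable by (auto simp: tint_def[abs_def])
  have le: "norm (tint T f x) \<le> (T * B) * exp (- \<beta> * (norm x)\<^sup>2)" for x
    using norm_LINT_Icc_le[OF gaussian_family_set_integrable[OF f] T, of x 0] b(3)[of _ x] by (simp add: tint_def mult.assoc)
  then show "\<exists>B \<beta>. 0 < \<beta> \<and> (\<forall>x. norm (tint T f x) \<le> B * exp (- \<beta> * (norm x)\<^sup>2))" using b(2) by blast
  show "sq_integrable (tint T f)" by (rule sq_integrable_of_gaussian_bound[OF m le b(2)])
qed

text \<open>Pairing with a test function commutes with the integral in time, hence so do weak
  derivatives.\<close>

lemma weakly_tint:
  assumes f: "gaussian_family T f" and f': "gaussian_family T f'" and T: "0 \<le> T"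
    and w: "\<And>t. t \<in> {0..T} \<Longrightarrow> weakly js (f t) (f' t)"
  shows "weakly js (tint T f) (tint T f')"
  unfolding weakly_def
proof (intro conjI allI impI tint_gaussian(3) f f' T)
  fix \<phi> :: "real^'a \<Rightarrow> complex" assume \<phi>: "test_function \<phi>"
  have "test_function (pderivs js \<phi>)" by (induction js) (auto intro: \<phi> test_function_partial)
  note s1 = sq_integrable_test_function[OF this] and s2 = sq_integrable_test_function[OF \<phi>]
  have "(LINT t:{0..T}|lborel. (\<integral>x. f t x * pderivs js \<phi> x \<partial>lborel))
    = (LINT t:{0..T}|lborel. (- 1) ^ length js * (\<integral>x. f' t x * \<phi> x \<partial>lborel))"
    using w \<phi> by (intro set_lebesgue_integral_cong) (auto simp: weakly_def)
  also have "\<dots> = (- 1) ^ length js * (LINT t:{0..T}|lborel. (\<integral>x. f' t x * \<phi> x \<partial>lborel))"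
    by (rule set_integral_mult_right)
  finally show "(\<integral>x. tint T f x * pderivs js \<phi> x \<partial>lborel) = (- 1) ^ length js * (\<integral>x. tint T f' x * \<phi> x \<partial>lborel)"
    by (simp add: tint_pairing[OF f s1] tint_pairing[OF f' s2])
qed

text \<open>The product with a test function has an integrable classical derivative in direction j,
  whose integral is 0 by \<open>integral_directional_derivative_zero\<close>.\<close>

lemma weakly_classical:
  fixes u u' :: "real^'n::finite \<Rightarrow> complex"
  assumes s: "sq_integrable u" "sq_integrable u'" and c: "continuous_on UNIV u" "continuous_on UNIV u'"
    and der: "\<And>x t. ((\<lambda>t. u (x + t *\<^sub>R axis j 1)) has_vector_derivative u' (x + t *\<^sub>R axis j 1)) (at t)"
  shows "weakly [j] u u'"
  unfolding weakly_def
proof (intro conjI s allI impI)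
  fix \<phi> :: "real^'n \<Rightarrow> complex" assume \<phi>: "test_function \<phi>"
  have sm: "smooth \<phi>" using \<phi> by (simp add: test_function_def)
  note s1 = sq_integrable_test_function[OF \<phi>] and s2 = sq_integrable_test_function[OF test_function_partial[OF \<phi>, of j]]
  have i: "integrable lborel (\<lambda>x. u x * \<phi> x)" "integrable lborel (\<lambda>x. u' x * \<phi> x)" "integrable lborel (\<lambda>x. u x * partial j \<phi> x)"
    by (intro sq_integrable_mult_integrable s s1 s2)+
  have "(\<integral>x. u x * partial j \<phi> x + u' x * \<phi> x \<partial>lborel) = 0"
  proof (rule integral_directional_derivative_zero[OF _ _ i(1)])
    show "((\<lambda>t. u (x + t *\<^sub>R axis j 1) * \<phi> (x + t *\<^sub>R axis j 1)) has_vector_derivative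
       u (x + t *\<^sub>R axis j 1) * partial j \<phi> (x + t *\<^sub>R axis j 1) + u' (x + t *\<^sub>R axis j 1) * \<phi> (x + t *\<^sub>R axis j 1)) (at t)" for x t
      by (rule has_vector_derivative_mult[OF der has_vector_derivative_line[OF smooth_differentiable[OF sm]]])
    show "continuous_on UNIV (\<lambda>x. u x * partial j \<phi> x + u' x * \<phi> x)"
      by (intro continuous_intros c smooth_imp_continuous_on sm smooth_partial)
    show "integrable lborel (\<lambda>x. u x * partial j \<phi> x + u' x * \<phi> x)"
      by (intro Bochner_Integration.integrable_add i)
  qed
  then have "(\<integral>x. u x * partial j \<phi> x \<partial>lborel) + (\<integral>x. u' x * \<phi> x \<partial>lborel) = 0"
    by (subst (asm) Bochner_Integration.integral_add[OF i(3) i(2)])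
  then show "(\<integral>x. u x * pderivs [j] \<phi> x \<partial>lborel) = (- 1) ^ length [j] * (\<integral>x. u' x * \<phi> x \<partial>lborel)"
    by (simp add: eq_neg_iff_add_eq_0)
qed

lemma weakly_compose:
  assumes "weakly [i] u v" "weakly [j] v w"
  shows "weakly [i, j] u w"
  unfolding weakly_def
proof (intro conjI allI impI)
  fix \<phi> :: "real^'a \<Rightarrow> complex" assume \<phi>: "test_function \<phi>"
  have "(\<integral>x. u x * partial i (partial j \<phi>) x \<partial>lborel) = - (\<integral>x. v x * partial j \<phi> x \<partial>lborel)"
    using assms(1) test_function_partial[OF \<phi>, of j] by (auto simp: weakly_def)
  also have "\<dots> = (\<integral>x. w x * \<phi> x \<partial>lborel)"
    using assms(2) \<phi> by (auto simp: weakly_def)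
  finally show "(\<integral>x. u x * pderivs [i, j] \<phi> x \<partial>lborel) = (- 1) ^ length [i, j] * (\<integral>x. w x * \<phi> x \<partial>lborel)"
    by simp
qed (use assms in \<open>auto simp: weakly_def\<close>)

lemma H2_I:
  assumes "\<And>j. weakly [j] u (v j)" "\<And>i j. weakly [i, j] u (w i j)"
  shows "abs_L2 u \<in> H2"
  unfolding H2_def
proof (intro CollectI allI impI)
  have su: "sq_integrable u" using assms by (auto simp: weakly_def)
  fix js :: "'a list" assume "length js \<le> 2"
  then consider "js = []" | j where "js = [j]" | i j where "js = [i, j]"
    by (cases js; cases "tl js") auto
  then have "\<exists>v. weakly js u v"
    using assms su by cases (auto simp: weakly_def[of "[]"])
  then obtain v where v: "weakly js u v" by blast
  then have "weak_deriv js (abs_L2 u) (abs_L2 v)" using weak_deriv_iff_weakly su by (auto simp: weakly_def)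
  then show "\<exists>v. weak_deriv js (abs_L2 u) v" by blast
qed

text \<open>Exchanges the integrals in t and x, so that the one-variable inequalities of the
  discrete Fourier section, valid at each x, become inequalities between L2 norms.\<close>

lemma gaussian_family_energy:
  fixes f :: "real \<Rightarrow> real^'n::finite \<Rightarrow> complex"
  assumes f: "gaussian_family T f"
  shows "set_integrable lborel {0..T} (\<lambda>t. (L2_norm (f t))\<^sup>2)"
    and "integrable lborel (\<lambda>x. integral {0..T} (\<lambda>t. (norm (f t x))\<^sup>2))"
    and "(\<integral>x. integral {0..T} (\<lambda>t. (norm (f t x))\<^sup>2) \<partial>lborel) = (LINT t:{0..T}|lborel. (L2_norm (f t))\<^sup>2)"
proof -
  obtain B \<beta> where b: "0 \<le> B" "0 < \<beta>" "\<And>t x. t \<in> {0..T} \<Longrightarrow> norm (f t x) \<le> B * exp (- \<beta> * (norm x)\<^sup>2)"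
    using f by (rule gaussian_family_bound) blast
  have sqb: "(norm (f t x))\<^sup>2 \<le> B\<^sup>2 * exp (- (2 * \<beta>) * (norm x)\<^sup>2)" if "t \<in> {0..T}" for t x
  proof -
    have "(norm (f t x))\<^sup>2 \<le> (B * exp (- \<beta> * (norm x)\<^sup>2))\<^sup>2" by (intro power_mono b that) auto
    also have "\<dots> = B\<^sup>2 * exp (- (2 * \<beta>) * (norm x)\<^sup>2)"
      by (simp add: power_mult_distrib power2_eq_square flip: exp_add)
    finally show ?thesis .
  qed
  have m: "(\<lambda>p. (norm (f (fst p) (snd p)))\<^sup>2) \<in> borel_measurable (borel \<Otimes>\<^sub>M borel)"
    using gaussian_family_measurable(1)[OF f] by measurable
  have i: "integrable lborel (\<lambda>x. (norm (f t x))\<^sup>2)" if "t \<in> {0..T}" for t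
    using sq_integrable_of_gaussian_bound[OF gaussian_family_measurable(2)[OF f] b(3)[OF that] b(2)]
    by (simp add: sq_integrable_def)
  have n: "(\<integral>x. norm ((norm (f t x))\<^sup>2) \<partial>lborel) \<le> (\<integral>x. B\<^sup>2 * exp (- (2 * \<beta>) * (norm x)\<^sup>2) \<partial>(lborel :: (real^'n) measure))"
    if "t \<in> {0..T}" for t
    using b sqb[OF that] i[OF that] by (intro integral_mono integrable_norm integrable_mult_right integrable_gaussian) auto
  have eq: "(LINT t:{0..T}|lborel. (norm (f t x))\<^sup>2) = integral {0..T} (\<lambda>t. (norm (f t x))\<^sup>2)" for x
    by (intro set_borel_integral_eq_integral(2) set_integrable_continuous continuous_intros gaussian_family_measurable(3)[OF f])
  show "set_integrable lborel {0..T} (\<lambda>t. (L2_norm (f t))\<^sup>2)"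
    unfolding L2_norm_power2 by (rule fubini_Icc(4)[OF m i n])
  show "integrable lborel (\<lambda>x. integral {0..T} (\<lambda>t. (norm (f t x))\<^sup>2))"
    unfolding eq[symmetric] by (rule fubini_Icc(2)[OF m i n])
  show "(\<integral>x. integral {0..T} (\<lambda>t. (norm (f t x))\<^sup>2) \<partial>lborel) = (LINT t:{0..T}|lborel. (L2_norm (f t))\<^sup>2)"
    unfolding eq[symmetric] L2_norm_power2 by (rule fubini_Icc(3)[OF m i n])
qed

lemma gaussian_family_time_mult:
  assumes "continuous_on UNIV c" "gaussian_family T f"
  shows "gaussian_family T (\<lambda>t x. c t * f t x)"
  by (rule gaussian_family_mult[OF poly_family_time[OF assms(1)] assms(2)])

definition wave :: "real \<Rightarrow> real \<Rightarrow> nat \<Rightarrow> real \<Rightarrow> complex"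
  where "wave r T k t = cis (2 * pi * (real k - r) * t / T)"

lemma continuous_on_wave: "T > 0 \<Longrightarrow> continuous_on UNIV (wave r T k)"
  unfolding wave_def by (intro continuous_intros) auto

text \<open>Here and in \<open>family_coercivity\<close> the scalar inequality is applied at each x
  and integrated over x; \<open>r\<close> is the centre of the frequency window.\<close>

lemma family_bessel:
  fixes f :: "real \<Rightarrow> real^'n::finite \<Rightarrow> complex"
  assumes f: "gaussian_family T f" and N: "N > 0" and T: "T > 0"
  shows "(\<Sum>k<N. (L2_norm (tint T (\<lambda>t x. wave r T k t * f t x)))\<^sup>2) \<le> T * (LINT t:{0..T}|lborel. (L2_norm (f t))\<^sup>2)"
proof -
  have fk: "gaussian_family T (\<lambda>t x. wave r T k t * f t x)" for k
    by (rule gaussian_family_time_mult[OF continuous_on_wave[OF T] f])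
  have tk: "tint T (\<lambda>t x. wave r T k t * f t x) x = integral {0..T} (\<lambda>t. f t x * cis (2 * pi * (real k - r) * t / T))" for k x
    unfolding tint_eq_integral[OF fk] by (simp add: wave_def mult.commute)
  have ik: "integrable lborel (\<lambda>x. (norm (tint T (\<lambda>t x. wave r T k t * f t x) x))\<^sup>2)" for k
    using tint_gaussian(3)[OF fk] T by (simp add: sq_integrable_def)
  have "(\<Sum>k<N. (L2_norm (tint T (\<lambda>t x. wave r T k t * f t x)))\<^sup>2)
     = (\<integral>x. (\<Sum>k<N. (norm (tint T (\<lambda>t x. wave r T k t * f t x) x))\<^sup>2) \<partial>lborel)"
    unfolding L2_norm_power2 by (rule Bochner_Integration.integral_sum[symmetric]) (rule ik)
  also have "\<dots> \<le> (\<integral>x. T * integral {0..T} (\<lambda>t. (norm (f t x))\<^sup>2) \<partial>lborel)"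
  proof (rule integral_mono)
    show "(\<Sum>k<N. (norm (tint T (\<lambda>t x. wave r T k t * f t x) x))\<^sup>2) \<le> T * integral {0..T} (\<lambda>t. (norm (f t x))\<^sup>2)" for x
      unfolding tk by (rule window_bessel[OF N T refl gaussian_family_measurable(3)[OF f]])
  qed (intro Bochner_Integration.integrable_sum ik integrable_mult_right gaussian_family_energy(2) f)+
  also have "\<dots> = T * (LINT t:{0..T}|lborel. (L2_norm (f t))\<^sup>2)"
    by (simp add: gaussian_family_energy(3)[OF f])
  finally show ?thesis .
qed

lemma family_coercivity:
  fixes f f' :: "real \<Rightarrow> real^'n::finite \<Rightarrow> complex"
  assumes f: "gaussian_family T f" and f': "gaussian_family T f'" and N: "N > 0" and T: "T > 0"
    and \<tau>: "\<tau> = T / real N" and r: "real N = 2 * r"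
    and der: "\<And>t x. ((\<lambda>t. f t x) has_vector_derivative f' t x) (at t)"
  shows "T / 18 * (LINT t:{0..T}|lborel. (L2_norm (f t))\<^sup>2)
     \<le> (\<Sum>k<N. (L2_norm (tint T (\<lambda>t x. wave r T k t * f t x)))\<^sup>2) + T * \<tau>\<^sup>2 * (LINT t:{0..T}|lborel. (L2_norm (f' t))\<^sup>2)"
proof -
  have fk: "gaussian_family T (\<lambda>t x. wave r T k t * f t x)" for k
    by (rule gaussian_family_time_mult[OF continuous_on_wave[OF T] f])
  have tk: "tint T (\<lambda>t x. wave r T k t * f t x) x = integral {0..T} (\<lambda>t. f t x * cis (2 * pi * (real k - r) * t / T))" for k x
    unfolding tint_eq_integral[OF fk] by (simp add: wave_def mult.commute)
  have ik: "integrable lborel (\<lambda>x. (norm (tint T (\<lambda>t x. wave r T k t * f t x) x))\<^sup>2)" for k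
    using tint_gaussian(3)[OF fk] T by (simp add: sq_integrable_def)
  note e = gaussian_family_energy[OF f] and e' = gaussian_family_energy[OF f']
  have "T / 18 * (LINT t:{0..T}|lborel. (L2_norm (f t))\<^sup>2) = (\<integral>x. T / 18 * integral {0..T} (\<lambda>t. (norm (f t x))\<^sup>2) \<partial>lborel)"
    by (simp add: e(3))
  also have "\<dots> \<le> (\<integral>x. (\<Sum>k<N. (norm (tint T (\<lambda>t x. wave r T k t * f t x) x))\<^sup>2) + T * \<tau>\<^sup>2 * integral {0..T} (\<lambda>t. (norm (f' t x))\<^sup>2) \<partial>lborel)"
  proof (rule integral_mono)
    show "T / 18 * integral {0..T} (\<lambda>t. (norm (f t x))\<^sup>2) \<le> (\<Sum>k<N. (norm (tint T (\<lambda>t x. wave r T k t * f t x) x))\<^sup>2) + T * \<tau>\<^sup>2 * integral {0..T} (\<lambda>t. (norm (f' t x))\<^sup>2)" for x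
      unfolding tk
      by (rule window_coercivity[OF N T \<tau> gaussian_family_measurable(3)[OF f] r der gaussian_family_measurable(3)[OF f']])
  qed (intro Bochner_Integration.integrable_add Bochner_Integration.integrable_sum ik integrable_mult_right e e')+
  also have "\<dots> = (\<Sum>k<N. (L2_norm (tint T (\<lambda>t x. wave r T k t * f t x)))\<^sup>2) + T * \<tau>\<^sup>2 * (LINT t:{0..T}|lborel. (L2_norm (f' t))\<^sup>2)"
    unfolding L2_norm_power2[of "tint _ _"]
    by (subst Bochner_Integration.integral_add)
       (auto intro!: Bochner_Integration.integrable_sum ik integrable_mult_right e' simp: Bochner_Integration.integral_sum[OF ik] e'(3))
  finally show ?thesis .
qed


section \<open>Quasimodes\<close>

lemma L2_norm_scale: "L2_norm (\<lambda>x. c * f x) = norm c * L2_norm f"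
  by (simp add: L2_norm_def norm_mult power_mult_distrib real_sqrt_mult)

text \<open>The two error bounds hold for all x and not only near q, so that they integrate against
  moments of the packet without a cut-off in space.\<close>

locale damped_packet = wave_packet V q \<xi> E A G S a
  for V :: "real^'n::finite \<Rightarrow> real" and q \<xi> E A G S a +
  fixes V2 :: "real^'n \<Rightarrow> real" and C2 C3 R :: real
  assumes V_cont: "continuous_on UNIV V" and V_bdd: "bounded (range V)"
    and V2_cont: "continuous_on UNIV V2" and V2_bdd: "bounded (range V2)" and V2_nonneg: "\<And>x. 0 \<le> V2 x"
    and taylor_error: "\<And>t x. norm (of_real (V x) - taylor t x) \<le> C3 * norm (x - q t) ^ 3"
    and V2_error: "\<And>t x. V2 x \<le> C2 * norm (x - q t) ^ 2"
    and q_bdd: "\<And>t. norm (q t) \<le> R" and C2: "0 \<le> C2" and C3: "0 \<le> C3"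
begin

lemma R_nonneg: "0 \<le> R"
  using order_trans[OF norm_ge_zero q_bdd] .

lemma packet_family:
  assumes h: "h > 0"
  shows "gaussian_family T (packet h)"
proof -
  obtain m where m: "m > 0" "\<And>t y. \<bar>t\<bar> \<le> T \<Longrightarrow> m * (norm y)\<^sup>2 \<le> Im (quad (G t) y)" using G_pos by blast
  obtain M where M: "M > 0" "\<And>t. \<bar>t\<bar> \<le> T \<Longrightarrow> norm (a t) \<le> M" using continuous_bounded_on_interval[OF cont_a] by blast
  \<comment> \<open>The squared modulus decays like exp (-m * norm (x - q)^2 / h). A factor 2 is
    lost in passing from x - q to x, at the price of a constant depending on R, and another in
    taking the square root.\<close>
  define \<beta> where "\<beta> = m / (4 * h)"
  have \<beta>: "\<beta> > 0" using m h by (simp add: \<beta>_def)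
  have "norm (packet h t x) \<le> (M * exp (2 * \<beta> * R\<^sup>2)) * exp (- \<beta> * (norm x)\<^sup>2)" if "t \<in> {0..T}" for t x
  proof (rule power2_le_imp_le)
    have t: "\<bar>t\<bar> \<le> T" using that by auto
    have "(norm x)\<^sup>2 \<le> (norm (x - q t) + R)\<^sup>2"
      using norm_triangle_ineq[of "x - q t" "q t"] q_bdd[of t] by (intro power_mono) auto
    also have "\<dots> \<le> 2 * (norm (x - q t))\<^sup>2 + 2 * R\<^sup>2"
      using sum_squares_bound[of "norm (x - q t)" R] by (simp add: power2_sum)
    finally have "2 * \<beta> * (norm x)\<^sup>2 \<le> 2 * \<beta> * (2 * (norm (x - q t))\<^sup>2 + 2 * R\<^sup>2)"
      using \<beta> by (intro mult_left_mono) auto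
    moreover have "4 * \<beta> * (norm (x - q t))\<^sup>2 \<le> Im (quad (G t) (x - q t)) / h"
      using m(2)[OF t, of "x - q t"] h by (simp add: \<beta>_def divide_right_mono)
    ultimately have "- Im (quad (G t) (x - q t)) / h \<le> 4 * \<beta> * R\<^sup>2 + - (2 * \<beta> * (norm x)\<^sup>2)" by (simp add: algebra_simps)
    then have "(norm (packet h t x))\<^sup>2 \<le> M\<^sup>2 * exp (4 * \<beta> * R\<^sup>2 + - (2 * \<beta> * (norm x)\<^sup>2))"
      unfolding norm_packet[OF h] using M(2)[OF t] by (intro mult_mono power_mono) auto
    also have "\<dots> = ((M * exp (2 * \<beta> * R\<^sup>2)) * exp (- \<beta> * (norm x)\<^sup>2))\<^sup>2"
      by (simp add: power2_eq_square flip: exp_add)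
    finally show "(norm (packet h t x))\<^sup>2 \<le> ((M * exp (2 * \<beta> * R\<^sup>2)) * exp (- \<beta> * (norm x)\<^sup>2))\<^sup>2" .
  qed (use M in simp)
  then show ?thesis unfolding gaussian_family_def using continuous_on_packet[OF h] \<beta> M(1)
    by (intro conjI exI[of _ "M * exp (2 * \<beta> * R\<^sup>2)"] exI[of _ \<beta>]) auto
qed

lemma poly_momentum: "poly_family T (\<lambda>t x. momentum t x $ j)"
proof -
  have "poly_family T (\<lambda>t x. of_real (\<xi> t $ j) + (\<Sum>l\<in>UNIV. G t $ j $ l * (of_real (x $ l) + (- of_real (q t $ l)))))"
    by (intro poly_family_add poly_family_sum poly_family_mult poly_family_component poly_family_time
        continuous_intros cont_G cont_q cont_\<xi>)
  then show ?thesis by (simp add: momentum_def dev_def cvec_def matrix_vector_mult_def)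
qed

text \<open>Since \<open>taylor\<close> is V minus (V - taylor), boundedness of \<open>V\<close> and
  the cubic error bound give the growth at once.\<close>

lemma poly_taylor: "poly_family T taylor"
proof -
  obtain B where B: "\<And>x. \<bar>V x\<bar> \<le> B" using V_bdd by (auto simp: bounded_iff)
  have B0: "0 \<le> B" using order_trans[OF abs_ge_zero B] .
  have "norm (taylor t x) \<le> (B + C3 * (1 + R) ^ 3) * (1 + norm x) ^ 3" for t x
  proof -
    have "norm (x - q t) \<le> norm x + norm (q t)" by (rule norm_triangle_ineq4)
    also have "\<dots> \<le> norm x + R" using q_bdd[of t] by simp
    also have "\<dots> \<le> (1 + R) * (1 + norm x)"
      using mult_nonneg_nonneg[OF R_nonneg norm_ge_zero[of x]] by (simp add: algebra_simps)
    finally have "norm (x - q t) ^ 3 \<le> ((1 + R) * (1 + norm x)) ^ 3" by (intro power_mono) auto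
    then have "C3 * norm (x - q t) ^ 3 \<le> C3 * ((1 + R) ^ 3 * (1 + norm x) ^ 3)"
      using C3 by (simp add: power_mult_distrib mult_left_mono)
    moreover have "B * 1 \<le> B * (1 + norm x) ^ 3" using B0 by (intro mult_left_mono) (auto simp: one_le_power)
    moreover have "norm (taylor t x) \<le> norm (complex_of_real (V x)) + norm (of_real (V x) - taylor t x)"
      using norm_triangle_ineq4[of "complex_of_real (V x)" "of_real (V x) - taylor t x"] by simp
    ultimately show ?thesis using taylor_error[of x t] B[of x] by (simp add: distrib_right mult.assoc)
  qed
  moreover have "0 \<le> B + C3 * (1 + R) ^ 3" using B0 C3 R_nonneg by simp
  ultimately show ?thesis unfolding poly_family_def using continuous_on_taylor[OF V_cont] by blast
qed

lemma poly_V: "poly_family T (\<lambda>_ x. complex_of_real (V x))"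
  and poly_V2: "poly_family T (\<lambda>_ x. complex_of_real (V2 x))"
proof -
  obtain B where B: "\<And>x. \<bar>V x\<bar> \<le> B" using V_bdd by (auto simp: bounded_iff)
  show "poly_family T (\<lambda>_ x. complex_of_real (V x))"
    by (rule poly_family_bounded[of _ B]) (use B in \<open>auto intro!: continuous_intros V_cont\<close>)
  obtain B where B: "\<And>x. \<bar>V2 x\<bar> \<le> B" using V2_bdd by (auto simp: bounded_iff)
  show "poly_family T (\<lambda>_ x. complex_of_real (V2 x))"
    by (rule poly_family_bounded[of _ B]) (use B in \<open>auto intro!: continuous_intros V2_cont\<close>)
qed

text \<open>Vanishes at both ends of [0, T], which removes the boundary terms in
  \<open>quasimode_equation\<close>, while its derivative is only of size 1/T.\<close>

definition cut :: "real \<Rightarrow> real \<Rightarrow> complex"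
  where "cut T t = of_real (sin (pi * t / T))"

definition cut' :: "real \<Rightarrow> real \<Rightarrow> complex"
  where "cut' T t = of_real (pi / T * cos (pi * t / T))"

definition error :: "real \<Rightarrow> real \<Rightarrow> real^'n \<Rightarrow> complex"
  where "error h t x = of_real (V x) - taylor t x - \<i> * of_real (h * V2 x)"

text \<open>What H_h - \<omega> applied to \<open>mode\<close> leaves when i*h times the time
  derivative of \<open>mode\<close> is taken off: the derivative of the cut-off, the Taylor error
  and the damping.\<close>

definition source :: "real \<Rightarrow> real \<Rightarrow> real \<Rightarrow> real \<Rightarrow> real^'n \<Rightarrow> complex"
  where "source T h \<omega> t x = cis (\<omega> * t / h) * ((- \<i> * of_real h * cut' T t + cut T t * error h t x) * packet h t x)"

definition mode :: "real \<Rightarrow> real \<Rightarrow> real \<Rightarrow> real \<Rightarrow> real^'n \<Rightarrow> complex"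
  where "mode T h \<omega> t x = cis (\<omega> * t / h) * (cut T t * packet h t x)"

definition mode1 :: "real \<Rightarrow> real \<Rightarrow> real \<Rightarrow> 'n \<Rightarrow> real \<Rightarrow> real^'n \<Rightarrow> complex"
  where "mode1 T h \<omega> i t x = \<i> / of_real h * (momentum t x $ i * mode T h \<omega> t x)"

definition mode2 :: "real \<Rightarrow> real \<Rightarrow> real \<Rightarrow> 'n \<Rightarrow> 'n \<Rightarrow> real \<Rightarrow> real^'n \<Rightarrow> complex"
  where "mode2 T h \<omega> i j t x = \<i> / of_real h * ((G t $ i $ j + \<i> / of_real h * (momentum t x $ i * momentum t x $ j)) * mode T h \<omega> t x)"

lemma cont_cut: "T > 0 \<Longrightarrow> continuous_on UNIV (cut T)" "T > 0 \<Longrightarrow> continuous_on UNIV (cut' T)"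
  unfolding cut_def cut'_def by (intro continuous_intros; simp)+

lemma cont_cis: "h > 0 \<Longrightarrow> continuous_on UNIV (\<lambda>t. cis (\<omega> * t / h))"
  by (intro continuous_intros) auto

lemma poly_error: "poly_family T (error h)"
proof -
  have "poly_family T (\<lambda>t x. (of_real (V x) + (- 1) * taylor t x) + (- \<i> * of_real h) * of_real (V2 x))"
    by (intro poly_family_add poly_family_mult poly_V poly_V2 poly_taylor poly_family_const)
  then show ?thesis by (simp add: error_def[abs_def] mult_ac)
qed

lemma mode_family:
  assumes "h > 0" "T > 0"
  shows "gaussian_family T (mode T h \<omega>)"
  unfolding mode_def[abs_def]
  by (intro gaussian_family_time_mult cont_cis cont_cut packet_family assms)

lemma mode1_family:
  assumes "h > 0" "T > 0"
  shows "gaussian_family T (mode1 T h \<omega> i)"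
  unfolding mode1_def[abs_def]
  by (intro gaussian_family_mult[OF poly_family_const] gaussian_family_mult[OF poly_momentum] mode_family assms)

lemma mode2_family:
  assumes "h > 0" "T > 0"
  shows "gaussian_family T (mode2 T h \<omega> i j)"
  unfolding mode2_def[abs_def]
  by (intro gaussian_family_mult[OF poly_family_const] gaussian_family_mult[OF poly_family_add] poly_family_time
      poly_family_mult poly_family_const poly_momentum mode_family assms continuous_intros cont_G)

lemma source_family:
  assumes "h > 0" "T > 0"
  shows "gaussian_family T (source T h \<omega>)"
  unfolding source_def[abs_def]
  by (intro gaussian_family_time_mult[OF cont_cis] gaussian_family_mult[OF poly_family_add] poly_family_mult
     poly_family_time poly_error packet_family assms continuous_intros cont_cut)

lemma gaussian_family_slice:
  assumes "gaussian_family T f" "t \<in> {0..T}"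
  shows "sq_integrable (f t)" "continuous_on UNIV (f t)"
proof -
  obtain B \<beta> where b: "0 \<le> B" "0 < \<beta>" "\<And>t x. t \<in> {0..T} \<Longrightarrow> norm (f t x) \<le> B * exp (- \<beta> * (norm x)\<^sup>2)"
    using assms(1) by (rule gaussian_family_bound) blast
  show "sq_integrable (f t)"
    by (rule sq_integrable_of_gaussian_bound[OF gaussian_family_measurable(2)[OF assms(1)] b(3)[OF assms(2)] b(2)])
  have c: "continuous_on UNIV (\<lambda>p. f (fst p) (snd p))" using assms(1) by (simp add: gaussian_family_def)
  have "continuous_on UNIV (\<lambda>x. f (fst (t, x)) (snd (t, x)))"
    by (rule continuous_on_compose2[OF c]) (auto intro!: continuous_intros)
  then show "continuous_on UNIV (f t)" by simp
qed

lemma mode_line: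
  "((\<lambda>s. mode T h \<omega> t (x + s *\<^sub>R axis j 1)) has_vector_derivative mode1 T h \<omega> j t (x + s *\<^sub>R axis j 1)) (at s)"
  unfolding mode_def mode1_def
  by (rule has_vector_derivative_eq_rhs[OF has_vector_derivative_mult_right[OF has_vector_derivative_mult_right[OF packet_line]]])
     (simp add: mult_ac)

lemma mode1_line:
  "((\<lambda>s. mode1 T h \<omega> i t (x + s *\<^sub>R axis j 1)) has_vector_derivative mode2 T h \<omega> i j t (x + s *\<^sub>R axis j 1)) (at s)"
  unfolding mode1_def mode2_def
  by (rule has_vector_derivative_eq_rhs[OF has_vector_derivative_mult_right[OF has_vector_derivative_mult[OF momentum_line mode_line]]])
     (simp add: mode1_def algebra_simps)

lemma mode_weakly:
  assumes h: "h > 0" and T: "T > 0"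
  shows "weakly [j] (tint T (mode T h \<omega>)) (tint T (mode1 T h \<omega> j))"
    and "weakly [i, j] (tint T (mode T h \<omega>)) (tint T (mode2 T h \<omega> i j))"
proof -
  note s = gaussian_family_slice[OF mode_family[OF h T]] gaussian_family_slice[OF mode1_family[OF h T]]
    gaussian_family_slice[OF mode2_family[OF h T]]
  have T0: "0 \<le> T" using T by simp
  show 1: "weakly [j] (tint T (mode T h \<omega>)) (tint T (mode1 T h \<omega> j))" for j
    by (rule weakly_tint[OF mode_family[OF h T] mode1_family[OF h T] T0], rule weakly_classical)
       (rule s mode_line; assumption?)+
  have 2: "weakly [j] (tint T (mode1 T h \<omega> i)) (tint T (mode2 T h \<omega> i j))"
    by (rule weakly_tint[OF mode1_family[OF h T] mode2_family[OF h T] T0], rule weakly_classical)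
       (rule s mode1_line; assumption?)+
  show "weakly [i, j] (tint T (mode T h \<omega>)) (tint T (mode2 T h \<omega> i j))"
    by (rule weakly_compose[OF 1 2])
qed

lemma cut_time: "(cut T has_vector_derivative cut' T t) (at t)"
proof -
  have "((\<lambda>t. complex_of_real (sin (pi / T * t))) has_vector_derivative of_real (cos (pi / T * t) * (pi / T * 1))) (at t)"
    by (rule has_vector_derivative_of_real[OF DERIV_fun_sin[OF DERIV_cmult[OF DERIV_ident]]])
  then have "(cut T has_vector_derivative of_real (cos (pi / T * t) * (pi / T * 1))) (at t)"
    by (simp add: cut_def[abs_def])
  then show ?thesis by (rule has_vector_derivative_eq_rhs) (simp add: cut'_def)
qed

lemma cis_time: "((\<lambda>t. cis (\<omega> * t / h)) has_vector_derivative \<i> * of_real (\<omega> / h) * cis (\<omega> * t / h)) (at t)"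
proof -
  have "((\<lambda>t. \<i> * of_real (\<omega> / h * t)) has_vector_derivative \<i> * of_real (\<omega> / h * 1)) (at t)"
    by (intro has_vector_derivative_mult_right has_vector_derivative_of_real DERIV_cmult DERIV_ident)
  from has_vector_derivative_exp[OF this] show ?thesis by (simp add: cis_conv_exp mult_ac)
qed

text \<open>Written with sums and factors -1 instead of \<open>cdot\<close> and subtraction, to
  match the closure rules for \<open>poly_family\<close>.\<close>

definition mode_time :: "real \<Rightarrow> real \<Rightarrow> real \<Rightarrow> real \<Rightarrow> real^'n \<Rightarrow> complex"
  where "mode_time T h \<omega> t x = cis (\<omega> * t / h) * ((cut' T t + \<i> / of_real h * (cut T t *
     (of_real \<omega> + (- 1) * (\<Sum>j\<in>UNIV. momentum t x $ j * momentum t x $ j) + (- 1) * taylor t x + \<i> * of_real h * trace (G t)))) * packet h t x)"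

lemma mode_has_time_derivative:
  assumes h: "h > 0"
  shows "((\<lambda>t. mode T h \<omega> t x) has_vector_derivative mode_time T h \<omega> t x) (at t)"
  unfolding mode_def mode_time_def cdot_def[symmetric]
  by (rule has_vector_derivative_eq_rhs[OF has_vector_derivative_mult[OF cis_time has_vector_derivative_mult[OF cut_time packet_time]]])
     (use h in \<open>simp add: field_simps\<close>)

lemma mode_time_family:
  assumes "h > 0" "T > 0"
  shows "gaussian_family T (mode_time T h \<omega>)"
proof -
  have tr: "continuous_on UNIV (\<lambda>t. trace (G t))" unfolding trace_def by (intro continuous_intros cont_G)
  show ?thesis
    unfolding mode_time_def[abs_def]
    by (intro gaussian_family_time_mult[OF cont_cis] gaussian_family_mult[OF poly_family_add] poly_family_mult poly_family_add
       poly_family_const poly_family_time poly_taylor poly_momentum poly_family_sum packet_family assms tr continuous_intros cont_cut)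
qed

text \<open>At each t, (H_h - \<omega>) mode = source + i*h * (time derivative of mode). Integrated
  over [0, T], the last term leaves the values of \<open>mode\<close> at 0 and T, where the cut-off
  vanishes.\<close>

lemma quasimode_equation:
  assumes h: "h > 0" and T: "T > 0"
  shows "- of_real (h\<^sup>2) * (\<Sum>j\<in>UNIV. tint T (mode2 T h \<omega> j j) x) + of_real (V x) * tint T (mode T h \<omega>) x
      - \<i> * of_real (h * V2 x) * tint T (mode T h \<omega>) x - of_real \<omega> * tint T (mode T h \<omega>) x = tint T (source T h \<omega>) x"
proof -
  note f = mode_family[OF h T, of \<omega>] and f2 = mode2_family[OF h T, of \<omega>]
    and fs = source_family[OF h T, of \<omega>] and ft = mode_time_family[OF h T, of \<omega>]
  define c where "c = of_real (V x) - \<i> * of_real (h * V2 x) - complex_of_real \<omega>"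
  have sum_fam: "gaussian_family T (\<lambda>t x. \<Sum>j\<in>UNIV. mode2 T h \<omega> j j t x)"
    by (rule gaussian_family_sum) (auto intro: f2)
  have fam1: "gaussian_family T (\<lambda>t x. - of_real (h\<^sup>2) * (\<Sum>j\<in>UNIV. mode2 T h \<omega> j j t x))"
    by (rule gaussian_family_mult[OF poly_family_const sum_fam])
  have fam2: "gaussian_family T (\<lambda>t x. c * mode T h \<omega> t x)"
    by (rule gaussian_family_mult[OF poly_family_const f])
  have fam3: "gaussian_family T (\<lambda>t x. \<i> * of_real h * mode_time T h \<omega> t x)"
    by (rule gaussian_family_mult[OF poly_family_const ft])
  have pw: "- of_real (h\<^sup>2) * (\<Sum>j\<in>UNIV. mode2 T h \<omega> j j t x) + c * mode T h \<omega> t x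
      = source T h \<omega> t x + \<i> * of_real h * mode_time T h \<omega> t x" for t
  proof -
    define M where "M = mode T h \<omega> t x"
    have sm: "(\<Sum>j\<in>UNIV. mode2 T h \<omega> j j t x)
       = \<i> / of_real h * ((trace (G t) + \<i> / of_real h * (\<Sum>j\<in>UNIV. momentum t x $ j * momentum t x $ j)) * M)"
      unfolding mode2_def M_def[symmetric] sum_distrib_left[symmetric] sum_distrib_right[symmetric] sum.distrib trace_def ..
    have M: "M = cis (\<omega> * t / h) * (cut T t * packet h t x)" by (simp add: M_def mode_def)
    show ?thesis
      unfolding sm M_def[symmetric] M source_def mode_time_def error_def c_def
      using h by (simp add: power2_eq_square field_simps)
  qed
  have "- of_real (h\<^sup>2) * (\<Sum>j\<in>UNIV. tint T (mode2 T h \<omega> j j) x) + c * tint T (mode T h \<omega>) x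
     = tint T (\<lambda>t x. - of_real (h\<^sup>2) * (\<Sum>j\<in>UNIV. mode2 T h \<omega> j j t x)) x + tint T (\<lambda>t x. c * mode T h \<omega> t x) x"
    by (simp only: tint_mult_left[of T "\<lambda>_. - of_real (h\<^sup>2)"] tint_mult_left[of T "\<lambda>_. c"] tint_sum[OF f2 finite])
  also have "\<dots> = (LINT t:{0..T}|lborel. - of_real (h\<^sup>2) * (\<Sum>j\<in>UNIV. mode2 T h \<omega> j j t x) + c * mode T h \<omega> t x)"
    using tint_add[OF fam1 fam2, of x] by (simp add: tint_def)
  also have "\<dots> = tint T (\<lambda>t x. source T h \<omega> t x + \<i> * of_real h * mode_time T h \<omega> t x) x"
    unfolding pw by (simp add: tint_def)
  also have "\<dots> = tint T (source T h \<omega>) x + \<i> * of_real h * tint T (mode_time T h \<omega>) x"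
    by (simp only: tint_add[OF fs fam3] tint_mult_left[of T "\<lambda>_. \<i> * of_real h"])
  also have "tint T (mode_time T h \<omega>) x = mode T h \<omega> T x - mode T h \<omega> 0 x"
    unfolding tint_def
    by (rule LINT_Icc_FTC) (use T mode_has_time_derivative[OF h] gaussian_family_measurable(3)[OF ft] in auto)
  also have "mode T h \<omega> T x - mode T h \<omega> 0 x = 0"
    using T by (simp add: mode_def cut_def)
  finally show ?thesis by (simp add: c_def algebra_simps)
qed

text \<open>The energy \<omega> is real while the bound concerns \<omega> + i*\<mu> with \<mu> > 0,
  where the quasimode v has source F - i*\<mu>*v. Gaussian decay gives both terms a finite norm with
  the growing weight, so \<mu> may tend to 0 with h and T fixed.\<close>

lemma quasimode_estimate:
  assumes h: "h > 0" and T: "T > 0" and s: "s > 0" and c: "0 \<le> c"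
    and op: "\<And>\<mu>. \<mu> > 0 \<Longrightarrow> op_norm (weighted_resolvent V V2 s h (Complex \<omega> \<mu>)) \<le> ennreal c"
  shows "L2_norm (\<lambda>x. of_real (jbracket x powr (- s)) * tint T (mode T h \<omega>) x)
    \<le> c * L2_norm (\<lambda>x. of_real (jbracket x powr s) * tint T (source T h \<omega>) x)"
proof -
  define v where "v = tint T (mode T h \<omega>)"
  define F where "F = tint T (source T h \<omega>)"
  define J where "J r x = complex_of_real (jbracket x powr r)" for r and x :: "real^'n"
  have T0: "0 \<le> T" using T by simp
  have sJ: "sq_integrable (\<lambda>x. J r x * tint T f x)" if "gaussian_family T f" for r f
    using tint_gaussian(3)[OF gaussian_family_mult[OF poly_family_jbracket[of T r] that] T0]
    by (simp add: tint_mult_left[abs_def] J_def)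
  have sv: "sq_integrable v" unfolding v_def by (rule tint_gaussian(3)[OF mode_family[OF h T] T0])
  have sJv: "sq_integrable (\<lambda>x. J r x * v x)" and sJF: "sq_integrable (\<lambda>x. J r x * F x)" for r
    unfolding v_def F_def by (rule sJ[OF mode_family[OF h T]], rule sJ[OF source_family[OF h T]])
  have mV: "V \<in> borel_measurable borel" "V2 \<in> borel_measurable borel"
    by (intro borel_measurable_continuous_onI V_cont V2_cont)+
  have mJ: "J r \<in> borel_measurable borel" for r
    unfolding J_def by (intro borel_measurable_continuous_onI continuous_intros continuous_on_jbracket_powr)
  have bJ: "bounded (range (J (- s)))"
  proof -
    have "norm (J (- s) x) \<le> 1" for x
      using jbracket_powr_le(1)[of "- s" 0 x] s by (simp add: J_def)
    then show ?thesis by (auto simp: bounded_iff)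
  qed
  have JJ: "J (- s) x * (J s x * y) = y" for x y
  proof -
    have "jbracket x powr (- s) * jbracket x powr s = 1"
      using jbracket_powr_le(2)[of 0 0 x] by (simp flip: powr_add)
    then show ?thesis unfolding J_def by (metis mult.assoc mult_1 of_real_1 of_real_mult)
  qed
  have est: "L2_norm (\<lambda>x. J (- s) x * v x) \<le> c * (L2_norm (\<lambda>x. J s x * F x) + \<mu> * L2_norm (\<lambda>x. J s x * v x))"
    if \<mu>: "\<mu> > 0" for \<mu>
  proof -
    \<comment> \<open>The source divided by the decaying weight: \<open>weight (- s)\<close> applied
      to it is F - i*\<mu>*v.\<close>
    define g where "g x = J s x * F x + (- \<i> * of_real \<mu>) * (J s x * v x)" for x
    have sg: "sq_integrable g" unfolding g_def by (intro sq_integrable_add sq_integrable_scale sJF sJv)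
    note w2 = mode_weakly(2)[OF h T, where \<omega> = \<omega>, folded v_def]
    have eq: "- of_real (h\<^sup>2) * (\<Sum>j\<in>UNIV. tint T (mode2 T h \<omega> j j) x) + of_real (V x) * v x
        - \<i> * of_real (h * V2 x) * v x - Complex \<omega> \<mu> * v x = J (- s) x * g x" for x
    proof -
      have "J (- s) x * g x = J (- s) x * (J s x * F x) + (- \<i> * of_real \<mu>) * (J (- s) x * (J s x * v x))"
        by (simp add: g_def algebra_simps)
      then have "J (- s) x * g x = F x - \<i> * of_real \<mu> * v x"
        unfolding JJ by simp
      moreover have "Complex \<omega> \<mu> = of_real \<omega> + \<i> * of_real \<mu>" by (simp add: complex_eq_iff)
      ultimately show ?thesis
        using quasimode_equation[OF h T, of \<omega> x] by (simp add: v_def F_def algebra_simps)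
    qed
    have 1: "norm (weight (- s) (abs_L2 v)) \<le> c * norm (abs_L2 g)"
    proof (rule weighted_estimate[OF mV(1) V_bdd mV(2) V2_bdd V2_nonneg h _ op[OF \<mu>] c])
      show "abs_L2 v \<in> H2"
        unfolding v_def by (rule H2_I) (rule mode_weakly[OF h T])+
      show "schroedinger V V2 h (abs_L2 v) - mult_op (\<lambda>_. Complex \<omega> \<mu>) (abs_L2 v) = weight (- s) (abs_L2 g)"
        unfolding schroedinger_abs_L2(1)[OF mV(1) V_bdd mV(2) V2_bdd V2_nonneg h w2] eq
        unfolding weight_def using mult_op_abs_L2[OF sg mJ bJ] by (simp add: J_def[abs_def])
    qed (use \<mu> in simp)
    have 2: "norm (weight (- s) (abs_L2 v)) = L2_norm (\<lambda>x. J (- s) x * v x)"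
      unfolding weight_def using mult_op_abs_L2[OF sv mJ bJ] norm_abs_L2[OF sJv[of "- s"]] by (simp add: J_def[abs_def])
    have 3: "norm (abs_L2 g) \<le> L2_norm (\<lambda>x. J s x * F x) + \<mu> * L2_norm (\<lambda>x. J s x * v x)"
    proof -
      have "L2_norm g \<le> L2_norm (\<lambda>x. J s x * F x) + L2_norm (\<lambda>x. (- \<i> * of_real \<mu>) * (J s x * v x))"
        unfolding g_def by (intro L2_norm_triangle sq_integrable_scale sJF sJv)
      then show ?thesis unfolding L2_norm_scale norm_abs_L2[OF sg] using \<mu> by (simp add: norm_mult)
    qed
    show ?thesis using order_trans[OF 1 mult_left_mono[OF 3 c]] unfolding 2 .
  qed
  have "((\<lambda>\<mu>. c * (L2_norm (\<lambda>x. J s x * F x) + \<mu> * L2_norm (\<lambda>x. J s x * v x))) \<longlongrightarrow>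
     c * (L2_norm (\<lambda>x. J s x * F x) + 0 * L2_norm (\<lambda>x. J s x * v x))) (at_right 0)"
    by (intro tendsto_intros)
  then have "L2_norm (\<lambda>x. J (- s) x * v x) \<le> c * (L2_norm (\<lambda>x. J s x * F x) + 0 * L2_norm (\<lambda>x. J s x * v x))"
    by (rule tendsto_lowerbound) (auto simp: eventually_at_filter est)
  then show ?thesis by (simp add: J_def v_def F_def)
qed

text \<open>Multiplication by \<open>wave\<close> shifts the energy E by a multiple of 2*pi*h/T, so
  the time integrals of the weighted mode are weighted quasimodes at 2*m energies around E.
  Coercivity for the mode, the resolvent estimate at each energy and Bessel for the source are
  chained in this order.\<close>

lemma integrated_resolvent_estimate:
  assumes h: "h > 0" and T: "T > 0" and s: "s > 0" and c: "0 \<le> c" and m: "m > 0"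
    and op: "\<And>k \<mu>. k < 2 * m \<Longrightarrow> \<mu> > 0 \<Longrightarrow>
      op_norm (weighted_resolvent V V2 s h (Complex (E + h * (2 * pi * (real k - real m) / T)) \<mu>)) \<le> ennreal c"
  shows "T / 18 * (LINT t:{0..T}|lborel. (L2_norm (\<lambda>x. of_real (jbracket x powr (- s)) * mode T h E t x))\<^sup>2)
    \<le> c\<^sup>2 * (T * (LINT t:{0..T}|lborel. (L2_norm (\<lambda>x. of_real (jbracket x powr s) * source T h E t x))\<^sup>2))
      + T * (T / real (2 * m))\<^sup>2 * (LINT t:{0..T}|lborel. (L2_norm (\<lambda>x. of_real (jbracket x powr (- s)) * mode_time T h E t x))\<^sup>2)"
proof -
  let ?J = "\<lambda>r x. complex_of_real (jbracket (x::real^'n) powr r)"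
  let ?\<omega> = "\<lambda>k. E + h * (2 * pi * (real k - real m) / T)"
  have N: "2 * m > 0" using m by simp
  have ph: "wave (real m) T k t * cis (E * t / h) = cis (?\<omega> k * t / h)" for k t
    unfolding wave_def cis_mult by (rule arg_cong[of _ _ cis]) (use h in \<open>simp add: field_simps\<close>)
  have fam: "gaussian_family T (\<lambda>t x. ?J r x * f t x)" if "gaussian_family T f" for r f
    by (rule gaussian_family_mult[OF poly_family_jbracket that])
  have tv: "tint T (\<lambda>t x. wave (real m) T k t * (?J (- s) x * mode T h E t x)) = (\<lambda>x. ?J (- s) x * tint T (mode T h (?\<omega> k)) x)" for k
  proof
    fix x
    have pw: "wave (real m) T k t * (?J (- s) x * mode T h E t x) = ?J (- s) x * mode T h (?\<omega> k) t x" for t x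
      unfolding mode_def ph[symmetric] by (simp add: mult_ac)
    show "tint T (\<lambda>t x. wave (real m) T k t * (?J (- s) x * mode T h E t x)) x = ?J (- s) x * tint T (mode T h (?\<omega> k)) x"
      unfolding pw by (rule tint_mult_left)
  qed
  have tF: "tint T (\<lambda>t x. wave (real m) T k t * (?J s x * source T h E t x)) = (\<lambda>x. ?J s x * tint T (source T h (?\<omega> k)) x)" for k
  proof
    fix x
    have pw: "wave (real m) T k t * (?J s x * source T h E t x) = ?J s x * source T h (?\<omega> k) t x" for t x
      unfolding source_def ph[symmetric] by (simp add: mult_ac)
    show "tint T (\<lambda>t x. wave (real m) T k t * (?J s x * source T h E t x)) x = ?J s x * tint T (source T h (?\<omega> k)) x"
      unfolding pw by (rule tint_mult_left)
  qed
  have "T / 18 * (LINT t:{0..T}|lborel. (L2_norm (\<lambda>x. ?J (- s) x * mode T h E t x))\<^sup>2)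
     \<le> (\<Sum>k<2 * m. (L2_norm (tint T (\<lambda>t x. wave (real m) T k t * (?J (- s) x * mode T h E t x))))\<^sup>2)
       + T * (T / real (2 * m))\<^sup>2 * (LINT t:{0..T}|lborel. (L2_norm (\<lambda>x. ?J (- s) x * mode_time T h E t x))\<^sup>2)"
    by (rule family_coercivity[OF fam[OF mode_family[OF h T]] fam[OF mode_time_family[OF h T]] N T refl])
       (use m in \<open>auto intro!: has_vector_derivative_mult_right mode_has_time_derivative h\<close>)
  also have "(\<Sum>k<2 * m. (L2_norm (tint T (\<lambda>t x. wave (real m) T k t * (?J (- s) x * mode T h E t x))))\<^sup>2)
     \<le> (\<Sum>k<2 * m. c\<^sup>2 * (L2_norm (tint T (\<lambda>t x. wave (real m) T k t * (?J s x * source T h E t x))))\<^sup>2)"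
  proof (rule sum_mono)
    fix k assume "k \<in> {..<2 * m}"
    then have "L2_norm (\<lambda>x. ?J (- s) x * tint T (mode T h (?\<omega> k)) x) \<le> c * L2_norm (\<lambda>x. ?J s x * tint T (source T h (?\<omega> k)) x)"
      by (intro quasimode_estimate[OF h T s c] op) auto
    from power_mono[OF this L2_norm_nonneg, of 2]
    show "(L2_norm (tint T (\<lambda>t x. wave (real m) T k t * (?J (- s) x * mode T h E t x))))\<^sup>2
      \<le> c\<^sup>2 * (L2_norm (tint T (\<lambda>t x. wave (real m) T k t * (?J s x * source T h E t x))))\<^sup>2"
      unfolding tv tF by (simp add: power_mult_distrib)
  qed
  also have "\<dots> = c\<^sup>2 * (\<Sum>k<2 * m. (L2_norm (tint T (\<lambda>t x. wave (real m) T k t * (?J s x * source T h E t x))))\<^sup>2)"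
    by (rule sum_distrib_left[symmetric])
  also have "(\<Sum>k<2 * m. (L2_norm (tint T (\<lambda>t x. wave (real m) T k t * (?J s x * source T h E t x))))\<^sup>2)
     \<le> T * (LINT t:{0..T}|lborel. (L2_norm (\<lambda>x. ?J s x * source T h E t x))\<^sup>2)"
    by (rule family_bessel[OF fam[OF source_family[OF h T]] N T])
  finally show ?thesis by (simp add: mult_left_mono)
qed

end


section \<open>Weighted bounds and the semiclassical limit\<close>

lemma jbracket_powr_square: "(jbracket x powr r)\<^sup>2 = (1 + (norm x)\<^sup>2) powr r"
proof -
  have "jbracket x = (1 + (norm x)\<^sup>2) powr (1 / 2)" by (simp add: jbracket_def powr_half_sqrt)
  then have "(jbracket x powr r)\<^sup>2 = ((1 + (norm x)\<^sup>2) powr (r / 2))\<^sup>2" by (simp add: powr_powr)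
  also have "\<dots> = (1 + (norm x)\<^sup>2) powr r" by (simp add: power2_eq_square flip: powr_add)
  finally show ?thesis .
qed

lemma one_plus_power_le:
  fixes a :: real
  assumes "0 \<le> a"
  shows "(1 + a) ^ k \<le> 2 ^ k * (1 + a ^ k)"
proof (cases "a \<le> 1")
  case True
  then have "(1 + a) ^ k \<le> 2 ^ k * 1" using assms power_mono[of "1 + a" 2 k] by simp
  also have "\<dots> \<le> 2 ^ k * (1 + a ^ k)" using assms by (intro mult_left_mono) auto
  finally show ?thesis .
next
  case False
  then have "(1 + a) ^ k \<le> (2 * a) ^ k" using assms by (intro power_mono) auto
  also have "\<dots> = 2 ^ k * a ^ k" by (rule power_mult_distrib)
  also have "\<dots> \<le> 2 ^ k * (1 + a ^ k)" by (intro mult_left_mono) auto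
  finally show ?thesis .
qed

text \<open>The two sides differ by (a - b - c)^2 + 2 * (b - c)^2.\<close>

lemma square_sum_le:
  fixes a b c :: real
  shows "(a + b + c)\<^sup>2 \<le> 2 * a\<^sup>2 + 4 * b\<^sup>2 + 4 * c\<^sup>2"
proof -
  have "(a + b + c)\<^sup>2 + (a - b - c)\<^sup>2 + 2 * (b - c)\<^sup>2 = 2 * a\<^sup>2 + 4 * b\<^sup>2 + 4 * c\<^sup>2"
    by (simp add: power2_eq_square algebra_simps)
  then show ?thesis using zero_le_power2[of "a - b - c"] zero_le_power2[of "b - c"] by linarith
qed

lemma integral_sin_square:
  assumes "T > 0"
  shows "(LINT t:{0..T}|lborel. (sin (pi * t / T))\<^sup>2) = T / 2"
proof -
  have "((\<lambda>t. t / 2 - T / (4 * pi) * sin (2 * (pi * t / T))) has_real_derivative (sin (pi * t / T))\<^sup>2) (at t)" for t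
  proof -
    have "((\<lambda>t. t / 2 - T / (4 * pi) * sin (2 * (pi * t / T))) has_real_derivative 1 / 2 - T / (4 * pi) * (cos (2 * (pi * t / T)) * (2 * (pi / T)))) (at t)"
      using assms by (auto intro!: derivative_eq_intros)
    moreover have "1 / 2 - T / (4 * pi) * (cos (2 * (pi * t / T)) * (2 * (pi / T))) = (sin (pi * t / T))\<^sup>2"
      unfolding cos_double_sin using assms by (simp add: field_simps)
    ultimately show ?thesis by simp
  qed
  then have d: "((\<lambda>t. t / 2 - T / (4 * pi) * sin (2 * (pi * t / T))) has_vector_derivative (sin (pi * t / T))\<^sup>2) (at t)" for t
    by (simp add: has_real_derivative_iff_has_vector_derivative)
  have "(LINT t:{0..T}|lborel. (sin (pi * t / T))\<^sup>2)
     = (T / 2 - T / (4 * pi) * sin (2 * (pi * T / T))) - (0 / 2 - T / (4 * pi) * sin (2 * (pi * 0 / T)))"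
    by (rule LINT_Icc_FTC[OF _ d]) (use assms in \<open>auto intro!: continuous_intros\<close>)
  then show ?thesis using assms by simp
qed

section \<open>Norms of the mode, of its source and of its time derivative\<close>

context damped_packet
begin

lemma moments_bounded: "\<exists>K>0. \<forall>p\<le>P. \<forall>t. \<bar>t\<bar> \<le> T \<longrightarrow> moment p t \<le> K"
proof (induction P)
  case 0
  then show ?case using moment_bounded[of T 0] by simp
next
  case (Suc P)
  then obtain K where K: "K > 0" "\<And>p t. p \<le> P \<Longrightarrow> \<bar>t\<bar> \<le> T \<Longrightarrow> moment p t \<le> K" by blast
  obtain K' where K': "K' > 0" "\<And>t. \<bar>t\<bar> \<le> T \<Longrightarrow> moment (Suc P) t \<le> K'" using moment_bounded[of T "Suc P"] by blast
  have "moment p t \<le> max K K'" if "p \<le> Suc P" "\<bar>t\<bar> \<le> T" for p t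
    using that K(2)[of p t] K'(2)[of t] by (cases "p = Suc P") (auto simp: le_max_iff_disj)
  then show ?case using K(1) by (intro exI[of _ "max K K'"]) auto
qed

lemma even_moment:
  assumes h: "h > 0"
  shows "(\<integral>x. norm (x - q t) ^ (2 * j) * (norm (packet h t x))\<^sup>2 \<partial>lborel) = sqrt h ^ CARD('n) * (h ^ j * moment (2 * j) t)"
  using packet_moment(2)[OF h, of t "2 * j"] h by (simp add: power_mult)

text \<open>A polynomial in x - q is put below the weight so that moments can be inserted: 1 - norm
  (x - q)^2 is positive only at distance less than 1 from q, where 1 + norm x^2 <= 3 +
  2*R^2.\<close>

lemma weight_lower:
  assumes "s > 0"
  shows "(3 + 2 * R\<^sup>2) powr (- s) * (1 - norm (x - q t) ^ 2) \<le> (jbracket x powr (- s))\<^sup>2"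
proof (cases "norm (x - q t) \<le> 1")
  case True
  have "norm x \<le> 1 + R" using norm_triangle_ineq[of "x - q t" "q t"] q_bdd[of t] True by simp
  then have "(norm x)\<^sup>2 \<le> (1 + R)\<^sup>2" by (intro power_mono) auto
  also have "\<dots> \<le> 2 + 2 * R\<^sup>2" using sum_squares_bound[of 1 R] by (simp add: power2_sum)
  finally have "(3 + 2 * R\<^sup>2) powr (- s) \<le> (1 + (norm x)\<^sup>2) powr (- s)"
    using assms by (intro powr_mono2') (auto simp: add_pos_nonneg)
  moreover have "(3 + 2 * R\<^sup>2) powr (- s) * (1 - norm (x - q t) ^ 2) \<le> (3 + 2 * R\<^sup>2) powr (- s)"
    by (intro mult_left_le) auto
  ultimately show ?thesis by (simp add: jbracket_powr_square)
next
  case False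
  then have "1 - norm (x - q t) ^ 2 \<le> 0" using one_le_power[of "norm (x - q t)" 2] by simp
  then have "(3 + 2 * R\<^sup>2) powr (- s) * (1 - norm (x - q t) ^ 2) \<le> 0" by (intro mult_nonneg_nonpos) auto
  then show ?thesis using zero_le_power2 order_trans by blast
qed

text \<open>An integer k above s lets a polynomial in norm (x - q) dominate the weight, again for
  the sake of moments; the constant comes from 1 + norm x^2 <= (2 + 2*R^2) * (1 + norm (x -
  q)^2).\<close>

lemma weight_upper:
  assumes "s \<le> real k"
  shows "(jbracket x powr s)\<^sup>2 \<le> (4 + 4 * R\<^sup>2) ^ k * (1 + norm (x - q t) ^ (2 * k))"
proof -
  let ?y = "norm (x - q t)"
  have "(norm x)\<^sup>2 \<le> (?y + R)\<^sup>2"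
    using norm_triangle_ineq[of "x - q t" "q t"] q_bdd[of t] by (intro power_mono) auto
  also have "\<dots> \<le> 2 * ?y\<^sup>2 + 2 * R\<^sup>2" using sum_squares_bound[of ?y R] by (simp add: power2_sum)
  finally have "(norm x)\<^sup>2 \<le> 2 * ?y\<^sup>2 + 2 * R\<^sup>2" .
  moreover have "0 \<le> R\<^sup>2 * ?y\<^sup>2" by simp
  ultimately have le: "1 + (norm x)\<^sup>2 \<le> (2 + 2 * R\<^sup>2) * (1 + ?y\<^sup>2)" unfolding distrib_left distrib_right by linarith
  have p: "1 \<le> 1 + (norm x)\<^sup>2" by simp
  have "(1 + (norm x)\<^sup>2) powr s \<le> (1 + (norm x)\<^sup>2) powr real k" using assms p by (intro powr_mono) auto
  also have "\<dots> = (1 + (norm x)\<^sup>2) ^ k" by (rule powr_realpow) (use p in linarith)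
  also have "\<dots> \<le> ((2 + 2 * R\<^sup>2) * (1 + ?y\<^sup>2)) ^ k" by (intro power_mono le) auto
  also have "\<dots> \<le> (2 + 2 * R\<^sup>2) ^ k * (2 ^ k * (1 + (?y\<^sup>2) ^ k))"
    unfolding power_mult_distrib by (intro mult_left_mono one_plus_power_le) auto
  also have "\<dots> = (4 + 4 * R\<^sup>2) ^ k * (1 + ?y ^ (2 * k))"
  proof -
    have "4 + 4 * R\<^sup>2 = (2 + 2 * R\<^sup>2) * 2" by simp
    then show ?thesis by (simp only: power_mult_distrib power_mult mult.assoc)
  qed
  finally show ?thesis by (simp add: jbracket_powr_square)
qed

lemma weighted_slice_integrable:
  assumes "gaussian_family T f" "t \<in> {0..T}"
  shows "integrable lborel (\<lambda>x. (jbracket x powr r)\<^sup>2 * (norm (f t x))\<^sup>2)"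
    and "(L2_norm (\<lambda>x. of_real (jbracket x powr r) * f t x))\<^sup>2 = (\<integral>x. (jbracket x powr r)\<^sup>2 * (norm (f t x))\<^sup>2 \<partial>lborel)"
proof -
  have "sq_integrable (\<lambda>x. of_real (jbracket x powr r) * f t x)"
    by (rule gaussian_family_slice(1)[OF gaussian_family_mult[OF poly_family_jbracket assms(1)] assms(2)])
  then show "integrable lborel (\<lambda>x. (jbracket x powr r)\<^sup>2 * (norm (f t x))\<^sup>2)"
    by (simp add: sq_integrable_def norm_mult power_mult_distrib)
  show "(L2_norm (\<lambda>x. of_real (jbracket x powr r) * f t x))\<^sup>2 = (\<integral>x. (jbracket x powr r)\<^sup>2 * (norm (f t x))\<^sup>2 \<partial>lborel)"
    by (simp add: L2_norm_power2 norm_mult power_mult_distrib)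
qed

text \<open>Relative to the common factor \<open>sqrt h ^ CARD('n)\<close>, moment 0 carries no h
  and is the conserved mass, while moment 2 carries one power of h. The weighted norm therefore
  keeps a fixed fraction of the mass as h tends to 0.\<close>

lemma mode_lower:
  assumes h: "h > 0" and T: "T > 0" and s: "s > 0" and t: "t \<in> {0..T}" and K: "moment 2 t \<le> K"
  shows "(sin (pi * t / T))\<^sup>2 * (sqrt h ^ CARD('n) * ((3 + 2 * R\<^sup>2) powr (- s) * (moment 0 0 - h * K)))
    \<le> (L2_norm (\<lambda>x. of_real (jbracket x powr (- s)) * mode T h \<omega> t x))\<^sup>2"
proof -
  define m where "m p x = norm (x - q t) ^ p * (norm (packet h t x))\<^sup>2" for p and x
  have im: "integrable lborel (m p)" for p unfolding m_def by (rule packet_moment(1)[OF h])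
  define b where "b = (3 + 2 * R\<^sup>2) powr (- s)"
  define \<sigma> where "\<sigma> = (sin (pi * t / T))\<^sup>2"
  have \<sigma>b: "0 \<le> \<sigma>" "0 \<le> b" by (simp_all add: \<sigma>_def b_def)
  have M0: "integral\<^sup>L lborel (m 0) = sqrt h ^ CARD('n) * moment 0 0"
    using even_moment[OF h, of t 0] mass_conserved[of t] t by (simp add: m_def[abs_def])
  have M2: "integral\<^sup>L lborel (m 2) = sqrt h ^ CARD('n) * (h * moment 2 t)"
    using even_moment[OF h, of t 1] by (simp add: m_def[abs_def])
  have "\<sigma> * (sqrt h ^ CARD('n) * (b * (moment 0 0 - h * K))) \<le> \<sigma> * (sqrt h ^ CARD('n) * (b * (moment 0 0 - h * moment 2 t)))"
    using h K \<sigma>b by (intro mult_left_mono diff_left_mono) auto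
  also have "\<dots> = (\<integral>x. \<sigma> * b * (m 0 x - m 2 x) \<partial>lborel)"
    by (simp add: im M0 M2 algebra_simps)
  also have "\<dots> \<le> (\<integral>x. (jbracket x powr (- s))\<^sup>2 * (norm (mode T h \<omega> t x))\<^sup>2 \<partial>lborel)"
  proof (rule integral_mono)
    show "integrable lborel (\<lambda>x. \<sigma> * b * (m 0 x - m 2 x))" by (intro integrable_mult_right Bochner_Integration.integrable_diff im)
    show "integrable lborel (\<lambda>x. (jbracket x powr (- s))\<^sup>2 * (norm (mode T h \<omega> t x))\<^sup>2)"
      by (rule weighted_slice_integrable(1)[OF mode_family[OF h T] t])
    show "\<sigma> * b * (m 0 x - m 2 x) \<le> (jbracket x powr (- s))\<^sup>2 * (norm (mode T h \<omega> t x))\<^sup>2" for x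
    proof -
      have n: "(norm (mode T h \<omega> t x))\<^sup>2 = \<sigma> * (norm (packet h t x))\<^sup>2"
        by (simp add: mode_def norm_mult cut_def \<sigma>_def power_mult_distrib)
      have "\<sigma> * b * (m 0 x - m 2 x) = (b * (1 - norm (x - q t) ^ 2)) * (\<sigma> * (norm (packet h t x))\<^sup>2)"
        by (simp add: m_def algebra_simps)
      also have "\<dots> \<le> (jbracket x powr (- s))\<^sup>2 * (\<sigma> * (norm (packet h t x))\<^sup>2)"
        unfolding b_def using \<sigma>b by (intro mult_right_mono weight_lower s) auto
      finally show ?thesis by (simp add: n)
    qed
  qed
  finally show ?thesis unfolding \<sigma>_def b_def by (simp add: weighted_slice_integrable(2)[OF mode_family[OF h T] t])
qed

lemma norm_error_le:
  assumes "h > 0"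
  shows "norm (error h t x) \<le> C3 * norm (x - q t) ^ 3 + h * (C2 * norm (x - q t) ^ 2)"
proof -
  have "norm (error h t x) \<le> norm (of_real (V x) - taylor t x) + norm (\<i> * complex_of_real (h * V2 x))"
    unfolding error_def by (rule norm_triangle_ineq4)
  also have "norm (\<i> * complex_of_real (h * V2 x)) = h * V2 x"
    using assms V2_nonneg[of x] by (simp add: norm_mult)
  also have "h * V2 x \<le> h * (C2 * norm (x - q t) ^ 2)" using assms V2_error by (intro mult_left_mono) auto
  finally show ?thesis using taylor_error[of x t] by linarith
qed

text \<open>Three contributions to the squared norm: the cut-off gives h^2 times the mass, the
  Taylor error meets norm (x - q)^6 and gives h^3, and for the damping, h^2 * norm (x - q)^4, the
  power h^3 is enough. Since h is at most 1, the higher moments produced by the weight obey the same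
  powers.\<close>

lemma source_upper:
  assumes h: "0 < h" "h \<le> 1" and T: "T > 0" and k: "s \<le> real k" "0 < k" and t: "t \<in> {0..T}"
    and K: "\<And>p. p \<le> 6 + 2 * k \<Longrightarrow> moment p t \<le> K" and K0: "0 \<le> K"
  shows "(L2_norm (\<lambda>x. of_real (jbracket x powr s) * source T h \<omega> t x))\<^sup>2
    \<le> sqrt h ^ CARD('n) * ((4 + 4 * R\<^sup>2) ^ k * (2 * h\<^sup>2 * (pi / T)\<^sup>2 * (moment 0 0 + h * K) + 8 * (C3\<^sup>2 + C2\<^sup>2) * K * h ^ 3))"
proof -
  define m where "m p x = norm (x - q t) ^ p * (norm (packet h t x))\<^sup>2" for p and x
  have im: "integrable lborel (m p)" for p unfolding m_def by (rule packet_moment(1)[OF h(1)])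
  define H where "H = sqrt h ^ CARD('n)"
  have H: "0 \<le> H" using h by (simp add: H_def)
  define b where "b = (4 + 4 * R\<^sup>2) ^ k"
  have b: "0 \<le> b" by (simp add: b_def)
  have M: "integral\<^sup>L lborel (m (2 * j)) = H * (h ^ j * moment (2 * j) t)" for j
    unfolding m_def H_def by (rule even_moment[OF h(1)])
  have M0: "integral\<^sup>L lborel (m 0) = H * moment 0 0" using M[of 0] mass_conserved[of t] t by simp
  have Mle: "integral\<^sup>L lborel (m (2 * j)) \<le> H * (h ^ i * K)" if "i \<le> j" "2 * j \<le> 6 + 2 * k" for i j
  proof -
    have "h ^ j * moment (2 * j) t \<le> h ^ j * K" using K[OF that(2)] h by (intro mult_left_mono) auto
    also have "\<dots> \<le> h ^ i * K" using that(1) h K0 by (intro mult_right_mono power_decreasing) auto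
    finally show ?thesis unfolding M using H by (intro mult_left_mono)
  qed
  have "(\<integral>x. (jbracket x powr s)\<^sup>2 * (norm (source T h \<omega> t x))\<^sup>2 \<partial>lborel)
     \<le> (\<integral>x. b * (2 * h\<^sup>2 * (pi / T)\<^sup>2 * (m 0 x + m (2 * k) x) + 4 * C3\<^sup>2 * (m (2 * 3) x + m (2 * (3 + k)) x)
        + 4 * h\<^sup>2 * C2\<^sup>2 * (m (2 * 2) x + m (2 * (2 + k)) x)) \<partial>lborel)"
  proof (rule integral_mono)
    show "integrable lborel (\<lambda>x. (jbracket x powr s)\<^sup>2 * (norm (source T h \<omega> t x))\<^sup>2)"
      by (rule weighted_slice_integrable(1)[OF source_family[OF h(1) T] t])
    show "integrable lborel (\<lambda>x. b * (2 * h\<^sup>2 * (pi / T)\<^sup>2 * (m 0 x + m (2 * k) x) + 4 * C3\<^sup>2 * (m (2 * 3) x + m (2 * (3 + k)) x)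
        + 4 * h\<^sup>2 * C2\<^sup>2 * (m (2 * 2) x + m (2 * (2 + k)) x)))"
      by (intro integrable_mult_right Bochner_Integration.integrable_add im)
    show "(jbracket x powr s)\<^sup>2 * (norm (source T h \<omega> t x))\<^sup>2 \<le>
        b * (2 * h\<^sup>2 * (pi / T)\<^sup>2 * (m 0 x + m (2 * k) x) + 4 * C3\<^sup>2 * (m (2 * 3) x + m (2 * (3 + k)) x)
        + 4 * h\<^sup>2 * C2\<^sup>2 * (m (2 * 2) x + m (2 * (2 + k)) x))" for x
    proof -
      let ?y = "norm (x - q t)" and ?u = "(norm (packet h t x))\<^sup>2"
      have c1: "norm (- \<i> * of_real h * cut' T t) \<le> h * (pi / T)"
      proof -
        have "norm (cut' T t) = pi / T * \<bar>cos (pi * t / T)\<bar>" unfolding cut'_def norm_of_real using T by (simp add: abs_mult)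
        also have "\<dots> \<le> pi / T * 1" using T by (intro mult_left_mono) auto
        finally have "norm (cut' T t) \<le> pi / T" by simp
        then show ?thesis using h by (simp add: norm_mult mult_left_mono del: times_divide_eq_right)
      qed
      have c2: "norm (cut T t * error h t x) \<le> C3 * ?y ^ 3 + h * C2 * ?y ^ 2"
      proof -
        have "norm (cut T t) \<le> 1" by (simp add: cut_def)
        then have "norm (cut T t * error h t x) \<le> 1 * norm (error h t x)" unfolding norm_mult by (intro mult_right_mono) auto
        then show ?thesis using norm_error_le[OF h(1), of t x] by (simp add: mult.assoc)
      qed
      have "norm (- \<i> * of_real h * cut' T t + cut T t * error h t x) \<le> h * (pi / T) + C3 * ?y ^ 3 + h * C2 * ?y ^ 2"
        using norm_triangle_mono[OF c1 c2] by simp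
      then have "(norm (- \<i> * of_real h * cut' T t + cut T t * error h t x))\<^sup>2 \<le> (h * (pi / T) + C3 * ?y ^ 3 + h * C2 * ?y ^ 2)\<^sup>2"
        by (rule power_mono) simp
      also have "\<dots> \<le> 2 * (h * (pi / T))\<^sup>2 + 4 * (C3 * ?y ^ 3)\<^sup>2 + 4 * (h * C2 * ?y ^ 2)\<^sup>2" by (rule square_sum_le)
      also have "\<dots> = 2 * h\<^sup>2 * (pi / T)\<^sup>2 + 4 * C3\<^sup>2 * ?y ^ 6 + 4 * h\<^sup>2 * C2\<^sup>2 * ?y ^ 4"
        by (simp only: power_mult_distrib flip: power_mult) (simp add: mult.assoc)
      finally have s: "(norm (source T h \<omega> t x))\<^sup>2 \<le> (2 * h\<^sup>2 * (pi / T)\<^sup>2 + 4 * C3\<^sup>2 * ?y ^ 6 + 4 * h\<^sup>2 * C2\<^sup>2 * ?y ^ 4) * ?u"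
        unfolding source_def norm_mult power_mult_distrib norm_cis by (simp add: mult_right_mono)
      have "(jbracket x powr s)\<^sup>2 * (norm (source T h \<omega> t x))\<^sup>2
        \<le> (b * (1 + ?y ^ (2 * k))) * ((2 * h\<^sup>2 * (pi / T)\<^sup>2 + 4 * C3\<^sup>2 * ?y ^ 6 + 4 * h\<^sup>2 * C2\<^sup>2 * ?y ^ 4) * ?u)"
        unfolding b_def by (intro mult_mono s weight_upper k) auto
      also have "\<dots> = b * (2 * h\<^sup>2 * (pi / T)\<^sup>2 * (m 0 x + m (2 * k) x) + 4 * C3\<^sup>2 * (m (2 * 3) x + m (2 * (3 + k)) x)
        + 4 * h\<^sup>2 * C2\<^sup>2 * (m (2 * 2) x + m (2 * (2 + k)) x))"
      proof -
        have pw: "?y ^ (2 * (2 + k)) = ?y ^ 4 * ?y ^ (2 * k)" "?y ^ (2 * (3 + k)) = ?y ^ 6 * ?y ^ (2 * k)"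
          by (simp_all only: distrib_left power_add) simp_all
        have m: "m 0 x = ?u" "m (2 * k) x = ?y ^ (2 * k) * ?u" "m (2 * 3) x = ?y ^ 6 * ?u" "m (2 * 2) x = ?y ^ 4 * ?u"
            "m (2 * (3 + k)) x = ?y ^ 6 * ?y ^ (2 * k) * ?u" "m (2 * (2 + k)) x = ?y ^ 4 * ?y ^ (2 * k) * ?u"
          unfolding m_def pw by simp_all
        show ?thesis unfolding m by (simp only: distrib_left distrib_right mult_1_left mult_1_right mult_ac add_ac)
      qed
      finally show ?thesis .
    qed
  qed
  also have "\<dots> = b * (2 * h\<^sup>2 * (pi / T)\<^sup>2 * (integral\<^sup>L lborel (m 0) + integral\<^sup>L lborel (m (2 * k)))
      + 4 * C3\<^sup>2 * (integral\<^sup>L lborel (m (2 * 3)) + integral\<^sup>L lborel (m (2 * (3 + k))))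
      + 4 * h\<^sup>2 * C2\<^sup>2 * (integral\<^sup>L lborel (m (2 * 2)) + integral\<^sup>L lborel (m (2 * (2 + k)))))"
    by (simp only: Bochner_Integration.integral_add integral_mult_right_zero Bochner_Integration.integrable_add im integrable_mult_right)
  also have "\<dots> \<le> b * (2 * h\<^sup>2 * (pi / T)\<^sup>2 * (H * moment 0 0 + H * (h ^ 1 * K))
      + 4 * C3\<^sup>2 * (H * (h ^ 3 * K) + H * (h ^ 3 * K)) + 4 * h\<^sup>2 * C2\<^sup>2 * (H * (h ^ 1 * K) + H * (h ^ 1 * K)))"
    unfolding M0 using b k(2) by (intro mult_left_mono add_mono Mle order_refl) auto
  also have "\<dots> = H * (b * (2 * h\<^sup>2 * (pi / T)\<^sup>2 * (moment 0 0 + h * K) + 8 * (C3\<^sup>2 + C2\<^sup>2) * K * h ^ 3))"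
    by (simp add: algebra_simps power2_eq_square power3_eq_cube)
  finally show ?thesis
    unfolding weighted_slice_integrable(2)[OF source_family[OF h(1) T] t] H_def b_def .
qed

text \<open>Divided by h, the energy defect has squared norm of order h^(-2) * h, because its
  leading term is linear in x - q and meets moment 2. The weight is at most 1, and h <= 1 allows the
  bounded terms to be put over h as well.\<close>

lemma mode_time_upper:
  assumes h: "0 < h" "h \<le> 1" and T: "T > 0" and s: "0 < s" and t: "t \<in> {0..T}"
    and K: "moment 2 t \<le> K" "moment 4 t \<le> K" and K0: "0 \<le> K"
    and L: "\<And>x. norm (of_real E - cdot (momentum t x) (momentum t x) - taylor t x) \<le> L * (norm (x - q t) + norm (x - q t) ^ 2)"
    and L': "norm (trace (G t)) \<le> L"
  shows "(L2_norm (\<lambda>x. of_real (jbracket x powr (- s)) * mode_time T h E t x))\<^sup>2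
    \<le> sqrt h ^ CARD('n) * ((2 * (pi / T + L)\<^sup>2 * moment 0 0 + 8 * L\<^sup>2 * K) / h)"
proof -
  define m where "m p x = norm (x - q t) ^ p * (norm (packet h t x))\<^sup>2" for p and x
  have im: "integrable lborel (m p)" for p unfolding m_def by (rule packet_moment(1)[OF h(1)])
  define H where "H = sqrt h ^ CARD('n)"
  have H: "0 \<le> H" using h by (simp add: H_def)
  have M: "integral\<^sup>L lborel (m (2 * j)) = H * (h ^ j * moment (2 * j) t)" for j
    unfolding m_def H_def by (rule even_moment[OF h(1)])
  have M0: "integral\<^sup>L lborel (m 0) = H * moment 0 0" using M[of 0] mass_conserved[of t] t by simp
  have M2: "integral\<^sup>L lborel (m 2) \<le> H * (h * K)"
    using M[of 1] K(1) h H by (simp add: mult_left_mono)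
  have M4: "integral\<^sup>L lborel (m 4) \<le> H * (h * K)"
  proof -
    have "h\<^sup>2 * moment 4 t \<le> h\<^sup>2 * K" using K by (intro mult_left_mono) auto
    also have "\<dots> \<le> h * K" using h K0 by (intro mult_right_mono) (auto simp: power2_eq_square mult_left_le)
    finally show ?thesis using M[of 2] H by (simp add: mult_left_mono)
  qed
  have "(\<integral>x. (jbracket x powr (- s))\<^sup>2 * (norm (mode_time T h E t x))\<^sup>2 \<partial>lborel)
    \<le> (\<integral>x. 2 * (pi / T + L)\<^sup>2 * m 0 x + 4 * (L / h)\<^sup>2 * (m 2 x + m 4 x) \<partial>lborel)"
  proof (rule integral_mono)
    show "integrable lborel (\<lambda>x. (jbracket x powr (- s))\<^sup>2 * (norm (mode_time T h E t x))\<^sup>2)"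
      by (rule weighted_slice_integrable(1)[OF mode_time_family[OF h(1) T] t])
    show "integrable lborel (\<lambda>x. 2 * (pi / T + L)\<^sup>2 * m 0 x + 4 * (L / h)\<^sup>2 * (m 2 x + m 4 x))"
      by (intro integrable_mult_right Bochner_Integration.integrable_add im)
    show "(jbracket x powr (- s))\<^sup>2 * (norm (mode_time T h E t x))\<^sup>2 \<le> 2 * (pi / T + L)\<^sup>2 * m 0 x + 4 * (L / h)\<^sup>2 * (m 2 x + m 4 x)" for x
    proof -
      let ?y = "norm (x - q t)" and ?u = "(norm (packet h t x))\<^sup>2"
      let ?D = "of_real E + (- 1) * (\<Sum>j\<in>UNIV. momentum t x $ j * momentum t x $ j) + (- 1) * taylor t x"
      have D: "norm ?D \<le> L * (?y + ?y ^ 2)" using L[of x] by (simp add: cdot_def algebra_simps)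
      have c1: "norm (cut' T t) \<le> pi / T"
      proof -
        have "norm (cut' T t) = pi / T * \<bar>cos (pi * t / T)\<bar>" unfolding cut'_def norm_of_real using T by (simp add: abs_mult)
        also have "\<dots> \<le> pi / T * 1" using T by (intro mult_left_mono) auto
        finally show ?thesis by simp
      qed
      have c2: "norm (\<i> / of_real h * (cut T t * (?D + \<i> * of_real h * trace (G t)))) \<le> L + L / h * ?y + L / h * ?y ^ 2"
      proof -
        have "norm (?D + \<i> * of_real h * trace (G t)) \<le> L * (?y + ?y ^ 2) + h * L"
          using h L' by (intro norm_triangle_mono D) (simp add: norm_mult mult_left_mono)
        moreover have "norm (cut T t) \<le> 1" by (simp add: cut_def)
        ultimately have "norm (cut T t * (?D + \<i> * of_real h * trace (G t))) \<le> 1 * (L * (?y + ?y ^ 2) + h * L)"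
          unfolding norm_mult by (intro mult_mono) auto
        then have "1 / h * norm (cut T t * (?D + \<i> * of_real h * trace (G t))) \<le> 1 / h * (L * (?y + ?y ^ 2) + h * L)"
          using h by (intro mult_left_mono) auto
        also have "\<dots> = L + L / h * ?y + L / h * ?y ^ 2" using h by (simp add: field_simps)
        finally show ?thesis unfolding norm_mult[of "\<i> / of_real h"] using h by (simp add: norm_divide)
      qed
      have "norm (cut' T t + \<i> / of_real h * (cut T t * (?D + \<i> * of_real h * trace (G t)))) \<le> (pi / T + L) + L / h * ?y + L / h * ?y ^ 2"
        using norm_triangle_mono[OF c1 c2] by simp
      then have "(norm (cut' T t + \<i> / of_real h * (cut T t * (?D + \<i> * of_real h * trace (G t)))))\<^sup>2 \<le> ((pi / T + L) + L / h * ?y + L / h * ?y ^ 2)\<^sup>2"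
        by (rule power_mono) simp
      also have "\<dots> \<le> 2 * (pi / T + L)\<^sup>2 + 4 * (L / h * ?y)\<^sup>2 + 4 * (L / h * ?y ^ 2)\<^sup>2" by (rule square_sum_le)
      also have "\<dots> = 2 * (pi / T + L)\<^sup>2 + 4 * (L / h)\<^sup>2 * (?y ^ 2 + ?y ^ 4)"
        by (simp only: power_mult_distrib distrib_left flip: power_mult) simp
      finally have n: "(norm (mode_time T h E t x))\<^sup>2 \<le> (2 * (pi / T + L)\<^sup>2 + 4 * (L / h)\<^sup>2 * (?y ^ 2 + ?y ^ 4)) * ?u"
        unfolding mode_time_def norm_mult[of "cis _"] norm_mult[of _ "packet h t x"] power_mult_distrib norm_cis
        by (simp add: mult_right_mono add.assoc)
      have "(jbracket x powr (- s))\<^sup>2 \<le> 1"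
        using jbracket_powr_le(1)[of "- s" 0 x] s by (simp add: power_le_one)
      then have "(jbracket x powr (- s))\<^sup>2 * (norm (mode_time T h E t x))\<^sup>2
        \<le> 1 * ((2 * (pi / T + L)\<^sup>2 + 4 * (L / h)\<^sup>2 * (?y ^ 2 + ?y ^ 4)) * ?u)"
        by (intro mult_mono n) auto
      then show ?thesis by (simp only: m_def) (simp add: algebra_simps)
    qed
  qed
  also have "\<dots> = 2 * (pi / T + L)\<^sup>2 * integral\<^sup>L lborel (m 0) + 4 * (L / h)\<^sup>2 * (integral\<^sup>L lborel (m 2) + integral\<^sup>L lborel (m 4))"
    by (simp only: Bochner_Integration.integral_add integral_mult_right_zero Bochner_Integration.integrable_add im integrable_mult_right)
  also have "\<dots> \<le> 2 * (pi / T + L)\<^sup>2 * (H * moment 0 0) + 4 * (L / h)\<^sup>2 * (H * (h * K) + H * (h * K))"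
    unfolding M0 by (intro add_mono mult_left_mono M2 M4 order_refl) auto
  also have "\<dots> = H * (2 * (pi / T + L)\<^sup>2 * moment 0 0 + 8 * L\<^sup>2 * K / h)"
    using h by (simp add: field_simps power2_eq_square)
  also have "\<dots> \<le> H * ((2 * (pi / T + L)\<^sup>2 * moment 0 0 + 8 * L\<^sup>2 * K) / h)"
  proof (intro mult_left_mono H)
    have "0 \<le> 2 * (pi / T + L)\<^sup>2 * moment 0 0" using mass_pos by simp
    then have "2 * (pi / T + L)\<^sup>2 * moment 0 0 \<le> 2 * (pi / T + L)\<^sup>2 * moment 0 0 / h"
      using h by (simp add: le_divide_eq mult_left_le)
    then show "2 * (pi / T + L)\<^sup>2 * moment 0 0 + 8 * L\<^sup>2 * K / h \<le> (2 * (pi / T + L)\<^sup>2 * moment 0 0 + 8 * L\<^sup>2 * K) / h"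
      by (simp add: add_divide_distrib)
  qed
  finally show ?thesis
    unfolding weighted_slice_integrable(2)[OF mode_time_family[OF h(1) T] t] H_def .
qed

text \<open>The coefficients in \<open>energy_defect\<close> are continuous in time, hence bounded
  on [-T, T]; the constant is enlarged so that it serves for the trace too.\<close>

lemma energy_defect_bound:
  obtains L where "0 \<le> L"
    "\<And>t x. \<bar>t\<bar> \<le> T \<Longrightarrow> norm (of_real E - cdot (momentum t x) (momentum t x) - taylor t x) \<le> L * (norm (x - q t) + norm (x - q t) ^ 2)"
    "\<And>t. \<bar>t\<bar> \<le> T \<Longrightarrow> norm (trace (G t)) \<le> L"
proof -
  obtain K where K: "\<And>(M::complex^'n^'n) v. norm (M *v v) \<le> norm M * norm v * K" and K0: "K > 0"
    using mv.pos_bounded by blast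
  obtain X where X: "X > 0" "\<And>t. \<bar>t\<bar> \<le> T \<Longrightarrow> norm (\<xi> t) \<le> X" using continuous_bounded_on_interval[OF cont_\<xi>] by blast
  obtain N where N: "N > 0" "\<And>t. \<bar>t\<bar> \<le> T \<Longrightarrow> norm (G t) \<le> N" using continuous_bounded_on_interval[OF cont_G] by blast
  obtain Y where Y: "Y > 0" "\<And>t. \<bar>t\<bar> \<le> T \<Longrightarrow> norm (grad V (q t)) \<le> Y" using continuous_bounded_on_interval[OF grad_cont] by blast
  obtain Z where Z: "Z > 0" "\<And>t. \<bar>t\<bar> \<le> T \<Longrightarrow> norm (A t) \<le> Z" using continuous_bounded_on_interval[OF A_cont] by blast
  have ctr: "continuous_on UNIV (\<lambda>t. trace (G t))" unfolding trace_def by (intro continuous_intros cont_G)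
  obtain W where W: "W > 0" "\<And>t. \<bar>t\<bar> \<le> T \<Longrightarrow> norm (trace (G t)) \<le> W" using continuous_bounded_on_interval[OF ctr] by blast
  define a1 a2 where "a1 = 2 * X * N * K + Y" and "a2 = (N * K)\<^sup>2 + Z * K"
  have a: "0 \<le> a1" "0 \<le> a2" using K0 X N Y Z by (simp_all add: a1_def a2_def)
  show thesis
  proof (rule that[of "a1 + a2 + W"])
    show "0 \<le> a1 + a2 + W" using a W by simp
    show "norm (trace (G t)) \<le> a1 + a2 + W" if "\<bar>t\<bar> \<le> T" for t using W(2)[OF that] a by linarith
    fix t x assume t: "\<bar>t\<bar> \<le> T"
    let ?y = "norm (x - q t)"
    have ny: "norm (dev t x) = ?y" by (simp add: dev_def norm_cvec)
    have g: "norm (G t *v dev t x) \<le> N * K * ?y"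
    proof -
      have "norm (G t *v dev t x) \<le> norm (G t) * ?y * K" using K[of "G t" "dev t x"] by (simp add: ny)
      also have "\<dots> \<le> N * ?y * K" using K0 by (intro mult_right_mono N t) auto
      finally show ?thesis by (simp add: mult_ac)
    qed
    have 1: "norm (2 * cdot (cvec (\<xi> t)) (G t *v dev t x)) \<le> 2 * (X * (N * K * ?y))"
    proof -
      have "norm (cdot (cvec (\<xi> t)) (G t *v dev t x)) \<le> norm (cvec (\<xi> t)) * norm (G t *v dev t x)" by (rule norm_cdot_le)
      also have "\<dots> \<le> X * (N * K * ?y)" using X(1) X(2)[OF t] g by (intro mult_mono) (auto simp: norm_cvec)
      finally show ?thesis by (simp add: norm_mult)
    qed
    have 2: "norm (cdot (G t *v dev t x) (G t *v dev t x)) \<le> (N * K * ?y) * (N * K * ?y)"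
      using g N K0 by (intro order_trans[OF norm_cdot_le] mult_mono) auto
    have 3: "norm (complex_of_real (grad V (q t) \<bullet> (x - q t))) \<le> Y * ?y"
      unfolding norm_of_real using Y(2)[OF t] by (intro order_trans[OF Cauchy_Schwarz_ineq2] mult_right_mono) auto
    have 4: "norm (cdot (dev t x) (A t *v dev t x) / 2) \<le> Z * K * ?y * ?y"
    proof -
      have "norm (A t *v dev t x) \<le> norm (A t) * ?y * K" using K[of "A t" "dev t x"] by (simp add: ny)
      also have "\<dots> \<le> Z * ?y * K" using K0 by (intro mult_right_mono Z t) auto
      finally have "norm (dev t x) * norm (A t *v dev t x) \<le> ?y * (Z * ?y * K)" by (simp add: ny mult_left_mono)
      then have "norm (cdot (dev t x) (A t *v dev t x)) \<le> Z * K * ?y * ?y"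
        using norm_cdot_le[of "dev t x" "A t *v dev t x"] by (simp add: mult_ac)
      moreover have "0 \<le> norm (cdot (dev t x) (A t *v dev t x))" by simp
      moreover have "norm (cdot (dev t x) (A t *v dev t x) / 2) = norm (cdot (dev t x) (A t *v dev t x)) / 2"
        by (simp add: norm_divide)
      ultimately show ?thesis by linarith
    qed
    have "norm (of_real E - cdot (momentum t x) (momentum t x) - taylor t x)
      \<le> 2 * (X * (N * K * ?y)) + (N * K * ?y) * (N * K * ?y) + Y * ?y + Z * K * ?y * ?y"
      unfolding energy_defect norm_minus_cancel by (intro norm_triangle_mono 1 2 3 4)
    also have "\<dots> = a1 * ?y + a2 * ?y ^ 2" by (simp add: a1_def a2_def power2_eq_square algebra_simps)
    also have "\<dots> \<le> (a1 + a2 + W) * ?y + (a1 + a2 + W) * ?y ^ 2"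
      using a W by (intro add_mono mult_right_mono) auto
    finally show "norm (of_real E - cdot (momentum t x) (momentum t x) - taylor t x) \<le> (a1 + a2 + W) * (?y + ?y ^ 2)"
      by (simp add: distrib_left)
  qed
qed

text \<open>T is fixed first, from c, R and s alone, and h then tends to 0 along a sequence. In the
  limit the Taylor error, the damping and the loss outside the window disappear; only the cut-off
  remains, and the mass divides out to leave T^2 * b0 / 36 <= 2 * c^2 * b1 * pi^2.\<close>

lemma no_uniform_resolvent_bound:
  assumes s: "s > 0" and \<epsilon>: "\<epsilon> > 0" and h0: "h0 > 0" and c: "0 \<le> c"
    and op: "\<And>h z. 0 < h \<Longrightarrow> h \<le> h0 \<Longrightarrow> Im z > 0 \<Longrightarrow> \<bar>Re z - E\<bar> < \<epsilon> \<Longrightarrow>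
      op_norm (weighted_resolvent V V2 s h z) \<le> ennreal (c / h)"
  shows False
proof -
  define k where "k = nat \<lceil>s\<rceil>"
  have k: "s \<le> real k" "0 < k" using s by (simp_all add: k_def real_nat_ceiling_ge)
  define \<nu> where "\<nu> = moment 0 0"
  have \<nu>: "\<nu> > 0" using mass_pos by (simp add: \<nu>_def)
  define b0 where "b0 = (3 + 2 * R\<^sup>2) powr (- s)"
  have "0 < 3 + 2 * R\<^sup>2" by (simp add: add_pos_nonneg)
  then have b0: "b0 > 0" by (simp add: b0_def)
  define b1 where "b1 = (4 + 4 * R\<^sup>2) ^ k"
  have b1: "b1 \<ge> 0" by (simp add: b1_def)
  \<comment> \<open>72 = 18 * 2 * 2: the constant of coercivity, the mean 1/2 of the squared sine,
    and the factor 2 of the cut-off term in \<open>source_upper\<close>. The limit inequality will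
    read T^2 <= w.\<close>
  define w where "w = 72 * (c\<^sup>2 * b1 * pi\<^sup>2) / b0"
  have w: "w \<ge> 0" using b0 b1 by (simp add: w_def)
  define T where "T = sqrt w + 1"
  have T: "T > 0" using w by (simp add: T_def add_nonneg_pos)
  have Tw: "T\<^sup>2 > w" using w real_sqrt_ge_zero[OF w] unfolding T_def power2_sum real_sqrt_pow2[OF w] one_power2 mult_1_right by linarith
  \<comment> \<open>Order 6 comes from the square of the cubic Taylor error, 2 * k from the growing
    weight.\<close>
  obtain K where K0: "K > 0" and K: "\<And>p t. p \<le> 6 + 2 * k \<Longrightarrow> \<bar>t\<bar> \<le> T \<Longrightarrow> moment p t \<le> K"
    using moments_bounded[of "6 + 2 * k" T] by blast
  obtain L where "0 \<le> L"
    and L: "\<And>t x. \<bar>t\<bar> \<le> T \<Longrightarrow> norm (of_real E - cdot (momentum t x) (momentum t x) - taylor t x) \<le> L * (norm (x - q t) + norm (x - q t) ^ 2)"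
    and L': "\<And>t. \<bar>t\<bar> \<le> T \<Longrightarrow> norm (trace (G t)) \<le> L"
    using energy_defect_bound[of T] by blast
  define K3 where "K3 = 2 * (pi / T + L)\<^sup>2 * \<nu> + 8 * L\<^sup>2 * K"
  define D where "D = 8 * (C3\<^sup>2 + C2\<^sup>2) * K"
  \<comment> \<open>h is tied to m: the 2 * m energies with spacing 2*pi*h/T start at E -
    \<epsilon>/2 and stay below E + \<epsilon>/2, inside the interval of the hypothesis, and growing
    m sends h to 0.\<close>
  have step: "T\<^sup>2 / 36 * (b0 * (\<nu> - h * K)) \<le> c\<^sup>2 * (T\<^sup>2 * (b1 * (2 * (pi / T)\<^sup>2 * (\<nu> + h * K) + D * h))) + T\<^sup>2 * ((2 * pi / \<epsilon>)\<^sup>2 * K3) * h"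
    if m: "m > 0" and h: "h = \<epsilon> * T / (4 * pi * real m)" and h1: "h \<le> 1" "h \<le> h0" for m h
  proof -
    have h_pos: "h > 0" using \<epsilon> T m by (simp add: h)
    define H where "H = sqrt h ^ CARD('n)"
    have H: "H > 0" using h_pos by (simp add: H_def)
    have ci: "set_integrable lborel {0..T} (\<lambda>_. r :: real)" for r by (intro set_integrable_continuous) simp
    have fam: "gaussian_family T (\<lambda>t x. of_real (jbracket x powr r) * f t x)" if "gaussian_family T f" for r f
      by (rule gaussian_family_mult[OF poly_family_jbracket that])
    have const: "(LINT t:{0..T}|lborel. (r :: real)) = T * r" for r
      using T by (simp add: set_lebesgue_integral_def)
    have lower: "T / 2 * (H * (b0 * (\<nu> - h * K))) \<le> (LINT t:{0..T}|lborel. (L2_norm (\<lambda>x. of_real (jbracket x powr (- s)) * mode T h E t x))\<^sup>2)"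
    proof -
      have "T / 2 * (H * (b0 * (\<nu> - h * K))) = (LINT t:{0..T}|lborel. (sin (pi * t / T))\<^sup>2 * (H * (b0 * (\<nu> - h * K))))"
        by (simp only: set_integral_mult_left integral_sin_square[OF T])
      also have "\<dots> \<le> (LINT t:{0..T}|lborel. (L2_norm (\<lambda>x. of_real (jbracket x powr (- s)) * mode T h E t x))\<^sup>2)"
      proof (rule set_integral_mono)
        show "set_integrable lborel {0..T} (\<lambda>t. (sin (pi * t / T))\<^sup>2 * (H * (b0 * (\<nu> - h * K))))"
          using T by (intro set_integrable_continuous continuous_intros) auto
        show "set_integrable lborel {0..T} (\<lambda>t. (L2_norm (\<lambda>x. of_real (jbracket x powr (- s)) * mode T h E t x))\<^sup>2)"
          by (rule gaussian_family_energy(1)[OF fam[OF mode_family[OF h_pos T]]])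
        show "(sin (pi * t / T))\<^sup>2 * (H * (b0 * (\<nu> - h * K))) \<le> (L2_norm (\<lambda>x. of_real (jbracket x powr (- s)) * mode T h E t x))\<^sup>2"
          if "t \<in> {0..T}" for t
          unfolding H_def b0_def \<nu>_def using that by (intro mode_lower h_pos T s K) auto
      qed
      finally show ?thesis .
    qed
    have upper: "(LINT t:{0..T}|lborel. (L2_norm (\<lambda>x. of_real (jbracket x powr s) * source T h E t x))\<^sup>2)
       \<le> T * (H * (b1 * (2 * h\<^sup>2 * (pi / T)\<^sup>2 * (\<nu> + h * K) + D * h ^ 3)))"
      unfolding const[symmetric]
    proof (rule set_integral_mono[OF _ ci])
      show "set_integrable lborel {0..T} (\<lambda>t. (L2_norm (\<lambda>x. of_real (jbracket x powr s) * source T h E t x))\<^sup>2)"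
        by (rule gaussian_family_energy(1)[OF fam[OF source_family[OF h_pos T]]])
      show "(L2_norm (\<lambda>x. of_real (jbracket x powr s) * source T h E t x))\<^sup>2 \<le> H * (b1 * (2 * h\<^sup>2 * (pi / T)\<^sup>2 * (\<nu> + h * K) + D * h ^ 3))"
        if "t \<in> {0..T}" for t
        unfolding H_def b1_def \<nu>_def D_def using that K0 by (intro source_upper h_pos h1 T k K) auto
    qed
    have upper': "(LINT t:{0..T}|lborel. (L2_norm (\<lambda>x. of_real (jbracket x powr (- s)) * mode_time T h E t x))\<^sup>2) \<le> T * (H * (K3 / h))"
      unfolding const[symmetric]
    proof (rule set_integral_mono[OF _ ci])
      show "set_integrable lborel {0..T} (\<lambda>t. (L2_norm (\<lambda>x. of_real (jbracket x powr (- s)) * mode_time T h E t x))\<^sup>2)"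
        by (rule gaussian_family_energy(1)[OF fam[OF mode_time_family[OF h_pos T]]])
      show "(L2_norm (\<lambda>x. of_real (jbracket x powr (- s)) * mode_time T h E t x))\<^sup>2 \<le> H * (K3 / h)"
        if "t \<in> {0..T}" for t
        unfolding H_def K3_def \<nu>_def using that K0 by (intro mode_time_upper[where K = K and L = L] h_pos h1 T s K L L') auto
    qed
    have bound: "op_norm (weighted_resolvent V V2 s h (Complex (E + h * (2 * pi * (real j - real m) / T)) \<mu>)) \<le> ennreal (c / h)"
      if "j < 2 * m" "\<mu> > 0" for j \<mu>
    proof (rule op[OF h_pos h1(2)])
      have "\<bar>real j - real m\<bar> \<le> real m" using that(1) by linarith
      then have "\<bar>h * (2 * pi * (real j - real m) / T)\<bar> \<le> h * (2 * pi * real m / T)"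
        using h_pos T by (simp add: abs_mult divide_right_mono mult_left_mono)
      also have "\<dots> = \<epsilon> / 2" using T m by (simp add: h)
      finally have "\<bar>h * (2 * pi * (real j - real m) / T)\<bar> < \<epsilon>" by (rule order.strict_trans1) (use \<epsilon> in simp)
      then show "\<bar>Re (Complex (E + h * (2 * pi * (real j - real m) / T)) \<mu>) - E\<bar> < \<epsilon>"
        unfolding complex.sel add_diff_cancel_left' .
    qed (use that in simp)
    have ch: "0 \<le> c / h" using c h_pos by simp
    \<comment> \<open>The cell length is proportional to h, so its square times the 1/h of
      \<open>mode_time_upper\<close> makes the coercivity error of order h.\<close>
    have tau: "T / real (2 * m) = 2 * pi * h / \<epsilon>" using T m \<epsilon> by (simp add: h)
    have "T / 18 * (T / 2 * (H * (b0 * (\<nu> - h * K))))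
       \<le> T / 18 * (LINT t:{0..T}|lborel. (L2_norm (\<lambda>x. of_real (jbracket x powr (- s)) * mode T h E t x))\<^sup>2)"
      using T by (intro mult_left_mono lower) auto
    also have "\<dots> \<le> (c / h)\<^sup>2 * (T * (LINT t:{0..T}|lborel. (L2_norm (\<lambda>x. of_real (jbracket x powr s) * source T h E t x))\<^sup>2))
      + T * (T / real (2 * m))\<^sup>2 * (LINT t:{0..T}|lborel. (L2_norm (\<lambda>x. of_real (jbracket x powr (- s)) * mode_time T h E t x))\<^sup>2)"
      by (rule integrated_resolvent_estimate[OF h_pos T s ch m bound])
    also have "\<dots> \<le> (c / h)\<^sup>2 * (T * (T * (H * (b1 * (2 * h\<^sup>2 * (pi / T)\<^sup>2 * (\<nu> + h * K) + D * h ^ 3)))))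
      + T * (T / real (2 * m))\<^sup>2 * (T * (H * (K3 / h)))"
      using T by (intro add_mono mult_left_mono upper upper') auto
    also have "\<dots> = H * (c\<^sup>2 * (T\<^sup>2 * (b1 * (2 * (pi / T)\<^sup>2 * (\<nu> + h * K) + D * h))) + T\<^sup>2 * ((2 * pi / \<epsilon>)\<^sup>2 * K3) * h)"
    proof -
      have 1: "(c / h)\<^sup>2 * (T * (T * (H * (b1 * (2 * h\<^sup>2 * (pi / T)\<^sup>2 * (\<nu> + h * K) + D * h ^ 3)))))
        = H * (c\<^sup>2 * (T\<^sup>2 * (b1 * (2 * (pi / T)\<^sup>2 * (\<nu> + h * K) + D * h))))"
      proof -
        have "2 * h\<^sup>2 * (pi / T)\<^sup>2 * (\<nu> + h * K) + D * h ^ 3 = h\<^sup>2 * (2 * (pi / T)\<^sup>2 * (\<nu> + h * K) + D * h)"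
          by (simp add: algebra_simps power2_eq_square power3_eq_cube)
        moreover have "(c / h)\<^sup>2 * (T * (T * (H * (b1 * (h\<^sup>2 * X))))) = H * ((c / h)\<^sup>2 * h\<^sup>2 * (T\<^sup>2 * (b1 * X)))" for X
          by (simp only: power2_eq_square mult_ac)
        moreover have "(c / h)\<^sup>2 * h\<^sup>2 = c\<^sup>2" using h_pos by (simp add: power_divide)
        ultimately show ?thesis by simp
      qed
      have 2: "T * (T / real (2 * m))\<^sup>2 * (T * (H * (K3 / h))) = H * (T\<^sup>2 * ((2 * pi / \<epsilon>)\<^sup>2 * K3) * h)"
        unfolding tau
      proof -
        have "(2 * pi * h / \<epsilon>)\<^sup>2 = (2 * pi / \<epsilon>)\<^sup>2 * h * h" by (simp add: power2_eq_square)
        moreover have "T * (X * h * h) * (T * (H * (K3 / h))) = H * (T\<^sup>2 * (X * (K3 / h * h)) * h)" for X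
          by (simp only: power2_eq_square mult_ac)
        ultimately show "T * (2 * pi * h / \<epsilon>)\<^sup>2 * (T * (H * (K3 / h))) = H * (T\<^sup>2 * ((2 * pi / \<epsilon>)\<^sup>2 * K3) * h)"
          using h_pos by simp
      qed
      show ?thesis unfolding 1 2 by (simp add: distrib_left)
    qed
    finally have *: "T / 18 * (T / 2 * (H * (b0 * (\<nu> - h * K)))) \<le> H * (c\<^sup>2 * (T\<^sup>2 * (b1 * (2 * (pi / T)\<^sup>2 * (\<nu> + h * K) + D * h))) + T\<^sup>2 * ((2 * pi / \<epsilon>)\<^sup>2 * K3) * h)" .
    \<comment> \<open>\<open>H\<close>, the volume scale of the packet, is common to all terms and
      is divided out before h tends to 0.\<close>
    have "H * (T\<^sup>2 / 36 * (b0 * (\<nu> - h * K))) \<le> H * (c\<^sup>2 * (T\<^sup>2 * (b1 * (2 * (pi / T)\<^sup>2 * (\<nu> + h * K) + D * h))) + T\<^sup>2 * ((2 * pi / \<epsilon>)\<^sup>2 * K3) * h)"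
    proof -
      have "T / 18 * (T / 2 * (H * Z)) = H * (T\<^sup>2 / 36 * Z)" for Z by (simp add: power2_eq_square)
      with * show ?thesis by (simp only:)
    qed
    then show ?thesis using H by (simp only: mult_le_cancel_left_pos)
  qed
  define hm where "hm m = \<epsilon> * T / (4 * pi * real m)" for m
  have lim: "hm \<longlonglongrightarrow> 0"
  proof -
    have "(\<lambda>m. (\<epsilon> * T / (4 * pi)) * inverse (real m)) \<longlonglongrightarrow> 0"
      by (rule tendsto_mult_right_zero[OF lim_inverse_n])
    moreover have "hm = (\<lambda>m. (\<epsilon> * T / (4 * pi)) * inverse (real m))" by (simp add: hm_def fun_eq_iff flip: divide_inverse)
    ultimately show ?thesis by simp
  qed
  have ev: "\<forall>\<^sub>F m in sequentially. T\<^sup>2 / 36 * (b0 * (\<nu> - hm m * K)) \<le> c\<^sup>2 * (T\<^sup>2 * (b1 * (2 * (pi / T)\<^sup>2 * (\<nu> + hm m * K) + D * hm m))) + T\<^sup>2 * ((2 * pi / \<epsilon>)\<^sup>2 * K3) * hm m"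
    using order_tendstoD(2)[OF lim, of "min 1 h0"] eventually_gt_at_top[of 0]
  proof (rule eventually_elim2)
    show "0 < min 1 h0" using h0 by simp
    fix m assume "hm m < min 1 h0" "0 < m"
    then show "T\<^sup>2 / 36 * (b0 * (\<nu> - hm m * K)) \<le> c\<^sup>2 * (T\<^sup>2 * (b1 * (2 * (pi / T)\<^sup>2 * (\<nu> + hm m * K) + D * hm m))) + T\<^sup>2 * ((2 * pi / \<epsilon>)\<^sup>2 * K3) * hm m"
      by (intro step[of m]) (auto simp: hm_def)
  qed
  have "T\<^sup>2 / 36 * (b0 * (\<nu> - 0 * K)) \<le> c\<^sup>2 * (T\<^sup>2 * (b1 * (2 * (pi / T)\<^sup>2 * (\<nu> + 0 * K) + D * 0))) + T\<^sup>2 * ((2 * pi / \<epsilon>)\<^sup>2 * K3) * 0"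
    by (rule tendsto_le[OF sequentially_bot _ _ ev]) (intro tendsto_intros lim)+
  moreover have "c\<^sup>2 * (T\<^sup>2 * (b1 * (2 * (pi / T)\<^sup>2 * (\<nu> + 0 * K) + D * 0))) + T\<^sup>2 * ((2 * pi / \<epsilon>)\<^sup>2 * K3) * 0
      = 2 * (c\<^sup>2 * b1 * (T\<^sup>2 * (pi / T)\<^sup>2)) * \<nu>"
    by (simp only: mult_zero_left mult_zero_right add_0_right mult_ac)
  moreover have "T\<^sup>2 * (pi / T)\<^sup>2 = pi\<^sup>2" using T by (simp add: power_divide)
  moreover have "T\<^sup>2 / 36 * (b0 * (\<nu> - 0 * K)) = T\<^sup>2 * b0 / 36 * \<nu>" by simp
  ultimately have "T\<^sup>2 * b0 / 36 * \<nu> \<le> 2 * (c\<^sup>2 * b1 * pi\<^sup>2) * \<nu>" by (simp only:)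
  then have "T\<^sup>2 * b0 / 36 \<le> 2 * (c\<^sup>2 * b1 * pi\<^sup>2)" using \<nu> by (simp only: mult_le_cancel_right_pos)
  then have "T\<^sup>2 * b0 \<le> 72 * (c\<^sup>2 * b1 * pi\<^sup>2)" by linarith
  then have "T\<^sup>2 \<le> w" using b0 by (simp add: w_def le_divide_eq)
  then show False using Tw by simp
qed

end


section \<open>Bounded undamped trajectories\<close>

lemma hamiltonian_flow_energy:
  assumes V: "smooth V" and \<phi>: "hamiltonian_flow V \<phi>"
  shows "symbol_p V (\<phi> t w) = symbol_p V w"
proof -
  define q \<xi> where "q t = fst (\<phi> t w)" and "\<xi> t = snd (\<phi> t w)" for t
  have q: "(q has_vector_derivative 2 *\<^sub>R \<xi> t) (at t)" and \<xi>: "(\<xi> has_vector_derivative - grad V (q t)) (at t)" for t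
    using \<phi> unfolding hamiltonian_flow_def q_def \<xi>_def by blast+
  have "((\<lambda>t. \<xi> t \<bullet> \<xi> t + V (q t)) has_vector_derivative 0) (at t)" for t
  proof -
    define D where "D = frechet_derivative V (at (q t))"
    have D: "(V has_derivative D) (at (q t))"
      unfolding D_def using smooth_differentiable[OF V] frechet_derivative_works by blast
    have lin: "linear D" using D has_derivative_linear by blast
    have "D y = grad V (q t) \<bullet> y" for y
    proof -
      have "D y = D (\<Sum>i\<in>UNIV. y $ i *\<^sub>R axis i 1)"
        using basis_expansion[of y] by (simp add: scalar_mult_eq_scaleR)
      also have "\<dots> = (\<Sum>i\<in>UNIV. y $ i * D (axis i 1))" by (simp add: linear_sum[OF lin] linear_scale[OF lin])
      finally show ?thesis by (simp add: grad_def partial_def D_def inner_vec_def mult.commute)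
    qed
    then have D2: "D (2 *\<^sub>R \<xi> t) = 2 * (grad V (q t) \<bullet> \<xi> t)" by simp
    have "((\<lambda>t. V (q t)) has_vector_derivative D (2 *\<^sub>R \<xi> t)) (at t)"
      using vector_derivative_diff_chain_within[OF q[of t] has_derivative_at_withinI[OF D]] by (simp add: o_def)
    note has_vector_derivative_add[OF bounded_bilinear.has_vector_derivative[OF bounded_bilinear_inner \<xi>[of t] \<xi>[of t]] this]
    then show ?thesis unfolding D2 by (simp add: inner_commute)
  qed
  from has_vector_derivative_zero_const[OF this, of t]
  moreover have "\<phi> 0 w = w" using \<phi> unfolding hamiltonian_flow_def by blast
  ultimately show ?thesis by (simp add: symbol_p_def power2_norm_eq_inner q_def \<xi>_def)
qed

lemma smooth_imp_continuous_on_pderivs: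
  assumes "smooth V" "continuous_on A q"
  shows "continuous_on A (\<lambda>t. pderivs js V (q t))"
proof (rule continuous_on_compose2[OF _ assms(2)])
  show "continuous_on UNIV (pderivs js V)"
    using assms(1) by (auto simp: smooth_def intro!: continuous_at_imp_continuous_on differentiable_imp_continuous_within)
qed auto

text \<open>Symmetrised by definition, which yields at once the symmetry that the Riccati equation
  requires; the quadratic form, all that Taylor's formula sees, is that of the matrix of second
  derivatives.\<close>

definition real_hessian :: "(real^'n::finite \<Rightarrow> real) \<Rightarrow> real^'n \<Rightarrow> complex^'n^'n"
  where "real_hessian V x = (\<chi> i j. of_real ((pderivs [i, j] V x + pderivs [j, i] V x) / 2))"

lemma cdot_real_hessian:
  "cdot (cvec y) (real_hessian V x *v cvec y) = of_real (\<Sum>i\<in>UNIV. \<Sum>j\<in>UNIV. pderivs [j, i] V x * y $ i * y $ j)"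
proof -
  have sw: "(\<Sum>i\<in>UNIV. \<Sum>j\<in>UNIV. pderivs [i, j] V x * y $ i * y $ j) = (\<Sum>i\<in>UNIV. \<Sum>j\<in>UNIV. pderivs [j, i] V x * y $ i * y $ j)"
    by (subst sum.swap) (simp only: mult.assoc mult.commute mult.left_commute)
  have "cdot (cvec y) (real_hessian V x *v cvec y)
    = of_real (\<Sum>i\<in>UNIV. \<Sum>j\<in>UNIV. (pderivs [i, j] V x * y $ i * y $ j + pderivs [j, i] V x * y $ i * y $ j) / 2)"
    unfolding quad_conv_cdot[symmetric] quad_def real_hessian_def of_real_sum
    by (intro sum.cong refl) (simp add: field_simps)
  also have "\<dots> = of_real (\<Sum>i\<in>UNIV. \<Sum>j\<in>UNIV. pderivs [j, i] V x * y $ i * y $ j)"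
    by (simp only: sum_divide_distrib[symmetric] sum.distrib sw) simp
  finally show ?thesis .
qed

text \<open>There are finitely many coordinate lists of a given length, so the sum of their
  individual bounds serves for all of them.\<close>

lemma uniform_pderivs_bound:
  fixes V :: "real^'n::finite \<Rightarrow> real"
  assumes "\<And>js. bounded (range (pderivs js V))"
  obtains B where "0 \<le> B" "\<And>js x. length js = m \<Longrightarrow> \<bar>pderivs js V x\<bar> \<le> B"
proof -
  obtain C where C: "\<And>js x. \<bar>pderivs js V x\<bar> \<le> C js"
    using assms unfolding bounded_iff by simp metis
  have fin: "finite {js :: 'n list. length js = m}"
    using finite_lists_length_eq[of "UNIV :: 'n set" m] by simp
  have C0: "0 \<le> C js" for js using order_trans[OF abs_ge_zero C] .
  show thesis
  proof
    show "0 \<le> sum C {js. length js = m}" by (intro sum_nonneg C0)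
    show "\<bar>pderivs js V x\<bar> \<le> sum C {js. length js = m}" if "length js = m" for js x
    proof -
      have "C js \<le> sum C {js. length js = m}" by (rule member_le_sum) (use that fin C0 in auto)
      then show ?thesis using C[of js x] by linarith
    qed
  qed
qed

text \<open>The trajectory supplies \<open>q\<close> and \<open>\<xi>\<close>; \<open>A\<close> is
  the Hessian along it, \<open>G\<close> the Riccati solution, \<open>S\<close> the action and
  \<open>a\<close> the solution of the scalar transport equation. Every q(t) is a zero of V2, which
  is where \<open>nonneg_zero_quadratic_bound\<close> enters.\<close>

lemma bounded_trajectory_damped_packet:
  fixes V V2 :: "real^'n::finite \<Rightarrow> real"
  assumes V: "smooth V" "\<And>js. bounded (range (pderivs js V))"
    and V2: "smooth V2" "\<And>js. bounded (range (pderivs js V2))" "\<And>x. 0 \<le> V2 x"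
    and \<phi>: "hamiltonian_flow V \<phi>" and w: "bounded (range (\<lambda>t. fst (\<phi> t w)))" "\<And>t. V2 (fst (\<phi> t w)) = 0"
  obtains q \<xi> A G S a C2 C3 R where "damped_packet V q \<xi> (symbol_p V w) A G S a V2 C2 C3 R"
proof -
  define q \<xi> where "q t = fst (\<phi> t w)" and "\<xi> t = snd (\<phi> t w)" for t
  have q': "(q has_vector_derivative 2 *\<^sub>R \<xi> t) (at t)" and \<xi>': "(\<xi> has_vector_derivative - grad V (q t)) (at t)" for t
    using \<phi> unfolding hamiltonian_flow_def q_def \<xi>_def by blast+
  have energy: "(norm (\<xi> t))\<^sup>2 + V (q t) = symbol_p V w" for t
    using hamiltonian_flow_energy[OF V(1) \<phi>, of t w] by (simp add: symbol_p_def q_def \<xi>_def)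
  have cq: "continuous_on UNIV q" and c\<xi>: "continuous_on UNIV \<xi>"
    by (intro continuous_at_imp_continuous_on ballI has_vector_derivative_continuous, rule q' \<xi>')+
  note cp = smooth_imp_continuous_on_pderivs[OF V(1) cq]
  define A where "A t = real_hessian V (q t)" for t
  have cA: "continuous_on UNIV A" unfolding A_def real_hessian_def
    by (intro continuous_intros cp) auto
  have sA: "transpose (A t) = A t" for t by (simp add: A_def real_hessian_def transpose_def vec_eq_iff add.commute)
  have rA: "adjoint_mat (A t) = A t" for t by (simp add: A_def real_hessian_def adjoint_mat_def vec_eq_iff add.commute)
  have cg: "continuous_on UNIV (\<lambda>t. grad V (q t))"
    unfolding grad_def using cp[of "[_]"] by (intro continuous_intros) simp
  obtain G where G: "\<And>t. (G has_vector_derivative - 2 *\<^sub>R (G t ** G t) - A t) (at t)" "\<And>t. transpose (G t) = G t"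
    "\<And>b. \<exists>m>0. \<forall>t. \<bar>t\<bar> \<le> b \<longrightarrow> (\<forall>y. m * (norm y)\<^sup>2 \<le> Im (quad (G t) y))"
    using riccati_solution[OF cA sA rA] by blast
  have cG: "continuous_on UNIV G"
    by (intro continuous_at_imp_continuous_on ballI has_vector_derivative_continuous, rule G)
  have "continuous_on UNIV (\<lambda>t. (norm (\<xi> t))\<^sup>2 - V (q t))"
    using cp[of "[]"] by (intro continuous_intros c\<xi>) simp
  then obtain S where S: "\<And>t. (S has_vector_derivative (norm (\<xi> t))\<^sup>2 - V (q t)) (at t)"
    using continuous_antiderivative by blast
  define L where "L t = Blinfun (\<lambda>z :: complex. - trace (G t) * z)" for t
  have L: "blinfun_apply (L t) z = - trace (G t) * z" for t z
    unfolding L_def by (subst bounded_linear_Blinfun_apply) (rule bounded_linear_mult_right, rule refl)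
  have "continuous_on UNIV L"
    by (rule continuous_on_blinfun_componentwise) (auto simp: L trace_def intro!: continuous_intros cG)
  from linear_ode_solution[OF this, of 1]
  obtain a where a: "a 0 = 1" "\<And>t. (a has_vector_derivative - trace (G t) * a t) (at t)"
    unfolding L by blast
  interpret wave_packet V q \<xi> "symbol_p V w" A G S a
    by (unfold_locales; fact q' \<xi>' energy cA rA sA cg G S a)
  obtain B where B: "0 \<le> B" "\<And>js x. length js = 3 \<Longrightarrow> \<bar>pderivs js V x\<bar> \<le> B"
    using uniform_pderivs_bound[OF V(2)] by metis
  obtain B2 where B2: "0 \<le> B2" "\<And>js x. length js = 2 \<Longrightarrow> \<bar>pderivs js V2 x\<bar> \<le> B2"
    using uniform_pderivs_bound[OF V2(2)] by metis
  obtain R where R: "\<And>t. norm (q t) \<le> R" using w(1) by (auto simp: bounded_iff q_def)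
  have "damped_packet V q \<xi> (symbol_p V w) A G S a V2 (real CARD('n) ^ 2 * B2) (real CARD('n) ^ 3 * B) R"
  proof unfold_locales
    show "continuous_on UNIV V" "continuous_on UNIV V2"
      using V(1) V2(1) by (auto intro: smooth_imp_continuous_on)
    show "bounded (range V)" "bounded (range V2)" using V(2)[of "[]"] V2(2)[of "[]"] by auto
    show "norm (of_real (V x) - taylor t x) \<le> real CARD('n) ^ 3 * B * norm (x - q t) ^ 3" for t x
    proof -
      let ?y = "x - q t"
      have "of_real (V x) - taylor t x = of_real (V (q t + ?y) - (V (q t) + grad V (q t) \<bullet> ?y
          + (\<Sum>i\<in>UNIV. \<Sum>j\<in>UNIV. pderivs [j, i] V (q t) * ?y $ i * ?y $ j) / 2))"
        unfolding taylor_def dev_def A_def cdot_real_hessian by (simp del: of_real_sum pderivs.simps)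
      also have "norm \<dots> \<le> real CARD('n) ^ 3 * B * norm ?y ^ 3"
        unfolding norm_of_real by (intro taylor_remainder_third V B) simp
      finally show ?thesis .
    qed
    show "V2 x \<le> real CARD('n) ^ 2 * B2 * norm (x - q t) ^ 2" for t x
    proof -
      have "V2 (q t + (x - q t)) \<le> real CARD('n) ^ 2 * B2 * norm (x - q t) ^ 2"
        by (intro nonneg_zero_quadratic_bound V2 B2) (auto simp: q_def w)
      then show ?thesis by simp
    qed
  qed (use V2 R B B2 in auto)
  then show thesis by (rule that)
qed

theorem theorem4p1:
  fixes V1 V2 :: "real^'n::finite \<Rightarrow> real"
    and \<rho> E :: real
    and \<phi> :: "real \<Rightarrow> (real^'n) \<times> (real^'n) \<Rightarrow> (real^'n) \<times> (real^'n)"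
  assumes "\<rho> > 0"
    and "smooth V1"
    and "\<exists>C :: ('n \<Rightarrow> nat) \<Rightarrow> real. (\<forall>\<alpha>. C \<alpha> \<ge> 0) \<and>
           (\<forall>js x. \<bar>pderivs js V1 x\<bar>
              \<le> C (count_list js) * jbracket x powr (- \<rho> - real (length js)))"
    and "smooth V2"
    and "\<forall>x. V2 x \<ge> 0"
    and "\<forall>js. bounded (range (pderivs js V2))"
    and "(V2 \<longlongrightarrow> 0) at_infinity"
    and "hamiltonian_flow V1 \<phi>"
    and "E > 0"
    and "\<exists>s. 1 / 2 < s \<and> s < (1 + \<rho>) / 2 \<and>
           (\<exists>\<epsilon>>0. \<exists>h0>0. h0 \<le> 1 \<and>
             (let J = {E - \<epsilon><..<E + \<epsilon>} in
               (\<forall>e\<in>J. \<forall>h\<in>{0<..h0}. \<exists>L :: 'n L2 \<Rightarrow>\<^sub>L 'n L2.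
                  op_tendsto (\<lambda>\<mu>. weighted_resolvent V1 V2 s h (Complex e \<mu>)) L (at_right 0)) \<and>
               (\<exists>c\<ge>0. \<forall>z\<in>upper_strip J. \<forall>h\<in>{0<..h0}.
                  op_norm (weighted_resolvent V1 V2 s h z) \<le> ennreal (c / h))))"
  shows "\<forall>w. symbol_p V1 w = E \<and> bounded (range (\<lambda>t. fst (\<phi> t w))) \<longrightarrow>
           (\<exists>t. \<phi> t w \<in> {(x, \<xi>). V2 x > 0})"
proof (intro allI impI)
  fix w assume w: "symbol_p V1 w = E \<and> bounded (range (\<lambda>t. fst (\<phi> t w)))"
  show "\<exists>t. \<phi> t w \<in> {(x, \<xi>). V2 x > 0}"
  proof (rule ccontr)
    assume "\<not> ?thesis"
    \<comment> \<open>The negated conclusion and V2 \<ge> 0 together put the whole trajectory into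
      the zero set of V2.\<close>
    then have V2_zero: "V2 (fst (\<phi> t w)) = 0" for t
      using assms(5) by (metis (mono_tags, lifting) case_prod_unfold mem_Collect_eq order_le_less)
    obtain C :: "('n \<Rightarrow> nat) \<Rightarrow> real" where C: "\<And>\<alpha>. C \<alpha> \<ge> 0"
      "\<And>js x. \<bar>pderivs js V1 x\<bar> \<le> C (count_list js) * jbracket x powr (- \<rho> - real (length js))"
      using assms(3) by blast
    \<comment> \<open>The exponent is negative because \<rho> > 0, and the bracket is at least 1, so
      the decay bounds each derivative by its constant.\<close>
    have V1_bdd: "bounded (range (pderivs js V1))" for js
    proof -
      have "\<bar>pderivs js V1 x\<bar> \<le> C (count_list js)" for x
      proof -
        have "1 \<le> jbracket x" by (simp add: jbracket_def)
        then have "jbracket x powr (- \<rho> - real (length js)) \<le> jbracket x powr 0"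
          using assms(1) by (intro powr_mono) auto
        also have "\<dots> = 1" using \<open>1 \<le> jbracket x\<close> by simp
        finally show ?thesis using order_trans[OF C(2) mult_left_le[OF _ C(1)]] by blast
      qed
      then show ?thesis unfolding bounded_iff by auto
    qed
    have V2_bdd: "bounded (range (pderivs js V2))" and V2_nonneg: "0 \<le> V2 x" for js x
      using assms(5,6) by auto
    obtain s \<epsilon> h0 c where s: "1 / 2 < s" and \<epsilon>: "\<epsilon> > 0" and h0: "h0 > 0" and c: "c \<ge> 0"
      and bound: "\<forall>z\<in>upper_strip {E - \<epsilon><..<E + \<epsilon>}. \<forall>h\<in>{0<..h0}. op_norm (weighted_resolvent V1 V2 s h z) \<le> ennreal (c / h)"
      using assms(10) unfolding Let_def by blast
    obtain q \<xi> A G S a C2 C3 R where "damped_packet V1 q \<xi> (symbol_p V1 w) A G S a V2 C2 C3 R"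
      using w by (elim bounded_trajectory_damped_packet[OF assms(2) V1_bdd assms(4) V2_bdd V2_nonneg assms(8) conjunct2 V2_zero])
    then interpret damped_packet V1 q \<xi> E A G S a V2 C2 C3 R using w by simp
    show False
    proof (rule no_uniform_resolvent_bound[OF _ \<epsilon> h0 c])
      show "s > 0" using s by simp
      show "op_norm (weighted_resolvent V1 V2 s h z) \<le> ennreal (c / h)"
        if "0 < h" "h \<le> h0" "Im z > 0" "\<bar>Re z - E\<bar> < \<epsilon>" for h z
        using bound that by (auto simp: upper_strip_def abs_less_iff)
    qed
  qed
qed

end
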